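(* Let $0<\alpha<\beta$ with $\alpha,\beta\notin\mathbb{Z}$, and let $f$ be analytic inside a closed contour strictly containing $[\alpha,\beta]$. Let $\chi_1$ and $\chi_2$ be non-principal even primitive Dirichlet characters modulo $p$ and $q$ respectively, and let $\nu\in\mathbb{C}$ with $0<\Re(\nu)<\frac12$. Then \begin{align*} & \frac{ p^{1-\frac{\nu}{2}}q^{1+\frac{\nu}{2}} }{ \tau(\chi_1)\tau(\chi_2)} \sum_{\alpha<j <\beta} \sigma_{-\nu, \chi_2,\chi_1}(j) f(j) = 2\pi \sum_{n=1}^{\infty}\sigma_{-\nu, \bar{\chi}_1,\bar{\chi}_2}(n)\, n^{\nu/2} \int_{\alpha} ^{ \beta }f(t) t^{-\frac{\nu}{2}} \\ & \times \left\{ \left( \frac{2}{\pi} K_{\nu}\left(4\pi \sqrt{\tfrac{nt}{pq}} \right) - Y_{\nu}\left(4\pi \sqrt{\tfrac{nt}{pq}} \right) \right) \cos \left(\frac{\pi \nu}{2}\right) - J_{\nu}\left(4\pi \sqrt{\tfrac{nt}{pq}} \right) \sin \left(\frac{\pi \nu}{2}\right) \right\} dt, \end{align*} where the sum on the left is over integers $j$.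
   Context: For Dirichlet characters $\chi_1,\chi_2$ and $z\in\mathbb{C}$: $\sigma_{z,\chi_1,\chi_2}(n)=\sum_{d\mid n}d^z\chi_1(d)\chi_2(n/d)$. $\tau(\chi)=\sum_{h=1}^q\chi(h)e^{2\pi i h/q}$ is the Gauss sum. $J_\nu$, $Y_\nu$ are the Bessel functions of the first and second kind and $K_\nu$ the modified Bessel function of the second kind. *)

theory Defs
  imports "HOL-Analysis.Analysis"
begin

definition dirichlet_character :: "nat \<Rightarrow> (int \<Rightarrow> complex) \<Rightarrow> bool" where
  "dirichlet_character q chi \<longleftrightarrow> q > 0 \<and>
     (\<forall>a b. chi (a * b) = chi a * chi b) \<and>
     (\<forall>a. chi (a + int q) = chi a) \<and>
     (\<forall>a. chi a = 0 \<longleftrightarrow> \<not> coprime a (int q))"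

definition principal_character :: "nat \<Rightarrow> (int \<Rightarrow> complex) \<Rightarrow> bool" where
  "principal_character q chi \<longleftrightarrow> (\<forall>a. coprime a (int q) \<longrightarrow> chi a = 1)"

definition even_character :: "(int \<Rightarrow> complex) \<Rightarrow> bool" where
  "even_character chi \<longleftrightarrow> chi (-1) = 1"

definition primitive_character :: "nat \<Rightarrow> (int \<Rightarrow> complex) \<Rightarrow> bool" where
  "primitive_character q chi \<longleftrightarrow>
     (\<forall>d. d dvd q \<and> d < q \<longrightarrow>
        (\<exists>a. coprime a (int q) \<and> a mod int d = 1 mod int d \<and> chi a \<noteq> 1))"

definition gauss_sum :: "nat \<Rightarrow> (int \<Rightarrow> complex) \<Rightarrow> complex" where
  "gauss_sum q chi = (\<Sum>h = 1..q. chi (int h) * exp (2 * of_real pi * \<i> * of_nat h / of_nat q))"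

definition sigma_chi :: "complex \<Rightarrow> (int \<Rightarrow> complex) \<Rightarrow> (int \<Rightarrow> complex) \<Rightarrow> nat \<Rightarrow> complex" where
  "sigma_chi z chi1 chi2 n = (\<Sum>d \<in> {d. d dvd n}. of_nat d powr z * chi1 (int d) * chi2 (int (n div d)))"

text \<open>Bessel functions of complex order and positive real argument (principal branch).\<close>
definition besselJ :: "complex \<Rightarrow> real \<Rightarrow> complex" where
  "besselJ \<nu> x = (\<Sum>m. (-1) ^ m * rGamma (of_nat m + \<nu> + 1) / fact m * (of_real (x / 2)) ^ (2 * m))
                  * of_real (x / 2) powr \<nu>"

definition besselI :: "complex \<Rightarrow> real \<Rightarrow> complex" where
  "besselI \<nu> x = (\<Sum>m. rGamma (of_nat m + \<nu> + 1) / fact m * (of_real (x / 2)) ^ (2 * m))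
                  * of_real (x / 2) powr \<nu>"

definition besselY :: "complex \<Rightarrow> real \<Rightarrow> complex" where
  "besselY \<nu> x =
     (let g = (\<lambda>\<mu>. (besselJ \<mu> x * cos (\<mu> * of_real pi) - besselJ (-\<mu>) x) / sin (\<mu> * of_real pi))
      in if \<nu> \<notin> \<int> then g \<nu> else Lim (at \<nu>) g)"

definition besselK :: "complex \<Rightarrow> real \<Rightarrow> complex" where
  "besselK \<nu> x =
     (let g = (\<lambda>\<mu>. of_real pi / 2 * (besselI (-\<mu>) x - besselI \<mu> x) / sin (\<mu> * of_real pi))
      in if \<nu> \<notin> \<int> then g \<nu> else Lim (at \<nu>) g)"

end

theory Submission
  imports Defs "HOL-Probability.Probability" "HOL-Complex_Analysis.Complex_Analysis" "HOL-Number_Theory.Number_Theory"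
begin

text \<open>
  Applying Poisson summation for even primitive characters twice, to \<open>x \<mapsto> x powr (-\<nu> - 1)\<close> times the cosine
  transform of a smooth compactly supported \<open>F\<close> and then to \<open>F\<close> itself, turns the divisor sum over \<open>F\<close> into a
  double series whose terms are Hankel-type integrals. These integrals are evaluated by regularising with
  \<open>exp (-\<delta> x - \<delta> / x)\<close>, which gives the Bessel kernel.

  The sharp cutoff at \<open>\<alpha>\<close> and \<open>\<beta>\<close> is reached as follows. In the variable \<open>u = sqrt t\<close> the indicator function of
  \<open>[sqrt \<alpha>, sqrt \<beta>]\<close> is replaced by its Fourier integral truncated at the frequency \<open>L\<close> of the \<open>N\<close>-th kernel. The
  truncation is entire, so the smooth formula applies to it. By the two-term asymptotics of the kernel, its
  transform agrees with that of the sharp cutoff for frequencies below \<open>L\<close> and vanishes above \<open>L\<close>, up to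
  \<open>O(1 / (L (1 + |L - l|)^3))\<close>. Since \<open>\<sigma>(n) n powr (\<nu> / 2) = o(n powr (1 / 4))\<close> for \<open>Re \<nu> < 1 / 2\<close>, the sum of
  these errors tends to zero, so the partial sums of the series converge to the left-hand side.
\<close>

text \<open>The obstacle is conditional convergence. Jumps of the cutoff leave a transform of size
  about n powr (-3/4), while the coefficients may be almost as large as n powr (1/4), so no summable
  majorant exists and a smooth cutoff cannot be sharpened termwise. Cutting in frequency makes the
  regularised series comparable with one partial sum of the sharp series. Near L there are about L
  frequencies \<open>l k\<close> in a unit interval, because they are multiples of square roots; the
  factor 1 / L in the error compensates exactly this density. The variable u = sqrt t is forced: the
  Bessel argument is linear in u, so the kernel consists of pure exponentials on which a Fourier
  truncation acts sharply. A second asymptotic term of the kernel is required because a remainder of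
  relative size 1 / l could not be summed absolutely, whereas 1 / l^2 can. The whole argument is
  real-variable: twisted Poisson summation comes from the Fourier series of the periodic quadratic
  polynomial, and all Bessel facts come from power series and one differential equation.\<close>

section \<open>Integration on half-lines and termwise integration of series\<close>

lemma set_integrable_Ioi_powr_bounds:
  fixes f :: "real \<Rightarrow> complex"
  assumes cont: "continuous_on {0<..} f" and a: "a > -1" and b: "b < -1"
    and small: "\<And>x. 0 < x \<Longrightarrow> x \<le> 1 \<Longrightarrow> norm (f x) \<le> C * x powr a"
    and large: "\<And>x. 1 \<le> x \<Longrightarrow> norm (f x) \<le> C * x powr b"
  shows "set_integrable lborel {0<..} f"
proof -
  define w where "w = (\<lambda>x. if x \<le> 1 then C * x powr a else C * x powr b)"
  have C: "C \<ge> 0" using small[of 1] order_trans[OF norm_ge_zero] by fastforce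
  have "((\<lambda>x. C * x powr a) has_integral (C * (1 powr (a+1) / (a+1)))) {0..1}"
    by (intro has_integral_mult_right has_integral_powr_from_0) (use a in auto)
  hence "(w has_integral (C * (1 powr (a+1) / (a+1)))) {0..1}"
    by (rule has_integral_eq[rotated]) (auto simp: w_def)
  moreover have "((\<lambda>x. C * x powr b) has_integral (C * (-(1 powr (b+1)) / (b+1)))) {1..}"
    by (intro has_integral_mult_right has_integral_powr_to_inf) (use b in auto)
  hence "(w has_integral (C * (-(1 powr (b+1)) / (b+1)))) {1..}"
    by (rule has_integral_eq[rotated]) (auto simp: w_def)
  ultimately have "w integrable_on ({0..1} \<union> {1..})"
    unfolding integrable_on_def using has_integral_Un[of w _ "{0..1}" _ "{1..}"] by fastforce
  also have "{0..1} \<union> {1..} = {0::real..}" by auto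
  finally have "w absolutely_integrable_on {0..}"
    by (intro nonnegative_absolutely_integrable_1) (auto simp: w_def C)
  hence w: "w absolutely_integrable_on {0<..}"
    by (rule set_integrable_subset) (auto)
  have meas: "(\<lambda>x. indicator {0<..} x *\<^sub>R f x) \<in> borel_measurable borel"
    using cont by (intro borel_measurable_continuous_on_indicator) auto
  have "f absolutely_integrable_on {0<..}"
  proof (rule set_integrable_bound[OF w])
    show "set_borel_measurable lebesgue {0<..} f"
      unfolding set_borel_measurable_def using meas by (simp add: measurable_completion)
    show "AE x in lebesgue. x \<in> {0<..} \<longrightarrow> norm (f x) \<le> norm (w x)"
      using small large C by (auto simp: w_def)
  qed
  thus ?thesis unfolding set_integrable_def
    by (subst (asm) integrable_completion) (use meas in auto)
qed

lemma set_sums_integral: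
  fixes f :: "nat \<Rightarrow> real \<Rightarrow> complex"
  assumes S: "S \<in> sets lborel" and f: "\<And>i. set_integrable lborel S (f i)"
    and sumf: "\<And>x. x \<in> S \<Longrightarrow> summable (\<lambda>i. norm (f i x))"
    and sumint: "summable (\<lambda>i. LINT x:S|lborel. norm (f i x))"
  shows "set_integrable lborel S (\<lambda>x. \<Sum>i. f i x)"
    and "(\<lambda>i. LINT x:S|lborel. f i x) sums (LINT x:S|lborel. (\<Sum>i. f i x))"
proof -
  let ?g = "\<lambda>i x. indicator S x *\<^sub>R f i x"
  have eq: "(\<Sum>i. ?g i x) = indicator S x *\<^sub>R (\<Sum>i. f i x)" for x
    by (cases "x \<in> S") auto
  have i: "integrable lborel (?g i)" for i using f unfolding set_integrable_def by auto
  have s: "AE x in lborel. summable (\<lambda>i. norm (?g i x))"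
    by (intro AE_I2) (use sumf in \<open>auto simp: indicator_def\<close>)
  have "(\<lambda>i. LINT x:S|lborel. norm (f i x)) = (\<lambda>i. LINT x|lborel. norm (?g i x))"
    unfolding set_lebesgue_integral_def by (simp add: indicator_def if_distrib)
  with sumint have n: "summable (\<lambda>i. LINT x|lborel. norm (?g i x))" by simp
  show "set_integrable lborel S (\<lambda>x. \<Sum>i. f i x)"
    using integrable_suminf[OF i s n] unfolding set_integrable_def eq .
  show "(\<lambda>i. LINT x:S|lborel. f i x) sums (LINT x:S|lborel. (\<Sum>i. f i x))"
    using sums_integral[OF i s n] unfolding set_lebesgue_integral_def eq .
qed

lemma set_integral_FTC_Ioi:
  fixes f F :: "real \<Rightarrow> complex"
  assumes F: "\<And>x. x > a \<Longrightarrow> (F has_vector_derivative f x) (at x)"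
    and f: "continuous_on {a<..} f" and int: "set_integrable lborel {a<..} f"
    and A: "(F \<longlongrightarrow> A) (at_right a)" and B: "(F \<longlongrightarrow> B) at_top"
  shows "(LINT x:{a<..}|lborel. f x) = B - A"
proof -
  have e: "einterval (ereal a) \<infinity> = {a<..}" by (auto simp: einterval_def)
  have "(LBINT x=ereal a..\<infinity>. f x) = B - A"
  proof (rule interval_integral_FTC_integrable[of _ _ F])
    show "isCont f x" if "ereal a < ereal x" for x
      using f that by (simp add: continuous_on_eq_continuous_at)
    show "((F \<circ> real_of_ereal) \<longlongrightarrow> A) (at_right (ereal a))"
      unfolding o_def ereal_tendsto_simps1[symmetric] using A by (simp add: at_right_ereal filterlim_filtermap)
    show "((F \<circ> real_of_ereal) \<longlongrightarrow> B) (at_left \<infinity>)"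
      unfolding o_def using B by (simp add: at_left_PInf filterlim_filtermap)
  qed (use F int e in auto)
  thus ?thesis by (simp add: interval_lebesgue_integral_def e)
qed

lemma set_integral_dominated_convergence:
  fixes f :: "real \<Rightarrow> complex" and s :: "nat \<Rightarrow> real \<Rightarrow> complex" and w :: "real \<Rightarrow> real"
  assumes s: "\<And>i. set_integrable lborel S (s i)" and f: "set_borel_measurable lborel S f"
    and w: "set_integrable lborel S w"
    and lim: "\<And>x. x \<in> S \<Longrightarrow> (\<lambda>i. s i x) \<longlonglongrightarrow> f x"
    and bound: "\<And>i x. x \<in> S \<Longrightarrow> norm (s i x) \<le> w x"
  shows "(\<lambda>i. LINT x:S|lborel. s i x) \<longlonglongrightarrow> (LINT x:S|lborel. f x)"
  unfolding set_lebesgue_integral_def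
proof (rule integral_dominated_convergence[where w = "\<lambda>x. indicator S x *\<^sub>R w x"])
  show "(\<lambda>x. indicator S x *\<^sub>R s i x) \<in> borel_measurable lborel" for i
    using s[of i] unfolding set_integrable_def by (rule borel_measurable_integrable)
qed (use f w lim bound in \<open>auto simp: set_borel_measurable_def set_integrable_def indicator_def\<close>)

section \<open>Dirichlet characters and Poisson summation\<close>

lemma dirichlet_character_mod:
 assumes "dirichlet_character q chi"
 shows "chi (a mod int q) = chi a"
proof -
 have per: "chi (x + int q) = chi x" for x using assms by (auto simp: dirichlet_character_def)
 have 1: "chi (x + int n * int q) = chi x" for x n
 proof (induction n)
  case (Suc n)
  have "chi (x + int (Suc n) * int q) = chi ((x + int n * int q) + int q)" by (simp add: algebra_simps)
  thus ?case using per Suc by simp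
 qed auto
 have 2: "chi (x + k * int q) = chi x" for x k
 proof (cases "k \<ge> 0")
  case True thus ?thesis using 1[of x "nat k"] by simp
 next
  case False thus ?thesis using 1[of "x + k * int q" "nat (-k)"] by simp
 qed
 have "chi a = chi (a mod int q + (a div int q) * int q)" by simp
 thus ?thesis using 2 by metis
qed

lemma dirichlet_character_mult: "dirichlet_character q chi ==> chi (a * b) = chi a * chi b"
 by (simp add: dirichlet_character_def)

lemma dirichlet_character_1:
 assumes "dirichlet_character q chi" shows "chi 1 = 1"
proof -
 have "chi 1 = chi 1 * chi 1" using dirichlet_character_mult[OF assms, of 1 1] by simp
 moreover have "chi 1 \<noteq> 0" using assms by (auto simp: dirichlet_character_def)
 ultimately show ?thesis by simp
qed

lemma dirichlet_character_power:
 assumes "dirichlet_character q chi" shows "chi (a ^ n) = chi a ^ n"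
 by (induction n) (use assms in \<open>auto simp: dirichlet_character_1 dirichlet_character_mult\<close>)

text \<open>By Euler's theorem a power of the residue is congruent to 1, so the value is a root of
  unity.\<close>

lemma dirichlet_character_norm_coprime:
 assumes chi: "dirichlet_character q chi" and cop: "coprime a (int q)"
 shows "norm (chi a) = 1"
proof -
 have q: "q > 0" using chi by (simp add: dirichlet_character_def)
 define b where "b = nat (a mod int q)"
 have b: "int b = a mod int q" using q by (simp add: b_def)
 have "coprime (int b) (int q)" unfolding b using cop q by (simp add: coprime_mod_left_iff)
 hence "coprime b q" by simp
 hence "[b ^ totient q = 1] (mod q)" by (rule euler_theorem)
 hence "int b ^ totient q mod int q = 1 mod int q"
  unfolding cong_def by (metis of_nat_1 of_nat_mod of_nat_power)
 hence "chi (int b ^ totient q) = chi 1" using dirichlet_character_mod[OF chi] by metis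
 hence "chi (int b) ^ totient q = 1"
  using dirichlet_character_power[OF chi] dirichlet_character_1[OF chi] by metis
 hence "norm (chi (int b)) ^ totient q = 1" by (metis norm_one norm_power)
 moreover have "totient q > 0" using q by simp
 ultimately have "norm (chi (int b)) = 1"
  by (metis norm_ge_zero power_eq_1_iff less_imp_neq norm_ge_zero real_norm_def abs_norm_cancel)
 thus ?thesis using b dirichlet_character_mod[OF chi] by metis
qed

lemma dirichlet_character_norm_le:
 assumes chi: "dirichlet_character q chi" shows "norm (chi a) \<le> 1"
proof (cases "coprime a (int q)")
 case False
 hence "chi a = 0" using chi by (auto simp: dirichlet_character_def)
 thus ?thesis by simp
qed (use dirichlet_character_norm_coprime[OF chi] in auto)

lemma dirichlet_character_uminus:
 assumes chi: "dirichlet_character q chi" "even_character chi" shows "chi (- a) = chi a"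
 using dirichlet_character_mult[OF chi(1), of "-1" a] chi(2) by (simp add: even_character_def)

lemma sum_residues_mult:
 fixes \<phi> :: "int => complex"
 assumes q: "q > 0" and cop: "coprime c (int q)" and per: "!!x. \<phi> (x mod int q) = \<phi> x"
 shows "(\<Sum>h<q. \<phi> (c * int h)) = (\<Sum>h<q. \<phi> (int h))"
proof -
 let ?f = "\<lambda>h. nat ((c * int h) mod int q)"
 have inj: "inj_on ?f {..<q}"
 proof (rule inj_onI)
  fix x y assume x: "x \<in> {..<q}" and y: "y \<in> {..<q}" and eq: "?f x = ?f y"
  have "(c * int x) mod int q = (c * int y) mod int q"
   using eq q by (metis nat_0_le pos_mod_sign of_nat_0_less_iff)
  hence "[c * int x = c * int y] (mod int q)" by (simp add: cong_def)
  hence "[int x = int y] (mod int q)" using cop by (simp add: cong_mult_lcancel)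
  thus "x = y" using x y by (simp add: cong_def)
 qed
 have "?f ` {..<q} \<subseteq> {..<q}" using q by (auto simp: nat_less_iff)
 hence "?f ` {..<q} = {..<q}" using inj by (simp add: card_image card_subset_eq)
 hence "(\<Sum>h<q. \<phi> (int h)) = (\<Sum>h<q. \<phi> (int (?f h)))"
  using sum.reindex[OF inj, of "\<lambda>h. \<phi> (int h)"] by (simp add: o_def)
 also have "\<dots> = (\<Sum>h<q. \<phi> (c * int h))"
  by (intro sum.cong refl) (use q per in simp)
 finally show ?thesis by simp
qed

text \<open>Multiplication by a \<open>c\<close> with \<open>chi c \<noteq> 1\<close> permutes the
  residues and scales the sum by \<open>chi c\<close>, so the sum must be 0.\<close>

lemma sum_nonprincipal_character:
 assumes chi: "dirichlet_character q chi" "\<not> principal_character q chi"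
 shows "(\<Sum>h<q. chi (int h)) = 0"
proof -
 have q: "q > 0" using chi by (simp add: dirichlet_character_def)
 obtain c where c: "coprime c (int q)" "chi c \<noteq> 1" using chi by (auto simp: principal_character_def)
 have "(\<Sum>h<q. chi (c * int h)) = (\<Sum>h<q. chi (int h))"
  by (rule sum_residues_mult[OF q c(1)]) (rule dirichlet_character_mod[OF chi(1)])
 hence "chi c * (\<Sum>h<q. chi (int h)) = (\<Sum>h<q. chi (int h))"
  by (simp add: dirichlet_character_mult[OF chi(1)] sum_distrib_left)
 thus ?thesis using c(2) by simp
qed

lemma nonprincipal_character_modulus:
 assumes chi: "dirichlet_character q chi" "\<not> principal_character q chi"
 shows "q > 1" "chi 0 = 0"
proof -
 have q: "q > 0" using chi by (simp add: dirichlet_character_def)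
 have "q \<noteq> 1"
 proof
  assume [simp]: "q = 1"
  have "chi a = 1" for a
   using dirichlet_character_mod[OF chi(1), of a] dirichlet_character_mod[OF chi(1), of 1]
    dirichlet_character_1[OF chi(1)] by simp
  thus False using chi by (auto simp: principal_character_def)
 qed
 with q show "q > 1" by linarith
 thus "chi 0 = 0" using chi by (auto simp: dirichlet_character_def)
qed

text \<open>Passes from the range 1..q of \<open>gauss_sum\<close> to the residues 0..<q; the end
  terms agree for periodic summands.\<close>

lemma sum_atLeast1_eq_lessThan:
 fixes g :: "nat => complex"
 assumes "g q = g 0" shows "(\<Sum>h=1..q. g h) = (\<Sum>h<q. g h)"
proof (cases q)
 case (Suc n)
 have "(\<Sum>h=1..q. g h) = (\<Sum>h=1..<q. g h) + g q"
  using Suc by (simp add: atLeastLessThanSuc_atLeastAtMost[symmetric])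
 also have "\<dots> = g 0 + (\<Sum>h=1..<q. g h)" using assms by simp
 also have "\<dots> = (\<Sum>h=0..<q. g h)" using Suc by (simp add: sum.atLeast_Suc_lessThan)
 finally show ?thesis by (simp add: atLeast0LessThan)
qed auto

lemma exp_2pi_int_mod:
 assumes q: "q > 0"
 shows "exp (2 * of_real pi * \<i> * of_int (x mod int q) / of_nat q) = exp (2 * of_real pi * \<i> * of_int x / of_nat q)"
proof -
 have "of_int x = (of_int (x mod int q) + of_int (x div int q) * of_nat q :: complex)"
  by (metis mod_mult_div_eq of_int_add of_int_mult of_int_of_nat_eq mult.commute)
 hence "2 * of_real pi * \<i> * of_int x / of_nat q
   = 2 * of_real pi * \<i> * of_int (x mod int q) / of_nat q + 2 * of_real pi * \<i> * of_int (x div int q)"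
  using q by (simp add: field_simps)
 hence "2 * of_real pi * \<i> * of_int x / of_nat q = 2 * of_real pi * \<i> * of_int (x mod int q) / of_nat q
   + (of_int (2 * (x div int q)) * of_real pi) * \<i>" by simp
 hence "exp (2 * of_real pi * \<i> * of_int x / of_nat q) = exp (2 * of_real pi * \<i> * of_int (x mod int q) / of_nat q)"
  unfolding exp_eq by (intro exI[of _ "x div int q"]) simp
 thus ?thesis by simp
qed

text \<open>For \<open>a\<close> coprime to \<open>q\<close> this is the substitution h -> a h. For
  the other \<open>a\<close> the right side is 0, and primitivity has to make the twisted sum vanish
  as well.\<close>

lemma gauss_sum_twist:
 fixes a :: int
 assumes chi: "dirichlet_character q chi" "primitive_character q chi"
 shows "(\<Sum>h<q. chi (int h) * exp (2 * of_real pi * \<i> * of_int (a * int h) / of_nat q)) = cnj (chi a) * gauss_sum q chi"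
proof -
 have q: "q > 0" using chi by (simp add: dirichlet_character_def)
 let ?e = "\<lambda>x. exp (2 * of_real pi * \<i> * of_int x / of_nat q) :: complex"
 define S where "S = (\<lambda>a. \<Sum>h<q. chi (int h) * ?e (a * int h))"
 have per: "chi (x mod int q) * ?e (b * (x mod int q)) = chi x * ?e (b * x)" for x b
  using dirichlet_character_mod[OF chi(1), of x] exp_2pi_int_mod[OF q, of "b * x"]
   exp_2pi_int_mod[OF q, of "b * (x mod int q)"] by (simp add: mod_mult_right_eq)
 have re: "S b = chi c * S (b * c)" if "coprime c (int q)" for b c
 proof -
  have "S b = (\<Sum>h<q. chi (c * int h) * ?e (b * (c * int h)))"
   unfolding S_def using sum_residues_mult[OF q that, of "\<lambda>x. chi x * ?e (b * x)"] per by simp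
  also have "\<dots> = chi c * S (b * c)" unfolding S_def
   by (simp add: sum_distrib_left dirichlet_character_mult[OF chi(1)] mult.assoc)
  finally show ?thesis .
 qed
 have tau: "S 1 = gauss_sum q chi"
 proof -
  have "gauss_sum q chi = (\<Sum>h=1..q. chi (int h) * ?e (int h))" by (simp add: gauss_sum_def)
  also have "\<dots> = (\<Sum>h<q. chi (int h) * ?e (int h))"
   by (rule sum_atLeast1_eq_lessThan) (use per[of "int q" 1] in simp)
  finally show ?thesis by (simp add: S_def)
 qed
 show ?thesis
 proof (cases "coprime a (int q)")
  case True
  have "S 1 = chi a * S a" using re[OF True, of 1] by simp
  hence "cnj (chi a) * S 1 = (cnj (chi a) * chi a) * S a" by simp
  also have "cnj (chi a) * chi a = 1"
   using complex_norm_square[of "chi a"] dirichlet_character_norm_coprime[OF chi(1) True]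
   by (simp add: mult.commute)
  finally show ?thesis using tau by (simp add: S_def)
 next
  case False
  define d where "d = nat (gcd a (int q))"
  have d: "int d = gcd a (int q)" by (simp add: d_def)
  have "d dvd q" using d by (metis gcd_dvd2 of_nat_dvd_iff)
  have "d > 1" using False d q unfolding coprime_iff_gcd_eq_1
   by (metis One_nat_def Suc_lessI d_def gcd_pos_int nat_0_less_mult_iff of_nat_0_less_iff of_nat_1 zero_less_nat_eq less_numeral_extra(3) neq0_conv of_nat_eq_0_iff gcd_eq_0_iff)
  obtain q' where q': "q = d * q'" using \<open>d dvd q\<close> by auto
  have "q' < q" using q' \<open>d > 1\<close> q by auto
  \<comment> \<open>With \<open>d = gcd a q\<close> and \<open>q = d * q'\<close>, every
    \<open>c\<close> congruent to 1 modulo the proper divisor \<open>q'\<close> satisfies a c = a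
    modulo \<open>q\<close>. Primitivity supplies such a \<open>c\<close> with
    \<open>chi c \<noteq> 1\<close>, and the twisted sum then equals \<open>chi c\<close> times
    itself.\<close>
  then obtain c where c: "coprime c (int q)" "c mod int q' = 1 mod int q'" "chi c \<noteq> 1"
   using chi(2) q' unfolding primitive_character_def by (metis dvd_triv_right)
  have dv: "int q dvd a * c - a"
  proof -
   have "int q' dvd c - 1" using c(2) by (simp add: mod_eq_dvd_iff)
   moreover have "int d dvd a" using d by simp
   ultimately have "int d * int q' dvd a * (c - 1)" by (rule mult_dvd_mono[rotated])
   thus ?thesis using q' by (simp add: algebra_simps)
  qed
  have "S (a * c) = S a" unfolding S_def
  proof (intro sum.cong refl)
   fix h
   have "int q dvd a * c * int h - a * int h"
    using dv by (metis dvd_mult2 left_diff_distrib)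
   hence "(a * c * int h) mod int q = (a * int h) mod int q" by (simp add: mod_eq_dvd_iff)
   hence "?e (a * c * int h) = ?e (a * int h)"
    using exp_2pi_int_mod[OF q] by metis
   thus "chi (int h) * ?e (a * c * int h) = chi (int h) * ?e (a * int h)" by simp
  qed
  hence "S a = chi c * S a" using re[OF c(1), of a] by simp
  hence "S a = 0" using c(3) by auto
  moreover have "chi a = 0" using False chi by (auto simp: dirichlet_character_def)
  ultimately show ?thesis by (simp add: S_def)
 qed
qed

section \<open>Fourier series of the periodic quadratic polynomial\<close>

lemma set_integral_Ioo_eq_Icc:
 fixes f :: "real => complex"
 assumes "set_integrable lborel {a..b} f"
 shows "(LINT s:{a<..<b}|lborel. f s) = (LINT s:{a..b}|lborel. f s)"
 unfolding set_lebesgue_integral_def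
proof (rule integral_cong_AE)
 have "AE s in lborel. s \<noteq> a \<and> s \<noteq> b"
  using AE_lborel_singleton[of a] AE_lborel_singleton[of b] by eventually_elim auto
 thus "AE s in lborel. indicat_real {a<..<b} s *\<^sub>R f s = indicat_real {a..b} s *\<^sub>R f s"
  by (rule eventually_mono) (auto simp: indicator_def)
 have "set_integrable lborel {a<..<b} f" by (rule set_integrable_subset[OF assms]) auto
 thus "(\<lambda>s. indicat_real {a<..<b} s *\<^sub>R f s) \<in> borel_measurable lborel"
  unfolding set_integrable_def by (rule borel_measurable_integrable)
 show "(\<lambda>s. indicat_real {a..b} s *\<^sub>R f s) \<in> borel_measurable lborel"
  using assms unfolding set_integrable_def by (rule borel_measurable_integrable)
qed

text \<open>The factorisation 1 - exp(2 pi i s) = 2 sin(pi s) exp(i pi (s - 1/2)) has positive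
  modulus and an angle inside (-pi/2, pi/2), so the principal logarithm can be read off. Its
  imaginary part is the sawtooth function.\<close>

lemma Ln_one_minus_exp:
 assumes s: "0 < s" "s < 1"
 shows "Ln (1 - exp (2 * of_real pi * \<i> * of_real s)) = of_real (ln (2 * sin (pi * s))) + \<i> * of_real (pi * (s - 1/2))"
proof -
 have pos: "sin (pi * s) > 0" using s by (intro sin_gt_zero) (auto simp: field_simps)
 have "1 - exp (2 * of_real pi * \<i> * of_real s) = of_real (2 * sin (pi * s)) * exp (\<i> * of_real (pi * (s - 1/2)))"
 proof -
  have "pi * (s - 1/2) = pi * s - pi / 2" by (simp add: field_simps)
  hence c: "cos (pi * (s - 1/2)) = sin (pi * s)" "sin (pi * (s - 1/2)) = - cos (pi * s)"
   by (simp_all add: cos_diff sin_diff)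
  have e: "exp (2 * of_real pi * \<i> * of_real s) = cis (2 * (pi * s))"
   by (simp add: cis_conv_exp mult_ac)
  have f: "exp (\<i> * of_real (pi * (s - 1/2))) = cis (pi * (s - 1/2))"
   by (simp add: cis_conv_exp)
  show ?thesis unfolding e f
   by (rule complex_eqI) (simp_all add: c cos_double_sin sin_double power2_eq_square)
 qed
 also have "\<dots> = exp (of_real (ln (2 * sin (pi * s))) + \<i> * of_real (pi * (s - 1/2)))"
  using pos by (simp add: exp_add exp_of_real)
 also have "Ln \<dots> = of_real (ln (2 * sin (pi * s))) + \<i> * of_real (pi * (s - 1/2))"
 proof (rule Ln_exp)
  have "pi * (s - 1/2) > pi * (-1)" "pi * (s - 1/2) < pi * 1"
   using s by (intro mult_strict_left_mono; simp)+
  thus "- pi < Im (of_real (ln (2 * sin (pi * s))) + \<i> * of_real (pi * (s - 1/2)))"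
   "Im (of_real (ln (2 * sin (pi * s))) + \<i> * of_real (pi * (s - 1/2))) \<le> pi" by simp_all
 qed
 finally show ?thesis .
qed

text \<open>Abel-damped sawtooth series: the factor \<rho> < 1 keeps the logarithm series absolutely
  convergent, so that it can be integrated term by term afterwards.\<close>

lemma sin_series_Im_Ln:
 assumes "0 \<le> \<rho>" "\<rho> < 1"
 shows "(\<lambda>n. \<rho> ^ Suc n * sin (2 * pi * real (Suc n) * s) / real (Suc n)) sums
  (- Im (Ln (1 - of_real \<rho> * exp (2 * of_real pi * \<i> * of_real s))))"
proof -
 let ?z = "of_real \<rho> * exp (2 * of_real pi * \<i> * of_real s) :: complex"
 have nz: "norm ?z < 1" using assms by (simp add: norm_mult)
 have "(\<lambda>n. (-1) ^ Suc n / of_nat n * (- ?z) ^ n) sums ln (1 + (- ?z))"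
  by (rule Ln_series) (use nz in simp)
 hence "(\<lambda>n. (-1) ^ Suc (Suc n) / of_nat (Suc n) * (- ?z) ^ Suc n) sums ln (1 + (- ?z))"
  by (subst sums_Suc_iff) simp
 hence "(\<lambda>n. Im ((-1) ^ Suc (Suc n) / of_nat (Suc n) * (- ?z) ^ Suc n)) sums Im (ln (1 + (- ?z)))"
  by (rule sums_Im)
 hence "(\<lambda>n. - Im ((-1) ^ Suc (Suc n) / of_nat (Suc n) * (- ?z) ^ Suc n)) sums (- Im (ln (1 + (- ?z))))"
  by (rule sums_minus)
 moreover have "- Im ((-1) ^ Suc (Suc n) / of_nat (Suc n) * (- ?z) ^ Suc n)
   = \<rho> ^ Suc n * sin (2 * pi * real (Suc n) * s) / real (Suc n)" for n
 proof -
  have "(-1) ^ Suc (Suc n) * (- ?z) ^ Suc n = - (?z ^ Suc n)"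
   by (subst power_minus) (simp flip: power_add mult.assoc)
  moreover have "?z ^ Suc n = of_real (\<rho> ^ Suc n) * cis (2 * pi * real (Suc n) * s)"
   unfolding power_mult_distrib exp_of_nat_mult[symmetric] cis_conv_exp
   by (simp add: mult_ac)
  ultimately have "(-1) ^ Suc (Suc n) / of_nat (Suc n) * (- ?z) ^ Suc n
   = - (of_real (\<rho> ^ Suc n) * cis (2 * pi * real (Suc n) * s)) / of_nat (Suc n)"
   by (metis times_divide_eq_left)
  also have "Im \<dots> = - (\<rho> ^ Suc n * sin (2 * pi * real (Suc n) * s) / real (Suc n))"
   by (simp add: Im_divide_of_nat del: of_nat_Suc)
  finally show ?thesis by simp
 qed
 ultimately show ?thesis by simp
qed

lemma cos_series_Im_Ln:
 assumes "0 \<le> \<rho>" "\<rho> < 1" "0 \<le> x"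
 shows "(\<lambda>n. \<rho> ^ Suc n * (1 - cos (2 * pi * real (Suc n) * x)) / (2 * pi * real (Suc n) ^ 2)) sums
  (LINT s:{0..x}|lborel. - Im (Ln (1 - of_real \<rho> * exp (2 * of_real pi * \<i> * of_real s))))"
proof -
 define f where "f = (\<lambda>n s. complex_of_real (\<rho> ^ Suc n * sin (2 * pi * real (Suc n) * s) / real (Suc n)))"
 have int: "set_integrable lborel {0..x} (f n)" for n
  unfolding f_def by (intro borel_integrable_atLeastAtMost' continuous_intros) auto
 have le: "norm (f n s) \<le> \<rho> ^ Suc n" for n s
 proof -
  have "norm (f n s) = \<rho> ^ Suc n * \<bar>sin (2 * pi * real (Suc n) * s)\<bar> / real (Suc n)"
   unfolding f_def using assms by (simp add: abs_mult norm_mult norm_divide norm_power del: of_nat_Suc)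
  also have "\<dots> \<le> \<rho> ^ Suc n * 1 / 1"
   using assms by (intro frac_le mult_mono) auto
  finally show ?thesis by simp
 qed
 have sg: "summable (\<lambda>n. \<rho> ^ Suc n)" using assms by (subst summable_Suc_iff) (auto intro: summable_geometric)
 have "(\<lambda>n. LINT s:{0..x}|lborel. f n s) sums (LINT s:{0..x}|lborel. (\<Sum>n. f n s))"
 proof (rule set_sums_integral(2)[OF _ int])
  show "summable (\<lambda>n. norm (f n s))" for s
   by (rule summable_comparison_test'[OF sg]) (use le in auto)
  show "summable (\<lambda>n. LINT s:{0..x}|lborel. norm (f n s))"
  proof (rule summable_comparison_test'[where g = "\<lambda>n. x * \<rho> ^ Suc n"])
   fix n
   have "(LINT s:{0..x}|lborel. norm (f n s)) \<le> (LINT s:{0..x}|lborel. \<rho> ^ Suc n)"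
    by (rule set_integral_mono) (use int le in \<open>auto intro!: borel_integrable_atLeastAtMost' simp: set_integrable_norm\<close>)
   moreover have "(LINT s:{0..x}|lborel. norm (f n s)) \<ge> 0"
    unfolding set_lebesgue_integral_def by (intro Bochner_Integration.integral_nonneg) auto
   ultimately show "norm (LINT s:{0..x}|lborel. norm (f n s)) \<le> x * \<rho> ^ Suc n"
    using assms by (simp add: set_lebesgue_integral_def mult_ac)
  qed (use sg in \<open>auto intro: summable_mult\<close>)
 qed auto
 moreover have "(LINT s:{0..x}|lborel. f n s) = of_real (\<rho> ^ Suc n * (1 - cos (2 * pi * real (Suc n) * x)) / (2 * pi * real (Suc n) ^ 2))" for n
 proof -
  have alg: "- P * C / D - - P * 1 / D = P * (1 - C) / D" for P C D :: real
   by (simp add: divide_inverse algebra_simps)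
  have "(f n has_integral (of_real (- (\<rho> ^ Suc n) * cos (2 * pi * real (Suc n) * x) / (2 * pi * real (Suc n) ^ 2)) 
   - complex_of_real (- (\<rho> ^ Suc n) * cos (2 * pi * real (Suc n) * 0) / (2 * pi * real (Suc n) ^ 2)))) {0..x}"
   unfolding f_def
   by (rule fundamental_theorem_of_calculus[OF assms(3)])
    (auto intro!: derivative_eq_intros has_vector_derivative_of_real 
      simp: field_simps power2_eq_square simp flip: has_real_derivative_iff_has_vector_derivative simp del: of_nat_Suc)
  hence "integral {0..x} (f n) = of_real (\<rho> ^ Suc n * (1 - cos (2 * pi * real (Suc n) * x)) / (2 * pi * real (Suc n) ^ 2))"
   by (subst integral_unique, assumption) (simp only: of_real_diff[symmetric] alg mult_zero_right cos_zero)
  thus ?thesis using set_borel_integral_eq_integral(2)[OF int[of n]] by simp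
 qed
 moreover have "(\<Sum>n. f n s) = of_real (- Im (Ln (1 - of_real \<rho> * exp (2 * of_real pi * \<i> * of_real s))))" for s
  unfolding f_def using sums_of_real[OF sin_series_Im_Ln[OF assms(1,2), of s], where 'a=complex] 
  by (simp add: sums_iff del: of_nat_Suc)
 ultimately have "(\<lambda>n. complex_of_real (\<rho> ^ Suc n * (1 - cos (2 * pi * real (Suc n) * x)) / (2 * pi * real (Suc n) ^ 2))) sums
  of_real (LINT s:{0..x}|lborel. - Im (Ln (1 - of_real \<rho> * exp (2 * of_real pi * \<i> * of_real s))))"
  by (simp only: set_integral_complex_of_real)
 thus ?thesis by (simp only: sums_of_real_iff)
qed

text \<open>The damping is sent to 1. The series side converges because its terms are dominated by
  inverse squares, the integral side because the imaginary part of a logarithm is bounded by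
  pi.\<close>

lemma cos_inverse_squares_sums_01:
 assumes x: "0 \<le> x" "x \<le> 1"
 shows "(\<lambda>n. (1 - cos (2 * pi * real (Suc n) * x)) / real (Suc n) ^ 2) sums (pi\<^sup>2 * (x - x\<^sup>2))"
proof -
 define \<rho> where "\<rho> = (\<lambda>k::nat. 1 - 1 / (real k + 2))"
 have \<rho>: "0 \<le> \<rho> k" "\<rho> k < 1" for k by (auto simp: \<rho>_def field_simps)
 have \<rho>lim: "\<rho> \<longlonglongrightarrow> 1" unfolding \<rho>_def by real_asymp
 define c where "c = (\<lambda>n. (1 - cos (2 * pi * real (Suc n) * x)) / (2 * pi * real (Suc n) ^ 2))"
 have cb: "norm (c n) \<le> 1 / real (Suc n) ^ 2" for n
 proof -
  have "\<bar>1 - cos (2 * pi * real (Suc n) * x)\<bar> \<le> 2"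
   using cos_ge_minus_one[of "2 * pi * real (Suc n) * x"] cos_le_one[of "2 * pi * real (Suc n) * x"] by linarith
  moreover have "norm (c n) = \<bar>1 - cos (2 * pi * real (Suc n) * x)\<bar> / (2 * pi * real (Suc n) ^ 2)"
   by (simp add: c_def abs_mult del: of_nat_Suc)
  ultimately have "norm (c n) \<le> 2 / (2 * pi * real (Suc n) ^ 2)"
   by (simp only:) (rule divide_right_mono, auto)
  also have "\<dots> \<le> 1 / real (Suc n) ^ 2"
   using pi_ge_two by (simp add: field_simps del: of_nat_Suc) 
  finally show ?thesis .
 qed
 have sq: "summable (\<lambda>n. 1 / real (Suc n) ^ 2)"
  using inverse_squares_sums by (simp add: sums_iff add.commute)
 have sc: "summable c" by (rule summable_comparison_test'[OF sq]) (use cb in auto)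
 have T: "(\<lambda>k. \<Sum>n. \<rho> k ^ Suc n * c n) \<longlonglongrightarrow> (\<Sum>n. c n)"
 proof -
  have "(\<lambda>k. \<Sum>n. \<rho> k ^ Suc n * c n) \<longlonglongrightarrow> suminf c"
  proof (rule tannerys_theorem[THEN conjunct2, THEN conjunct2])
   show "(\<lambda>k. \<rho> k ^ Suc n * c n) \<longlonglongrightarrow> c n" for n
    using tendsto_mult[OF tendsto_power[OF \<rho>lim, of "Suc n"] tendsto_const[of "c n"]] by simp
   show "\<forall>\<^sub>F (n, k) in sequentially \<times>\<^sub>F sequentially. norm (\<rho> k ^ Suc n * c n) \<le> 1 / real (Suc n) ^ 2"
   proof (rule always_eventually, safe)
    fix n k
    have "norm (\<rho> k ^ Suc n * c n) \<le> 1 * norm (c n)"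
     unfolding norm_mult using \<rho>[of k] by (intro mult_right_mono) (auto intro!: power_le_one simp: norm_power simp del: power_Suc)
    thus "norm (\<rho> k ^ Suc n * c n) \<le> 1 / real (Suc n) ^ 2" using cb[of n] by simp
   qed
  qed (use sq in auto)
  thus ?thesis by simp
 qed
 let ?L = "\<lambda>r s. complex_of_real (- Im (Ln (1 - of_real r * exp (2 * of_real pi * \<i> * of_real s))))"
 have nn: "1 - of_real (\<rho> k) * exp (2 * of_real pi * \<i> * of_real s) \<notin> \<real>\<^sub>\<le>\<^sub>0" for k s
 proof -
  have "norm (of_real (\<rho> k) * exp (2 * of_real pi * \<i> * of_real s)) < 1" using \<rho>[of k] by (simp add: norm_mult)
  hence "Re (of_real (\<rho> k) * exp (2 * of_real pi * \<i> * of_real s)) < 1"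
   using complex_Re_le_cmod le_less_trans by blast
  thus ?thesis by (auto simp: complex_nonpos_Reals_iff)
 qed
 have I: "set_integrable lborel {0..x} (?L (\<rho> k))" for k
  by (intro borel_integrable_atLeastAtMost' continuous_intros) (use nn in auto)
 \<comment> \<open>The open interval avoids s = 0, and s = 1 when x = 1, where 1 - exp(2 pi i s)
   vanishes and the undamped logarithm is singular.\<close>
 have "(\<lambda>k. LINT s:{0<..<x}|lborel. ?L (\<rho> k) s) \<longlonglongrightarrow> (LINT s:{0<..<x}|lborel. of_real (- (pi * (s - 1/2))))"
 proof (rule set_integral_dominated_convergence[where w = "\<lambda>_. pi"])
  show "set_integrable lborel {0<..<x} (?L (\<rho> k))" for k
   by (rule set_integrable_subset[OF I]) auto
  show "set_borel_measurable lborel {0<..<x} (\<lambda>s. complex_of_real (- (pi * (s - 1/2))))"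
   unfolding set_borel_measurable_def by measurable
  show "set_integrable lborel {0<..<x} (\<lambda>_. pi)"
   by (rule set_integrable_subset[OF borel_integrable_atLeastAtMost'[of 0 x]]) auto
  show "norm (?L (\<rho> k) s) \<le> pi" for k s
   using Im_Ln_le_pi[of "1 - of_real (\<rho> k) * exp (2 * of_real pi * \<i> * of_real s)"]
    mpi_less_Im_Ln[of "1 - of_real (\<rho> k) * exp (2 * of_real pi * \<i> * of_real s)"] nn[of k s] 
   by (cases "1 - of_real (\<rho> k) * exp (2 * of_real pi * \<i> * of_real s) = 0") auto
  show "(\<lambda>k. ?L (\<rho> k) s) \<longlonglongrightarrow> of_real (- (pi * (s - 1/2)))" if "s \<in> {0<..<x}" for s
  proof -
   have s: "0 < s" "s < 1" using that x by auto
   have e: "- (pi * (s - 1/2)) = - Im (Ln (1 - of_real 1 * exp (2 * of_real pi * \<i> * of_real s)))"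
    using Ln_one_minus_exp[OF s] by simp
   have "Re (exp (2 * of_real pi * \<i> * of_real s)) < 1"
   proof -
    have "Re (exp (2 * of_real pi * \<i> * of_real s)) = cos (2 * (pi * s))"
     by (simp add: Re_exp mult_ac)
    also have "\<dots> = 1 - 2 * sin (pi * s) ^ 2" by (simp add: cos_double_sin)
    finally have "Re (exp (2 * of_real pi * \<i> * of_real s)) = 1 - 2 * sin (pi * s) ^ 2" .
    moreover have "sin (pi * s) > 0" using s by (intro sin_gt_zero) (auto simp: field_simps)
    ultimately show ?thesis by simp
   qed
   hence "1 - of_real 1 * exp (2 * of_real pi * \<i> * of_real s) \<notin> \<real>\<^sub>\<le>\<^sub>0"
    by (auto simp: complex_nonpos_Reals_iff)
   thus ?thesis unfolding e by (intro tendsto_intros \<rho>lim)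
  qed
 qed
 moreover have "(LINT s:{0<..<x}|lborel. ?L (\<rho> k) s) = of_real (\<Sum>n. \<rho> k ^ Suc n * c n)" for k
 proof -
  have "(LINT s:{0<..<x}|lborel. ?L (\<rho> k) s) = (LINT s:{0..x}|lborel. ?L (\<rho> k) s)"
   by (rule set_integral_Ioo_eq_Icc[OF I])
  also have "\<dots> = of_real (\<Sum>n. \<rho> k ^ Suc n * c n)"
   unfolding set_integral_complex_of_real c_def times_divide_eq_right
   using cos_series_Im_Ln[OF \<rho> x(1), of k] by (simp add: sums_iff del: of_nat_Suc)
  finally show ?thesis .
 qed
 ultimately have "(\<lambda>k. complex_of_real (\<Sum>n. \<rho> k ^ Suc n * c n)) \<longlonglongrightarrow> (LINT s:{0<..<x}|lborel. of_real (- (pi * (s - 1/2))))" by simp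
 moreover have "(LINT s:{0<..<x}|lborel. complex_of_real (- (pi * (s - 1/2)))) = of_real (- (pi * (x\<^sup>2 - x) / 2))"
 proof -
  have i: "set_integrable lborel {0..x} (\<lambda>s. complex_of_real (- (pi * (s - 1/2))))"
   by (intro borel_integrable_atLeastAtMost' continuous_intros)
  have "((\<lambda>s. complex_of_real (- (pi * (s - 1/2)))) has_integral (of_real (- (pi * (x\<^sup>2 - x) / 2)) - complex_of_real (- (pi * (0\<^sup>2 - 0) / 2)))) {0..x}"
   by (rule fundamental_theorem_of_calculus[OF x(1)])
    (auto intro!: derivative_eq_intros has_vector_derivative_of_real 
      simp: field_simps power2_eq_square simp flip: has_real_derivative_iff_has_vector_derivative)
  hence h: "(LINT s:{0..x}|lborel. complex_of_real (- (pi * (s - 1/2)))) = of_real (- (pi * (x\<^sup>2 - x) / 2))"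
   unfolding set_borel_integral_eq_integral(2)[OF i] by (subst integral_unique, assumption) simp
  have "(LINT s:{0<..<x}|lborel. complex_of_real (- (pi * (s - 1/2)))) = (LINT s:{0..x}|lborel. complex_of_real (- (pi * (s - 1/2))))"
   by (rule set_integral_Ioo_eq_Icc[OF i])
  with h show ?thesis by simp
 qed
 ultimately have "(\<lambda>k. (\<Sum>n. \<rho> k ^ Suc n * c n)) \<longlonglongrightarrow> - (pi * (x\<^sup>2 - x) / 2)"
  by (simp only: tendsto_of_real_iff)
 with T have "suminf c = - (pi * (x\<^sup>2 - x) / 2)" by (rule LIMSEQ_unique)
 with sc have "c sums (- (pi * (x\<^sup>2 - x) / 2))" by (simp add: sums_iff)
 hence "(\<lambda>n. 2 * pi * c n) sums (2 * pi * (- (pi * (x\<^sup>2 - x) / 2)))" by (rule sums_mult)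
 moreover have "2 * pi * c n = (1 - cos (2 * pi * real (Suc n) * x)) / real (Suc n) ^ 2" for n
  by (simp add: c_def del: of_nat_Suc)
 moreover have "2 * pi * (- (pi * (x\<^sup>2 - x) / 2)) = pi\<^sup>2 * (x - x\<^sup>2)"
  by (simp add: power2_eq_square field_simps)
 ultimately show ?thesis by simp
qed

text \<open>The periodic quadratic is written as one global quadratic corrected by a hinge y - k for
  each integer k that has been passed. The hinges carry the point masses of the second derivative;
  from them Poisson summation later recovers values at integers.\<close>

lemma cos_inverse_squares_sums:
 fixes y :: real
 assumes y: "0 \<le> y"
 shows "(\<lambda>n. cos (2 * pi * real (Suc n) * y) / real (Suc n) ^ 2) sums
  (pi\<^sup>2 / 6 + pi\<^sup>2 * (y\<^sup>2 - y) - 2 * pi\<^sup>2 * (\<Sum>k=1..nat \<lfloor>y\<rfloor>. y - real k))"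
proof -
 define m where "m = nat \<lfloor>y\<rfloor>"
 define z where "z = y - real m"
 have z: "0 \<le> z" "z \<le> 1" using y unfolding z_def m_def by linarith+
 have c: "cos (2 * pi * real (Suc n) * y) = cos (2 * pi * real (Suc n) * z)" for n
 proof -
  have "2 * pi * real (Suc n) * y = 2 * pi * real (Suc n) * z + 2 * real (Suc n * m) * pi"
   by (simp add: z_def algebra_simps)
  thus ?thesis by (simp only: cos_add cos_2npi sin_2npi mult_1_right mult_zero_right diff_zero)
 qed
 have "(\<lambda>n. 1 / real (Suc n) ^ 2) sums (pi\<^sup>2 / 6)"
  using inverse_squares_sums by (simp add: add.commute)
 from sums_diff[OF this cos_inverse_squares_sums_01[OF z]]
 have "(\<lambda>n. cos (2 * pi * real (Suc n) * y) / real (Suc n) ^ 2) sums (pi\<^sup>2 / 6 - pi\<^sup>2 * (z - z\<^sup>2))"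
  unfolding c by (simp add: diff_divide_distrib del: of_nat_Suc)
 also have "pi\<^sup>2 / 6 - pi\<^sup>2 * (z - z\<^sup>2) = pi\<^sup>2 / 6 + pi\<^sup>2 * (y\<^sup>2 - y) - 2 * pi\<^sup>2 * (real m * y - real m * (real m + 1) / 2)"
  by (simp add: z_def power2_eq_square field_simps)
 also have "real m * y - real m * (real m + 1) / 2 = (\<Sum>k=1..m. y - real k)"
  by (induction m) (simp_all add: field_simps)
 finally show ?thesis by (simp add: m_def)
qed

section \<open>Fourier expansion of a character-weighted staircase\<close>

text \<open>Reflecting h to q - h preserves \<open>chi\<close> by evenness and turns the sum S into
  q times the full character sum, which is 0, minus S.\<close>

lemma sum_times_even_character:
 assumes chi: "dirichlet_character q chi" "\<not> principal_character q chi" "even_character chi"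
 shows "(\<Sum>h<q. of_nat h * chi (int h)) = 0"
proof -
 have q: "q > 1" and chi0: "chi 0 = 0" using nonprincipal_character_modulus[OF chi(1,2)] by auto
 have chiq: "chi (int (q - h)) = chi (int h)" if "h \<in> {1..<q}" for h
 proof -
  have "chi (int (q - h)) = chi (- int h + int q)" using that by (simp add: of_nat_diff)
  also have "\<dots> = chi (- int h)" using chi(1) unfolding dirichlet_character_def by blast
  finally show ?thesis using dirichlet_character_uminus[OF chi(1,3)] by simp
 qed
 have s0: "(\<Sum>h<q. g h) = (\<Sum>h=1..<q. g h)" if "g 0 = 0" for g :: "nat => complex"
  using that q by (simp add: atLeast0LessThan[symmetric] sum.atLeast_Suc_lessThan)
 have "(\<Sum>h=1..<q. of_nat h * chi (int h)) = (\<Sum>h=1..<q. of_nat (q - h) * chi (int (q - h)))"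
  by (rule sum.reindex_bij_witness[of _ "\<lambda>h. q - h" "\<lambda>h. q - h"]) auto
 also have "\<dots> = (\<Sum>h=1..<q. of_nat q * chi (int h) - of_nat h * chi (int h))"
  by (intro sum.cong refl) (simp only: chiq, auto simp: of_nat_diff algebra_simps)
 also have "\<dots> = of_nat q * (\<Sum>h=1..<q. chi (int h)) - (\<Sum>h=1..<q. of_nat h * chi (int h))"
  by (simp add: sum_subtractf sum_distrib_left)
 also have "(\<Sum>h=1..<q. chi (int h)) = 0"
  using sum_nonprincipal_character[OF chi(1,2)] s0[of "\<lambda>h. chi (int h)"] chi0 by simp
 finally have "(\<Sum>h=1..<q. of_nat h * chi (int h)) = 0"
  by (simp add: eq_neg_iff_add_eq_0)
 thus ?thesis using s0[of "\<lambda>h. of_nat h * chi (int h)"] by simp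
qed

text \<open>Evenness makes the sum with sines vanish, since h -> -h reverses its sign. Only the
  product of cosines survives in the addition formula.\<close>

lemma gauss_sum_twist_cos:
 fixes a :: int
 assumes chi: "dirichlet_character q chi" "primitive_character q chi" "even_character chi"
 shows "gauss_sum q chi * cnj (chi a) * of_real (cos (2 * pi * of_int a * x / real q))
  = (\<Sum>h<q. chi (int h) * of_real (cos (2 * pi * of_int a * ((x + real h) / real q))))"
proof -
 have q: "q > 0" using chi by (simp add: dirichlet_character_def)
 let ?\<theta> = "\<lambda>h. 2 * pi * of_int a * real h / real q"
 have e: "exp (2 * of_real pi * \<i> * of_int (b * int h) / of_nat q) = cis (2 * pi * of_int b * real h / real q)" for h b
  by (simp add: cis_conv_exp mult_ac)
 let ?\<phi> = "\<lambda>x. chi x * exp (2 * of_real pi * \<i> * of_int (a * x) / of_nat q)"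
 have per: "?\<phi> (x mod int q) = ?\<phi> x" for x
  using dirichlet_character_mod[OF chi(1), of x] exp_2pi_int_mod[OF q, of "a * x"]
   exp_2pi_int_mod[OF q, of "a * (x mod int q)"] by (simp add: mod_mult_right_eq)
 have S: "gauss_sum q chi * cnj (chi a) = (\<Sum>h<q. chi (int h) * cis (?\<theta> h))"
  using gauss_sum_twist[OF chi(1,2), of a] unfolding e by (simp add: mult.commute)
 have "(\<Sum>h<q. ?\<phi> (-1 * int h)) = (\<Sum>h<q. ?\<phi> (int h))"
  by (rule sum_residues_mult[OF q, of "-1" ?\<phi>]) (use per in auto)
 moreover have "?\<phi> (-1 * int h) = chi (int h) * cis (- ?\<theta> h)" for h
  using dirichlet_character_uminus[OF chi(1,3), of "int h"] e[of "-a" h] by simp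
 ultimately have S': "(\<Sum>h<q. chi (int h) * cis (- ?\<theta> h)) = (\<Sum>h<q. chi (int h) * cis (?\<theta> h))"
  unfolding e by simp
 have sin0: "(\<Sum>h<q. chi (int h) * of_real (sin (?\<theta> h))) = 0"
 proof -
  have "of_real (sin t) = (cis t - cis (- t)) / (2 * \<i>)" for t
   by (simp add: complex_eq_iff)
  hence "(\<Sum>h<q. chi (int h) * of_real (sin (?\<theta> h))) = ((\<Sum>h<q. chi (int h) * cis (?\<theta> h)) - (\<Sum>h<q. chi (int h) * cis (- ?\<theta> h))) / (2 * \<i>)"
   by (simp only: right_diff_distrib diff_divide_distrib sum_subtractf times_divide_eq_right sum_divide_distrib)
  thus ?thesis using S' by simp
 qed
 have cos1: "(\<Sum>h<q. chi (int h) * of_real (cos (?\<theta> h))) = gauss_sum q chi * cnj (chi a)"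
 proof -
  have "cis t = of_real (cos t) + \<i> * of_real (sin t)" for t by (simp add: complex_eq_iff)
  hence "(\<Sum>h<q. chi (int h) * cis (?\<theta> h)) = (\<Sum>h<q. chi (int h) * of_real (cos (?\<theta> h))) + \<i> * (\<Sum>h<q. chi (int h) * of_real (sin (?\<theta> h)))"
   by (simp add: sum.distrib[symmetric] sum_distrib_left algebra_simps)
  thus ?thesis using sin0 S by simp
 qed
 let ?X = "2 * pi * of_int a * x / real q"
 have "cos (2 * pi * of_int a * ((x + real h) / real q)) = cos ?X * cos (?\<theta> h) - sin ?X * sin (?\<theta> h)" for h
 proof -
  have "2 * pi * of_int a * ((x + real h) / real q) = ?X + ?\<theta> h" by (simp add: add_divide_distrib algebra_simps)
  thus ?thesis by (simp add: cos_add)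
 qed
 hence "(\<Sum>h<q. chi (int h) * of_real (cos (2 * pi * of_int a * ((x + real h) / real q))))
  = of_real (cos ?X) * (\<Sum>h<q. chi (int h) * of_real (cos (?\<theta> h))) - of_real (sin ?X) * (\<Sum>h<q. chi (int h) * of_real (sin (?\<theta> h)))"
  by (simp only: of_real_diff of_real_mult right_diff_distrib sum_subtractf sum_distrib_left mult_ac)
 thus ?thesis using sin0 cos1 by simp
qed

text \<open>Every m \<ge> 1 is k q - h for exactly one h with 0 \<le> h < q, and then (x + h)/q - k
  = (x - m)/q and chi(h) = chi(-h) = chi(m). The hinges of the q shifted copies therefore merge into
  one hinge per integer, weighted by the character.\<close>

lemma sum_character_staircase:
 assumes chi: "dirichlet_character q chi" "even_character chi" and x: "0 \<le> x"
 shows "(\<Sum>h<q. chi (int h) * (\<Sum>k=1..nat \<lfloor>(x + real h) / real q\<rfloor>. of_real ((x + real h) / real q - real k)))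
  = (\<Sum>m=1..nat \<lfloor>x\<rfloor>. chi (int m) * of_real (x - real m)) / of_nat q"
proof -
 have q: "q > 0" using chi by (simp add: dirichlet_character_def)
 define T where "T = (SIGMA h:{..<q}. {1..nat \<lfloor>(x + real h) / real q\<rfloor>})"
 have T: "(h, k) \<in> T \<longleftrightarrow> h < q \<and> 1 \<le> k \<and> real k * real q - real h \<le> x" for h k
  using q x unfolding T_def by (auto simp: le_nat_iff le_floor_iff field_simps)
 have bound: "h \<le> k * q" if "(h, k) \<in> T" for h k
 proof -
  have "h < q" "1 \<le> k" using that by (auto simp: T)
  thus ?thesis using mult_le_mono1[of 1 k q] by linarith
 qed
 have "(\<Sum>h<q. chi (int h) * (\<Sum>k=1..nat \<lfloor>(x + real h) / real q\<rfloor>. of_real ((x + real h) / real q - real k)))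
  = (\<Sum>(h,k)\<in>T. chi (int h) * of_real ((x + real h) / real q - real k))"
  unfolding T_def by (subst sum.Sigma[symmetric]) (auto simp: sum_distrib_left)
 also have "\<dots> = (\<Sum>m=1..nat \<lfloor>x\<rfloor>. chi (int m) * of_real (x - real m) / of_nat q)"
 proof (rule sum.reindex_bij_witness[where j = "\<lambda>(h,k). k * q - h" and i = "\<lambda>m. (nat ((- int m) mod int q), (m + nat ((- int m) mod int q)) div q)"])
  fix hk assume hk: "hk \<in> T"
  obtain h k where [simp]: "hk = (h, k)" by force
  note b = bound[OF hk[simplified]]
  have h: "h < q" "1 \<le> k" "real k * real q - real h \<le> x" using hk T by auto
  have im: "int (k * q - h) = int k * int q - int h" using b by (simp add: of_nat_diff)
  have "(- int (k * q - h)) mod int q = (int h + (- int k) * int q) mod int q"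
   unfolding im by (simp add: algebra_simps)
  also have "\<dots> = int h" using h(1) by (simp only: mod_mult_self1) simp
  finally have e: "nat ((- int (k * q - h)) mod int q) = h" by simp
  show "(nat ((- int (case hk of (h, k) => k * q - h)) mod int q),
    ((case hk of (h, k) => k * q - h) + nat ((- int (case hk of (h, k) => k * q - h)) mod int q)) div q) = hk"
   using e b q by simp
  have "1 \<le> k * q - h" using h mult_le_mono1[of 1 k q] by linarith
  moreover have "real (k * q - h) \<le> x" using h(3) b by (simp add: of_nat_diff)
  ultimately show "(case hk of (h, k) => k * q - h) \<in> {1..nat \<lfloor>x\<rfloor>}"
   using le_nat_floor[of "k * q - h" x] by simp
  have "chi (int (k * q - h)) = chi ((- int h) mod int q)"
   unfolding im using dirichlet_character_mod[OF chi(1), of "int k * int q - int h"]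
   by (metis mod_mult_self2 uminus_add_conv_diff mult.commute diff_conv_add_uminus add.commute mod_mult_self1)
  hence "chi (int (k * q - h)) = chi (int h)"
   using dirichlet_character_mod[OF chi(1)] dirichlet_character_uminus[OF chi] by simp
  thus "chi (int (case hk of (h, k) => k * q - h)) * of_real (x - real (case hk of (h, k) => k * q - h)) / of_nat q
    = (case hk of (h, k) => chi (int h) * of_real ((x + real h) / real q - real k))"
   using b q by (simp add: of_nat_diff field_simps)
 next
  fix m assume m: "m \<in> {1..nat \<lfloor>x\<rfloor>}"
  define h where "h = nat ((- int m) mod int q)"
  have ih: "int h = (- int m) mod int q" using q by (simp add: h_def)
  have hq: "h < q" using q by (simp add: h_def nat_less_iff)
  have "int q dvd int m + int h" unfolding ih
   by (metis add.commute dvd_minus_mod minus_add_distrib diff_minus_eq_add dvd_minus_iff minus_diff_eq uminus_add_conv_diff add.inverse_inverse)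
  hence "q dvd m + h" by (metis of_nat_add of_nat_dvd_iff)
  then obtain k where k: "m + h = k * q" by (metis dvdE mult.commute)
  have kk: "(m + h) div q = k" using k q by simp
  have "k \<ge> 1" using k m by (cases k) auto
  have mk: "m = k * q - h" using k by simp
  have "real k * real q - real h = real m" using k by (metis add_diff_cancel_right' of_nat_add of_nat_mult)
  moreover have "real m \<le> x" using m x by simp linarith
  ultimately show "(nat ((- int m) mod int q), (m + nat ((- int m) mod int q)) div q) \<in> T"
   using hq \<open>k \<ge> 1\<close> kk unfolding h_def[symmetric] T by simp
  show "(case (nat ((- int m) mod int q), (m + nat ((- int m) mod int q)) div q) of (h, k) => k * q - h) = m"
   unfolding h_def[symmetric] kk using mk by simp
 qed
 finally show ?thesis by (simp add: sum_divide_distrib)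
qed

text \<open>A character-weighted combination of the quadratics at (x + h)/q. The parts free of h and
  linear in h vanish because the sums of chi(h) and h chi(h) do. The part quadratic in h is the
  constant \<open>K\<close>, which later meets the integral of a second derivative and
  disappears.\<close>

lemma gauss_sum_cos_series:
 assumes chi: "dirichlet_character q chi" "primitive_character q chi" "\<not> principal_character q chi" "even_character chi"
 obtains K where "!!x. x \<ge> 0 ==>
  (\<lambda>n. gauss_sum q chi * cnj (chi (int (Suc n))) * of_real (cos (2 * pi * real (Suc n) * x / real q)) / of_nat (Suc n) ^ 2) sums
   (K - 2 * of_real pi ^ 2 / of_nat q * (\<Sum>m=1..nat \<lfloor>x\<rfloor>. chi (int m) * of_real (x - real m)))"
proof
 fix x :: real assume x: "x \<ge> 0"
 have q: "q > 0" using chi by (simp add: dirichlet_character_def)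
 let ?y = "\<lambda>h. (x + real h) / real q"
 let ?K = "of_real pi ^ 2 * (\<Sum>h<q. chi (int h) * of_nat h ^ 2) / of_nat q ^ 2 :: complex"
 have "(\<lambda>n. \<Sum>h<q. chi (int h) * of_real (cos (2 * pi * real (Suc n) * ?y h) / real (Suc n) ^ 2)) sums
  (\<Sum>h<q. chi (int h) * of_real (pi\<^sup>2 / 6 + pi\<^sup>2 * ((?y h)\<^sup>2 - ?y h) - 2 * pi\<^sup>2 * (\<Sum>k=1..nat \<lfloor>?y h\<rfloor>. ?y h - real k)))"
  by (intro sums_sum sums_mult sums_of_real cos_inverse_squares_sums) (use x in auto)
 also have "(\<lambda>n. \<Sum>h<q. chi (int h) * of_real (cos (2 * pi * real (Suc n) * ?y h) / real (Suc n) ^ 2)) =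
  (\<lambda>n. gauss_sum q chi * cnj (chi (int (Suc n))) * of_real (cos (2 * pi * real (Suc n) * x / real q)) / of_nat (Suc n) ^ 2)"
 proof
  fix n
  show "(\<Sum>h<q. chi (int h) * of_real (cos (2 * pi * real (Suc n) * ?y h) / real (Suc n) ^ 2)) =
   gauss_sum q chi * cnj (chi (int (Suc n))) * of_real (cos (2 * pi * real (Suc n) * x / real q)) / of_nat (Suc n) ^ 2"
   using gauss_sum_twist_cos[OF chi(1,2,4), of "int (Suc n)" x]
   by (simp add: sum_divide_distrib del: of_nat_Suc)
 qed
 also have "(\<Sum>h<q. chi (int h) * of_real (pi\<^sup>2 / 6 + pi\<^sup>2 * ((?y h)\<^sup>2 - ?y h) - 2 * pi\<^sup>2 * (\<Sum>k=1..nat \<lfloor>?y h\<rfloor>. ?y h - real k)))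
  = ?K - 2 * of_real pi ^ 2 / of_nat q * (\<Sum>m=1..nat \<lfloor>x\<rfloor>. chi (int m) * of_real (x - real m))"
 proof -
  let ?c = "of_real (pi\<^sup>2 / 6 + pi\<^sup>2 * (x\<^sup>2 / real q ^ 2 - x / real q)) :: complex"
  let ?d = "of_real (pi\<^sup>2 * (2 * x / real q ^ 2 - 1 / real q)) :: complex"
  have "chi (int h) * of_real (pi\<^sup>2 / 6 + pi\<^sup>2 * ((?y h)\<^sup>2 - ?y h) - 2 * pi\<^sup>2 * (\<Sum>k=1..nat \<lfloor>?y h\<rfloor>. ?y h - real k))
   = ?c * chi (int h) + ?d * (of_nat h * chi (int h)) + of_real pi ^ 2 / of_nat q ^ 2 * (chi (int h) * of_nat h ^ 2)
    - 2 * of_real pi ^ 2 * (chi (int h) * (\<Sum>k=1..nat \<lfloor>?y h\<rfloor>. of_real (?y h - real k)))" for h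
  proof -
   have "pi\<^sup>2 * ((?y h)\<^sup>2 - ?y h) = pi\<^sup>2 * (x\<^sup>2 / real q ^ 2 - x / real q) + pi\<^sup>2 * (2 * x / real q ^ 2 - 1 / real q) * real h + pi\<^sup>2 / real q ^ 2 * real h ^ 2"
    using q by (simp add: field_simps power2_eq_square)
   hence r: "pi\<^sup>2 / 6 + pi\<^sup>2 * ((?y h)\<^sup>2 - ?y h) - 2 * pi\<^sup>2 * (\<Sum>k=1..nat \<lfloor>?y h\<rfloor>. ?y h - real k)
    = (pi\<^sup>2 / 6 + pi\<^sup>2 * (x\<^sup>2 / real q ^ 2 - x / real q)) + pi\<^sup>2 * (2 * x / real q ^ 2 - 1 / real q) * real h + pi\<^sup>2 / real q ^ 2 * real h ^ 2
     - 2 * pi\<^sup>2 * (\<Sum>k=1..nat \<lfloor>?y h\<rfloor>. ?y h - real k)" by simp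
   show ?thesis unfolding r unfolding of_real_add of_real_diff[of _ "2 * pi\<^sup>2 * (\<Sum>k=1..nat \<lfloor>?y h\<rfloor>. ?y h - real k)"] of_real_mult[of _ "real h"]
     of_real_mult[of _ "real h ^ 2"] of_real_mult[of _ "(\<Sum>k=1..nat \<lfloor>?y h\<rfloor>. ?y h - real k)"]
    of_real_sum distrib_left right_diff_distrib
    by (simp add: algebra_simps)
  qed
  hence "(\<Sum>h<q. chi (int h) * of_real (pi\<^sup>2 / 6 + pi\<^sup>2 * ((?y h)\<^sup>2 - ?y h) - 2 * pi\<^sup>2 * (\<Sum>k=1..nat \<lfloor>?y h\<rfloor>. ?y h - real k)))
   = ?c * (\<Sum>h<q. chi (int h)) + ?d * (\<Sum>h<q. of_nat h * chi (int h)) + of_real pi ^ 2 / of_nat q ^ 2 * (\<Sum>h<q. chi (int h) * of_nat h ^ 2)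
   - 2 * of_real pi ^ 2 * (\<Sum>h<q. chi (int h) * (\<Sum>k=1..nat \<lfloor>?y h\<rfloor>. of_real (?y h - real k)))"
   by (simp only: sum.distrib sum_subtractf sum_distrib_left)
  thus ?thesis
   unfolding sum_nonprincipal_character[OF chi(1,3)] sum_times_even_character[OF chi(1,3,4)]
    sum_character_staircase[OF chi(1,4) x] by simp
 qed
 finally show "(\<lambda>n. gauss_sum q chi * cnj (chi (int (Suc n))) * of_real (cos (2 * pi * real (Suc n) * x / real q)) / of_nat (Suc n) ^ 2) sums
   (?K - 2 * of_real pi ^ 2 / of_nat q * (\<Sum>m=1..nat \<lfloor>x\<rfloor>. chi (int m) * of_real (x - real m)))" .
qed

section \<open>Poisson summation twisted by an even primitive character\<close>

text \<open>At most \<open>nat \<lfloor>x\<rfloor>\<close> hinges are nonzero and each is at most x.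
  This gives the majorant x^2 \<open>norm (h'' x)\<close> under which the sum over hinges is
  integrated term by term.\<close>

lemma sum_max_le_square:
 fixes x :: real
 assumes x: "x \<ge> 0"
 shows "(\<Sum>m<M. max 0 (x - real (Suc m))) \<le> x\<^sup>2"
proof -
 have "(\<Sum>m<M. max 0 (x - real (Suc m))) = (\<Sum>m\<in>{..<M} \<inter> {..<nat \<lfloor>x\<rfloor>}. max 0 (x - real (Suc m)))"
 proof (rule sum.mono_neutral_right)
  show "\<forall>m\<in>{..<M} - {..<M} \<inter> {..<nat \<lfloor>x\<rfloor>}. max 0 (x - real (Suc m)) = 0"
  proof
   fix m assume "m \<in> {..<M} - {..<M} \<inter> {..<nat \<lfloor>x\<rfloor>}"
   hence "nat \<lfloor>x\<rfloor> \<le> m" by auto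
   hence "x < real (Suc m)" using x by linarith
   thus "max 0 (x - real (Suc m)) = 0" by simp
  qed
 qed auto
 also have "\<dots> \<le> (\<Sum>m\<in>{..<M} \<inter> {..<nat \<lfloor>x\<rfloor>}. x)"
  by (intro sum_mono) (use x in auto)
 also have "\<dots> \<le> (\<Sum>m\<in>{..<nat \<lfloor>x\<rfloor>}. x)" by (rule sum_mono2) (use x in auto)
 also have "\<dots> = of_int \<lfloor>x\<rfloor> * x" using x by simp
 also have "\<dots> \<le> x * x" using x by (intro mult_right_mono) auto
 finally show ?thesis by (simp add: power2_eq_square)
qed

text \<open>Both integrations by parts are done at once: h sin(w x)/w + h' cos(w x)/w^2 is a
  primitive of h cos(w x) + h'' cos(w x)/w^2 and vanishes at both ends.\<close>

lemma cos_integral_by_parts_Ioi: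
 fixes h h' h'' :: "real => complex"
 assumes w: "w > 0"
  and d1: "!!x. x > 0 ==> (h has_vector_derivative h' x) (at x)"
  and d2: "!!x. x > 0 ==> (h' has_vector_derivative h'' x) (at x)"
  and c2: "continuous_on {0<..} h''"
  and i0: "set_integrable lborel {0<..} h" and i2: "set_integrable lborel {0<..} h''"
  and l0: "(h \<longlongrightarrow> 0) (at_right 0)" "(h' \<longlongrightarrow> 0) (at_right 0)"
  and l1: "(h \<longlongrightarrow> 0) at_top" "(h' \<longlongrightarrow> 0) at_top"
 shows "(LINT x:{0<..}|lborel. h x * of_real (cos (w * x))) = - (LINT x:{0<..}|lborel. h'' x * of_real (cos (w * x))) / of_real (w\<^sup>2)"
proof -
 have c0: "continuous_on {0<..} h"
  using d1 by (intro continuous_at_imp_continuous_on) (auto intro: has_vector_derivative_continuous)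
 have I: "set_integrable lborel {0<..} (\<lambda>x. f x * complex_of_real (cos (w * x)))"
  if "set_integrable lborel {0<..} f" for f
 proof (rule set_integrable_bound[OF that])
  have [measurable]: "(\<lambda>x. indicator {0<..} x *\<^sub>R f x) \<in> borel_measurable lborel"
   using that unfolding set_integrable_def by (rule borel_measurable_integrable)
  have "(\<lambda>x. (indicator {0<..} x *\<^sub>R f x) * complex_of_real (cos (w * x))) \<in> borel_measurable lborel" by measurable
  thus "set_borel_measurable lborel {0<..} (\<lambda>x. f x * complex_of_real (cos (w * x)))"
   by (simp add: set_borel_measurable_def)
  show "AE x in lborel. x \<in> {0<..} \<longrightarrow> norm (f x * complex_of_real (cos (w * x))) \<le> norm (f x)"
   by (auto simp: norm_mult intro!: mult_left_le)
 qed
 let ?f = "\<lambda>x. h x * of_real (cos (w * x)) + h'' x * of_real (cos (w * x)) / of_real (w\<^sup>2)"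
 let ?F = "\<lambda>x. h x * of_real (sin (w * x) / w) + h' x * of_real (cos (w * x) / w\<^sup>2)"
 have i2': "set_integrable lborel {0<..} (\<lambda>x. h'' x * of_real (cos (w * x)) / complex_of_real (w\<^sup>2))"
  using I[OF i2] by (rule set_integrable_divide)
 have "(LINT x:{0<..}|lborel. ?f x) = 0 - 0"
 proof (rule set_integral_FTC_Ioi[where F = ?F])
  show "(?F has_vector_derivative ?f x) (at x)" if "x > 0" for x
  proof -
   have s: "((\<lambda>x. complex_of_real (sin (w * x) / w)) has_vector_derivative of_real (cos (w * x))) (at x)"
    by (intro has_vector_derivative_of_real) (use w in \<open>auto intro!: derivative_eq_intros\<close>)
   have c: "((\<lambda>x. complex_of_real (cos (w * x) / w\<^sup>2)) has_vector_derivative of_real (- sin (w * x) / w)) (at x)"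
    by (intro has_vector_derivative_of_real) (use w in \<open>auto intro!: derivative_eq_intros simp: power2_eq_square\<close>)
   have "(?F has_vector_derivative (h x * of_real (cos (w * x)) + h' x * of_real (sin (w * x) / w)
     + (h' x * of_real (- sin (w * x) / w) + h'' x * of_real (cos (w * x) / w\<^sup>2)))) (at x)"
    by (intro has_vector_derivative_add has_vector_derivative_mult d1 d2 that s c)
   thus ?thesis by simp
  qed
  show "continuous_on {0<..} ?f" by (intro continuous_intros c0 c2) (use w in auto)
  show "set_integrable lborel {0<..} ?f" by (intro set_integral_add I i0 i2')
  have A: "((\<lambda>x. g x * of_real (b x)) \<longlongrightarrow> 0) F" if "(g \<longlongrightarrow> 0) F" "!!x. norm (b x) \<le> B" 
   for g :: "real => complex" and b B F
  proof (rule Lim_null_comparison)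
   show "\<forall>\<^sub>F x in F. norm (g x * of_real (b x)) \<le> norm (g x) * B"
    using that(2) by (intro always_eventually) (auto simp: norm_mult intro!: mult_left_mono)
   show "((\<lambda>x. norm (g x) * B) \<longlongrightarrow> 0) F"
    using tendsto_mult_left_zero[OF tendsto_norm_zero[OF that(1)]] .
  qed
  have b1: "norm (sin (w * x) / w) \<le> 1 / w" for x using w by (simp add: divide_right_mono)
  have b2: "norm (cos (w * x) / w\<^sup>2) \<le> 1 / w\<^sup>2" for x using w by (simp add: divide_right_mono)
  show "(?F \<longlongrightarrow> 0) (at_right 0)" using tendsto_add[OF A[OF l0(1) b1] A[OF l0(2) b2]] by simp
  show "(?F \<longlongrightarrow> 0) at_top" using tendsto_add[OF A[OF l1(1) b1] A[OF l1(2) b2]] by simp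
 qed
 also have "(LINT x:{0<..}|lborel. ?f x) = (LINT x:{0<..}|lborel. h x * of_real (cos (w * x))) + (LINT x:{0<..}|lborel. h'' x * of_real (cos (w * x)) / of_real (w\<^sup>2))"
  by (rule set_integral_add(2)[OF I[OF i0] i2'])
 finally show ?thesis by (simp add: set_integral_divide_zero eq_neg_iff_add_eq_0)
qed

text \<open>The hinge max 0 (x - m) is a Green function of the second derivative, so pairing it with
  \<open>h''\<close> returns the value at m. The conditions at infinity remove the boundary term of
  the primitive (x - m) h' - h.\<close>

lemma tail_integral_second_derivative:
 fixes h h' h'' :: "real => complex"
 assumes m: "m > 0"
  and d1: "!!x. x > 0 ==> (h has_vector_derivative h' x) (at x)"
  and d2: "!!x. x > 0 ==> (h' has_vector_derivative h'' x) (at x)"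
  and c2: "continuous_on {0<..} h''"
  and i1: "set_integrable lborel {0<..} (\<lambda>x. of_real (max 0 (x - m)) * h'' x)"
  and l1: "(h \<longlongrightarrow> 0) at_top" "((\<lambda>x. of_real x * h' x) \<longlongrightarrow> 0) at_top" "(h' \<longlongrightarrow> 0) at_top"
 shows "(LINT x:{0<..}|lborel. of_real (max 0 (x - m)) * h'' x) = h m"
proof -
 have "(LINT x:{0<..}|lborel. of_real (max 0 (x - m)) * h'' x) = (LINT x:{m<..}|lborel. of_real (x - m) * h'' x)"
  unfolding set_lebesgue_integral_def
  by (intro Bochner_Integration.integral_cong) (use m in \<open>auto simp: indicator_def max_def\<close>)
 also have "\<dots> = 0 - (- h m)"
 proof (rule set_integral_FTC_Ioi[where F = "\<lambda>x. of_real (x - m) * h' x - h x"])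
  show "((\<lambda>x. of_real (x - m) * h' x - h x) has_vector_derivative of_real (x - m) * h'' x) (at x)" if "x > m" for x
  proof -
   have "((\<lambda>x. complex_of_real (x - m)) has_vector_derivative of_real 1) (at x)"
    by (intro has_vector_derivative_of_real) (auto intro!: derivative_eq_intros)
   hence "((\<lambda>x. of_real (x - m) * h' x - h x) has_vector_derivative (of_real (x - m) * h'' x + of_real 1 * h' x - h' x)) (at x)"
    by (intro has_vector_derivative_diff has_vector_derivative_mult d1 d2) (use m that in auto)
   thus ?thesis by simp
  qed
  show "continuous_on {m<..} (\<lambda>x. of_real (x - m) * h'' x)"
   by (intro continuous_intros continuous_on_subset[OF c2]) (use m in auto)
  have "set_integrable lborel {m<..} (\<lambda>x. of_real (max 0 (x - m)) * h'' x)"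
   by (rule set_integrable_subset[OF i1]) (use m in auto)
  thus "set_integrable lborel {m<..} (\<lambda>x. of_real (x - m) * h'' x)"
   by (rule set_integrable_cong[THEN iffD1, rotated -1]) auto
  have hm: "isCont h m" "isCont h' m"
   using d1[OF m] d2[OF m] by (auto intro: has_vector_derivative_continuous)
  hence "isCont (\<lambda>x. of_real (x - m) * h' x - h x) m" by (intro continuous_intros)
  hence "((\<lambda>x. of_real (x - m) * h' x - h x) \<longlongrightarrow> - h m) (at m)" by (simp add: isCont_def)
  thus "((\<lambda>x. of_real (x - m) * h' x - h x) \<longlongrightarrow> - h m) (at_right m)"
   by (rule tendsto_within_subset) auto
  have "((\<lambda>x. of_real x * h' x - of_real m * h' x - h x) \<longlongrightarrow> 0 - of_real m * 0 - 0) at_top"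
   by (intro tendsto_intros l1)
  thus "((\<lambda>x. of_real (x - m) * h' x - h x) \<longlongrightarrow> 0) at_top"
   by (simp add: left_diff_distrib)
 qed
 finally show ?thesis by simp
qed

text \<open>The expansion of \<open>gauss_sum_cos_series\<close> is integrated against
  \<open>h''\<close>. Two integrations by parts turn each cosine into a cosine transform of
  \<open>h\<close>, and each hinge yields a point value. The inverse squares make the frequency side
  absolutely convergent; the integrability of x^2 \<open>h''\<close> dominates the sum of the
  hinges.\<close>

lemma poisson_summation_character:
 fixes h h' h'' :: "real => complex"
 assumes chi: "dirichlet_character q chi" "primitive_character q chi" "\<not> principal_character q chi" "even_character chi"
  and d1: "!!x. x > 0 ==> (h has_vector_derivative h' x) (at x)"
  and d2: "!!x. x > 0 ==> (h' has_vector_derivative h'' x) (at x)"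
  and c2: "continuous_on {0<..} h''"
  and i0: "set_integrable lborel {0<..} h" and i2: "set_integrable lborel {0<..} h''"
  and i3: "set_integrable lborel {0<..} (\<lambda>x. of_real (x\<^sup>2) * h'' x)"
  and l0: "(h \<longlongrightarrow> 0) (at_right 0)" "(h' \<longlongrightarrow> 0) (at_right 0)"
  and l1: "(h \<longlongrightarrow> 0) at_top" "((\<lambda>x. of_real x * h' x) \<longlongrightarrow> 0) at_top"
 shows "summable (\<lambda>m. chi (int (Suc m)) * h (real (Suc m)))"
  and "(\<lambda>n. gauss_sum q chi * cnj (chi (int (Suc n))) * (LINT x:{0<..}|lborel. h x * of_real (cos (2 * pi * real (Suc n) / real q * x))))
   sums (of_nat q / 2 * (\<Sum>m. chi (int (Suc m)) * h (real (Suc m))))"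
proof -
 have q: "q > 0" using chi by (simp add: dirichlet_character_def)
 have l1': "(h' \<longlongrightarrow> 0) at_top"
 proof (rule Lim_null_comparison[OF _ tendsto_norm_zero[OF l1(2)]])
  show "\<forall>\<^sub>F x in at_top. norm (h' x) \<le> norm (of_real x * h' x)"
   using eventually_ge_at_top[of 1]
  proof eventually_elim
   case (elim x)
   thus ?case using mult_right_mono[of 1 x "norm (h' x)"] by (simp add: norm_mult)
  qed
 qed
 have meas2: "(\<lambda>x. indicator {0<..} x *\<^sub>R h'' x) \<in> borel_measurable lborel"
  using i2 unfolding set_integrable_def by (rule borel_measurable_integrable)
 define w where "w = (\<lambda>n. 2 * pi * real (Suc n) / real q)"
 have w: "w n > 0" for n using q by (simp add: w_def)
 obtain K where K: "!!x. x \<ge> 0 ==>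
  (\<lambda>n. gauss_sum q chi * cnj (chi (int (Suc n))) * of_real (cos (2 * pi * real (Suc n) * x / real q)) / of_nat (Suc n) ^ 2) sums
   (K - 2 * of_real pi ^ 2 / of_nat q * (\<Sum>m=1..nat \<lfloor>x\<rfloor>. chi (int m) * of_real (x - real m)))"
  using gauss_sum_cos_series[OF chi] by blast
 define g where "g = (\<lambda>m x. chi (int (Suc m)) * (complex_of_real (max 0 (x - real (Suc m))) * h'' x))"
 have maxle: "max 0 (x - real (Suc m)) \<le> x\<^sup>2" if "x > 0" for x m
  using sum_max_le_square[of x "Suc m"] that sum_nonneg[of "{..<m}" "\<lambda>m. max 0 (x - real (Suc m))"] by (auto simp del: of_nat_Suc)
 have maxint: "set_integrable lborel {0<..} (\<lambda>x. complex_of_real (max 0 (x - real (Suc m))) * h'' x)" for m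
 proof (rule set_integrable_bound[OF i3])
  have "(\<lambda>x. complex_of_real (max 0 (x - real (Suc m))) * (indicator {0<..} x *\<^sub>R h'' x)) \<in> borel_measurable lborel"
   using meas2 by measurable
  thus "set_borel_measurable lborel {0<..} (\<lambda>x. complex_of_real (max 0 (x - real (Suc m))) * h'' x)"
   unfolding set_borel_measurable_def by (simp add: mult_ac scaleR_conv_of_real)
  show "AE x in lborel. x \<in> {0<..} \<longrightarrow> norm (complex_of_real (max 0 (x - real (Suc m))) * h'' x) \<le> norm (complex_of_real (x\<^sup>2) * h'' x)"
  proof (intro AE_I2 impI)
   fix x :: real assume "x \<in> {0<..}"
   hence "norm (complex_of_real (max 0 (x - real (Suc m)))) \<le> norm (complex_of_real (x\<^sup>2))"
    unfolding norm_of_real using maxle[of x m] by (simp del: of_nat_Suc)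
   thus "norm (complex_of_real (max 0 (x - real (Suc m))) * h'' x) \<le> norm (complex_of_real (x\<^sup>2) * h'' x)"
    unfolding norm_mult by (rule mult_right_mono) simp
  qed
 qed
 have gint: "set_integrable lborel {0<..} (g m)" for m
  unfolding g_def by (intro set_integrable_mult_right maxint)
 have gval: "(LINT x:{0<..}|lborel. g m x) = chi (int (Suc m)) * h (real (Suc m))" for m
  unfolding g_def set_integral_mult_right
  by (subst tail_integral_second_derivative[OF _ d1 d2 c2 maxint l1 l1']) auto
 have normg: "(\<Sum>m<M. norm (g m x)) \<le> norm (of_real (x\<^sup>2) * h'' x)" if "x > 0" for M x
 proof -
  have "(\<Sum>m<M. norm (g m x)) \<le> (\<Sum>m<M. max 0 (x - real (Suc m)) * norm (h'' x))"
   unfolding g_def norm_mult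
   by (intro sum_mono) (auto intro!: mult_right_mono mult_left_le_one_le dirichlet_character_norm_le[OF chi(1)] simp del: of_nat_Suc)
  also have "\<dots> \<le> x\<^sup>2 * norm (h'' x)" unfolding sum_distrib_right[symmetric]
   using that by (intro mult_right_mono sum_max_le_square) auto
  finally show ?thesis unfolding norm_mult norm_of_real by simp
 qed
 have gsum: "summable (\<lambda>m. norm (g m x))" if "x \<in> {0<..}" for x
  by (rule summableI_nonneg_bounded[OF _ normg]) (use that in auto)
 have gsumint: "summable (\<lambda>m. LINT x:{0<..}|lborel. norm (g m x))"
 proof (rule summableI_nonneg_bounded)
  fix M
  show "0 \<le> (LINT x:{0<..}|lborel. norm (g M x))"
   unfolding set_lebesgue_integral_def by (intro Bochner_Integration.integral_nonneg) auto
  have "(\<Sum>m<M. LINT x:{0<..}|lborel. norm (g m x)) = (LINT x:{0<..}|lborel. (\<Sum>m<M. norm (g m x)))"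
   unfolding set_lebesgue_integral_def scaleR_sum_right
   using gint[THEN set_integrable_norm] by (subst Bochner_Integration.integral_sum) (auto simp: set_integrable_def)
  also have "\<dots> \<le> (LINT x:{0<..}|lborel. norm (of_real (x\<^sup>2) * h'' x))"
  proof (rule set_integral_mono)
   show "set_integrable lborel {0<..} (\<lambda>x. \<Sum>m<M. norm (g m x))"
    unfolding set_integrable_def scaleR_sum_right
    using gint[THEN set_integrable_norm] by (intro Bochner_Integration.integrable_sum) (auto simp: set_integrable_def)
  qed (use normg i3 in \<open>auto intro!: set_integrable_norm\<close>)
  finally show "(\<Sum>m<M. LINT x:{0<..}|lborel. norm (g m x)) \<le> (LINT x:{0<..}|lborel. norm (of_real (x\<^sup>2) * h'' x))" .
 qed
 note gs = set_sums_integral[OF _ gint gsum gsumint]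
 have sums_m: "(\<lambda>m. chi (int (Suc m)) * h (real (Suc m))) sums (LINT x:{0<..}|lborel. (\<Sum>m. g m x))"
  using gs(2) by (simp add: gval)
 thus "summable (\<lambda>m. chi (int (Suc m)) * h (real (Suc m)))" by (rule sums_summable)
 have gfin: "(\<Sum>m. g m x) = h'' x * (\<Sum>m=1..nat \<lfloor>x\<rfloor>. chi (int m) * of_real (x - real m))" if "x > 0" for x
 proof -
  have "(\<Sum>m. g m x) = (\<Sum>m<nat \<lfloor>x\<rfloor>. g m x)"
  proof (rule suminf_finite)
   fix m assume "m \<notin> {..<nat \<lfloor>x\<rfloor>}"
   hence "x < real (Suc m)" using that by (simp add: not_less) linarith
   thus "g m x = 0" by (simp add: g_def)
  qed auto
  also have "\<dots> = (\<Sum>m<nat \<lfloor>x\<rfloor>. chi (int (Suc m)) * (of_real (x - real (Suc m)) * h'' x))"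
  proof (rule sum.cong[OF refl])
   fix m assume "m \<in> {..<nat \<lfloor>x\<rfloor>}"
   hence "real (Suc m) \<le> x" using that by (simp add: Suc_le_eq[symmetric] le_nat_iff le_floor_iff del: of_nat_Suc)
   thus "g m x = chi (int (Suc m)) * (of_real (x - real (Suc m)) * h'' x)" by (simp add: g_def max_def)
  qed
  also have "\<dots> = (\<Sum>m=1..nat \<lfloor>x\<rfloor>. chi (int m) * (of_real (x - real m) * h'' x))"
   by (rule sum.reindex_bij_witness[of _ "\<lambda>m. m - 1" Suc]) auto
  finally show ?thesis by (simp add: sum_distrib_left mult_ac)
 qed
 define f where "f = (\<lambda>n x. h'' x * (gauss_sum q chi * cnj (chi (int (Suc n))) * of_real (cos (w n * x)) / of_nat (Suc n) ^ 2))"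
 have fint: "set_integrable lborel {0<..} (f n)" for n
 proof (rule set_integrable_bound[OF set_integrable_mult_right[OF i2, of "norm (gauss_sum q chi)"]])
  have "(\<lambda>x. (indicator {0<..} x *\<^sub>R h'' x) * (gauss_sum q chi * cnj (chi (int (Suc n))) * of_real (cos (w n * x)) / of_nat (Suc n) ^ 2)) \<in> borel_measurable lborel"
   using meas2 by measurable
  thus "set_borel_measurable lborel {0<..} (f n)"
   unfolding set_borel_measurable_def f_def by (simp only: mult_scaleR_left)
  show "AE x in lborel. x \<in> {0<..} \<longrightarrow> norm (f n x) \<le> norm (of_real (norm (gauss_sum q chi)) * h'' x)"
  proof (intro AE_I2 impI)
   fix x
   have "norm (f n x) = norm (h'' x) * (norm (gauss_sum q chi) * norm (chi (int (Suc n))) * \<bar>cos (w n * x)\<bar> / real (Suc n) ^ 2)"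
    by (simp add: f_def norm_mult norm_divide norm_power del: of_nat_Suc)
   also have "\<dots> \<le> norm (h'' x) * (norm (gauss_sum q chi) * 1 * 1 / 1)"
    by (intro mult_left_mono frac_le mult_mono dirichlet_character_norm_le[OF chi(1)]) auto
   finally show "norm (f n x) \<le> norm (of_real (norm (gauss_sum q chi)) * h'' x)" by (simp add: norm_mult mult_ac)
  qed
 qed
 have fle: "norm (f n x) \<le> norm (h'' x) * norm (gauss_sum q chi) * (1 / real (Suc n) ^ 2)" for n x
 proof -
  have "norm (f n x) = norm (h'' x) * (norm (gauss_sum q chi) * norm (chi (int (Suc n))) * \<bar>cos (w n * x)\<bar> / real (Suc n) ^ 2)"
   by (simp add: f_def norm_mult norm_divide norm_power del: of_nat_Suc)
  also have "\<dots> \<le> norm (h'' x) * (norm (gauss_sum q chi) * 1 * 1 / real (Suc n) ^ 2)"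
   by (intro mult_left_mono divide_right_mono mult_mono dirichlet_character_norm_le[OF chi(1)]) auto
  finally show ?thesis by (simp add: mult_ac)
 qed
 have sq: "summable (\<lambda>n. 1 / real (Suc n) ^ 2)"
  using inverse_squares_sums by (simp add: sums_iff add.commute)
 have fsums: "(\<lambda>n. LINT x:{0<..}|lborel. f n x) sums (LINT x:{0<..}|lborel. (\<Sum>n. f n x))"
 proof (rule set_sums_integral(2)[OF _ fint])
  show "summable (\<lambda>n. norm (f n x))" for x
   by (rule summable_comparison_test'[OF summable_mult[OF sq]]) (use fle in auto)
  show "summable (\<lambda>n. LINT x:{0<..}|lborel. norm (f n x))"
  proof (rule summable_comparison_test'[OF summable_mult[OF sq]])
   fix n
   have "(LINT x:{0<..}|lborel. norm (f n x)) \<le> (LINT x:{0<..}|lborel. norm (h'' x) * norm (gauss_sum q chi) * (1 / real (Suc n) ^ 2))"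
    by (rule set_integral_mono) (use fle fint i2 in \<open>auto intro!: set_integrable_norm set_integrable_mult_left\<close>)
   moreover have "(LINT x:{0<..}|lborel. norm (f n x)) \<ge> 0"
    unfolding set_lebesgue_integral_def by (intro Bochner_Integration.integral_nonneg) auto
   ultimately show "norm (LINT x:{0<..}|lborel. norm (f n x)) \<le> (LINT x:{0<..}|lborel. norm (h'' x) * norm (gauss_sum q chi)) * (1 / real (Suc n) ^ 2)"
    by (simp add: mult.assoc[symmetric])
  qed
 qed auto
 have "(LINT x:{0<..}|lborel. (\<Sum>n. f n x)) = (LINT x:{0<..}|lborel. K * h'' x - 2 * of_real pi ^ 2 / of_nat q * (\<Sum>m. g m x))"
 proof (rule set_lebesgue_integral_cong)
  show "\<forall>x. x \<in> {0<..} \<longrightarrow> (\<Sum>n. f n x) = K * h'' x - 2 * of_real pi ^ 2 / of_nat q * (\<Sum>m. g m x)"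
  proof (intro allI impI)
   fix x :: real assume "x \<in> {0<..}"
   hence x: "x > 0" by simp
   have "f n x = h'' x * (gauss_sum q chi * cnj (chi (int (Suc n))) * of_real (cos (2 * pi * real (Suc n) * x / real q)) / of_nat (Suc n) ^ 2)" for n
    by (simp add: f_def w_def)
   hence "(\<lambda>n. f n x) sums (h'' x * (K - 2 * of_real pi ^ 2 / of_nat q * (\<Sum>m=1..nat \<lfloor>x\<rfloor>. chi (int m) * of_real (x - real m))))"
    using sums_mult[OF K[of x], of "h'' x"] x by (simp only: less_imp_le)
   thus "(\<Sum>n. f n x) = K * h'' x - 2 * of_real pi ^ 2 / of_nat q * (\<Sum>m. g m x)"
    unfolding gfin[OF x] by (simp add: sums_iff algebra_simps)
  qed
 qed auto
 also have "\<dots> = (LINT x:{0<..}|lborel. K * h'' x) - (LINT x:{0<..}|lborel. 2 * of_real pi ^ 2 / of_nat q * (\<Sum>m. g m x))"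
  by (intro set_integral_diff set_integrable_mult_right i2 gs(1)) auto
 also have "\<dots> = K * (LINT x:{0<..}|lborel. h'' x) - 2 * of_real pi ^ 2 / of_nat q * (\<Sum>m. chi (int (Suc m)) * h (real (Suc m)))"
  using sums_m by (simp add: sums_iff)
 \<comment> \<open>The constant \<open>K\<close> occurs only as a factor of this integral and hence
   drops out.\<close>
 also have "(LINT x:{0<..}|lborel. h'' x) = 0 - 0"
  by (rule set_integral_FTC_Ioi[where F = h']) (use d2 c2 i2 l0 l1' in auto)
 finally have F: "(\<lambda>n. LINT x:{0<..}|lborel. f n x) sums (- 2 * of_real pi ^ 2 / of_nat q * (\<Sum>m. chi (int (Suc m)) * h (real (Suc m))))"
  using fsums by simp
 have "gauss_sum q chi * cnj (chi (int (Suc n))) * (LINT x:{0<..}|lborel. h x * of_real (cos (w n * x)))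
  = - (of_nat q ^ 2 / (4 * of_real pi ^ 2)) * (LINT x:{0<..}|lborel. f n x)" for n
 proof -
  have "(LINT x:{0<..}|lborel. f n x) = (LINT x:{0<..}|lborel. (gauss_sum q chi * cnj (chi (int (Suc n))) / of_nat (Suc n) ^ 2) * (h'' x * of_real (cos (w n * x))))"
   by (intro set_lebesgue_integral_cong) (auto simp: f_def)
  also have "\<dots> = (gauss_sum q chi * cnj (chi (int (Suc n))) / of_nat (Suc n) ^ 2) * (LINT x:{0<..}|lborel. h'' x * of_real (cos (w n * x)))"
   by (rule set_integral_mult_right)
  finally have fe: "(LINT x:{0<..}|lborel. f n x) = (gauss_sum q chi * cnj (chi (int (Suc n))) / of_nat (Suc n) ^ 2) * (LINT x:{0<..}|lborel. h'' x * of_real (cos (w n * x)))" .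
  have ww: "complex_of_real ((w n)\<^sup>2) = 4 * of_real pi ^ 2 * of_nat (Suc n) ^ 2 / of_nat q ^ 2"
   by (simp add: w_def power_mult_distrib power_divide del: of_nat_Suc)
  have bp: "(LINT x:{0<..}|lborel. h x * of_real (cos (w n * x))) = - (LINT x:{0<..}|lborel. h'' x * of_real (cos (w n * x))) / of_real ((w n)\<^sup>2)"
   by (rule cos_integral_by_parts_Ioi[OF w d1 d2 c2 i0 i2 l0 l1(1) l1'])
  show ?thesis
   unfolding bp fe ww using q
   by (simp add: divide_simps del: of_nat_Suc)
 qed
 moreover have "(\<lambda>n. - (of_nat q ^ 2 / (4 * of_real pi ^ 2)) * (LINT x:{0<..}|lborel. f n x)) sums
  (- (of_nat q ^ 2 / (4 * of_real pi ^ 2)) * (- 2 * of_real pi ^ 2 / of_nat q * (\<Sum>m. chi (int (Suc m)) * h (real (Suc m)))))"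
  by (rule sums_mult[OF F])
 moreover have "- (of_nat q ^ 2 / (4 * of_real pi ^ 2)) * (- 2 * of_real pi ^ 2 / of_nat q * (\<Sum>m. chi (int (Suc m)) * h (real (Suc m))))
  = of_nat q / 2 * (\<Sum>m. chi (int (Suc m)) * h (real (Suc m)))"
  using q by (simp add: power2_eq_square)
 ultimately show "(\<lambda>n. gauss_sum q chi * cnj (chi (int (Suc n))) * (LINT x:{0<..}|lborel. h x * of_real (cos (2 * pi * real (Suc n) / real q * x))))
   sums (of_nat q / 2 * (\<Sum>m. chi (int (Suc m)) * h (real (Suc m))))"
  unfolding w_def by (simp only:)
qed

section \<open>A regularised Hankel-type integral\<close>

lemma set_integral_FTC_Ioo:
 fixes f F :: "real => complex"
 assumes ab: "a < b" and F: "!!x. a < x ==> x < b ==> (F has_vector_derivative f x) (at x)"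
  and f: "continuous_on {a<..<b} f" and int: "set_integrable lborel {a<..<b} f"
  and A: "(F \<longlongrightarrow> A) (at_right a)" and B: "(F \<longlongrightarrow> B) (at_left b)"
 shows "(LINT x:{a<..<b}|lborel. f x) = B - A"
proof -
 have e: "einterval (ereal a) (ereal b) = {a<..<b}" by (auto simp: einterval_def)
 have "(LBINT x=ereal a..ereal b. f x) = B - A"
 proof (rule interval_integral_FTC_integrable[of _ _ F])
  show "isCont f x" if "ereal a < ereal x" "ereal x < ereal b" for x
   using f that by (simp add: continuous_on_eq_continuous_at)
  show "((F \<circ> real_of_ereal) \<longlongrightarrow> A) (at_right (ereal a))"
   unfolding o_def using A by (simp add: at_right_ereal filterlim_filtermap)
  show "((F \<circ> real_of_ereal) \<longlongrightarrow> B) (at_left (ereal b))"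
   unfolding o_def using B by (simp add: at_left_ereal filterlim_filtermap)
 qed (use F int e ab in auto)
 thus ?thesis using ab by (simp add: interval_lebesgue_integral_def e)
qed

lemma set_integral_inverse_substitution:
 fixes f :: "real => complex"
 assumes cont: "continuous_on {0<..<1} f" and i1: "set_integrable lborel {0<..<1} f"
  and i2: "set_integrable lborel {1<..} (\<lambda>y. f (1 / y) / of_real (y\<^sup>2))"
 shows "(LINT x:{0<..<1}|lborel. f x) = (LINT y:{1<..}|lborel. f (1 / y) / of_real (y\<^sup>2))"
proof -
 have e1: "einterval (-\<infinity>) (ereal (-1)) = {..<-1}" by (auto simp: einterval_def)
 have e2: "einterval (ereal 0) (ereal 1) = {0<..<1}" by (auto simp: einterval_def)
 have e3: "einterval (ereal 1) \<infinity> = {1<..}" by (auto simp: einterval_def)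
 \<comment> \<open>The substitution rule asks for an increasing map, which 1/x is not. The map -1/x
   takes (-\<infinity>, -1) increasingly onto (0, 1), and a reflection afterwards moves the domain
   to (1, \<infinity>).\<close>
 have "(LBINT x=ereal 0..ereal 1. f x) = (LBINT x=-\<infinity>..ereal (-1). (1 / x\<^sup>2) *\<^sub>R f (- 1 / x))"
 proof (rule interval_integral_substitution_integrable[where g = "\<lambda>x. - 1 / x"])
  fix x assume "ereal x < ereal (-1)"
  hence x: "x < -1" by simp
  thus "((\<lambda>x. - 1 / x) has_real_derivative 1 / x\<^sup>2) (at x)"
   by (auto intro!: derivative_eq_intros simp: power2_eq_square)
  have "- 1 / x \<in> {0<..<1}" using x by (auto simp: divide_simps)
  thus "isCont f (- 1 / x)" using cont by (simp add: continuous_on_eq_continuous_at)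
  show "isCont (\<lambda>x. 1 / x\<^sup>2) x" using x by (intro continuous_intros) auto
 next
  have "((\<lambda>x::real. - 1 / x) \<longlongrightarrow> 0) at_bot" by real_asymp
  thus "((ereal \<circ> (\<lambda>x. - 1 / x) \<circ> real_of_ereal) \<longlongrightarrow> ereal 0) (at_right (-\<infinity>))"
   unfolding o_def by (simp add: at_right_MInf filterlim_filtermap zero_ereal_def)
  have "((\<lambda>x::real. - 1 / x) \<longlongrightarrow> - 1 / (-1)) (at_left (-1))" by (intro tendsto_intros) auto
  thus "((ereal \<circ> (\<lambda>x. - 1 / x) \<circ> real_of_ereal) \<longlongrightarrow> ereal 1) (at_left (ereal (-1)))"
   unfolding o_def at_left_ereal filterlim_filtermap by (simp add: one_ereal_def)
  have "integrable lborel (\<lambda>x. indicator {1<..} (0 + (-1) * x) *\<^sub>R (f (1 / (0 + (-1) * x)) / of_real ((0 + (-1) * x)\<^sup>2)))"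
   using i2 unfolding set_integrable_def by (rule lborel_integrable_real_affine) simp
  also have "(\<lambda>x. indicator {1<..} (0 + (-1) * x) *\<^sub>R (f (1 / (0 + (-1) * x)) / of_real ((0 + (-1) * x)\<^sup>2)))
   = (\<lambda>x. indicator {..<-1} x *\<^sub>R ((1 / x\<^sup>2) *\<^sub>R f (- 1 / x)))"
   by (auto simp: fun_eq_iff indicator_def scaleR_conv_of_real)
  finally show "set_integrable lborel (einterval (-\<infinity>) (ereal (-1))) (\<lambda>x. (1 / x\<^sup>2) *\<^sub>R f (- 1 / x))"
   unfolding e1 set_integrable_def .
 qed (use i1 e2 in auto)
 also have "\<dots> = (LBINT x=ereal 1..\<infinity>. (1 / x\<^sup>2) *\<^sub>R f (1 / x))"
  by (subst interval_integral_reflect) simp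
 finally show ?thesis
  by (simp add: interval_lebesgue_integral_def e2 e3 scaleR_conv_of_real)
qed

lemma norm_powr_of_real: "y > 0 ==> norm (complex_of_real y powr z) = y powr Re z"
 by (simp add: norm_powr_real_powr)

lemma complex_powr_of_real_add_nat:
 assumes "y > 0" shows "complex_of_real y powr (z + of_nat n) = of_real y powr z * of_real y ^ n"
 using assms by (simp add: powr_add powr_nat')

section \<open>Euler integrals with complex parameter and incomplete Gamma functions\<close>

definition Gint :: "complex => complex => real => complex" where
 "Gint s b y = of_real y powr (s - 1) * exp (- b * of_real y)"

lemma norm_Gint: "y > 0 ==> norm (Gint s b y) = y powr (Re s - 1) * exp (- Re b * y)"
 by (simp add: Gint_def norm_mult norm_powr_of_real)

lemma continuous_on_Gint: "continuous_on {0<..} (Gint s b)"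
 unfolding Gint_def by (intro continuous_intros) (auto simp: complex_nonpos_Reals_iff)

lemma set_borel_measurable_continuous_Ioi:
 fixes f :: "real => complex"
 assumes "continuous_on {0<..} f" "S \<subseteq> {0<..}" "S \<in> sets borel"
 shows "set_borel_measurable lborel S f"
 unfolding set_borel_measurable_def
 using borel_measurable_continuous_on_indicator[OF assms(3) continuous_on_subset[OF assms(1,2)]] by simp

lemma set_integrable_Gint:
 assumes "Re s > 0" "Re b > 0"
 shows "set_integrable lborel {0<..} (Gint s b)"
proof -
 have "(\<lambda>t. complex_of_real t powr (of_real (Re s) - 1) / of_real (exp (Re b * t))) absolutely_integrable_on {0<..}"
  by (rule absolutely_integrable_Gamma_integral) (use assms in auto)
 hence "Gint s b absolutely_integrable_on {0<..}"
 proof (rule set_integrable_bound)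
  show "set_borel_measurable lebesgue {0<..} (Gint s b)"
   using set_borel_measurable_continuous_Ioi[OF continuous_on_Gint, of "{0<..}"]
   unfolding set_borel_measurable_def by (simp add: measurable_completion)
  show "AE x in lebesgue. x \<in> {0<..} \<longrightarrow> norm (Gint s b x) \<le> norm (complex_of_real x powr (of_real (Re s) - 1) / of_real (exp (Re b * x)))"
   by (intro AE_I2 impI) (auto simp: norm_Gint norm_divide norm_powr_of_real exp_minus field_simps)
 qed
 thus ?thesis unfolding set_integrable_def
  by (subst (asm) integrable_completion)
   (use set_borel_measurable_continuous_Ioi[OF continuous_on_Gint, of "{0<..}"] in \<open>auto simp: set_borel_measurable_def\<close>)
qed

lemma integral_Gint_real:
 assumes s: "Re s > 0" and b: "b > 0"
 shows "(LINT y:{0<..}|lborel. Gint s (of_real b) y) = Gamma s * of_real b powr (- s)"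
proof -
 have "(LINT y:{0<..}|lborel. Gint s 1 y) = integral {0<..} (Gint s 1)"
  by (rule set_borel_integral_eq_integral) (rule set_integrable_Gint, use s in auto)
 also have "\<dots> = integral {0<..} (\<lambda>t. of_real t powr (s - 1) / of_real (exp t))"
  by (intro integral_cong) (auto simp: Gint_def exp_minus field_simps exp_of_real)
 also have "\<dots> = Gamma s" using Gamma_integral_complex'[OF s] by (rule integral_unique)
 finally have "Gamma s = (LINT y|lborel. indicator {0<..} y *\<^sub>R Gint s 1 y)" unfolding set_lebesgue_integral_def by simp
 also have "\<dots> = \<bar>b\<bar> *\<^sub>R (LINT y|lborel. indicator {0<..} (0 + b * y) *\<^sub>R Gint s 1 (0 + b * y))"
  by (rule lborel_integral_real_affine) (use b in auto)
 also have "(\<lambda>y. indicator {0<..} (0 + b * y) *\<^sub>R Gint s 1 (0 + b * y)) = (\<lambda>y. indicator {0<..} y *\<^sub>R (of_real b powr (s - 1) * Gint s (of_real b) y))"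
  using b by (auto simp: fun_eq_iff Gint_def indicator_def zero_less_mult_iff powr_times_real)
 also have "\<bar>b\<bar> *\<^sub>R (LINT y|lborel. indicator {0<..} y *\<^sub>R (of_real b powr (s - 1) * Gint s (of_real b) y))
  = of_real b * of_real b powr (s - 1) * (LINT y:{0<..}|lborel. Gint s (of_real b) y)"
  using b set_integral_mult_right[of lborel "{0<..}" "of_real b powr (s - 1)" "Gint s (of_real b)"]
  unfolding set_lebesgue_integral_def by (simp only: scaleR_conv_of_real abs_of_pos mult.assoc)
 also have "of_real b * of_real b powr (s - 1) = complex_of_real b powr s"
  using b by (simp add: powr_diff)
 finally show ?thesis using b by (simp add: powr_minus field_simps)
qed

text \<open>Complex b is reached without rotating a contour: exp(-d y) is expanded around a real
  centre c, the terms are Euler integrals with the real parameter c, and they add up to the binomial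
  series of (1 + d/c) powr (-s).\<close>

lemma integral_Gint:
 assumes s: "Re s > 0" and b: "Re b > 0"
 shows "(LINT y:{0<..}|lborel. Gint s b y) = Gamma s * b powr (- s)"
proof -
 \<comment> \<open>Since \<open>Re b * c = (norm b)\<^sup>2\<close>, this centre gives norm(b - c)^2
   = c^2 - norm(b)^2 < c^2. So every b in the right half-plane lies in the disc of convergence
   around its own centre.\<close>
 define c where "c = (norm b)\<^sup>2 / Re b"
 define d where "d = b - of_real c"
 have b0: "b \<noteq> 0" using b by auto
 have c: "c > 0" using b b0 by (simp add: c_def)
 have dc: "norm d < c"
 proof (rule power2_less_imp_less)
  have "(norm d)\<^sup>2 = (Re b - c)\<^sup>2 + (Im b)\<^sup>2" by (simp add: d_def cmod_power2)
  also have "\<dots> = (norm b)\<^sup>2 - 2 * (Re b * c) + c\<^sup>2" unfolding cmod_power2 by (simp add: power2_eq_square algebra_simps)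
  also have "Re b * c = (norm b)\<^sup>2" using b by (simp add: c_def)
  finally show "(norm d)\<^sup>2 < c\<^sup>2" using b0 by simp
 qed (use c in auto)
 define f where "f = (\<lambda>k y. (- d) ^ k / fact k * Gint (s + of_nat k) (of_real c) y)"
 have fi: "set_integrable lborel {0<..} (f k)" for k
  unfolding f_def by (intro set_integrable_mult_right set_integrable_Gint) (use s c in auto)
 have feq: "f k y = Gint s (of_real c) y * ((- d * of_real y) ^ k /\<^sub>R fact k)" if "y > 0" for k y
 proof -
  have "s + of_nat k - 1 = (s - 1) + of_nat k" by simp
  thus ?thesis unfolding f_def Gint_def using that
   by (simp only: complex_powr_of_real_add_nat power_mult_distrib[of "- d"]) (simp add: scaleR_conv_of_real field_simps)
 qed
 have sumsf: "(\<lambda>k. f k y) sums Gint s b y" if "y > 0" for y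
 proof -
  have "(\<lambda>k. Gint s (of_real c) y * ((- d * of_real y) ^ k /\<^sub>R fact k)) sums (Gint s (of_real c) y * exp (- d * of_real y))"
   by (intro sums_mult exp_converges)
  moreover have "Gint s (of_real c) y * exp (- d * of_real y) = Gint s b y"
   by (simp add: Gint_def d_def mult.assoc exp_add[symmetric] algebra_simps)
  ultimately show ?thesis using feq[OF that] by simp
 qed
 have sumsn: "(\<lambda>k. norm (f k y)) sums (norm (Gint s (of_real c) y) * exp (norm d * y))" if "y > 0" for y
 proof -
  have "(\<lambda>k. norm (Gint s (of_real c) y) * ((norm d * y) ^ k /\<^sub>R fact k)) sums (norm (Gint s (of_real c) y) * exp (norm d * y))"
   by (intro sums_mult exp_converges)
  moreover have "norm (f k y) = norm (Gint s (of_real c) y) * ((norm d * y) ^ k /\<^sub>R fact k)" for k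
   unfolding feq[OF that] using that by (simp add: norm_mult norm_power)
  ultimately show ?thesis by simp
 qed
 \<comment> \<open>Summing the absolute values of the expansion leaves the damping c - norm d, still
   positive, so one integrable function dominates all partial sums.\<close>
 define w where "w = (\<lambda>y. norm (Gint s (of_real (c - norm d)) y))"
 have weq: "norm (Gint s (of_real c) y) * exp (norm d * y) = w y" if "y > 0" for y
  using that by (simp add: norm_Gint w_def mult.assoc exp_add[symmetric] algebra_simps)
 have wi: "set_integrable lborel {0<..} w"
  unfolding w_def by (intro set_integrable_norm set_integrable_Gint) (use s dc in auto)
 have "(\<lambda>k. LINT y:{0<..}|lborel. f k y) sums (LINT y:{0<..}|lborel. (\<Sum>k. f k y))"
 proof (rule set_sums_integral(2)[OF _ fi])
  show "summable (\<lambda>k. norm (f k y))" if "y \<in> {0<..}" for y using sumsn[of y] that by (auto simp: sums_iff)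
  show "summable (\<lambda>k. LINT y:{0<..}|lborel. norm (f k y))"
  proof (rule summableI_nonneg_bounded)
   fix M
   show "0 \<le> (LINT y:{0<..}|lborel. norm (f M y))"
    unfolding set_lebesgue_integral_def by (intro Bochner_Integration.integral_nonneg) auto
   have "(\<Sum>k<M. LINT y:{0<..}|lborel. norm (f k y)) = (LINT y:{0<..}|lborel. (\<Sum>k<M. norm (f k y)))"
    unfolding set_lebesgue_integral_def scaleR_sum_right
    using fi[THEN set_integrable_norm] by (subst Bochner_Integration.integral_sum) (auto simp: set_integrable_def)
   also have "\<dots> \<le> (LINT y:{0<..}|lborel. w y)"
   proof (rule set_integral_mono)
    show "set_integrable lborel {0<..} (\<lambda>x. \<Sum>m<M. norm (f m x))"
     unfolding set_integrable_def scaleR_sum_right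
     using fi[THEN set_integrable_norm] by (intro Bochner_Integration.integrable_sum) (auto simp: set_integrable_def)
    show "(\<Sum>k<M. norm (f k y)) \<le> w y" if "y \<in> {0<..}" for y
    proof -
     have y: "y > 0" using that by simp
     have "(\<Sum>k<M. norm (f k y)) \<le> (\<Sum>k. norm (f k y))"
      by (rule sum_le_suminf) (use sumsn[OF y] in \<open>auto simp: sums_iff\<close>)
     also have "\<dots> = w y" using sumsn[OF y] weq[OF y] by (simp add: sums_iff)
     finally show ?thesis .
    qed
   qed (rule wi)
   finally show "(\<Sum>k<M. LINT y:{0<..}|lborel. norm (f k y)) \<le> (LINT y:{0<..}|lborel. w y)" .
  qed
 qed auto
 also have "(LINT y:{0<..}|lborel. (\<Sum>k. f k y)) = (LINT y:{0<..}|lborel. Gint s b y)"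
  by (intro set_lebesgue_integral_cong) (use sumsf in \<open>auto simp: sums_iff\<close>)
 finally have S1: "(\<lambda>k. LINT y:{0<..}|lborel. f k y) sums (LINT y:{0<..}|lborel. Gint s b y)" .
 have snz: "s \<notin> \<int>\<^sub>\<le>\<^sub>0" using s by (auto simp: complex_nonpos_Reals_iff elim!: nonpos_Ints_cases)
 have val: "(LINT y:{0<..}|lborel. f k y) = Gamma s * of_real c powr (- s) * ((- s gchoose k) * (d / of_real c) ^ k)" for k
 proof -
  have "(LINT y:{0<..}|lborel. f k y) = (- d) ^ k / fact k * (Gamma (s + of_nat k) * of_real c powr (- (s + of_nat k)))"
   unfolding f_def set_integral_mult_right using s c by (subst integral_Gint_real) auto
  also have "Gamma (s + of_nat k) = pochhammer s k * Gamma s"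
   using snz Gamma_eq_zero_iff[of s] by (simp add: pochhammer_Gamma)
  also have "of_real c powr (- (s + of_nat k)) = of_real c powr (- s) / of_real c ^ k"
  proof -
   have "- (s + of_nat k) = - s - of_nat k" by simp
   thus ?thesis using c by (simp only: powr_diff) (simp add: powr_nat')
  qed
  also have "(- d) ^ k / fact k * (pochhammer s k * Gamma s * (of_real c powr (- s) / of_real c ^ k))
   = Gamma s * of_real c powr (- s) * (((- 1) ^ k * pochhammer s k / fact k) * (d / of_real c) ^ k)"
   by (simp add: power_minus[of d] power_divide)
  also have "(- 1) ^ k * pochhammer s k / fact k = (- s gchoose k)" by (simp add: gbinomial_pochhammer)
  finally show ?thesis .
 qed
 have "(\<lambda>k. Gamma s * of_real c powr (- s) * ((- s gchoose k) * (d / of_real c) ^ k)) sums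
  (Gamma s * of_real c powr (- s) * (1 + d / of_real c) powr (- s))"
  by (intro sums_mult gen_binomial_complex) (use dc c in \<open>simp add: norm_divide\<close>)
 hence "(LINT y:{0<..}|lborel. Gint s b y) = Gamma s * (of_real c powr (- s) * (1 + d / of_real c) powr (- s))"
  using S1 unfolding val by (simp add: sums_unique2 mult.assoc)
 also have "of_real c powr (- s) * (1 + d / of_real c) powr (- s) = b powr (- s)"
 proof -
  have z: "1 + d / of_real c = b / of_real c" using c by (simp add: d_def field_simps)
  have "Ln b = Ln (of_real c) + Ln (b / of_real c)"
   using Ln_times_of_real[OF c, of "b / of_real c"] b0 c by simp
  thus ?thesis unfolding z powr_def using b0 c by (simp add: exp_add[symmetric] algebra_simps)
 qed
 finally show ?thesis .
qed

lemma summable_exp_like: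
 fixes b :: complex and u :: "nat => complex"
 assumes "!!k. norm (u k) \<le> C"
 shows "summable (\<lambda>k. norm (b ^ k / fact k * u k))"
proof (rule summable_comparison_test'[where N = 0])
 show "summable (\<lambda>k. (norm b ^ k /\<^sub>R fact k) * C)" by (intro summable_mult2 summable_exp_generic)
 fix k
 have "norm (norm (b ^ k / fact k * u k)) = norm b ^ k /\<^sub>R fact k * norm (u k)"
  by (simp add: norm_mult norm_divide norm_power field_simps)
 also have "\<dots> \<le> norm b ^ k /\<^sub>R fact k * C" by (intro mult_left_mono assms) auto
 finally show "norm (norm (b ^ k / fact k * u k)) \<le> norm b ^ k /\<^sub>R fact k * C" .
qed

lemma inverse_shift_bounded:
 fixes s :: complex
 assumes "s \<notin> \<int>"
 obtains C where "!!k::int. norm (1 / (of_int k + s)) \<le> C"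
proof -
 obtain d where d: "d > 0" "!!k::int. d \<le> norm (of_int k + s)"
 proof -
  have "closed (\<int> :: complex set)" by (rule closed_Ints)
  from separate_point_closed[OF this assms]
  obtain d where d: "d > 0" "\<forall>x\<in>\<int>. d \<le> dist s x" by blast
  have "d \<le> norm (of_int k + s)" for k
   using d(2)[THEN bspec, of "- of_int k"] by (simp add: dist_norm add.commute)
  with d(1) that show ?thesis by blast
 qed
 have "norm (1 / (of_int k + s)) \<le> 1 / d" for k
  using d(1) d(2)[of k] by (simp add: norm_divide frac_le)
 thus ?thesis using that by blast
qed

lemma Ints_add_of_nat: "s + of_nat n \<in> \<int> \<longleftrightarrow> (s::complex) \<in> \<int>"
 by (metis Ints_add Ints_diff Ints_of_nat add_diff_cancel_right')

lemma summable_incgamma_series: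
 fixes s b :: complex
 assumes "s \<notin> \<int>"
 shows "summable (\<lambda>k. norm ((- b) ^ k / fact k * (1 / (of_nat k + s))))"
proof -
 obtain C where "!!k::int. norm (1 / (of_int k + s)) \<le> C" using inverse_shift_bounded[OF assms] by blast
 hence "norm (1 / (of_nat k + s)) \<le> C" for k by (metis of_int_of_nat_eq)
 thus ?thesis by (rule summable_exp_like)
qed

text \<open>This is b powr (-s) times the lower incomplete Gamma function of s and b. For Re s > 0
  it is the part over (0, 1) of the Euler integral; the series continues that part to all
  non-integer s.\<close>

definition incgamma_series :: "complex => complex => complex" where
 "incgamma_series s b = (\<Sum>k. (- b) ^ k / fact k * (1 / (of_nat k + s)))"

lemma incgamma_series_sums:
 assumes "s \<notin> \<int>"
 shows "(\<lambda>k. (- b) ^ k / fact k * (1 / (of_nat k + s))) sums incgamma_series s b"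
 unfolding incgamma_series_def using summable_norm_cancel[OF summable_incgamma_series[OF assms]] by (rule summable_sums)

text \<open>Series form of integrating the derivative of y powr s exp(-b y) over (0, 1), obtained by
  an index shift. It allows s to be lowered by one beyond the range where the integral
  converges.\<close>

lemma incgamma_series_rec:
 assumes s: "s \<notin> \<int>"
 shows "s * incgamma_series s b = exp (- b) + b * incgamma_series (s + 1) b"
proof -
 have nz: "of_nat k + s \<noteq> 0" for k using s Ints_add_of_nat[of s k] by (metis Ints_0 add.commute)
 have s1: "s + 1 \<notin> \<int>" using s Ints_add_of_nat[of s 1] by simp
 have "(\<lambda>k. - b * ((- b) ^ k / fact k * (1 / (of_nat k + (s + 1))))) sums (- b * incgamma_series (s + 1) b)"
  by (intro sums_mult incgamma_series_sums s1)
 also have "(\<lambda>k. - b * ((- b) ^ k / fact k * (1 / (of_nat k + (s + 1))))) = (\<lambda>k. of_nat (Suc k) * ((- b) ^ Suc k / fact (Suc k) * (1 / (of_nat (Suc k) + s))))"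
  by (auto simp: fun_eq_iff fact_Suc add_ac divide_simps simp del: of_nat_Suc) (simp_all add: algebra_simps)
 finally have 1: "(\<lambda>k. of_nat k * ((- b) ^ k / fact k * (1 / (of_nat k + s)))) sums (- b * incgamma_series (s + 1) b)"
  by (subst (asm) sums_Suc_iff) simp
 have 2: "(\<lambda>k. (- b) ^ k / fact k) sums exp (- b)"
  using exp_converges[of "- b"] by (simp add: scaleR_conv_of_real field_simps)
 have "(\<lambda>k. (- b) ^ k / fact k - of_nat k * ((- b) ^ k / fact k * (1 / (of_nat k + s)))) sums (exp (- b) - (- b * incgamma_series (s + 1) b))"
  by (rule sums_diff[OF 2 1])
 moreover have "(- b) ^ k / fact k - of_nat k * ((- b) ^ k / fact k * (1 / (of_nat k + s))) = s * ((- b) ^ k / fact k * (1 / (of_nat k + s)))" for k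
  using nz[of k] by (simp add: divide_simps) (simp add: algebra_simps)
 ultimately have "(\<lambda>k. s * ((- b) ^ k / fact k * (1 / (of_nat k + s)))) sums (exp (- b) + b * incgamma_series (s + 1) b)"
  by simp
 moreover have "(\<lambda>k. s * ((- b) ^ k / fact k * (1 / (of_nat k + s)))) sums (s * incgamma_series s b)"
  by (intro sums_mult incgamma_series_sums s)
 ultimately show ?thesis by (rule sums_unique2[symmetric])
qed

lemma set_integrable_Gint_1:
 assumes b: "Re b > 0"
 shows "set_integrable lborel {1<..} (Gint s b)"
proof -
 have "set_integrable lborel {0<..} (Gint (of_real (max 1 (Re s))) b)" by (rule set_integrable_Gint) (use b in auto)
 hence "set_integrable lborel {1<..} (Gint (of_real (max 1 (Re s))) b)" by (rule set_integrable_subset) auto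
 thus ?thesis
 proof (rule set_integrable_bound)
  show "set_borel_measurable lborel {1<..} (Gint s b)"
   by (rule set_borel_measurable_continuous_Ioi[OF continuous_on_Gint]) auto
  show "AE x in lborel. x \<in> {1<..} \<longrightarrow> norm (Gint s b x) \<le> norm (Gint (of_real (max 1 (Re s))) b x)"
   by (intro AE_I2 impI) (auto simp: norm_Gint intro!: powr_mono)
 qed
qed

lemma has_vector_derivative_powr_of_real:
 assumes "y > 0"
 shows "((\<lambda>y. complex_of_real y powr s) has_vector_derivative (s * of_real y powr (s - 1))) (at y)"
proof -
 have "((\<lambda>z. z powr s) has_field_derivative (s * of_real y powr (s - 1))) (at (complex_of_real y))"
  using assms by (intro has_field_derivative_powr) (auto simp: complex_nonpos_Reals_iff)
 from has_vector_derivative_real_field[OF this] show ?thesis by simp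
qed

lemma integral_Gint_01:
 assumes s: "Re s > 0" and sn: "s \<notin> \<int>"
 shows "(LINT y:{0<..<1}|lborel. Gint s b y) = incgamma_series s b"
  and "set_integrable lborel {0<..<1} (Gint s b)"
proof -
 have base: "set_integrable lborel {0<..<1} (\<lambda>y. complex_of_real y powr (t - 1))" if "Re t > 0" for t
 proof -
  have "set_integrable lborel {0<..} (Gint t 1)" by (rule set_integrable_Gint) (use that in auto)
  hence "set_integrable lborel {0<..<1} (Gint t 1)" by (rule set_integrable_subset) auto
  hence "set_integrable lborel {0<..<1} (\<lambda>y. exp 1 * Gint t 1 y)" by (rule set_integrable_mult_right)
  thus ?thesis
  proof (rule set_integrable_bound)
   have "continuous_on {0<..} (\<lambda>y. complex_of_real y powr (t - 1))"
    by (intro continuous_intros) (auto simp: complex_nonpos_Reals_iff)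
   thus "set_borel_measurable lborel {0<..<1} (\<lambda>y. complex_of_real y powr (t - 1))"
    by (rule set_borel_measurable_continuous_Ioi) auto
   show "AE x in lborel. x \<in> {0<..<1} \<longrightarrow> norm (complex_of_real x powr (t - 1)) \<le> norm (exp 1 * Gint t 1 x)"
   proof (intro AE_I2 impI)
    fix x :: real assume x: "x \<in> {0<..<1}"
    have "norm (exp 1 * Gint t 1 x) = x powr (Re t - 1) * exp (1 - x)"
     using x by (simp add: norm_mult norm_Gint exp_diff exp_minus field_simps)
    moreover have "exp (1 - x) \<ge> 1" using x by simp
    ultimately show "norm (complex_of_real x powr (t - 1)) \<le> norm (exp 1 * Gint t 1 x)"
     using x mult_left_mono[of 1 "exp (1 - x)" "x powr (Re t - 1)"] by (simp add: norm_powr_of_real)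
   qed
  qed
 qed
 have val: "(LINT y:{0<..<1}|lborel. complex_of_real y powr (t - 1)) = 1 / t" if t: "Re t > 0" for t
 proof -
  have t0: "t \<noteq> 0" using t by auto
  have "(LINT y:{0<..<1}|lborel. complex_of_real y powr (t - 1)) = 1 / t - 0"
  proof (rule set_integral_FTC_Ioo[where F = "\<lambda>y. of_real y powr t / t"])
   show "((\<lambda>y. of_real y powr t / t) has_vector_derivative complex_of_real x powr (t - 1)) (at x)" if "0 < x" for x
    using has_vector_derivative_divide[OF has_vector_derivative_powr_of_real[OF that, of t], of t] t0 by simp
   show "continuous_on {0<..<1} (\<lambda>y. complex_of_real y powr (t - 1))"
    by (intro continuous_intros) (auto simp: complex_nonpos_Reals_iff)
   have "((\<lambda>y. norm (complex_of_real y powr t)) \<longlongrightarrow> 0) (at_right 0)"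
   proof (rule Lim_transform_eventually)
    have "((\<lambda>y. y powr Re t) \<longlongrightarrow> 0 powr Re t) (at_right 0)"
     by (rule tendsto_powr') (use t in \<open>auto simp: eventually_at_filter intro!: tendsto_intros\<close>)
    thus "((\<lambda>y. y powr Re t) \<longlongrightarrow> 0) (at_right 0)" by simp
    show "\<forall>\<^sub>F y in at_right 0. y powr Re t = norm (complex_of_real y powr t)"
     by (auto simp: eventually_at_filter norm_powr_of_real)
   qed
   hence "((\<lambda>y. complex_of_real y powr t) \<longlongrightarrow> 0) (at_right 0)" by (rule tendsto_norm_zero_cancel)
   from tendsto_divide[OF this tendsto_const[of t]] show "((\<lambda>y. complex_of_real y powr t / t) \<longlongrightarrow> 0) (at_right 0)"
    using t0 by simp
   have "((\<lambda>y. complex_of_real y powr t / t) \<longlongrightarrow> of_real 1 powr t / t) (at_left 1)"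
    by (intro tendsto_intros) (auto simp: t0 complex_nonpos_Reals_iff)
   thus "((\<lambda>y. complex_of_real y powr t / t) \<longlongrightarrow> 1 / t) (at_left 1)" by simp
  qed (use base[OF t] in auto)
  thus ?thesis by simp
 qed
 define f where "f = (\<lambda>k y. (- b) ^ k / fact k * complex_of_real y powr (s + of_nat k - 1))"
 have fi: "set_integrable lborel {0<..<1} (f k)" for k
  unfolding f_def by (intro set_integrable_mult_right base) (use s in auto)
 have feq: "f k y = of_real y powr (s - 1) * ((- b * of_real y) ^ k /\<^sub>R fact k)" if "y > 0" for k y
 proof -
  have "s + of_nat k - 1 = (s - 1) + of_nat k" by simp
  thus ?thesis unfolding f_def using that
   by (simp only: complex_powr_of_real_add_nat power_mult_distrib[of "- b"]) (simp add: scaleR_conv_of_real field_simps)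
 qed
 have sumsf: "(\<lambda>k. f k y) sums Gint s b y" if "y > 0" for y
  unfolding Gint_def feq[OF that] by (intro sums_mult exp_converges)
 have nf: "norm (f k y) \<le> norm b ^ k /\<^sub>R fact k * norm (complex_of_real y powr (s - 1))" if "y \<in> {0<..<1}" for k y
 proof -
  have y: "y > 0" "y < 1" using that by auto
  have "norm (f k y) = norm (complex_of_real y powr (s - 1)) * ((norm b * y) ^ k /\<^sub>R fact k)"
   unfolding feq[OF y(1)] using y by (simp add: norm_mult norm_power)
  also have "\<dots> \<le> norm (complex_of_real y powr (s - 1)) * ((norm b * 1) ^ k /\<^sub>R fact k)"
   using y by (intro mult_left_mono scaleR_left_mono power_mono) auto
  finally show ?thesis by (simp add: mult_ac)
 qed
 have fs: "summable (\<lambda>k. norm (f k y))" if "y \<in> {0<..<1}" for y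
  by (rule summable_comparison_test'[OF summable_mult2[OF summable_exp_generic[of "norm b"]]]) (use nf[OF that] in auto)
 have fsi: "summable (\<lambda>k. LINT y:{0<..<1}|lborel. norm (f k y))"
 proof (rule summable_comparison_test'[OF summable_mult2[OF summable_exp_generic[of "norm b"]]])
  fix k
  have "(LINT y:{0<..<1}|lborel. norm (f k y)) \<le> (LINT y:{0<..<1}|lborel. norm b ^ k /\<^sub>R fact k * norm (complex_of_real y powr (s - 1)))"
   by (intro set_integral_mono set_integrable_norm set_integrable_mult_right fi base nf) (use s in auto)
  moreover have "(LINT y:{0<..<1}|lborel. norm (f k y)) \<ge> 0"
   unfolding set_lebesgue_integral_def by (intro Bochner_Integration.integral_nonneg) auto
  ultimately show "norm (LINT y:{0<..<1}|lborel. norm (f k y)) \<le> norm b ^ k /\<^sub>R fact k * (LINT y:{0<..<1}|lborel. norm (complex_of_real y powr (s - 1)))"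
   by simp
 qed
 have eqs: "(\<Sum>k. f k y) = Gint s b y" if "y \<in> {0<..<1}" for y using sumsf[of y] that by (simp add: sums_iff)
 have I: "set_integrable lborel {0<..<1} (\<lambda>y. \<Sum>k. f k y)" and
  S: "(\<lambda>k. LINT y:{0<..<1}|lborel. f k y) sums (LINT y:{0<..<1}|lborel. (\<Sum>k. f k y))"
  using set_sums_integral[OF _ fi fs fsi] by auto
 show "set_integrable lborel {0<..<1} (Gint s b)"
  using I by (rule set_integrable_cong[THEN iffD1, rotated -1]) (use eqs in auto)
 have "(LINT y:{0<..<1}|lborel. f k y) = (- b) ^ k / fact k * (1 / (of_nat k + s))" for k
  unfolding f_def set_integral_mult_right using s by (subst val) (auto simp: add.commute)
 moreover have "(LINT y:{0<..<1}|lborel. (\<Sum>k. f k y)) = (LINT y:{0<..<1}|lborel. Gint s b y)"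
  by (intro set_lebesgue_integral_cong) (use eqs in auto)
 ultimately have "(\<lambda>k. (- b) ^ k / fact k * (1 / (of_nat k + s))) sums (LINT y:{0<..<1}|lborel. Gint s b y)" using S by simp
 thus "(LINT y:{0<..<1}|lborel. Gint s b y) = incgamma_series s b"
  using incgamma_series_sums[OF sn] by (rule sums_unique2)
qed

lemma set_integral_split_at_1:
 fixes f :: "real => complex"
 assumes i: "set_integrable lborel {0<..<1} f" "set_integrable lborel {1<..} f"
 shows "(LINT y:{0<..}|lborel. f y) = (LINT y:{0<..<1}|lborel. f y) + (LINT y:{1<..}|lborel. f y)"
  and "continuous_on {0<..} f ==> set_integrable lborel {0<..} f"
proof -
 have m1: "(\<lambda>y. indicator {0<..<1} y *\<^sub>R f y) \<in> borel_measurable lborel" "(\<lambda>y. indicator {1<..} y *\<^sub>R f y) \<in> borel_measurable lborel"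
  using i unfolding set_integrable_def by (auto intro: borel_measurable_integrable)
 define g where "g = (\<lambda>y. indicator {0<..<1} y *\<^sub>R f y + indicator {1<..} y *\<^sub>R f y)"
 \<comment> \<open>The point 1, left out by both open intervals, carries no mass.\<close>
 define h where "h = (\<lambda>y::real. indicator {1} y *\<^sub>R f 1)"
 have eq: "indicator {0<..} y *\<^sub>R f y = g y + h y" for y by (auto simp: g_def h_def indicator_def)
 have "AE y in lborel. h y = 0" using AE_lborel_singleton[of 1] by (rule eventually_mono) (simp add: h_def)
 moreover have "h \<in> borel_measurable lborel" unfolding h_def by measurable
 ultimately have h0: "integrable lborel h" "(LINT y|lborel. h y) = 0"
  by (simp_all add: integrable_cong_AE[of h _ "\<lambda>_. 0"] integral_cong_AE[of h _ "\<lambda>_. 0"])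
 have g: "integrable lborel g" unfolding g_def using i by (auto simp: set_integrable_def)
 show "set_integrable lborel {0<..} f" unfolding set_integrable_def eq using g h0 by auto
 have "(LINT y:{0<..}|lborel. f y) = (LINT y|lborel. g y)"
  unfolding set_lebesgue_integral_def eq using g h0 by simp
 also have "\<dots> = (LINT y:{0<..<1}|lborel. f y) + (LINT y:{1<..}|lborel. f y)"
  unfolding g_def set_lebesgue_integral_def using i by (simp add: set_integrable_def)
 finally show "(LINT y:{0<..}|lborel. f y) = (LINT y:{0<..<1}|lborel. f y) + (LINT y:{1<..}|lborel. f y)" .
qed

lemma tendsto_powr_exp_at_top:
 assumes b: "Re b > 0"
 shows "((\<lambda>y. complex_of_real y powr s * exp (- b * of_real y)) \<longlongrightarrow> 0) at_top"
proof (rule tendsto_norm_zero_cancel, rule Lim_transform_eventually)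
 define c where "c = Re b"
 have "c > 0" using b by (simp add: c_def)
 hence "((\<lambda>y. y powr Re s * exp (- c * y)) \<longlongrightarrow> 0) at_top" by real_asymp
 thus "((\<lambda>y. y powr Re s * exp (- Re b * y)) \<longlongrightarrow> 0) at_top" by (simp add: c_def)
 show "\<forall>\<^sub>F y in at_top. y powr Re s * exp (- Re b * y) = norm (complex_of_real y powr s * exp (- b * of_real y))"
  using eventually_gt_at_top[of 0] by eventually_elim (simp add: norm_mult norm_powr_of_real)
qed

text \<open>Induction lowers Re s one unit at a time. For Re s > 0 the tail is the full Euler
  integral minus its part over (0, 1). In the step, integrating the derivative of y powr s exp(-b y)
  over (1, \<infinity>) mirrors the recurrence of \<open>incgamma_series\<close>, and the terms
  exp(-b) cancel.\<close>

lemma integral_Gint_1_inf: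
 assumes b: "Re b > 0" and s: "s \<notin> \<int>"
 shows "(LINT y:{1<..}|lborel. Gint s b y) = Gamma s * b powr (- s) - incgamma_series s b"
proof -
 have "\<forall>s. s \<notin> \<int> \<longrightarrow> Re s > - real n \<longrightarrow> (LINT y:{1<..}|lborel. Gint s b y) = Gamma s * b powr (- s) - incgamma_series s b" for n
 proof (induction n)
  case 0
  show ?case
  proof (intro allI impI)
   fix s :: complex assume sn: "s \<notin> \<int>" and "- real 0 < Re s"
   hence s: "Re s > 0" by simp
   have "(LINT y:{0<..}|lborel. Gint s b y) = (LINT y:{0<..<1}|lborel. Gint s b y) + (LINT y:{1<..}|lborel. Gint s b y)"
    by (rule set_integral_split_at_1[OF integral_Gint_01(2)[OF s sn] set_integrable_Gint_1[OF b]])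
   thus "(LINT y:{1<..}|lborel. Gint s b y) = Gamma s * b powr (- s) - incgamma_series s b"
    using integral_Gint_01(1)[OF s sn, of b] integral_Gint[OF s b] by simp
  qed
 next
  case (Suc n)
  show ?case
  proof (intro allI impI)
   fix s :: complex assume sn: "s \<notin> \<int>" and sr: "- real (Suc n) < Re s"
   have s0: "s \<noteq> 0" using sn by auto
   have b0: "b \<noteq> 0" using b by auto
   have s1: "s + 1 \<notin> \<int>" using sn Ints_add_of_nat[of s 1] by simp
   have IH: "(LINT y:{1<..}|lborel. Gint (s + 1) b y) = Gamma (s + 1) * b powr (- (s + 1)) - incgamma_series (s + 1) b"
    using Suc s1 sr by simp
   have "(LINT y:{1<..}|lborel. s * Gint s b y - b * Gint (s + 1) b y) = 0 - exp (- b)"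
   proof (rule set_integral_FTC_Ioi[where F = "\<lambda>y. complex_of_real y powr s * exp (- b * of_real y)"])
    show "((\<lambda>y. complex_of_real y powr s * exp (- b * of_real y)) has_vector_derivative (s * Gint s b x - b * Gint (s + 1) b x)) (at x)" if "x > 1" for x
    proof -
     have "((\<lambda>z. exp (- b * z)) has_field_derivative (exp (- b * of_real x) * (- b))) (at (complex_of_real x))"
      by (auto intro!: derivative_eq_intros)
     from has_vector_derivative_real_field[OF this]
     have e: "((\<lambda>y. exp (- b * complex_of_real y)) has_vector_derivative (exp (- b * of_real x) * (- b))) (at x)" by simp
     have "((\<lambda>y. complex_of_real y powr s * exp (- b * of_real y)) has_vector_derivative
      (of_real x powr s * (exp (- b * of_real x) * (- b)) + s * of_real x powr (s - 1) * exp (- b * of_real x))) (at x)"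
      by (rule has_vector_derivative_mult[OF has_vector_derivative_powr_of_real e]) (use that in auto)
     thus ?thesis by (simp add: Gint_def algebra_simps)
    qed
    show "continuous_on {1<..} (\<lambda>y. s * Gint s b y - b * Gint (s + 1) b y)"
     by (intro continuous_intros continuous_on_subset[OF continuous_on_Gint]) auto
    show "set_integrable lborel {1<..} (\<lambda>y. s * Gint s b y - b * Gint (s + 1) b y)"
     by (intro set_integral_diff set_integrable_mult_right set_integrable_Gint_1 b)
    have "((\<lambda>y. complex_of_real y powr s * exp (- b * of_real y)) \<longlongrightarrow> of_real 1 powr s * exp (- b * of_real 1)) (at_right 1)"
     by (intro tendsto_intros) (auto simp: complex_nonpos_Reals_iff)
    thus "((\<lambda>y. complex_of_real y powr s * exp (- b * of_real y)) \<longlongrightarrow> exp (- b)) (at_right 1)" by simp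
   qed (rule tendsto_powr_exp_at_top[OF b])
   also have "(LINT y:{1<..}|lborel. s * Gint s b y - b * Gint (s + 1) b y) = (LINT y:{1<..}|lborel. s * Gint s b y) - (LINT y:{1<..}|lborel. b * Gint (s + 1) b y)"
    by (intro set_integral_diff set_integrable_mult_right set_integrable_Gint_1 b)
   finally have "s * (LINT y:{1<..}|lborel. Gint s b y) - b * (LINT y:{1<..}|lborel. Gint (s + 1) b y) = 0 - exp (- b)"
    unfolding set_integral_mult_right .
   hence "s * (LINT y:{1<..}|lborel. Gint s b y) = b * (Gamma (s + 1) * b powr (- (s + 1)) - incgamma_series (s + 1) b) - exp (- b)"
    unfolding IH by (simp add: algebra_simps)
   also have "b * (Gamma (s + 1) * b powr (- (s + 1)) - incgamma_series (s + 1) b) - exp (- b)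
    = Gamma (s + 1) * (b * b powr (- (s + 1))) - s * incgamma_series s b"
    unfolding incgamma_series_rec[OF sn] by (simp add: algebra_simps)
   also have "Gamma (s + 1) = s * Gamma s" using sn by (intro Gamma_plus1) (auto elim!: nonpos_Ints_cases)
   also have "b * b powr (- (s + 1)) = b powr (- s)" using b0 by (simp add: powr_diff)
   finally have "s * (LINT y:{1<..}|lborel. Gint s b y) = s * (Gamma s * b powr (- s) - incgamma_series s b)"
    by (simp add: algebra_simps)
   thus "(LINT y:{1<..}|lborel. Gint s b y) = Gamma s * b powr (- s) - incgamma_series s b" using s0 by simp
  qed
 qed
 moreover obtain n where "- Re s < real n" using reals_Archimedean2 by blast
 ultimately show ?thesis using s by (metis minus_less_iff)
qed

text \<open>A product majorant makes the double family absolutely summable. Besides the exchange of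
  sums, the identification with the unordered sum is recorded because regrouping by divisors works
  on unordered sums.\<close>

lemma double_suminf_swap:
 fixes D :: "nat => nat => complex" and x y :: "nat => real"
 assumes D: "!!k j. norm (D k j) \<le> x k * y j" and x: "summable x" "!!k. x k \<ge> 0" and y: "summable y" "!!k. y k \<ge> 0"
 shows "(\<lambda>(k,j). D k j) summable_on UNIV"
  and "!!k. summable (\<lambda>j. D k j)" "!!j. summable (\<lambda>k. D k j)"
  and "summable (\<lambda>k. \<Sum>j. D k j)" "summable (\<lambda>j. \<Sum>k. D k j)" "(\<Sum>k. \<Sum>j. D k j) = (\<Sum>j. \<Sum>k. D k j)"
  and "(\<Sum>k. \<Sum>j. D k j) = infsum (\<lambda>(k,j). D k j) UNIV"
proof -
 have "x summable_on UNIV" "y summable_on UNIV"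
  using x y by (auto intro!: norm_summable_imp_summable_on)
 hence xy: "(\<lambda>k. norm (x k)) summable_on UNIV" "(\<lambda>k. norm (y k)) summable_on UNIV" using x y by auto
 have s: "(\<lambda>kj. norm (case kj of (k, j) => x k * y j)) summable_on UNIV \<times> UNIV"
 proof (subst Infinite_Sum.abs_summable_on_Sigma_iff, intro conjI ballI)
  show "(\<lambda>j. norm (case (k, j) of (k, j) => x k * y j)) summable_on UNIV" for k
   unfolding prod.case norm_mult by (intro summable_on_cmult_right xy)
  show "(\<lambda>k. norm (\<Sum>\<^sub>\<infinity>j. norm (case (k, j) of (k, j) => x k * y j))) summable_on UNIV"
   unfolding prod.case norm_mult infsum_cmult_right' using summable_on_cmult_left[OF xy(1)] by simp
 qed
 have "(\<lambda>kj. norm (case kj of (k,j) => D k j)) summable_on UNIV \<times> UNIV"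
  by (rule summable_on_comparison_test[OF s]) (use D x y in \<open>auto simp: abs_mult\<close>)
 hence S': "(\<lambda>(k,j). D k j) summable_on UNIV \<times> UNIV" by (rule abs_summable_summable)
 thus S: "(\<lambda>(k,j). D k j) summable_on UNIV" by simp
 have n1: "summable (\<lambda>j. norm (D k j))" for k
  by (rule summable_comparison_test'[OF summable_mult[OF y(1), of "x k"]]) (use D in auto)
 have n2: "summable (\<lambda>k. norm (D k j))" for j
  by (rule summable_comparison_test'[OF summable_mult2[OF x(1), of "y j"]]) (use D in auto)
 show a: "!!k. summable (\<lambda>j. D k j)" and b: "!!j. summable (\<lambda>k. D k j)"
  using n1 n2 by (auto intro: summable_norm_cancel)
 have i1: "infsum (\<lambda>j. D k j) UNIV = (\<Sum>j. D k j)" for k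
  using norm_summable_imp_has_sum[OF n1 summable_sums[OF a]] by (rule infsumI)
 have i2: "infsum (\<lambda>k. D k j) UNIV = (\<Sum>k. D k j)" for j
  using norm_summable_imp_has_sum[OF n2 summable_sums[OF b]] by (rule infsumI)
 have "(\<lambda>k. infsum (\<lambda>j. D k j) UNIV) summable_on UNIV"
  using summable_on_Sigma_banach[OF S'] by simp
 hence o1: "(\<lambda>k. \<Sum>j. D k j) sums infsum (\<lambda>k. infsum (\<lambda>j. D k j) UNIV) UNIV"
  unfolding i1 by (intro has_sum_imp_sums) (simp add: has_sum_infsum)
 have "(\<lambda>(j,k). D k j) summable_on UNIV \<times> UNIV" using S' by (subst summable_on_swap) (simp add: case_prod_beta)
 hence "(\<lambda>j. infsum (\<lambda>k. D k j) UNIV) summable_on UNIV"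
  using summable_on_Sigma_banach[of "\<lambda>j k. D k j" UNIV "\<lambda>_. UNIV"] by simp
 hence o2: "(\<lambda>j. \<Sum>k. D k j) sums infsum (\<lambda>j. infsum (\<lambda>k. D k j) UNIV) UNIV"
  unfolding i2 by (intro has_sum_imp_sums) (simp add: has_sum_infsum)
 show "summable (\<lambda>k. \<Sum>j. D k j)" "summable (\<lambda>j. \<Sum>k. D k j)" using o1 o2 by (auto simp: sums_iff)
 show "(\<Sum>k. \<Sum>j. D k j) = (\<Sum>j. \<Sum>k. D k j)"
  using o1 o2 infsum_swap_banach[OF S'] by (simp add: sums_iff)
 show "(\<Sum>k. \<Sum>j. D k j) = infsum (\<lambda>(k,j). D k j) UNIV"
  using o1 infsum_Sigma'_banach[OF S'] by (simp add: sums_iff)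
qed

section \<open>Closed form of the integral of \<open>hint\<close>\<close>

text \<open>The Bessel-Clifford function, entire in w: up to the factor (x/2) powr \<mu>, J is its
  value at -(x/2)^2 and I its value at (x/2)^2. In this form no square root of w occurs, so no
  branch has to be chosen for complex w.\<close>

definition bessel_series :: "complex => complex => complex" where
 "bessel_series \<mu> w = (\<Sum>m. w ^ m * (rGamma (of_nat m + \<mu> + 1) / fact m))"

text \<open>Once norm z \<ge> 1, the identity rGamma(z) = z rGamma(z + 1) makes the absolute values
  non-increasing along z, z + 1, ...; the finitely many earlier indices are covered by a
  maximum.\<close>

lemma rGamma_shift_bounded:
 obtains C :: real where "!!m::nat. norm (rGamma (of_nat m + \<mu> :: complex)) \<le> C"
proof -
 obtain N :: nat where N: "real N > norm \<mu> + 1" using reals_Archimedean2 by blast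
 define C where "C = Max ((\<lambda>m. norm (rGamma (of_nat m + \<mu>))) ` {..N})"
 have C: "norm (rGamma (of_nat m + \<mu>)) \<le> C" if "m \<le> N" for m
  unfolding C_def using that by (intro Max_ge) auto
 have D: "norm (rGamma (of_nat (N + k) + \<mu>)) \<le> C" for k
 proof (induction k)
  case (Suc k)
  let ?z = "of_nat (N + k) + \<mu> :: complex"
  have "norm (of_nat (N + k) :: complex) - norm (- \<mu>) \<le> norm (of_nat (N + k) - (- \<mu>))" by (rule norm_triangle_ineq2)
  hence "real (N + k) - norm \<mu> \<le> norm ?z" by (simp only: norm_of_nat norm_minus_cancel diff_minus_eq_add)
  hence z1: "norm ?z \<ge> 1" using N by simp
  have "norm (rGamma (?z + 1)) \<le> norm ?z * norm (rGamma (?z + 1))"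
   using z1 mult_right_mono[of 1 "norm ?z" "norm (rGamma (?z + 1))"] by simp
  also have "\<dots> = norm (rGamma ?z)" by (simp only: norm_mult[symmetric] rGamma_plus1)
  also have "\<dots> \<le> C" by (rule Suc)
  finally show ?case by (simp add: add_ac)
 qed (use C in auto)
 have "norm (rGamma (of_nat m + \<mu>)) \<le> C" for m
 proof (cases "m \<le> N")
  case False
  thus ?thesis using D[of "m - N"] by simp
 qed (use C in auto)
 thus ?thesis using that by blast
qed

lemma summable_bessel_series:
 fixes w \<mu> :: complex
 shows "summable (\<lambda>m. norm (w ^ m * (rGamma (of_nat m + \<mu> + 1) / fact m)))"
proof -
 obtain C :: real where "!!m::nat. norm (rGamma (of_nat m + (\<mu> + 1) :: complex)) \<le> C" using rGamma_shift_bounded by blast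
 from summable_exp_like[OF this, of w] show ?thesis by (simp add: add.assoc)
qed

lemma bessel_series_sums: "(\<lambda>m. w ^ m * (rGamma (of_nat m + \<mu> + 1) / fact m)) sums bessel_series \<mu> w"
 unfolding bessel_series_def using summable_norm_cancel[OF summable_bessel_series] by (rule summable_sums)

text \<open>Reflection formula, with the sign of the sine under a shift by k. It converts the Gamma
  values of the tail integrals into coefficients of \<open>bessel_series\<close>.\<close>

lemma Gamma_minus_shift:
 fixes \<nu> :: complex
 assumes "\<nu> \<notin> \<int>"
 shows "Gamma (- \<nu> - of_nat k) = - ((- 1) ^ k * of_real pi / sin (of_real pi * \<nu>) * rGamma (of_nat k + \<nu> + 1))"
proof -
 have "\<nu> + of_nat (Suc k) \<notin> \<int>" using assms Ints_add_of_nat[of \<nu> "Suc k"] by simp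
 also have "\<nu> + of_nat (Suc k) = of_nat k + \<nu> + 1" by simp
 finally have nz: "Gamma (of_nat k + \<nu> + 1) \<noteq> 0"
  unfolding Gamma_eq_zero_iff using nonpos_Ints_subset_Ints by blast
 have s: "sin (of_real pi * (- \<nu> - of_nat k)) = - ((- 1) ^ k * sin (of_real pi * \<nu>))"
 proof -
  have "of_real pi * (- \<nu> - of_nat k) = - (of_real pi * \<nu> + of_real (pi * real k))" by (simp add: algebra_simps)
  also have "sin \<dots> = - (sin (of_real pi * \<nu>) * of_real (cos (pi * real k)) + cos (of_real pi * \<nu>) * of_real (sin (pi * real k)))"
   by (simp only: sin_minus sin_add cos_of_real sin_of_real)
  finally show ?thesis by simp
 qed
 have "Gamma (- \<nu> - of_nat k) * Gamma (1 - (- \<nu> - of_nat k)) = of_real pi / sin (of_real pi * (- \<nu> - of_nat k))"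
  by (rule Gamma_reflection_complex)
 also have "1 - (- \<nu> - of_nat k) = of_nat k + \<nu> + 1" by simp
 finally have e: "Gamma (- \<nu> - of_nat k) * Gamma (of_nat k + \<nu> + 1) = of_real pi / sin (of_real pi * (- \<nu> - of_nat k))" .
 have "Gamma (- \<nu> - of_nat k) = Gamma (- \<nu> - of_nat k) * Gamma (of_nat k + \<nu> + 1) * rGamma (of_nat k + \<nu> + 1)"
  using nz by (simp add: rGamma_inverse_Gamma)
 hence "Gamma (- \<nu> - of_nat k) = of_real pi / sin (of_real pi * (- \<nu> - of_nat k)) * rGamma (of_nat k + \<nu> + 1)"
  unfolding e .
 thus ?thesis unfolding s by (cases "even k") simp_all
qed

definition hint :: "complex => complex => complex => real => complex" where
 "hint \<nu> a b x = of_real x powr (- \<nu> - 1) * exp (- a * of_real x - b / of_real x)"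

lemma norm_hint: "x > 0 ==> norm (hint \<nu> a b x) = x powr (- Re \<nu> - 1) * exp (- Re a * x - Re b / x)"
 by (simp add: hint_def norm_mult norm_powr_of_real)

lemma continuous_on_hint: "continuous_on {0<..} (hint \<nu> a b)"
 unfolding hint_def by (intro continuous_intros) (auto simp: complex_nonpos_Reals_iff)

lemma powr_exp_bounded:
 fixes p c :: real assumes c: "c > 0"
 obtains C where "!!y. y \<ge> 1 ==> y powr p * exp (- c * y) \<le> C" "C > 0"
proof -
 have "((\<lambda>y. y powr p * exp (- c * y)) \<longlongrightarrow> 0) at_top" using c by real_asymp
 hence "\<forall>\<^sub>F y in at_top. y powr p * exp (- c * y) < 1" by (rule order_tendstoD) simp
 then obtain Y where Y: "!!y. y \<ge> Y ==> y powr p * exp (- c * y) < 1" by (auto simp: eventually_at_top_linorder)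
 have "continuous_on {1..max 1 Y} (\<lambda>y. y powr p * exp (- c * y))" by (intro continuous_intros) auto
 hence "bdd_above ((\<lambda>y. y powr p * exp (- c * y)) ` {1..max 1 Y})"
  by (intro bounded_imp_bdd_above compact_imp_bounded compact_continuous_image) auto
 then obtain B where B: "\<forall>y\<in>{1..max 1 Y}. y powr p * exp (- c * y) \<le> B"
  unfolding bdd_above_def by auto
 have "y powr p * exp (- c * y) \<le> max 1 B" if "y \<ge> 1" for y
 proof (cases "y \<ge> Y")
  case True thus ?thesis using Y[of y] by simp
 next
  case False thus ?thesis using B[THEN bspec, of y] that by auto
 qed
 thus ?thesis using that[of "max 1 B"] by auto
qed

text \<open>The factor exp(-b/x) beats every power at 0 and exp(-a x) every power at infinity, so no
  restriction on \<nu> arises.\<close>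

lemma set_integrable_hint:
 assumes a: "Re a > 0" and b: "Re b > 0"
 shows "set_integrable lborel {0<..} (hint \<nu> a b)"
proof -
 obtain C1 where C1: "!!y. y \<ge> 1 ==> y powr (Re \<nu> + 1) * exp (- Re b * y) \<le> C1" "C1 > 0" using powr_exp_bounded[OF b] by blast
 obtain C2 where C2: "!!y. y \<ge> 1 ==> y powr (1 - Re \<nu>) * exp (- Re a * y) \<le> C2" "C2 > 0" using powr_exp_bounded[OF a] by blast
 show ?thesis
 proof (rule set_integrable_Ioi_powr_bounds[where a = 0 and b = "-2" and C = "max C1 C2"])
  fix x :: real assume x: "0 < x" "x \<le> 1"
  have "norm (hint \<nu> a b x) \<le> x powr (- Re \<nu> - 1) * exp (- Re b / x)"
   using x a by (simp add: norm_hint)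
  also have "\<dots> = (1 / x) powr (Re \<nu> + 1) * exp (- Re b * (1 / x))"
  proof -
   have "(1 / x) powr (Re \<nu> + 1) = x powr (- (Re \<nu> + 1))" using x by (simp only: powr_minus powr_divide) (simp add: divide_inverse)
   thus ?thesis by simp
  qed
  also have "\<dots> \<le> C1" using x by (intro C1) auto
  finally show "norm (hint \<nu> a b x) \<le> max C1 C2 * x powr 0" using x by simp
 next
  fix x :: real assume x: "1 \<le> x"
  have "norm (hint \<nu> a b x) \<le> x powr (- Re \<nu> - 1) * exp (- Re a * x)"
   using x b by (simp add: norm_hint)
  also have "\<dots> = x powr (1 - Re \<nu>) * exp (- Re a * x) * x powr (-2)"
  proof -
   have "(1 - Re \<nu>) + (-2) = - Re \<nu> - 1" by simp
   hence "x powr (1 - Re \<nu>) * x powr (-2) = x powr (- Re \<nu> - 1)" by (metis powr_add)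
   thus ?thesis by (simp add: mult_ac)
  qed
  also have "\<dots> \<le> C2 * x powr (-2)" using x by (intro mult_right_mono C2) auto
  also have "\<dots> \<le> max C1 C2 * x powr (-2)" by (intro mult_right_mono) auto
  finally show "norm (hint \<nu> a b x) \<le> max C1 C2 * x powr (-2)" .
 qed (use continuous_on_hint in auto)
qed

text \<open>On x > 1 the factor exp(-b/x) is expanded in powers of b/x, dominated by an exponential
  series. Each term is an Euler tail with s = -\<nu> - k; its Gamma part builds a Bessel series, and
  its incomplete part goes into the residual sum.\<close>

lemma integral_hint_1_inf:
 assumes a: "Re a > 0" and nu: "\<nu> \<notin> \<int>"
 shows "(LINT x:{1<..}|lborel. hint \<nu> a b x) = - of_real pi / sin (of_real pi * \<nu>) * a powr \<nu> * bessel_series \<nu> (a * b)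
  - (\<Sum>k. (- b) ^ k / fact k * incgamma_series (- \<nu> - of_nat k) a)"
  and "summable (\<lambda>k. (- b) ^ k / fact k * incgamma_series (- \<nu> - of_nat k) a)"
proof -
 have a0: "a \<noteq> 0" using a by auto
 have nk: "- \<nu> - of_nat k \<notin> \<int>" for k
 proof
  assume "- \<nu> - of_nat k \<in> \<int>"
  hence "- (- \<nu> - of_nat k) \<in> \<int>" by (rule Ints_minus)
  thus False using nu Ints_add_of_nat[of \<nu> k] by (simp add: add.commute)
 qed
 define f where "f = (\<lambda>k x. (- b) ^ k / fact k * Gint (- \<nu> - of_nat k) a x)"
 have fi: "set_integrable lborel {1<..} (f k)" for k
  unfolding f_def by (intro set_integrable_mult_right set_integrable_Gint_1 a)
 have feq: "f k x = Gint (- \<nu>) a x * ((- b / of_real x) ^ k /\<^sub>R fact k)" if "x > 0" for k x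
 proof -
  have "- \<nu> - of_nat k - 1 = (- \<nu> - 1) - of_nat k" by simp
  hence p: "complex_of_real x powr (- \<nu> - of_nat k - 1) = of_real x powr (- \<nu> - 1) / of_real x ^ k"
   using that by (simp only: powr_diff[of _ "- \<nu> - 1" "of_nat k"]) (simp add: powr_nat')
  show ?thesis unfolding f_def Gint_def p power_divide by (simp add: scaleR_conv_of_real divide_inverse mult_ac)
 qed
 have sumsf: "(\<lambda>k. f k x) sums hint \<nu> a b x" if "x > 0" for x
 proof -
  have "(\<lambda>k. Gint (- \<nu>) a x * ((- b / of_real x) ^ k /\<^sub>R fact k)) sums (Gint (- \<nu>) a x * exp (- b / of_real x))"
   by (intro sums_mult exp_converges)
  moreover have "Gint (- \<nu>) a x * exp (- b / of_real x) = hint \<nu> a b x"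
   by (simp add: Gint_def hint_def exp_diff exp_minus divide_inverse)
  ultimately show ?thesis using feq[OF that] by simp
 qed
 have nf: "norm (f k x) \<le> norm b ^ k /\<^sub>R fact k * norm (Gint (- \<nu>) a x)" if "x \<in> {1<..}" for k x
 proof -
  have x: "x > 1" using that by auto
  have "norm (f k x) = norm (Gint (- \<nu>) a x) * ((norm b / x) ^ k /\<^sub>R fact k)"
   using x by (subst feq) (simp_all add: norm_mult norm_power norm_divide)
  also have "\<dots> \<le> norm (Gint (- \<nu>) a x) * ((norm b / 1) ^ k /\<^sub>R fact k)"
   using x by (intro mult_left_mono scaleR_left_mono power_mono frac_le) auto
  finally show ?thesis by (simp add: mult_ac)
 qed
 have fs: "summable (\<lambda>k. norm (f k x))" if "x \<in> {1<..}" for x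
  by (rule summable_comparison_test'[OF summable_mult2[OF summable_exp_generic[of "norm b"]]]) (use nf[OF that] in auto)
 have fsi: "summable (\<lambda>k. LINT x:{1<..}|lborel. norm (f k x))"
 proof (rule summable_comparison_test'[OF summable_mult2[OF summable_exp_generic[of "norm b"]]])
  fix k
  have "(LINT x:{1<..}|lborel. norm (f k x)) \<le> (LINT x:{1<..}|lborel. norm b ^ k /\<^sub>R fact k * norm (Gint (- \<nu>) a x))"
   by (intro set_integral_mono set_integrable_norm set_integrable_mult_right fi set_integrable_Gint_1 a nf)
  moreover have "(LINT x:{1<..}|lborel. norm (f k x)) \<ge> 0"
   unfolding set_lebesgue_integral_def by (intro Bochner_Integration.integral_nonneg) auto
  ultimately show "norm (LINT x:{1<..}|lborel. norm (f k x)) \<le> norm b ^ k /\<^sub>R fact k * (LINT x:{1<..}|lborel. norm (Gint (- \<nu>) a x))"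
   by simp
 qed
 have "(\<lambda>k. LINT x:{1<..}|lborel. f k x) sums (LINT x:{1<..}|lborel. (\<Sum>k. f k x))"
  using set_sums_integral[OF _ fi fs fsi] by auto
 also have "(LINT x:{1<..}|lborel. (\<Sum>k. f k x)) = (LINT x:{1<..}|lborel. hint \<nu> a b x)"
  by (intro set_lebesgue_integral_cong) (use sumsf in \<open>auto simp: sums_iff\<close>)
 finally have S: "(\<lambda>k. LINT x:{1<..}|lborel. f k x) sums (LINT x:{1<..}|lborel. hint \<nu> a b x)" .
 define c where "c = - of_real pi / sin (of_real pi * \<nu>) * a powr \<nu>"
 have val: "(LINT x:{1<..}|lborel. f k x) = c * ((a * b) ^ k * (rGamma (of_nat k + \<nu> + 1) / fact k))
  - (- b) ^ k / fact k * incgamma_series (- \<nu> - of_nat k) a" for k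
 proof -
  have "(LINT x:{1<..}|lborel. f k x) = (- b) ^ k / fact k * (Gamma (- \<nu> - of_nat k) * a powr (\<nu> + of_nat k) - incgamma_series (- \<nu> - of_nat k) a)"
   unfolding f_def set_integral_mult_right integral_Gint_1_inf[OF a nk] by (simp add: add.commute)
  also have "a powr (\<nu> + of_nat k) = a powr \<nu> * a ^ k" using a0 by (simp add: powr_add powr_nat')
  finally show ?thesis unfolding Gamma_minus_shift[OF nu] c_def
   by (cases "even k") (simp_all add: power_minus[of b] power_mult_distrib right_diff_distrib mult_ac)
 qed
 have B: "(\<lambda>k. c * ((a * b) ^ k * (rGamma (of_nat k + \<nu> + 1) / fact k))) sums (c * bessel_series \<nu> (a * b))"
  by (intro sums_mult bessel_series_sums)
 have "(\<lambda>k. (- b) ^ k / fact k * incgamma_series (- \<nu> - of_nat k) a) sums (c * bessel_series \<nu> (a * b) - (LINT x:{1<..}|lborel. hint \<nu> a b x))"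
  using sums_diff[OF B S] unfolding val by simp
 thus "summable (\<lambda>k. (- b) ^ k / fact k * incgamma_series (- \<nu> - of_nat k) a)"
  "(LINT x:{1<..}|lborel. hint \<nu> a b x) = - of_real pi / sin (of_real pi * \<nu>) * a powr \<nu> * bessel_series \<nu> (a * b)
  - (\<Sum>k. (- b) ^ k / fact k * incgamma_series (- \<nu> - of_nat k) a)"
  unfolding c_def[symmetric] by (simp_all add: sums_iff)
qed

text \<open>Both sums come from one absolutely convergent double series taken in opposite orders:
  the denominators j - \<nu> - k and k + \<nu> - j differ only by their sign.\<close>

lemma incgamma_double_series_cancel:
 assumes nu: "\<nu> \<notin> \<int>"
 shows "(\<Sum>k. (- b) ^ k / fact k * incgamma_series (- \<nu> - of_nat k) a) + (\<Sum>j. (- a) ^ j / fact j * incgamma_series (\<nu> - of_nat j) b) = 0"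
proof -
 define D where "D = (\<lambda>k j. (- b) ^ k / fact k * ((- a) ^ j / fact j * (1 / (of_nat j + (- \<nu> - of_nat k)))))"
 have nu': "- \<nu> \<notin> \<int>" using nu Ints_minus[of "- \<nu>"] by auto
 obtain C where C: "!!k::int. norm (1 / (of_int k + - \<nu>)) \<le> C"
  using inverse_shift_bounded[OF nu'] by blast
 have C': "norm (1 / (of_nat j + (- \<nu> - of_nat k))) \<le> C" for j k
  using C[of "int j - int k"] by (simp add: algebra_simps)
 have C0: "C \<ge> 0" using C norm_ge_zero order_trans by blast
 have Dle: "norm (D k j) \<le> (norm b ^ k /\<^sub>R fact k) * ((norm a ^ j /\<^sub>R fact j) * C)" for k j
 proof -
  have "norm (D k j) = (norm b ^ k /\<^sub>R fact k) * ((norm a ^ j /\<^sub>R fact j) * norm (1 / (of_nat j + (- \<nu> - of_nat k))))"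
   unfolding D_def norm_mult norm_divide norm_power by (simp add: divide_inverse mult_ac)
  also have "\<dots> \<le> (norm b ^ k /\<^sub>R fact k) * ((norm a ^ j /\<^sub>R fact j) * C)"
   by (intro mult_left_mono C') auto
  finally show ?thesis .
 qed
 have nk: "- \<nu> - of_nat k \<notin> \<int>" for k
 proof
  assume "- \<nu> - of_nat k \<in> \<int>"
  hence "- (- \<nu> - of_nat k) \<in> \<int>" by (rule Ints_minus)
  thus False using nu Ints_add_of_nat[of \<nu> k] by (simp add: add.commute)
 qed
 have nk2: "\<nu> - of_nat k \<notin> \<int>" for k
  using nu Ints_add_of_nat[of "\<nu> - of_nat k" k] by simp
 have sw: "(\<Sum>k. \<Sum>j. D k j) = (\<Sum>j. \<Sum>k. D k j)"
  by (rule double_suminf_swap(6)[OF Dle summable_exp_generic _ summable_mult2[OF summable_exp_generic]]) (use C0 in auto)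
 have "(\<Sum>j. D k j) = (- b) ^ k / fact k * incgamma_series (- \<nu> - of_nat k) a" for k
  unfolding D_def using sums_mult[OF incgamma_series_sums[OF nk[of k], of a], of "(- b) ^ k / fact k"] by (simp add: sums_iff)
 moreover have D2: "(\<Sum>k. D k j) = - ((- a) ^ j / fact j * incgamma_series (\<nu> - of_nat j) b)" for j
 proof -
  have "D k j = - ((- a) ^ j / fact j) * ((- b) ^ k / fact k * (1 / (of_nat k + (\<nu> - of_nat j))))" for k
  proof -
   have "of_nat j + (- \<nu> - of_nat k) = - (of_nat k + (\<nu> - of_nat j))" by simp
   thus ?thesis unfolding D_def by (simp only: divide_minus_right mult_minus_right mult_minus_left) (simp add: mult_ac)
  qed
  thus ?thesis
   using sums_mult[OF incgamma_series_sums[OF nk2[of j], of b], of "- ((- a) ^ j / fact j)"] by (simp add: sums_iff)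
 qed
 moreover have "(\<Sum>j. - ((- a) ^ j / fact j * incgamma_series (\<nu> - of_nat j) b)) = - (\<Sum>j. ((- a) ^ j / fact j * incgamma_series (\<nu> - of_nat j) b))"
 proof (rule suminf_minus)
  have "summable (\<lambda>j. \<Sum>k. D k j)"
   by (rule double_suminf_swap(5)[OF Dle summable_exp_generic _ summable_mult2[OF summable_exp_generic]]) (use C0 in auto)
  hence "summable (\<lambda>j. - ((- a) ^ j / fact j * incgamma_series (\<nu> - of_nat j) b))" using D2 by simp
  from summable_minus[OF this] show "summable (\<lambda>j. (- a) ^ j / fact j * incgamma_series (\<nu> - of_nat j) b)" by simp
 qed
 ultimately show ?thesis using sw by simp
qed

text \<open>The substitution x -> 1/x on (0, 1) exchanges a with b and \<nu> with -\<nu>, so two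
  tails over (1, \<infinity>) remain and their residual sums cancel. Classically the value is 2
  (a/b) powr (\<nu>/2) K_\<nu>(2 sqrt(a b)); the present form has a limit as a and b approach
  nonzero points of the imaginary axis.\<close>

theorem integral_hint:
 assumes a: "Re a > 0" and b: "Re b > 0" and nu: "\<nu> \<notin> \<int>"
 shows "(LINT x:{0<..}|lborel. hint \<nu> a b x)
  = of_real pi / sin (of_real pi * \<nu>) * (b powr (- \<nu>) * bessel_series (- \<nu>) (a * b) - a powr \<nu> * bessel_series \<nu> (a * b))"
proof -
 have nu': "- \<nu> \<notin> \<int>" using nu Ints_minus[of "- \<nu>"] by auto
 note I = set_integrable_hint[OF a b, of \<nu>]
 have I1: "set_integrable lborel {0<..<1} (hint \<nu> a b)" "set_integrable lborel {1<..} (hint \<nu> a b)"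
  by (rule set_integrable_subset[OF I]; auto)+
 have eq: "hint \<nu> a b (1 / y) / of_real (y\<^sup>2) = hint (- \<nu>) b a y" if "y \<in> {1<..}" for y
 proof -
  have y: "y > 0" using that by simp
  have "complex_of_real (1 / y) powr (- \<nu> - 1) = of_real y powr (\<nu> + 1)"
   using y unfolding powr_def by (simp add: Ln_of_real ln_div algebra_simps del: of_real_divide)
  also have "\<dots> = of_real y powr (\<nu> - 1) * of_real (y\<^sup>2)"
  proof -
   have "\<nu> + 1 = (\<nu> - 1) + of_nat 2" by simp
   thus ?thesis using y by (simp only: complex_powr_of_real_add_nat) simp
  qed
  finally have p: "complex_of_real (1 / y) powr (- \<nu> - 1) = of_real y powr (\<nu> - 1) * of_real (y\<^sup>2)" .
  have e: "- a * of_real (1 / y) - b / of_real (1 / y) = - b * of_real y - a / of_real y" by (simp add: algebra_simps)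
  show ?thesis unfolding hint_def p e using y by simp
 qed
 have I2: "set_integrable lborel {1<..} (\<lambda>y. hint \<nu> a b (1 / y) / of_real (y\<^sup>2))"
 proof -
  have "set_integrable lborel {1<..} (hint (- \<nu>) b a)" by (rule set_integrable_subset[OF set_integrable_hint[OF b a]]) auto
  thus ?thesis by (rule set_integrable_cong[THEN iffD1, rotated -1]) (use eq in auto)
 qed
 have "(LINT x:{0<..}|lborel. hint \<nu> a b x) = (LINT x:{0<..<1}|lborel. hint \<nu> a b x) + (LINT x:{1<..}|lborel. hint \<nu> a b x)"
  by (rule set_integral_split_at_1[OF I1])
 also have "(LINT x:{0<..<1}|lborel. hint \<nu> a b x) = (LINT y:{1<..}|lborel. hint \<nu> a b (1 / y) / of_real (y\<^sup>2))"
  by (rule set_integral_inverse_substitution[OF continuous_on_subset[OF continuous_on_hint] I1(1) I2]) auto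
 also have "\<dots> = (LINT y:{1<..}|lborel. hint (- \<nu>) b a y)"
  by (intro set_lebesgue_integral_cong) (use eq in auto)
 finally show ?thesis
  using integral_hint_1_inf(1)[OF a nu, of b] integral_hint_1_inf(1)[OF b nu', of a] incgamma_double_series_cancel[OF nu, of b a]
  by (simp add: mult.commute[of b a] right_diff_distrib) (simp add: algebra_simps)
qed

section \<open>Asymptotics of the Bessel kernel\<close>

lemma has_field_derivative_bessel_series:
 "(bessel_series \<mu> has_field_derivative bessel_series (\<mu> + 1) w) (at w)"
proof -
 define c where "c = (\<lambda>m. rGamma (of_nat m + \<mu> + 1) / fact m :: complex)"
 have s: "summable (\<lambda>m. c m * y ^ m)" for y
  using summable_norm_cancel[OF summable_bessel_series[of y \<mu>]] by (simp add: c_def mult.commute)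
 have "((\<lambda>x. \<Sum>n. c n * x ^ n) has_field_derivative (\<Sum>n. diffs c n * w ^ n)) (at w)"
  by (rule termdiffs_strong_converges_everywhere[OF s])
 also have "(\<lambda>x. \<Sum>n. c n * x ^ n) = bessel_series \<mu>"
  by (auto simp: fun_eq_iff bessel_series_def c_def mult.commute)
 also have "diffs c n = rGamma (of_nat n + (\<mu> + 1) + 1) / fact n" for n
  by (simp add: diffs_def c_def fact_Suc add_ac del: of_nat_Suc) (simp add: add_ac)
 hence "(\<Sum>n. diffs c n * w ^ n) = bessel_series (\<mu> + 1) w"
  by (simp add: bessel_series_def mult.commute)
 finally show ?thesis .
qed

lemma continuous_on_bessel_series [continuous_intros]:
 assumes "continuous_on S f" shows "continuous_on S (\<lambda>x. bessel_series \<mu> (f x))"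
proof -
 have "continuous_on UNIV (bessel_series \<mu>)"
  by (intro continuous_at_imp_continuous_on) (auto intro: DERIV_isCont has_field_derivative_bessel_series)
 thus ?thesis using assms by (rule continuous_on_compose2) auto
qed

text \<open>Coefficient by coefficient this is z rGamma(z + 1) = rGamma(z) at z = m + \<mu> + 1. As
  differentiation raises \<mu> by one, it encodes Bessel's equation.\<close>

lemma bessel_series_rec:
 "w * bessel_series (\<mu> + 2) w + (\<mu> + 1) * bessel_series (\<mu> + 1) w = bessel_series \<mu> w"
proof -
 have "(\<lambda>m. w * (w ^ m * (rGamma (of_nat m + (\<mu> + 2) + 1) / fact m))) sums (w * bessel_series (\<mu> + 2) w)"
  by (intro sums_mult bessel_series_sums)
 also have "(\<lambda>m. w * (w ^ m * (rGamma (of_nat m + (\<mu> + 2) + 1) / fact m)))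
   = (\<lambda>m. of_nat (Suc m) * (w ^ Suc m * (rGamma (of_nat (Suc m) + (\<mu> + 1) + 1) / fact (Suc m))))"
 proof
  fix m
  have "of_nat m + (\<mu> + 2) + 1 = of_nat (Suc m) + (\<mu> + 1) + 1" by simp
  thus "w * (w ^ m * (rGamma (of_nat m + (\<mu> + 2) + 1) / fact m))
   = of_nat (Suc m) * (w ^ Suc m * (rGamma (of_nat (Suc m) + (\<mu> + 1) + 1) / fact (Suc m)))"
   by (simp only: fact_Suc) (simp add: divide_simps del: of_nat_Suc)
 qed
 finally have 1: "(\<lambda>m. of_nat m * (w ^ m * (rGamma (of_nat m + (\<mu> + 1) + 1) / fact m))) sums (w * bessel_series (\<mu> + 2) w)"
  by (subst (asm) sums_Suc_iff) simp
 have 2: "(\<lambda>m. (\<mu> + 1) * (w ^ m * (rGamma (of_nat m + (\<mu> + 1) + 1) / fact m))) sums ((\<mu> + 1) * bessel_series (\<mu> + 1) w)"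
  by (intro sums_mult bessel_series_sums)
 have "of_nat m * (w ^ m * (rGamma (of_nat m + (\<mu> + 1) + 1) / fact m)) + (\<mu> + 1) * (w ^ m * (rGamma (of_nat m + (\<mu> + 1) + 1) / fact m))
  = w ^ m * (rGamma (of_nat m + \<mu> + 1) / fact m)" for m
 proof -
  have "(of_nat m + \<mu> + 1) * rGamma ((of_nat m + \<mu> + 1) + 1) = rGamma (of_nat m + \<mu> + 1)" by (rule rGamma_plus1)
  moreover have "of_nat m + (\<mu> + 1) + 1 = (of_nat m + \<mu> + 1) + 1" by simp
  moreover have "of_nat m * (w ^ m * (R / f)) + (\<mu> + 1) * (w ^ m * (R / f)) = w ^ m * (((of_nat m + \<mu> + 1) * R) / f)" for R f
   by (simp add: algebra_simps add_divide_distrib)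
  ultimately show ?thesis by (simp only:)
 qed
 with sums_add[OF 1 2] have "(\<lambda>m. w ^ m * (rGamma (of_nat m + \<mu> + 1) / fact m)) sums (w * bessel_series (\<mu> + 2) w + (\<mu> + 1) * bessel_series (\<mu> + 1) w)"
  by simp
 thus ?thesis using bessel_series_sums by (rule sums_unique2)
qed

lemma besselJ_eq: "besselJ \<mu> x = of_real (x / 2) powr \<mu> * bessel_series \<mu> (- (of_real (x / 2))\<^sup>2)"
proof -
 have "(- 1) ^ m * r / f * A ^ (2 * m) = (- (A\<^sup>2)) ^ m * (r / f)" for m and r f A :: complex
  unfolding power_mult power_minus[of "A\<^sup>2"] by (simp only: times_divide_eq_right times_divide_eq_left mult_ac)
 thus ?thesis unfolding besselJ_def bessel_series_def by (subst mult.commute) (simp only:)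
qed

lemma besselI_eq: "besselI \<mu> x = of_real (x / 2) powr \<mu> * bessel_series \<mu> ((of_real (x / 2))\<^sup>2)"
proof -
 have "r / f * A ^ (2 * m) = (A\<^sup>2) ^ m * (r / f)" for m and r f A :: complex
  unfolding power_mult by (simp only: mult_ac)
 thus ?thesis unfolding besselI_def bessel_series_def by (subst mult.commute) (simp only:)
qed

text \<open>The expression in braces of the theorem, as a function of the Bessel argument.\<close>

definition vkernel :: "complex => real => complex" where
 "vkernel \<nu> X = (2 / of_real pi * besselK \<nu> X - besselY \<nu> X) * cos (of_real pi * \<nu> / 2) - besselJ \<nu> X * sin (of_real pi * \<nu> / 2)"

lemma sin_cos_half_nonzero:
 fixes \<nu> :: complex
 assumes "\<nu> \<notin> \<int>"
 shows "sin (of_real pi * \<nu>) = 2 * sin (of_real pi * \<nu> / 2) * cos (of_real pi * \<nu> / 2)"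
  and "sin (of_real pi * \<nu> / 2) \<noteq> 0" "cos (of_real pi * \<nu> / 2) \<noteq> 0"
proof -
 show e: "sin (of_real pi * \<nu>) = 2 * sin (of_real pi * \<nu> / 2) * cos (of_real pi * \<nu> / 2)"
  using sin_double[of "of_real pi * \<nu> / 2"] by simp
 have "sin (of_real pi * \<nu>) \<noteq> 0"
 proof
  assume "sin (of_real pi * \<nu>) = 0"
  then obtain n :: int where "of_real pi * \<nu> = of_real (of_int n * pi)" by (auto simp: sin_eq_0)
  hence "\<nu> = of_int n" by simp
  thus False using assms by simp
 qed
 thus "sin (of_real pi * \<nu> / 2) \<noteq> 0" "cos (of_real pi * \<nu> / 2) \<noteq> 0" using e by auto
qed

text \<open>With s and c the sine and cosine of pi \<nu>/2, sin(pi \<nu>) = 2 s c cancels the factor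
  c in front of K and Y, and c^2 - s^2 + 2 s^2 = 1 merges the J terms. The result separates an
  exponentially small part, the difference of I, from an oscillating part, the difference of
  J.\<close>

lemma vkernel_eq:
 fixes \<nu> :: complex
 assumes nu: "\<nu> \<notin> \<int>"
 shows "vkernel \<nu> X = ((besselI (- \<nu>) X - besselI \<nu> X) + (besselJ (- \<nu>) X - besselJ \<nu> X)) / (2 * sin (of_real pi * \<nu> / 2))"
proof -
 let ?s = "sin (of_real pi * \<nu> / 2)" and ?c = "cos (of_real pi * \<nu> / 2)"
 note sc = sin_cos_half_nonzero[OF nu]
 have c2: "cos (of_real pi * \<nu>) = ?c * ?c - ?s * ?s"
  using cos_double[of "of_real pi * \<nu> / 2"] by (simp add: power2_eq_square)
 have one: "?c * ?c + ?s * ?s = 1" using sin_cos_squared_add3[of "of_real pi * \<nu> / 2"] by (simp add: mult.commute)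
 have gK: "2 / p * (p / 2 * D / (2 * s * c)) * c = D / (2 * s)" if "p \<noteq> 0" "s \<noteq> 0" "c \<noteq> 0" for p D s c :: complex
  using that by (simp add: divide_simps)
 have gJ: "a - (j * (c * c - s * s) - b) - j * (2 * (s * s)) = a + (b - j * (c * c + s * s))" for a b j s c :: complex
  by (simp add: algebra_simps)
 have gY: "N / (2 * s * c) * c = N / (2 * s)" if "s \<noteq> 0" "c \<noteq> 0" for N s c :: complex
  using that by (simp add: divide_simps)
 have K': "besselK \<nu> X = of_real pi / 2 * (besselI (- \<nu>) X - besselI \<nu> X) / (2 * ?s * ?c)"
  unfolding besselK_def Let_def mult.commute[of \<nu>] sc(1) using nu by (simp only: if_True not_False_eq_True)
 have K: "2 / of_real pi * besselK \<nu> X * ?c = (besselI (- \<nu>) X - besselI \<nu> X) / (2 * ?s)"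
  unfolding K' by (rule gK) (use sc in auto)
 have Y': "besselY \<nu> X = (besselJ \<nu> X * (?c * ?c - ?s * ?s) - besselJ (- \<nu>) X) / (2 * ?s * ?c)"
  unfolding besselY_def Let_def mult.commute[of \<nu>] sc(1) c2 using nu by (simp only: if_True not_False_eq_True)
 have Y: "besselY \<nu> X * ?c = (besselJ \<nu> X * (?c * ?c - ?s * ?s) - besselJ (- \<nu>) X) / (2 * ?s)"
  unfolding Y' by (rule gY) (use sc in auto)
 have J: "besselJ \<nu> X * ?s = (besselJ \<nu> X * (2 * (?s * ?s))) / (2 * ?s)" using sc by simp
 have "vkernel \<nu> X = ((besselI (- \<nu>) X - besselI \<nu> X) - (besselJ \<nu> X * (?c * ?c - ?s * ?s) - besselJ (- \<nu>) X) - besselJ \<nu> X * (2 * (?s * ?s))) / (2 * ?s)"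
  unfolding vkernel_def left_diff_distrib K Y J by (simp add: diff_divide_distrib)
 also have "(besselI (- \<nu>) X - besselI \<nu> X) - (besselJ \<nu> X * (?c * ?c - ?s * ?s) - besselJ (- \<nu>) X) - besselJ \<nu> X * (2 * (?s * ?s))
  = (besselI (- \<nu>) X - besselI \<nu> X) + (besselJ (- \<nu>) X - besselJ \<nu> X * (?c * ?c + ?s * ?s))" by (rule gJ)
 finally show ?thesis unfolding one by simp
qed

text \<open>Liouville normal form: the factor sqrt X removes the first-order term of Bessel's
  equation. It depends on \<mu> only through \<mu>^2, so the solutions for \<nu> and -\<nu>, and
  hence their difference, satisfy the same equation.\<close>

lemma bessel_ode:
 fixes \<mu> :: complex
 obtains W' W'' :: "real => complex" where
  "!!X. X > 0 ==> ((\<lambda>X. of_real (sqrt X) * besselJ \<mu> X) has_vector_derivative W' X) (at X)"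
  "!!X. X > 0 ==> (W' has_vector_derivative W'' X) (at X)"
  "!!X. X > 0 ==> W'' X = - (of_real (sqrt X) * besselJ \<mu> X) + (\<mu>\<^sup>2 - 1/4) * (of_real (sqrt X) * besselJ \<mu> X) / of_real (X\<^sup>2)"
proof -
 let ?E = "\<lambda>k z. bessel_series (\<mu> + k) (- (z / 2)\<^sup>2)"
 define k where "k = (2::complex) powr (- \<mu>)"
 define F where "F = (\<lambda>z::complex. k * (z powr (\<mu> + 1/2) * ?E 0 z))"
 define F' where "F' = (\<lambda>z::complex. k * ((\<mu> + 1/2) * (z powr (\<mu> - 1/2) * ?E 0 z) - z powr (\<mu> + 3/2) * ?E 1 z / 2))"
 define F'' where "F'' = (\<lambda>z::complex. - F z + (\<mu>\<^sup>2 - 1/4) * F z / z\<^sup>2)"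
 have dE: "((\<lambda>z. ?E j z) has_field_derivative ?E (j + 1) z * (- z / 2)) (at z)" for j z
 proof -
  have g: "((\<lambda>z::complex. - (z / 2)\<^sup>2) has_field_derivative (- z / 2)) (at z)"
   by (auto intro!: derivative_eq_intros)
  from DERIV_chain2[OF has_field_derivative_bessel_series g, of "\<mu> + j"] show ?thesis by (simp add: add.assoc)
 qed
 have dP: "((\<lambda>z. z powr s) has_field_derivative s * z powr (s - 1)) (at z)" if "z \<notin> \<real>\<^sub>\<le>\<^sub>0" for s z :: complex
  using that by (rule has_field_derivative_powr)
 have p1: "z powr (s + 1) = z * z powr s" if "z \<noteq> 0" for z s :: complex using that by (simp add: powr_add)
 have d1: "(F has_field_derivative F' z) (at z)" if z: "z \<notin> \<real>\<^sub>\<le>\<^sub>0" for z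
 proof -
  have z0: "z \<noteq> 0" using z by auto
  have p: "z powr (\<mu> + 3/2) = z * z powr (\<mu> + 1/2)" using p1[OF z0, of "\<mu> + 1/2"] by (simp add: add.assoc)
  have "(F has_field_derivative k * ((\<mu> + 1/2) * z powr (\<mu> + 1/2 - 1) * ?E 0 z + ?E (0 + 1) z * (- z / 2) * z powr (\<mu> + 1/2))) (at z)"
   unfolding F_def by (intro DERIV_cmult DERIV_mult dP z dE)
  moreover have "\<mu> + 1/2 - 1 = \<mu> - 1/2" by simp
  ultimately show ?thesis unfolding F'_def p by (simp add: mult_ac)
 qed
 have d2: "(F' has_field_derivative F'' z) (at z)" if z: "z \<notin> \<real>\<^sub>\<le>\<^sub>0" for z
 proof -
  have z0: "z \<noteq> 0" using z by auto
  define p where "p = z powr (\<mu> - 3/2)"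
  have e: "\<mu> - 3/2 + 1 = \<mu> - 1/2" "\<mu> - 1/2 + 1 = \<mu> + 1/2" "\<mu> + 1/2 + 1 = \<mu> + 3/2" by simp_all
  have q1: "z powr (\<mu> - 1/2) = z * p" using p1[OF z0, of "\<mu> - 3/2"] unfolding e p_def .
  have q2: "z powr (\<mu> + 1/2) = z\<^sup>2 * p" using p1[OF z0, of "\<mu> - 1/2"] unfolding e q1 by (simp add: power2_eq_square)
  have q3: "z powr (\<mu> + 3/2) = z ^ 3 * p" using p1[OF z0, of "\<mu> + 1/2"] unfolding e q2 by (simp add: power3_eq_cube power2_eq_square)
  have e1: "\<mu> - 1/2 - 1 = \<mu> - 3/2" "\<mu> + 3/2 - 1 = \<mu> + 1/2" by simp_all
  have rec: "?E 0 z = - (z / 2)\<^sup>2 * ?E 2 z + (\<mu> + 1) * ?E 1 z" using bessel_series_rec[of "- (z/2)\<^sup>2" \<mu>] by simp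
  have "(F' has_field_derivative k * ((\<mu> + 1/2) * ((\<mu> - 1/2) * z powr (\<mu> - 1/2 - 1) * ?E 0 z + ?E (0 + 1) z * (- z / 2) * z powr (\<mu> - 1/2))
   - ((\<mu> + 3/2) * z powr (\<mu> + 3/2 - 1) * ?E 1 z + ?E (1 + 1) z * (- z / 2) * z powr (\<mu> + 3/2)) / 2)) (at z)"
   unfolding F'_def by (intro DERIV_cmult DERIV_diff DERIV_mult dP z dE DERIV_cdivide)
  also have "k * ((\<mu> + 1/2) * ((\<mu> - 1/2) * z powr (\<mu> - 1/2 - 1) * ?E 0 z + ?E (0 + 1) z * (- z / 2) * z powr (\<mu> - 1/2))
   - ((\<mu> + 3/2) * z powr (\<mu> + 3/2 - 1) * ?E 1 z + ?E (1 + 1) z * (- z / 2) * z powr (\<mu> + 3/2)) / 2) = F'' z"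
  proof -
   have F0: "F z = k * (z\<^sup>2 * p * ?E 0 z)" by (simp add: F_def q2)
   have F2: "F'' z = k * p * ((\<mu>\<^sup>2 - 1/4) * ?E 0 z - z\<^sup>2 * ?E 0 z)"
    unfolding F''_def F0 using z0 by (simp add: field_simps)
   \<comment> \<open>The recurrence enters only here: it trades z^2 times the series of order \<mu>
     for the orders \<mu> + 1 and \<mu> + 2 that the two derivatives have produced.\<close>
   have F3: "z\<^sup>2 * ?E 0 z = z\<^sup>2 * (- (z / 2)\<^sup>2 * ?E 2 z + (\<mu> + 1) * ?E 1 z)" using rec by simp
   have o: "(1::complex) + 1 = 2" "(0::complex) + 1 = 1" by simp_all
   show ?thesis unfolding F2 F3 e1 q1 q2 q3 o p_def[symmetric]
    by (simp add: field_simps power2_eq_square power3_eq_cube)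
  qed
  finally show ?thesis .
 qed
 have W: "of_real (sqrt X) * besselJ \<mu> X = F (of_real X)" if "X > 0" for X
 proof -
  have l2: "Ln 2 = complex_of_real (ln 2)" using Ln_of_real[of 2] by simp
  have a: "complex_of_real (X / 2) powr \<mu> = of_real X powr \<mu> * k"
   unfolding k_def using that by (simp add: powr_def Ln_of_real ln_div exp_add[symmetric] algebra_simps del: of_real_divide)
    (simp add: l2 exp_diff exp_minus divide_inverse)
  have "complex_of_real (sqrt X) = of_real X powr (1/2)"
   using that by (simp add: powr_half_sqrt[symmetric] powr_of_real[symmetric] del: powr_half_sqrt)
  hence b: "complex_of_real (sqrt X) * of_real X powr \<mu> = of_real X powr (\<mu> + 1/2)" using that by (simp add: powr_add mult.commute)
  show ?thesis unfolding besselJ_eq a F_def b[symmetric] by (simp add: mult_ac)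
 qed
 have nn: "complex_of_real X \<notin> \<real>\<^sub>\<le>\<^sub>0" if "X > 0" for X using that by (simp add: complex_nonpos_Reals_iff)
 show ?thesis
 proof (rule that)
  fix X :: real assume X: "X > 0"
  have "((\<lambda>X. F (of_real X)) has_vector_derivative F' (of_real X)) (at X)"
   by (rule has_vector_derivative_real_field[OF d1[OF nn[OF X]]])
  thus "((\<lambda>X. of_real (sqrt X) * besselJ \<mu> X) has_vector_derivative F' (of_real X)) (at X)"
   by (rule has_vector_derivative_transform_within_open[of _ _ _ "{0<..}"]) (use X W in auto)
  show "((\<lambda>X. F' (of_real X)) has_vector_derivative F'' (of_real X)) (at X)"
   by (rule has_vector_derivative_real_field[OF d2[OF nn[OF X]]])
  show "F'' (of_real X) = - (of_real (sqrt X) * besselJ \<mu> X) + (\<mu>\<^sup>2 - 1/4) * (of_real (sqrt X) * besselJ \<mu> X) / of_real (X\<^sup>2)"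
   unfolding W[OF X] F''_def by simp
 qed
qed

section \<open>Asymptotics of solutions of W'' = - W + c W / X^2\<close>

text \<open>Comparison with -C/(2 X^2), whose derivative is C/X^3, makes f a Cauchy function at
  infinity and gives the rate along with the limit.\<close>

lemma asymptotic_limit_inverse_square:
 fixes f f' :: "real => complex"
 assumes X0: "X0 > 0" and d: "!!X. X \<ge> X0 ==> (f has_vector_derivative f' X) (at X)"
  and b: "!!X. X \<ge> X0 ==> norm (f' X) \<le> C / X ^ 3"
 obtains l where "!!X. X \<ge> X0 ==> norm (f X - l) \<le> C / 2 / X\<^sup>2"
proof -
 have C: "C \<ge> 0"
 proof -
  have "0 \<le> C / X0 ^ 3" using b[of X0] norm_ge_zero order_trans by blast
  thus ?thesis using X0 by (simp add: zero_le_divide_iff)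
 qed
 have le: "norm (f y - f x) \<le> C / 2 / x\<^sup>2 - C / 2 / y\<^sup>2" if "X0 \<le> x" "x < y" for x y
 proof -
  have "norm (f y - f x) \<le> (- (C / 2 / y\<^sup>2)) - (- (C / 2 / x\<^sup>2))"
  proof (rule differentiable_bound_general[OF that(2), where f' = f' and \<phi>' = "\<lambda>x. C / x ^ 3"])
   show "continuous_on {x..y} f"
    by (intro continuous_at_imp_continuous_on ballI has_vector_derivative_continuous[OF d]) (use that in auto)
   show "continuous_on {x..y} (\<lambda>x. - (C / 2 / x\<^sup>2))" by (intro continuous_intros) (use that X0 in auto)
   show "(f has_vector_derivative f' t) (at t)" if "x < t" for t using that \<open>X0 \<le> x\<close> by (intro d) auto
   show "((\<lambda>x. - (C / 2 / x\<^sup>2)) has_vector_derivative C / t ^ 3) (at t)" if "x < t" for t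
   proof -
    have "t > 0" using that \<open>X0 \<le> x\<close> X0 by simp
    thus ?thesis unfolding has_real_derivative_iff_has_vector_derivative[symmetric]
     by (auto intro!: derivative_eq_intros simp: field_simps power2_eq_square power3_eq_cube)
   qed
   show "norm (f' t) \<le> C / t ^ 3" if "x < t" for t using that \<open>X0 \<le> x\<close> by (intro b) auto
  qed
  thus ?thesis by simp
 qed
 have le': "norm (f y - f x) \<le> C / 2 / x\<^sup>2" if "X0 \<le> x" "x \<le> y" for x y
 proof (cases "x = y")
  case False
  have "C / 2 / y\<^sup>2 \<ge> 0" using C by simp
  thus ?thesis using le[of x y] that False by linarith
 qed (use C in auto)
 define u where "u = (\<lambda>n. f (X0 + real n))"
 have "Cauchy u"
 proof (rule CauchyI')
  fix e :: real assume e: "e > 0"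
  have "((\<lambda>n. C / 2 / (X0 + real n)\<^sup>2) \<longlongrightarrow> 0) sequentially" by real_asymp
  hence "\<forall>\<^sub>F n in sequentially. C / 2 / (X0 + real n)\<^sup>2 < e" using e by (rule order_tendstoD)
  then obtain N where N: "C / 2 / (X0 + real N)\<^sup>2 < e" by (auto simp: eventually_sequentially)
  hence N': "C / 2 / (X0 + real m)\<^sup>2 < e" if "m \<ge> N" for m
  proof -
   have "C / 2 / (X0 + real m)\<^sup>2 \<le> C / 2 / (X0 + real N)\<^sup>2"
    using that C X0 by (intro divide_left_mono power_mono mult_pos_pos zero_less_power) auto
   thus ?thesis using N by linarith
  qed
  show "\<exists>M. \<forall>m\<ge>M. \<forall>n>m. dist (u m) (u n) < e"
  proof (intro exI allI impI)
   fix m n assume "N \<le> m" "m < n"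
   thus "dist (u m) (u n) < e" using le'[of "X0 + real m" "X0 + real n"] N'[of m]
    unfolding u_def dist_norm by (simp add: norm_minus_commute)
  qed
 qed
 from Cauchy_convergent[OF this] obtain l where l: "u \<longlonglongrightarrow> l" by (auto simp: convergent_def)
 show ?thesis
 proof (rule that)
  fix X assume X: "X \<ge> X0"
  show "norm (f X - l) \<le> C / 2 / X\<^sup>2"
  proof (rule tendsto_upperbound)
   show "((\<lambda>n. norm (f X - u n)) \<longlongrightarrow> norm (f X - l)) sequentially" by (intro tendsto_intros l)
   obtain N :: nat where "real N \<ge> X" using real_arch_simple by blast
   thus "\<forall>\<^sub>F n in sequentially. norm (f X - u n) \<le> C / 2 / X\<^sup>2"
    using X X0 le'[of X] unfolding u_def eventually_sequentially
    by (intro exI[of _ N]) (auto simp: norm_minus_commute[of "f X"])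
  qed auto
 qed
qed

text \<open>The energy norm(W)^2 + norm(W')^2 is conserved by W'' = -W, and the perturbation makes
  it grow at a relative rate of at most norm c / X^2, which is integrable. The factor exp(norm c /
  X) absorbs this rate, so the product is non-increasing.\<close>

lemma ode_energy_bound:
 fixes W W' W'' :: "real => complex"
 assumes X0: "X0 > 0" and d1: "!!X. X \<ge> X0 ==> (W has_vector_derivative W' X) (at X)"
  and d2: "!!X. X \<ge> X0 ==> (W' has_vector_derivative W'' X) (at X)"
  and ode: "!!X. X \<ge> X0 ==> W'' X = - W X + c * W X / of_real (X\<^sup>2)"
 obtains M where "!!X. X \<ge> X0 ==> norm (W X) \<le> M" "!!X. X \<ge> X0 ==> norm (W' X) \<le> M"
proof -
 define e where "e = (\<lambda>X. W X \<bullet> W X + W' X \<bullet> W' X)"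
 define g where "g = (\<lambda>X. e X * exp (norm c / X))"
 have ed: "(e has_real_derivative (2 * (W X \<bullet> W' X) + 2 * (W' X \<bullet> W'' X))) (at X)" if "X \<ge> X0" for X
 proof -
  have "(e has_derivative (\<lambda>h. (W X \<bullet> (h *\<^sub>R W' X) + (h *\<^sub>R W' X) \<bullet> W X) + (W' X \<bullet> (h *\<^sub>R W'' X) + (h *\<^sub>R W'' X) \<bullet> W' X))) (at X)"
   unfolding e_def using d1[OF that] d2[OF that] unfolding has_vector_derivative_def
   by (intro has_derivative_add has_derivative_inner)
  moreover have "(\<lambda>h. (W X \<bullet> (h *\<^sub>R W' X) + (h *\<^sub>R W' X) \<bullet> W X) + (W' X \<bullet> (h *\<^sub>R W'' X) + (h *\<^sub>R W'' X) \<bullet> W' X)) = (*) (2 * (W X \<bullet> W' X) + 2 * (W' X \<bullet> W'' X))"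
   by (auto simp: fun_eq_iff inner_commute algebra_simps)
  ultimately show ?thesis unfolding has_field_derivative_def by simp
 qed
 have eb: "2 * (W X \<bullet> W' X) + 2 * (W' X \<bullet> W'' X) \<le> norm c * e X / X\<^sup>2" if "X \<ge> X0" for X
 proof -
  have X: "X > 0" using that X0 by simp
  have "2 * (W X \<bullet> W' X) + 2 * (W' X \<bullet> W'' X) = 2 * (W' X \<bullet> (c * W X / of_real (X\<^sup>2)))"
   unfolding ode[OF that] by (simp add: inner_add_right inner_diff_right inner_commute[of "W X"])
  also have "\<dots> \<le> 2 * (norm (W' X) * norm (c * W X / of_real (X\<^sup>2)))"
   by (intro mult_left_mono norm_cauchy_schwarz) auto
  also have "\<dots> = norm c / X\<^sup>2 * (2 * norm (W X) * norm (W' X))" by (simp add: norm_mult norm_divide norm_power)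
  also have "\<dots> \<le> norm c / X\<^sup>2 * ((norm (W X))\<^sup>2 + (norm (W' X))\<^sup>2)"
   by (intro mult_left_mono sum_squares_bound) auto
  also have "\<dots> = norm c * e X / X\<^sup>2" by (simp add: e_def power2_norm_eq_inner)
  finally show ?thesis .
 qed
 have gle: "g X \<le> g X0" if "X \<ge> X0" for X
 proof (rule DERIV_nonpos_imp_nonincreasing[OF that])
  fix x assume x: "X0 \<le> x" "x \<le> X"
  have x0: "x > 0" using x X0 by simp
  have "((\<lambda>X. exp (norm c / X)) has_real_derivative (exp (norm c / x) * (- norm c / x\<^sup>2))) (at x)"
   using x0 by (auto intro!: derivative_eq_intros simp: power2_eq_square)
  hence "(g has_real_derivative ((2 * (W x \<bullet> W' x) + 2 * (W' x \<bullet> W'' x)) * exp (norm c / x) + (exp (norm c / x) * (- norm c / x\<^sup>2)) * e x)) (at x)"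
   unfolding g_def by (intro DERIV_mult ed x)
  moreover have "(2 * (W x \<bullet> W' x) + 2 * (W' x \<bullet> W'' x)) * exp (norm c / x) + (exp (norm c / x) * (- norm c / x\<^sup>2)) * e x
   = exp (norm c / x) * ((2 * (W x \<bullet> W' x) + 2 * (W' x \<bullet> W'' x)) - norm c * e x / x\<^sup>2)" by (simp add: algebra_simps)
  moreover have "\<dots> \<le> 0" using eb[OF x(1)] by (intro mult_nonneg_nonpos) auto
  ultimately show "\<exists>y. (g has_real_derivative y) (at x) \<and> y \<le> 0" by metis
 qed
 have e0: "e X \<ge> 0" for X by (simp add: e_def)
 have "e X \<le> g X0" if "X \<ge> X0" for X
 proof -
  have "e X * 1 \<le> g X" unfolding g_def using that X0 e0[of X] by (intro mult_left_mono) auto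
  thus ?thesis using gle[OF that] by simp
 qed
 moreover have "norm (W X) \<le> sqrt (e X)" "norm (W' X) \<le> sqrt (e X)" for X
  by (auto intro!: real_le_rsqrt simp: e_def power2_norm_eq_inner)
 ultimately show ?thesis by (intro that[of "sqrt (g X0)"]) (meson order_trans real_sqrt_le_mono)+
qed

text \<open>Variation of constants: P = exp(-i X) (W' + i W) is constant for the free equation, and
  here it drifts by \<kappa> P/X^2 - \<kappa> exp(-2 i X) Q/X^2. Corrections of size 1/X and 1/X^2
  reduce the drift to O(X^-3), so the corrected quantity has a limit with error O(X^-2), and solving
  for P gives its first two terms.\<close>

lemma ode_half_asymptotics:
 fixes W W' W'' :: "real => complex"
 assumes X0: "X0 > 0" and d1: "!!X. X \<ge> X0 ==> (W has_vector_derivative W' X) (at X)"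
  and d2: "!!X. X \<ge> X0 ==> (W' has_vector_derivative W'' X) (at X)"
  and ode: "!!X. X \<ge> X0 ==> W'' X = - W X + c * W X / of_real (X\<^sup>2)"
 obtains A B C where "!!X. X \<ge> X0 ==> norm (cis (- X) * (W' X + \<i> * W X) - (A + B / of_real X)) \<le> C / X\<^sup>2"
proof -
 obtain M where M: "!!X. X \<ge> X0 ==> norm (W X) \<le> M" "!!X. X \<ge> X0 ==> norm (W' X) \<le> M"
  using ode_energy_bound[OF X0 d1 d2 ode] by blast
 have M0: "M \<ge> 0" using M(1)[of X0] norm_ge_zero order_trans by blast
 define P where "P = (\<lambda>X. cis (- X) * (W' X + \<i> * W X))"
 define Q where "Q = (\<lambda>X. cis X * (W' X - \<i> * W X))"
 define \<kappa> where "\<kappa> = c / (2 * \<i>)"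
 have dcis: "((\<lambda>X. cis (r * X)) has_vector_derivative (of_real r * \<i> * cis (r * X))) (at X)" for r X
 proof -
  have "((\<lambda>z. exp (\<i> * (of_real r * z))) has_field_derivative (of_real r * \<i> * exp (\<i> * (of_real r * of_real X)))) (at (of_real X))"
   by (auto intro!: derivative_eq_intros)
  from has_vector_derivative_real_field[OF this] show ?thesis by (simp add: cis_conv_exp)
 qed
 have dcm: "((\<lambda>X. cis (- X)) has_vector_derivative (- \<i> * cis (- X))) (at X)" for X using dcis[of "-1" X] by simp
 have dcp: "(cis has_vector_derivative (\<i> * cis X)) (at X)" for X using dcis[of 1 X] by simp
 have dc2: "((\<lambda>X. cis (- 2 * X)) has_vector_derivative (- 2 * \<i> * cis (- 2 * X))) (at X)" for X using dcis[of "-2" X] by simp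
 have dP: "(P has_vector_derivative cis (- X) * (c * W X / of_real (X\<^sup>2))) (at X)" if "X \<ge> X0" for X
 proof -
  have "((\<lambda>X. W' X + \<i> * W X) has_vector_derivative (W'' X + \<i> * W' X)) (at X)"
   by (intro has_vector_derivative_add d2 that has_vector_derivative_mult_right d1)
  hence "(P has_vector_derivative (cis (- X) * (W'' X + \<i> * W' X) + (- \<i> * cis (- X)) * (W' X + \<i> * W X))) (at X)"
   unfolding P_def by (intro has_vector_derivative_mult dcm)
  moreover have "cis (- X) * (W'' X + \<i> * W' X) + (- \<i> * cis (- X)) * (W' X + \<i> * W X) = cis (- X) * (c * W X / of_real (X\<^sup>2))"
   unfolding ode[OF that] by (simp add: algebra_simps)
  ultimately show ?thesis by simp
 qed
 have dQ: "(Q has_vector_derivative cis X * (c * W X / of_real (X\<^sup>2))) (at X)" if "X \<ge> X0" for X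
 proof -
  have "((\<lambda>X. W' X - \<i> * W X) has_vector_derivative (W'' X - \<i> * W' X)) (at X)"
   by (intro has_vector_derivative_diff d2 that has_vector_derivative_mult_right d1)
  hence "(Q has_vector_derivative (cis X * (W'' X - \<i> * W' X) + (\<i> * cis X) * (W' X - \<i> * W X))) (at X)"
   unfolding Q_def by (intro has_vector_derivative_mult dcp)
  moreover have "cis X * (W'' X - \<i> * W' X) + (\<i> * cis X) * (W' X - \<i> * W X) = cis X * (c * W X / of_real (X\<^sup>2))"
   unfolding ode[OF that] by (simp add: algebra_simps)
  ultimately show ?thesis by simp
 qed
 have cw: "cis (- X) * (c * W X / of_real (X\<^sup>2)) = \<kappa> * P X / of_real (X\<^sup>2) - \<kappa> * (cis (- 2 * X) * Q X) / of_real (X\<^sup>2)" for X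
 proof -
  have q: "cis (- 2 * X) * Q X = cis (- X) * (W' X - \<i> * W X)" by (simp add: Q_def mult.assoc[symmetric] cis_mult)
  have "\<kappa> * P X - \<kappa> * (cis (- 2 * X) * Q X) = \<kappa> * cis (- X) * (2 * \<i> * W X)" unfolding q by (simp add: P_def algebra_simps)
  also have "\<dots> = \<kappa> * (2 * \<i>) * (cis (- X) * W X)" by (simp only: mult_ac)
  also have "\<kappa> * (2 * \<i>) = c" unfolding \<kappa>_def by (subst nonzero_eq_divide_eq[symmetric]) auto
  also have "c * (cis (- X) * W X) = cis (- X) * (c * W X)" by (simp only: mult_ac)
  finally show ?thesis by (simp add: diff_divide_distrib[symmetric])
 qed
 define M2 where "M2 = 2 * M"
 have M20: "M2 \<ge> 0" using M0 by (simp add: M2_def)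
 have PQb: "norm (P X) \<le> M2" "norm (Q X) \<le> M2" if "X \<ge> X0" for X
 proof -
  have "norm (W' X + \<i> * W X) \<le> M + M" by (rule norm_triangle_mono) (use M that in \<open>auto simp: norm_mult\<close>)
  thus "norm (P X) \<le> M2" by (simp add: M2_def P_def norm_mult)
  have "norm (W' X - \<i> * W X) \<le> M + M" 
   using norm_triangle_ineq4[of "W' X" "\<i> * W X"] M[OF that] by (simp add: norm_mult)
  thus "norm (Q X) \<le> M2" by (simp add: M2_def Q_def norm_mult)
 qed
 \<comment> \<open>Differentiating exp(-2 i X) produces the factor -2 i, and -2 i \<kappa>2 =
   \<kappa>, so this correction cancels the oscillating part of the drift. The correction \<kappa>
   P/X in \<open>T\<close> removes the part \<kappa> P/X^2.\<close>
 define \<kappa>2 where "\<kappa>2 = \<kappa> * \<i> / 2"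
 define T where "T = (\<lambda>X. P X + \<kappa> * (P X * of_real (1 / X)) + \<kappa>2 * (cis (- 2 * X) * Q X * of_real (1 / X\<^sup>2)))"
 define T' where "T' = (\<lambda>X. \<kappa> * (cis (- X) * (c * W X / of_real (X\<^sup>2)) * of_real (1 / X))
   + \<kappa>2 * (cis (- 2 * X) * (cis X * (c * W X / of_real (X\<^sup>2))) * of_real (1 / X\<^sup>2)) - 2 * \<kappa>2 * (cis (- 2 * X) * Q X * of_real (1 / X ^ 3)))"
 have dT: "(T has_vector_derivative T' X) (at X)" if "X \<ge> X0" for X
 proof -
  have X: "X > 0" using that X0 by simp
  have i1: "((\<lambda>X. complex_of_real (1 / X)) has_vector_derivative of_real (- 1 / X\<^sup>2)) (at X)"
   using X by (intro has_vector_derivative_of_real) (auto intro!: derivative_eq_intros simp: power2_eq_square)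
  have i2: "((\<lambda>X. complex_of_real (1 / X\<^sup>2)) has_vector_derivative of_real (- 2 / X ^ 3)) (at X)"
   using X by (intro has_vector_derivative_of_real) (auto intro!: derivative_eq_intros simp: power2_eq_square power3_eq_cube field_simps)
  let ?P' = "cis (- X) * (c * W X / of_real (X\<^sup>2))" and ?Q' = "cis X * (c * W X / of_real (X\<^sup>2))"
  have D: "(T has_vector_derivative (?P' + \<kappa> * (P X * of_real (- 1 / X\<^sup>2) + ?P' * of_real (1 / X))
   + \<kappa>2 * (cis (- 2 * X) * Q X * of_real (- 2 / X ^ 3) + (cis (- 2 * X) * ?Q' + (- 2 * \<i> * cis (- 2 * X)) * Q X) * of_real (1 / X\<^sup>2)))) (at X)"
   unfolding T_def by (intro has_vector_derivative_add has_vector_derivative_mult_right has_vector_derivative_mult dP dQ that i1 i2 dc2)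
  have E: "?P' + \<kappa> * (P X * of_real (- 1 / X\<^sup>2) + ?P' * of_real (1 / X))
   + \<kappa>2 * (cis (- 2 * X) * Q X * of_real (- 2 / X ^ 3) + (cis (- 2 * X) * ?Q' + (- 2 * \<i> * cis (- 2 * X)) * Q X) * of_real (1 / X\<^sup>2))
   = (?P' - (\<kappa> * P X / of_real (X\<^sup>2) - (- 2 * \<i> * \<kappa>2) * (cis (- 2 * X) * Q X) / of_real (X\<^sup>2))) + T' X"
   unfolding T'_def by (simp add: algebra_simps)
  have k2: "- 2 * \<i> * \<kappa>2 = \<kappa>" by (simp add: \<kappa>2_def mult.commute[of \<kappa>])
  have Z: "?P' - (\<kappa> * P X / of_real (X\<^sup>2) - \<kappa> * (cis (- 2 * X) * Q X) / of_real (X\<^sup>2)) = 0"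
   using cw[of X] by (simp only: diff_self)
  from D show ?thesis unfolding E k2 Z by (simp only: add_0_left)
 qed
 define K where "K = norm \<kappa> * norm c * M + norm \<kappa>2 * norm c * M / X0 + 2 * norm \<kappa>2 * M2"
 have T'b: "norm (T' X) \<le> K / X ^ 3" if "X \<ge> X0" for X
 proof -
  have X: "X > 0" using that X0 by simp
  have w: "norm (c * W X / of_real (X\<^sup>2)) \<le> norm c * M / X\<^sup>2"
   using M(1)[OF that] X by (simp add: norm_mult norm_divide norm_power divide_right_mono mult_left_mono)
  have "norm (T' X) \<le> norm \<kappa> * norm (c * W X / of_real (X\<^sup>2)) * (1 / X) + norm \<kappa>2 * norm (c * W X / of_real (X\<^sup>2)) * (1 / X\<^sup>2) + 2 * norm \<kappa>2 * norm (Q X) * (1 / X ^ 3)"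
   unfolding T'_def
   by (rule order_trans[OF norm_triangle_ineq4 add_mono[OF order_trans[OF norm_triangle_ineq add_mono]]])
    (use X in \<open>auto simp: norm_mult norm_divide norm_power\<close>)
  also have "\<dots> \<le> norm \<kappa> * (norm c * M / X\<^sup>2) * (1 / X) + norm \<kappa>2 * (norm c * M / X\<^sup>2) * (1 / X\<^sup>2) + 2 * norm \<kappa>2 * M2 * (1 / X ^ 3)"
   by (intro add_mono mult_right_mono mult_left_mono w PQb that) (use X in auto)
  also have "norm \<kappa>2 * (norm c * M / X\<^sup>2) * (1 / X\<^sup>2) \<le> norm \<kappa>2 * norm c * M / X0 / X ^ 3"
  proof -
   have "norm \<kappa>2 * (norm c * M / X\<^sup>2) * (1 / X\<^sup>2) = (norm \<kappa>2 * norm c * M / X ^ 3) / X"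
    by (simp add: power2_eq_square power3_eq_cube)
   also have "\<dots> \<le> (norm \<kappa>2 * norm c * M / X ^ 3) / X0" using X X0 that M0 by (intro divide_left_mono) auto
   finally show ?thesis by (simp add: mult_ac)
  qed
  finally show ?thesis unfolding K_def using X by (simp add: power2_eq_square power3_eq_cube add_divide_distrib)
 qed
 obtain A where A: "!!X. X \<ge> X0 ==> norm (T X - A) \<le> K / 2 / X\<^sup>2"
  using asymptotic_limit_inverse_square[OF X0 dT T'b] by blast
 have K0: "K \<ge> 0" unfolding K_def using M0 M20 X0 by simp
 define K1 where "K1 = K / 2 / X0 + norm \<kappa> * M2 + norm \<kappa>2 * M2 / X0"
 have K10: "K1 \<ge> 0" unfolding K1_def using K0 M20 X0 by simp
 \<comment> \<open>First approximation P = A + O(1/X); fed back below, it replaces P/X by A/X at the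
   cost of O(1/X^2).\<close>
 have P1: "norm (P X - A) \<le> K1 / X" if "X \<ge> X0" for X
 proof -
  have X: "X > 0" using that X0 by simp
  have "P X - A = (T X - A) - \<kappa> * (P X * of_real (1 / X)) - \<kappa>2 * (cis (- 2 * X) * Q X * of_real (1 / X\<^sup>2))" by (simp add: T_def)
  hence "norm (P X - A) \<le> norm (T X - A) + norm (\<kappa> * (P X * of_real (1 / X))) + norm (\<kappa>2 * (cis (- 2 * X) * Q X * of_real (1 / X\<^sup>2)))"
   by (simp only: order_trans[OF norm_triangle_ineq4 add_right_mono[OF norm_triangle_ineq4]])
  also have "\<dots> \<le> K / 2 / X\<^sup>2 + norm \<kappa> * M2 * (1 / X) + norm \<kappa>2 * M2 * (1 / X\<^sup>2)"
   unfolding norm_mult norm_of_real norm_cis mult_1_left mult.assoc[symmetric] using X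
   by (intro add_mono A that mult_mono PQb) (auto simp: M20)
  also have "1 / X\<^sup>2 \<le> 1 / X0 / X" using X X0 that by (simp add: power2_eq_square field_simps)
  hence "K / 2 / X\<^sup>2 + norm \<kappa> * M2 * (1 / X) + norm \<kappa>2 * M2 * (1 / X\<^sup>2) \<le> K / 2 * (1 / X0 / X) + norm \<kappa> * M2 * (1 / X) + norm \<kappa>2 * M2 * (1 / X0 / X)"
   using K0 M20 mult_left_mono[of "1 / X\<^sup>2" "1 / X0 / X" "K / 2"] mult_left_mono[of "1 / X\<^sup>2" "1 / X0 / X" "norm \<kappa>2 * M2"] by simp
  finally show ?thesis unfolding K1_def by (simp add: add_divide_distrib)
 qed
 show ?thesis
 proof (rule that[of A "- \<kappa> * A" "K / 2 + norm \<kappa> * K1 + norm \<kappa>2 * M2"])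
  fix X assume that: "X \<ge> X0"
  have X: "X > 0" using that X0 by simp
  have "P X - (A + - \<kappa> * A / of_real X) = (T X - A) - \<kappa> * ((P X - A) * of_real (1 / X)) - \<kappa>2 * (cis (- 2 * X) * Q X * of_real (1 / X\<^sup>2))"
   by (simp add: T_def algebra_simps diff_divide_distrib)
  hence "norm (P X - (A + - \<kappa> * A / of_real X)) \<le> norm (T X - A) + norm (\<kappa> * ((P X - A) * of_real (1 / X))) + norm (\<kappa>2 * (cis (- 2 * X) * Q X * of_real (1 / X\<^sup>2)))"
   by (simp only: order_trans[OF norm_triangle_ineq4 add_right_mono[OF norm_triangle_ineq4]])
  also have "\<dots> \<le> K / 2 / X\<^sup>2 + norm \<kappa> * (K1 / X) * (1 / X) + norm \<kappa>2 * M2 * (1 / X\<^sup>2)"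
   unfolding norm_mult norm_of_real norm_cis mult_1_left mult.assoc[symmetric] using X
   by (intro add_mono A that mult_mono PQb P1) (auto simp: M20 K10)
  also have "\<dots> = (K / 2 + norm \<kappa> * K1 + norm \<kappa>2 * M2) / X\<^sup>2" by (simp add: power2_eq_square add_divide_distrib)
  finally show "norm (cis (- X) * (W' X + \<i> * W X) - (A + - \<kappa> * A / of_real X)) \<le> (K / 2 + norm \<kappa> * K1 + norm \<kappa>2 * M2) / X\<^sup>2"
   by (simp add: P_def)
 qed
qed

text \<open>The other quantity, exp(i X) (W' - i W), is the conjugate of the first one formed with
  the conjugated solution, so the previous lemma applied to \<open>cnj (W X)\<close> covers it. W is
  recovered from the two by elimination of W'.\<close>

lemma ode_asymptotics:
 fixes W W' W'' :: "real => complex"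
 assumes X0: "X0 > 0" and d1: "!!X. X \<ge> X0 ==> (W has_vector_derivative W' X) (at X)"
  and d2: "!!X. X \<ge> X0 ==> (W' has_vector_derivative W'' X) (at X)"
  and ode: "!!X. X \<ge> X0 ==> W'' X = - W X + c * W X / of_real (X\<^sup>2)"
 obtains A B A' B' C where "!!X. X \<ge> X0 ==>
  norm (W X - (cis X * (A + B / of_real X) + cis (- X) * (A' + B' / of_real X))) \<le> C / X\<^sup>2"
proof -
 obtain A B C where P: "!!X. X \<ge> X0 ==> norm (cis (- X) * (W' X + \<i> * W X) - (A + B / of_real X)) \<le> C / X\<^sup>2"
  using ode_half_asymptotics[OF X0 d1 d2 ode] by blast
 have "\<exists>A B C. \<forall>X\<ge>X0. norm (cis (- X) * (cnj (W' X) + \<i> * cnj (W X)) - (A + B / of_real X)) \<le> C / X\<^sup>2"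
 proof (rule ode_half_asymptotics[OF X0, of "\<lambda>X. cnj (W X)" "\<lambda>X. cnj (W' X)" "\<lambda>X. cnj (W'' X)" "cnj c"])
  show "((\<lambda>X. cnj (W X)) has_vector_derivative cnj (W' X)) (at X)" if "X \<ge> X0" for X
   using d1[OF that] by (rule has_vector_derivative_cnj)
  show "((\<lambda>X. cnj (W' X)) has_vector_derivative cnj (W'' X)) (at X)" if "X \<ge> X0" for X
   using d2[OF that] by (rule has_vector_derivative_cnj)
  show "cnj (W'' X) = - cnj (W X) + cnj c * cnj (W X) / of_real (X\<^sup>2)" if "X \<ge> X0" for X
   using ode[OF that] by simp
 qed blast
 then obtain A2 B2 C2 where Q: "!!X. X \<ge> X0 ==> norm (cis (- X) * (cnj (W' X) + \<i> * cnj (W X)) - (A2 + B2 / of_real X)) \<le> C2 / X\<^sup>2" by blast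
 show ?thesis
 proof (rule that[of "A / (2 * \<i>)" "B / (2 * \<i>)" "- cnj A2 / (2 * \<i>)" "- cnj B2 / (2 * \<i>)" "(C + C2) / 2"])
  fix X assume X: "X \<ge> X0"
  let ?P = "cis (- X) * (W' X + \<i> * W X) - (A + B / of_real X)"
  let ?Q = "cis (- X) * (cnj (W' X) + \<i> * cnj (W X)) - (A2 + B2 / of_real X)"
  have cc: "cis X * cis (- X) = 1" "cis (- X) * cis X = 1" by (simp_all add: cis_mult)
  have "cis X * ?P - cis (- X) * cnj ?Q = 2 * \<i> * (W X - (cis X * (A / (2 * \<i>) + B / (2 * \<i>) / of_real X) + cis (- X) * (- cnj A2 / (2 * \<i>) + - cnj B2 / (2 * \<i>) / of_real X)))"
  proof -
   have cj: "cnj (cis (- X)) = cis X" by (simp add: complex_eq_iff)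
   have 1: "cis X * ?P = (W' X + \<i> * W X) - cis X * (A + B / of_real X)"
    by (simp only: right_diff_distrib mult.assoc[symmetric] cc mult_1_left)
   have "cnj ?Q = cis X * (W' X - \<i> * W X) - (cnj A2 + cnj B2 / of_real X)" by (simp add: cj)
   hence 2: "cis (- X) * cnj ?Q = (W' X - \<i> * W X) - cis (- X) * (cnj A2 + cnj B2 / of_real X)"
    by (simp only: right_diff_distrib mult.assoc[symmetric] cc mult_1_left)
   show ?thesis unfolding 1 2 by (simp add: field_simps)
  qed
  hence "norm (2 * \<i> * (W X - (cis X * (A / (2 * \<i>) + B / (2 * \<i>) / of_real X) + cis (- X) * (- cnj A2 / (2 * \<i>) + - cnj B2 / (2 * \<i>) / of_real X))))
   \<le> norm (cis X * ?P) + norm (cis (- X) * cnj ?Q)" by (metis norm_triangle_ineq4)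
  also have "\<dots> = norm ?P + norm ?Q" unfolding norm_mult norm_cis complex_mod_cnj by simp
  also have "\<dots> \<le> C / X\<^sup>2 + C2 / X\<^sup>2" by (intro add_mono P Q X)
  finally show "norm (W X - (cis X * (A / (2 * \<i>) + B / (2 * \<i>) / of_real X) + cis (- X) * (- cnj A2 / (2 * \<i>) + - cnj B2 / (2 * \<i>) / of_real X))) \<le> (C + C2) / 2 / X\<^sup>2"
   by (simp add: norm_mult add_divide_distrib)
 qed
qed

section \<open>The exponentially small part and the full kernel\<close>

lemma besselI_difference_integral:
 assumes nu: "\<nu> \<notin> \<int>" and X: "X > 0"
 shows "besselI (- \<nu>) X - besselI \<nu> X = sin (of_real pi * \<nu>) / of_real pi * (LINT x:{0<..}|lborel. hint \<nu> (of_real (X / 2)) (of_real (X / 2)) x)"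
proof -
 have s: "sin (of_real pi * \<nu>) \<noteq> 0" using sin_cos_half_nonzero[OF nu] by simp
 have "(LINT x:{0<..}|lborel. hint \<nu> (of_real (X / 2)) (of_real (X / 2)) x) = of_real pi / sin (of_real pi * \<nu>) * (besselI (- \<nu>) X - besselI \<nu> X)"
  unfolding besselI_eq power2_eq_square using X nu by (intro integral_hint) auto
 thus ?thesis using s by simp
qed

text \<open>Each of the two I functions grows exponentially, so the difference is estimated through
  its integral representation, \<open>hint\<close> with a = b = X/2. There x + 1/x \<ge> 2 yields
  the factor exp(X0 - X) relative to the integral at X0.\<close>

lemma besselI_difference_bound:
 assumes nu: "\<nu> \<notin> \<int>" and X0: "X0 > 0"
 obtains C where "!!X. X \<ge> X0 ==> norm (of_real (sqrt X) * (besselI (- \<nu>) X - besselI \<nu> X)) \<le> C / X\<^sup>2"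
proof -
 define H where "H = (LINT x:{0<..}|lborel. norm (hint \<nu> (of_real (X0 / 2)) (of_real (X0 / 2)) x))"
 have H0: "H \<ge> 0" unfolding H_def set_lebesgue_integral_def by (intro Bochner_Integration.integral_nonneg) auto
 have Hb: "norm (LINT x:{0<..}|lborel. hint \<nu> (of_real (X / 2)) (of_real (X / 2)) x) \<le> exp (X0 - X) * H" if X: "X \<ge> X0" for X
 proof -
  have i1: "set_integrable lborel {0<..} (hint \<nu> (of_real (X / 2)) (of_real (X / 2)))" using X X0 by (intro set_integrable_hint) auto
  have i2: "set_integrable lborel {0<..} (hint \<nu> (of_real (X0 / 2)) (of_real (X0 / 2)))" using X X0 by (intro set_integrable_hint) auto
  have "norm (LINT x:{0<..}|lborel. hint \<nu> (of_real (X / 2)) (of_real (X / 2)) x) \<le> (LINT x:{0<..}|lborel. norm (hint \<nu> (of_real (X / 2)) (of_real (X / 2)) x))"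
   by (rule set_integral_norm_bound[OF i1])
  also have "\<dots> \<le> (LINT x:{0<..}|lborel. exp (X0 - X) * norm (hint \<nu> (of_real (X0 / 2)) (of_real (X0 / 2)) x))"
  proof (rule set_integral_mono)
   fix x :: real assume "x \<in> {0<..}"
   hence x: "x > 0" by simp
   have "x + 1 / x \<ge> 2"
   proof -
    have "0 \<le> (x - 1)\<^sup>2 / x" using x by simp
    also have "(x - 1)\<^sup>2 / x = x + 1 / x - 2" using x by (simp add: field_simps power2_eq_square)
    finally show ?thesis by simp
   qed
   hence "(X - X0) / 2 * 2 \<le> (X - X0) / 2 * (x + 1 / x)" using X by (intro mult_left_mono) auto
   moreover have "(X - X0) / 2 * (x + 1 / x) = (X / 2) * x + X / 2 / x - (X0 / 2) * x - X0 / 2 / x"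
    by (simp add: algebra_simps diff_divide_distrib add_divide_distrib)
   ultimately have "- (X / 2) * x - X / 2 / x \<le> (X0 - X) + (- (X0 / 2) * x - X0 / 2 / x)" by simp
   hence "exp (- (X / 2) * x - X / 2 / x) \<le> exp (X0 - X) * exp (- (X0 / 2) * x - X0 / 2 / x)" by (simp add: exp_add[symmetric])
   hence "x powr (- Re \<nu> - 1) * exp (- (X / 2) * x - X / 2 / x) \<le> x powr (- Re \<nu> - 1) * (exp (X0 - X) * exp (- (X0 / 2) * x - X0 / 2 / x))"
    by (intro mult_left_mono) auto
   thus "norm (hint \<nu> (of_real (X / 2)) (of_real (X / 2)) x) \<le> exp (X0 - X) * norm (hint \<nu> (of_real (X0 / 2)) (of_real (X0 / 2)) x)"
    unfolding norm_hint[OF x] Re_complex_of_real by (simp only: mult_ac)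
  qed (intro set_integrable_norm set_integrable_mult_right i1 i2)+
  also have "\<dots> = exp (X0 - X) * H" by (simp add: H_def)
  finally show ?thesis .
 qed
 obtain C1 where C1: "!!y::real. y \<ge> 1 ==> y powr (5/2) * exp (- 1 * y) \<le> C1" "C1 > 0"
  using powr_exp_bounded[of 1 "5/2"] zero_less_one by blast
 have C1': "X powr (5/2) * exp (- X) \<le> max 1 C1" if X: "X > 0" for X
 proof (cases "X \<ge> 1")
  case False
  have "X powr (5/2) * exp (- X) \<le> 1 * 1" using False X by (intro mult_mono powr_le1) auto
  thus ?thesis by simp
 qed (use C1(1)[of X] in auto)
 let ?k = "norm (sin (of_real pi * \<nu>) / of_real pi)"
 show ?thesis
 proof (rule that)
  fix X assume X: "X \<ge> X0"
  have Xp: "X > 0" using X X0 by simp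
  have "norm (of_real (sqrt X) * (besselI (- \<nu>) X - besselI \<nu> X)) \<le> sqrt X * (?k * (exp (X0 - X) * H))"
   unfolding besselI_difference_integral[OF nu Xp] norm_mult norm_of_real using Xp Hb[OF X] 
   by (intro mult_mono) (auto simp: norm_mult)
  also have "\<dots> = (?k * exp X0 * H) * (X powr (5/2) * exp (- X)) / X\<^sup>2"
  proof -
   have "X powr (5/2) = X powr (1/2 + 2)" by simp
   also have "\<dots> = sqrt X * X\<^sup>2" using Xp by (simp only: powr_add powr_half_sqrt) (simp add: powr_numeral)
   finally show ?thesis using Xp by (simp add: exp_diff exp_minus field_simps)
  qed
  also have "\<dots> \<le> (?k * exp X0 * H) * max 1 C1 / X\<^sup>2"
   by (intro divide_right_mono mult_left_mono C1' Xp) (auto simp: H0)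
  finally show "norm (of_real (sqrt X) * (besselI (- \<nu>) X - besselI \<nu> X)) \<le> (?k * exp X0 * H) * max 1 C1 / X\<^sup>2" .
 qed
qed

text \<open>The range starts at an arbitrary X0 > 0 instead of some large X, with C depending on it;
  in this way every index n of the series is covered later.\<close>

theorem vkernel_asymptotics:
 assumes nu: "\<nu> \<notin> \<int>" and X0: "X0 > 0"
 obtains A B A' B' C where "!!X. X \<ge> X0 ==>
  norm (of_real (sqrt X) * vkernel \<nu> X - (cis X * (A + B / of_real X) + cis (- X) * (A' + B' / of_real X))) \<le> C / X\<^sup>2"
proof -
 let ?s = "2 * sin (of_real pi * \<nu> / 2)"
 have s: "?s \<noteq> 0" using sin_cos_half_nonzero[OF nu] by simp
 have g1: "(- a + k * a / x - (- b + k * b / x)) / s = - ((a - b) / s) + k * ((a - b) / s) / x" for a b k x s :: complex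
  by (simp add: divide_inverse algebra_simps)
 have g2: "r * ((a + (b - c)) / s) - M = (r * b - r * c) / s - M + r * a / s" for r a b c s M :: complex
  by (simp add: divide_inverse algebra_simps)
 obtain U' U'' where U: "!!X. X > 0 ==> ((\<lambda>X. of_real (sqrt X) * besselJ (- \<nu>) X) has_vector_derivative U' X) (at X)"
  "!!X. X > 0 ==> (U' has_vector_derivative U'' X) (at X)"
  "!!X. X > 0 ==> U'' X = - (of_real (sqrt X) * besselJ (- \<nu>) X) + ((- \<nu>)\<^sup>2 - 1/4) * (of_real (sqrt X) * besselJ (- \<nu>) X) / of_real (X\<^sup>2)"
  using bessel_ode[of "- \<nu>"] by blast
 obtain V' V'' where V: "!!X. X > 0 ==> ((\<lambda>X. of_real (sqrt X) * besselJ \<nu> X) has_vector_derivative V' X) (at X)"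
  "!!X. X > 0 ==> (V' has_vector_derivative V'' X) (at X)"
  "!!X. X > 0 ==> V'' X = - (of_real (sqrt X) * besselJ \<nu> X) + (\<nu>\<^sup>2 - 1/4) * (of_real (sqrt X) * besselJ \<nu> X) / of_real (X\<^sup>2)"
  using bessel_ode[of \<nu>] by blast
 define W where "W = (\<lambda>X. (of_real (sqrt X) * besselJ (- \<nu>) X - of_real (sqrt X) * besselJ \<nu> X) / ?s)"
 have "\<exists>A B A' B' C. \<forall>X\<ge>X0. norm (W X - (cis X * (A + B / of_real X) + cis (- X) * (A' + B' / of_real X))) \<le> C / X\<^sup>2"
 proof (rule ode_asymptotics[OF X0, of W "\<lambda>X. (U' X - V' X) / ?s" "\<lambda>X. (U'' X - V'' X) / ?s" "\<nu>\<^sup>2 - 1/4"])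
  fix X assume "X \<ge> X0"
  hence X: "X > 0" using X0 by simp
  show "(W has_vector_derivative (U' X - V' X) / ?s) (at X)"
   unfolding W_def by (intro has_vector_derivative_divide has_vector_derivative_diff U V X)
  show "((\<lambda>X. (U' X - V' X) / ?s) has_vector_derivative (U'' X - V'' X) / ?s) (at X)"
   by (intro has_vector_derivative_divide has_vector_derivative_diff U V X)
  show "(U'' X - V'' X) / ?s = - W X + (\<nu>\<^sup>2 - 1/4) * W X / of_real (X\<^sup>2)"
   unfolding U(3)[OF X] V(3)[OF X] W_def power2_minus by (rule g1)
 qed blast
 then obtain A B A' B' C where W: "!!X. X \<ge> X0 ==> norm (W X - (cis X * (A + B / of_real X) + cis (- X) * (A' + B' / of_real X))) \<le> C / X\<^sup>2"
  by blast
 obtain C2 where C2: "!!X. X \<ge> X0 ==> norm (of_real (sqrt X) * (besselI (- \<nu>) X - besselI \<nu> X)) \<le> C2 / X\<^sup>2"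
  using besselI_difference_bound[OF nu X0] by blast
 show ?thesis
 proof (rule that)
  fix X assume X: "X \<ge> X0"
  let ?M = "cis X * (A + B / of_real X) + cis (- X) * (A' + B' / of_real X)"
  have "of_real (sqrt X) * vkernel \<nu> X - ?M = (W X - ?M) + of_real (sqrt X) * (besselI (- \<nu>) X - besselI \<nu> X) / ?s"
   unfolding vkernel_eq[OF nu] W_def by (rule g2)
  hence "norm (of_real (sqrt X) * vkernel \<nu> X - ?M) \<le> norm (W X - ?M) + norm (of_real (sqrt X) * (besselI (- \<nu>) X - besselI \<nu> X)) / norm ?s"
   by (metis norm_triangle_ineq norm_divide)
  also have "\<dots> \<le> C / X\<^sup>2 + C2 / X\<^sup>2 / norm ?s"
   by (intro add_mono W X divide_right_mono C2) auto
  finally show "norm (of_real (sqrt X) * vkernel \<nu> X - ?M) \<le> (C + C2 / norm ?s) / X\<^sup>2" by (simp add: add_divide_distrib mult_ac)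
 qed
qed

section \<open>Smooth cutoffs and decay of Fourier transforms\<close>

text \<open>Finite order is what piecewise polynomial cutoffs offer, and a fixed order of decay of
  Fourier integrals is all that is asked of them.\<close>

primrec Ck :: "nat => (real => real) => bool" where
 "Ck 0 f = continuous_on UNIV f"
| "Ck (Suc n) f = (\<exists>f'. (\<forall>x. (f has_real_derivative f' x) (at x)) \<and> Ck n f')"

lemma Ck_imp_continuous: "Ck n f ==> continuous_on S f"
proof (cases n)
 case (Suc m)
 assume "Ck n f"
 then obtain f' where "!!x. (f has_real_derivative f' x) (at x)" using Suc by auto
 thus ?thesis by (intro continuous_at_imp_continuous_on) (auto intro: DERIV_isCont)
qed (auto intro: continuous_on_subset)

lemma Ck_SucD: "Ck (Suc n) f ==> Ck n f"
proof (induction n arbitrary: f)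
 case 0
 thus ?case using Ck_imp_continuous[OF 0] by simp
next
 case (Suc n)
 then obtain f' where "\<forall>x. (f has_real_derivative f' x) (at x)" "Ck (Suc n) f'" by auto
 thus ?case using Suc.IH[of f'] by auto
qed

lemma Ck_const: "Ck n (\<lambda>x. c)"
proof (induction n arbitrary: c)
 case (Suc n)
 have "\<forall>x. ((\<lambda>x. c) has_real_derivative (\<lambda>x. 0) x) (at x)" by auto
 thus ?case using Suc by (auto simp del: DERIV_const intro!: exI[of _ "\<lambda>x. 0"])
qed auto

lemma Ck_ident: "Ck n (\<lambda>x. x)"
proof (cases n)
 case (Suc m)
 show ?thesis unfolding Suc Ck.simps by (rule exI[of _ "\<lambda>_. 1"]) (auto intro: Ck_const)
qed auto

lemma Ck_add: "Ck n f ==> Ck n g ==> Ck n (\<lambda>x. f x + g x)"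
proof (induction n arbitrary: f g)
 case (Suc n)
 obtain f' g' where f: "\<forall>x. (f has_real_derivative f' x) (at x)" "Ck n f'" and g: "\<forall>x. (g has_real_derivative g' x) (at x)" "Ck n g'"
  using Suc.prems by auto
 have "\<forall>x. ((\<lambda>x. f x + g x) has_real_derivative f' x + g' x) (at x)" using f g by (auto intro!: DERIV_add)
 moreover have "Ck n (\<lambda>x. f' x + g' x)" using Suc.IH f g by auto
 ultimately show ?case by auto
qed (auto intro: continuous_intros)

lemma Ck_mult: "Ck n f ==> Ck n g ==> Ck n (\<lambda>x. f x * g x)"
proof (induction n arbitrary: f g)
 case (Suc n)
 obtain f' g' where f: "\<forall>x. (f has_real_derivative f' x) (at x)" "Ck n f'" and g: "\<forall>x. (g has_real_derivative g' x) (at x)" "Ck n g'"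
  using Suc.prems by auto
 have "\<forall>x. ((\<lambda>x. f x * g x) has_real_derivative f' x * g x + g' x * f x) (at x)" using f g by (auto intro!: DERIV_mult)
 moreover have "Ck n (\<lambda>x. f' x * g x + g' x * f x)"
  by (intro Ck_add Suc.IH f(2) g(2) Ck_SucD[OF Suc.prems(1)] Ck_SucD[OF Suc.prems(2)])
 ultimately show ?case by (auto intro!: exI[of _ "\<lambda>x. f' x * g x + g' x * f x"])
qed (auto intro: continuous_intros)

lemma DERIV_max_power:
 fixes y :: real
 assumes m: "m \<ge> 2"
 shows "((\<lambda>y. max 0 y ^ m) has_real_derivative real m * max 0 y ^ (m - 1)) (at y)"
proof -
 consider "y > 0" | "y < 0" | "y = 0" by linarith
 thus ?thesis
 proof cases
  case 1
  have "((\<lambda>y. y ^ m) has_real_derivative real m * y ^ (m - 1)) (at y)" by (auto intro!: derivative_eq_intros)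
  hence "((\<lambda>y. max 0 y ^ m) has_real_derivative real m * y ^ (m - 1)) (at y)"
   by (rule DERIV_cong_ev[THEN iffD1, rotated -1, OF _ refl _ refl]) 
    (use 1 in \<open>auto intro!: eventually_mono[OF eventually_nhds_in_open[of "{0<..}" y]]\<close>)
  thus ?thesis using 1 by simp
 next
  case 2
  have "((\<lambda>y. 0) has_real_derivative 0) (at y)" by simp
  hence "((\<lambda>y. max 0 y ^ m) has_real_derivative 0) (at y)"
   by (rule DERIV_cong_ev[THEN iffD1, rotated -1, OF _ refl _ refl]) 
    (use 2 m in \<open>auto intro!: eventually_mono[OF eventually_nhds_in_open[of "{..<0}" y]]\<close>)
  moreover have "real m * max 0 y ^ (m - 1) = 0" using 2 m by (simp add: power_0_left)
  ultimately show ?thesis by (simp only:)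
 next
  case 3
  have "((\<lambda>h::real. max 0 h ^ m / h) \<longlongrightarrow> 0) (at 0)"
  proof (rule Lim_null_comparison)
   show "\<forall>\<^sub>F h in at 0. norm (max 0 h ^ m / h) \<le> \<bar>h\<bar> ^ (m - 1)"
   proof (rule always_eventually, rule allI)
    fix h :: real
    have "h ^ m = h * h ^ (m - 1)" using m by (cases m) auto
    thus "norm (max 0 h ^ m / h) \<le> \<bar>h\<bar> ^ (m - 1)" using m by (auto simp: max_def power_0_left)
   qed
   have "((\<lambda>h::real. \<bar>h\<bar> ^ (m - 1)) \<longlongrightarrow> \<bar>0\<bar> ^ (m - 1)) (at 0)" by (intro tendsto_intros)
   moreover have "\<bar>0::real\<bar> ^ (m - 1) = 0" using m by (simp add: power_0_left)
   ultimately show "((\<lambda>h::real. \<bar>h\<bar> ^ (m - 1)) \<longlongrightarrow> 0) (at 0)" by (simp only:)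
  qed
  thus ?thesis unfolding 3 DERIV_def using m by (simp add: power_0_left)
 qed
qed

lemma Ck_max_power: "Ck n g ==> m > n ==> Ck n (\<lambda>x. max 0 (g x) ^ m)"
proof (induction n arbitrary: g m)
 case 0
 thus ?case by (auto intro!: continuous_intros)
next
 case (Suc n)
 obtain g' where g: "\<forall>x. (g has_real_derivative g' x) (at x)" "Ck n g'" using Suc.prems by auto
 have "\<forall>x. ((\<lambda>x. max 0 (g x) ^ m) has_real_derivative real m * max 0 (g x) ^ (m - 1) * g' x) (at x)"
 proof
  fix x
  show "((\<lambda>x. max 0 (g x) ^ m) has_real_derivative real m * max 0 (g x) ^ (m - 1) * g' x) (at x)"
   by (rule DERIV_chain2[OF DERIV_max_power g(1)[rule_format]]) (use Suc.prems in auto)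
 qed
 moreover have "Ck n (\<lambda>x. real m * max 0 (g x) ^ (m - 1) * g' x)"
  by (intro Ck_mult Ck_const Suc.IH g(2) Ck_SucD[OF Suc.prems(1)]) (use Suc.prems in auto)
 ultimately show ?case by (auto intro!: exI[of _ "\<lambda>x. real m * max 0 (g x) ^ (m - 1) * g' x"])
qed

text \<open>A plateau made of truncated powers: the inner power is flat to order m at the edges of
  [\<alpha>, \<beta>], the outer one where the value 0 is reached after the margin \<delta>. With m
  > n this is of class \<open>Ck n\<close>.\<close>

definition cutoff :: "nat => real => real => real => real => real" where
 "cutoff m \<alpha> \<beta> \<delta> t = max 0 (1 - max 0 ((t - \<beta>) / \<delta>) ^ m) ^ m * max 0 (1 - max 0 ((\<alpha> - t) / \<delta>) ^ m) ^ m"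

lemma cutoff_eq_1: "m > 0 ==> \<delta> > 0 ==> t \<in> {\<alpha>..\<beta>} ==> cutoff m \<alpha> \<beta> \<delta> t = 1"
proof -
 assume m: "m > 0" and d: "\<delta> > 0" and t: "t \<in> {\<alpha>..\<beta>}"
 have "(t - \<beta>) / \<delta> \<le> 0" "(\<alpha> - t) / \<delta> \<le> 0" using d t by (auto intro!: divide_nonpos_pos)
 thus ?thesis using m by (simp add: cutoff_def max_absorb1 zero_power)
qed

lemma cutoff_eq_0:
 assumes "m > 0" "\<delta> > 0" "t \<notin> {\<alpha> - \<delta>..\<beta> + \<delta>}"
 shows "cutoff m \<alpha> \<beta> \<delta> t = 0"
proof -
 have z: "max 0 (1 - max 0 y ^ m) ^ m = 0" if "y \<ge> 1" for y :: real
 proof -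
  have "1 - max 0 y ^ m \<le> 0" using that one_le_power[of y m] by (simp add: max_def)
  thus ?thesis using assms(1) by (simp add: max_absorb1)
 qed
 consider "t > \<beta> + \<delta>" | "t < \<alpha> - \<delta>" using assms by force
 thus ?thesis
 proof cases
  case 1
  hence "(t - \<beta>) / \<delta> \<ge> 1" using assms by (simp add: field_simps)
  thus ?thesis unfolding cutoff_def using z by simp
 next
  case 2
  hence "(\<alpha> - t) / \<delta> \<ge> 1" using assms by (simp add: field_simps)
  thus ?thesis unfolding cutoff_def using z by simp
 qed
qed

lemma Ck_cutoff:
 assumes "Ck n g" "m > n" shows "Ck n (\<lambda>x. cutoff m \<alpha> \<beta> \<delta> (g x))"
proof -
 have l: "Ck n (\<lambda>x. a + b * h x)" if "Ck n h" for h a b by (intro Ck_add Ck_mult Ck_const that)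
 have 1: "Ck n (\<lambda>x. (g x - \<beta>) / \<delta>)"
  using l[OF assms(1), of "- \<beta> / \<delta>" "1 / \<delta>"] by (simp add: diff_divide_distrib add.commute)
 have 2: "Ck n (\<lambda>x. (\<alpha> - g x) / \<delta>)"
  using l[OF assms(1), of "\<alpha> / \<delta>" "- 1 / \<delta>"] by (simp add: diff_divide_distrib)
 have 3: "Ck n (\<lambda>x. max 0 (1 - max 0 (h x) ^ m) ^ m)" if "Ck n h" for h
  using l[OF Ck_max_power[OF that assms(2)], of 1 "-1"] assms(2) by (intro Ck_max_power) auto
 show ?thesis unfolding cutoff_def by (intro Ck_mult 3 1 2)
qed

lemma Ck_support_endpoints:
 assumes "Ck n \<psi>" "!!x. x \<notin> {c..d} ==> \<psi> x = 0"
 shows "\<psi> c = 0" "\<psi> d = 0"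
proof -
 have cont: "isCont \<psi> x" for x
  using Ck_imp_continuous[OF assms(1), of UNIV] by (simp add: continuous_on_eq_continuous_at)
 have "(\<psi> \<longlongrightarrow> \<psi> c) (at_left c)" using cont[of c] by (simp add: isCont_def filterlim_at_split)
 moreover have "(\<psi> \<longlongrightarrow> 0) (at_left c)"
  by (rule Lim_transform_eventually[OF tendsto_const]) (auto simp: eventually_at_filter assms(2))
 ultimately show "\<psi> c = 0" by (rule tendsto_unique[rotated]) auto
 have "(\<psi> \<longlongrightarrow> \<psi> d) (at_right d)" using cont[of d] by (simp add: isCont_def filterlim_at_split)
 moreover have "(\<psi> \<longlongrightarrow> 0) (at_right d)"
  by (rule Lim_transform_eventually[OF tendsto_const]) (auto simp: eventually_at_filter assms(2))
 ultimately show "\<psi> d = 0" by (rule tendsto_unique[rotated]) auto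
qed

section \<open>Decay and differentiation of Fourier integrals\<close>

text \<open>The amplitude is kept as a product of a real cutoff and a holomorphic function, so that
  derivatives come from \<open>Ck\<close> for one factor and from \<open>deriv\<close> for the
  other.\<close>

definition fourier_on :: "real => real => (real => real) => (complex => complex) => real => complex" where
 "fourier_on c d \<psi> g \<eta> = integral {c..d} (\<lambda>x. of_real (\<psi> x) * g (of_real x) * cis (\<eta> * x))"

lemma continuous_on_holomorphic_of_real:
 assumes "g holomorphic_on S" "of_real ` {c..d} \<subseteq> S"
 shows "continuous_on {c..d} (\<lambda>x. g (of_real x))"
 by (rule continuous_on_compose2[OF holomorphic_on_imp_continuous_on[OF assms(1)] _ assms(2)]) (intro continuous_intros)

lemma has_vector_derivative_holomorphic_of_real:
 assumes "g holomorphic_on S" "open S" "of_real x \<in> S"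
 shows "((\<lambda>x. g (of_real x)) has_vector_derivative deriv g (of_real x)) (at x within T)"
 by (rule has_vector_derivative_real_field[OF holomorphic_derivI[OF assms]])

text \<open>Each power of \<eta> is one integration by parts. The boundary terms vanish with the
  cutoff, and the derivative falls on the cutoff or on \<open>g\<close>, so the induction must be
  free in both.\<close>

lemma fourier_on_decay_aux:
 assumes "Ck n \<psi>" "!!x. x \<notin> {c..d} ==> \<psi> x = 0" "open S" "of_real ` {c..d} \<subseteq> S" "g holomorphic_on S" "c \<le> d"
 shows "\<exists>C. \<forall>\<eta>. norm (fourier_on c d \<psi> g \<eta>) * \<bar>\<eta>\<bar> ^ n \<le> C"
 using assms
proof (induction n arbitrary: \<psi> g)
 case 0
 have contg: "continuous_on {c..d} (\<lambda>x. g (of_real x))" by (rule continuous_on_holomorphic_of_real[OF 0(5,4)])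
 have cont: "continuous_on {c..d} (\<lambda>x. of_real (\<psi> x) * g (of_real x) * cis (\<eta> * x))" for \<eta>
  by (intro continuous_intros contg Ck_imp_continuous[OF 0(1)])
 have cont': "continuous_on {c..d} (\<lambda>x. norm (of_real (\<psi> x) * g (of_real x)))"
  by (intro continuous_intros contg Ck_imp_continuous[OF 0(1)])
 have "norm (fourier_on c d \<psi> g \<eta>) \<le> integral {c..d} (\<lambda>x. norm (of_real (\<psi> x) * g (of_real x)))" for \<eta>
  unfolding fourier_on_def
  by (rule integral_norm_bound_integral) (use cont cont' in \<open>auto intro!: integrable_continuous_interval simp: norm_mult\<close>)
 thus ?case by auto
next
 case (Suc n)
 note S = Suc.prems(3,4) and hol = Suc.prems(5) and cd = Suc.prems(6) and supp = Suc.prems(2)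
 obtain \<psi>' where chi': "!!x. (\<psi> has_real_derivative \<psi>' x) (at x)" "Ck n \<psi>'" using Suc.prems(1) by auto
 have supp': "\<psi>' x = 0" if "x \<notin> {c..d}" for x
 proof -
  have op: "open (- {c..d})" by (simp add: open_Compl)
  have "((\<lambda>x. 0) has_real_derivative 0) (at x)" by simp
  hence "(\<psi> has_real_derivative 0) (at x)"
   by (rule DERIV_cong_ev[THEN iffD1, rotated -1, OF _ refl _ refl])
    (use that supp in \<open>auto intro!: eventually_mono[OF eventually_nhds_in_open[OF op, of x]]\<close>)
  thus ?thesis using chi'(1)[of x] DERIV_unique by blast
 qed
 have hol': "deriv g holomorphic_on S" by (rule holomorphic_deriv[OF hol S(1)])
 obtain C1 where C1: "!!\<eta>. norm (fourier_on c d \<psi>' g \<eta>) * \<bar>\<eta>\<bar> ^ n \<le> C1"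
  using Suc.IH[OF chi'(2) supp' S hol cd] by blast
 obtain C2 where C2: "!!\<eta>. norm (fourier_on c d \<psi> (deriv g) \<eta>) * \<bar>\<eta>\<bar> ^ n \<le> C2"
  using Suc.IH[OF Ck_SucD[OF Suc.prems(1)] supp S hol' cd] by blast
 note cchi = Ck_imp_continuous[OF Suc.prems(1)] Ck_imp_continuous[OF chi'(2)]
 note cg = continuous_on_holomorphic_of_real[OF hol S(2)] continuous_on_holomorphic_of_real[OF hol' S(2)]
 have main: "of_real \<eta> * \<i> * fourier_on c d \<psi> g \<eta> = - fourier_on c d \<psi>' g \<eta> - fourier_on c d \<psi> (deriv g) \<eta>" for \<eta>
 proof -
  let ?G = "\<lambda>x. of_real (\<psi> x) * g (of_real x) * cis (\<eta> * x)"
  let ?a = "\<lambda>x. of_real (\<psi>' x) * g (of_real x) * cis (\<eta> * x)"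
  let ?b = "\<lambda>x. of_real (\<psi> x) * deriv g (of_real x) * cis (\<eta> * x)"
  have dcis: "((\<lambda>x. cis (\<eta> * x)) has_vector_derivative (of_real \<eta> * \<i> * cis (\<eta> * x))) (at x within T)" for x T
  proof -
   have "((\<lambda>z. exp (\<i> * (of_real \<eta> * z))) has_field_derivative (of_real \<eta> * \<i> * exp (\<i> * (of_real \<eta> * of_real x)))) (at (of_real x))"
    by (auto intro!: derivative_eq_intros)
   from has_vector_derivative_real_field[OF this] have "((\<lambda>x. cis (\<eta> * x)) has_vector_derivative (of_real \<eta> * \<i> * cis (\<eta> * x))) (at x)"
    by (simp add: cis_conv_exp)
   thus ?thesis by (rule has_vector_derivative_at_within)
  qed
  have "((\<lambda>x. of_real (\<psi> x) * g (of_real x) * (of_real \<eta> * \<i> * cis (\<eta> * x)) + (of_real (\<psi> x) * deriv g (of_real x) + of_real (\<psi>' x) * g (of_real x)) * cis (\<eta> * x)) has_integral (?G d - ?G c)) {c..d}"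
  proof (rule fundamental_theorem_of_calculus[OF cd])
   fix x assume x: "x \<in> {c..d}"
   have "((\<lambda>x. complex_of_real (\<psi> x)) has_vector_derivative of_real (\<psi>' x)) (at x within {c..d})"
    by (intro has_vector_derivative_of_real DERIV_subset[OF chi'(1)]) auto
   thus "(?G has_vector_derivative of_real (\<psi> x) * g (of_real x) * (of_real \<eta> * \<i> * cis (\<eta> * x)) + (of_real (\<psi> x) * deriv g (of_real x) + of_real (\<psi>' x) * g (of_real x)) * cis (\<eta> * x)) (at x within {c..d})"
    using S x by (intro has_vector_derivative_mult dcis has_vector_derivative_holomorphic_of_real[OF hol S(1)]) auto
  qed
  moreover have "?G d - ?G c = 0" using Ck_support_endpoints[OF Suc.prems(1) supp] by simp
  moreover have "(\<lambda>x. of_real (\<psi> x) * g (of_real x) * (of_real \<eta> * \<i> * cis (\<eta> * x)) + (of_real (\<psi> x) * deriv g (of_real x) + of_real (\<psi>' x) * g (of_real x)) * cis (\<eta> * x))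
   = (\<lambda>x. of_real \<eta> * \<i> * ?G x + (?b x + ?a x))" by (auto simp: fun_eq_iff algebra_simps)
  ultimately have "integral {c..d} (\<lambda>x. of_real \<eta> * \<i> * ?G x + (?b x + ?a x)) = 0" by (simp add: integral_unique)
  moreover have "integral {c..d} (\<lambda>x. of_real \<eta> * \<i> * ?G x + (?b x + ?a x)) = of_real \<eta> * \<i> * integral {c..d} ?G + (integral {c..d} ?b + integral {c..d} ?a)"
  proof -
   have i: "?G integrable_on {c..d}" "?a integrable_on {c..d}" "?b integrable_on {c..d}"
    by (intro integrable_continuous_interval continuous_intros cchi cg)+
   show ?thesis
    by (intro integral_unique has_integral_add has_integral_mult_right integrable_integral i)
  qed
  ultimately show ?thesis unfolding fourier_on_def by (simp add: algebra_simps add_eq_0_iff)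
 qed
 show ?case
 proof (intro exI allI)
  fix \<eta> :: real
  have "norm (fourier_on c d \<psi> g \<eta>) * \<bar>\<eta>\<bar> ^ Suc n = norm (of_real \<eta> * \<i> * fourier_on c d \<psi> g \<eta>) * \<bar>\<eta>\<bar> ^ n"
   by (simp add: norm_mult)
  also have "\<dots> \<le> (norm (fourier_on c d \<psi>' g \<eta>) + norm (fourier_on c d \<psi> (deriv g) \<eta>)) * \<bar>\<eta>\<bar> ^ n"
   unfolding main by (intro mult_right_mono order_trans[OF norm_triangle_ineq4]) auto
  also have "\<dots> \<le> C1 + C2" unfolding distrib_right by (intro add_mono C1 C2)
  finally show "norm (fourier_on c d \<psi> g \<eta>) * \<bar>\<eta>\<bar> ^ Suc n \<le> C1 + C2" .
 qed
qed

theorem fourier_on_decay: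
 assumes "Ck n \<psi>" "!!x. x \<notin> {c..d} ==> \<psi> x = 0" "open S" "of_real ` {c..d} \<subseteq> S" "g holomorphic_on S" "c \<le> d"
 obtains C where "!!\<eta>. norm (fourier_on c d \<psi> g \<eta>) \<le> C / (1 + \<bar>\<eta>\<bar>) ^ n" "C \<ge> 0"
proof -
 have "Ck 0 \<psi>" using Ck_imp_continuous[OF assms(1)] by simp
 then obtain C0 where C0: "!!\<eta>. norm (fourier_on c d \<psi> g \<eta>) \<le> C0"
  using fourier_on_decay_aux[of 0 \<psi> c d S g] assms by auto
 obtain C1 where C1: "!!\<eta>. norm (fourier_on c d \<psi> g \<eta>) * \<bar>\<eta>\<bar> ^ n \<le> C1"
  using fourier_on_decay_aux[OF assms] by auto
 have b: "norm (fourier_on c d \<psi> g \<eta>) * (1 + \<bar>\<eta>\<bar>) ^ n \<le> 2 ^ n * (C0 + C1)" for \<eta>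
 proof -
  have "(1 + \<bar>\<eta>\<bar>) ^ n \<le> (2 * max 1 \<bar>\<eta>\<bar>) ^ n" by (intro power_mono) auto
  also have "\<dots> = 2 ^ n * max 1 \<bar>\<eta>\<bar> ^ n" by (simp add: power_mult_distrib)
  also have "max 1 \<bar>\<eta>\<bar> ^ n \<le> 1 + \<bar>\<eta>\<bar> ^ n" by (auto simp: max_def)
  finally have "(1 + \<bar>\<eta>\<bar>) ^ n \<le> 2 ^ n * (1 + \<bar>\<eta>\<bar> ^ n)" by simp
  hence "norm (fourier_on c d \<psi> g \<eta>) * (1 + \<bar>\<eta>\<bar>) ^ n \<le> norm (fourier_on c d \<psi> g \<eta>) * (2 ^ n * (1 + \<bar>\<eta>\<bar> ^ n))"
   by (intro mult_left_mono) auto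
  also have "\<dots> = 2 ^ n * (norm (fourier_on c d \<psi> g \<eta>) + norm (fourier_on c d \<psi> g \<eta>) * \<bar>\<eta>\<bar> ^ n)" by (simp add: algebra_simps)
  also have "\<dots> \<le> 2 ^ n * (C0 + C1)" by (intro mult_left_mono add_mono C0 C1) auto
  finally show ?thesis .
 qed
 have pos: "(1 + \<bar>\<eta>\<bar>) ^ n > 0" for \<eta> :: real by (intro zero_less_power) auto
 show ?thesis
 proof (rule that)
  fix \<eta> :: real
  show "norm (fourier_on c d \<psi> g \<eta>) \<le> 2 ^ n * (C0 + C1) / (1 + \<bar>\<eta>\<bar>) ^ n"
   using b[of \<eta>] pos[of \<eta>] by (simp add: pos_le_divide_eq)
  show "2 ^ n * (C0 + C1) \<ge> 0" using b[of 0] order_trans[OF _ b[of 0], of 0] by simp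
 qed
qed

lemma fourier_on_deriv:
 assumes "Ck n \<psi>" "open S" "of_real ` {c..d} \<subseteq> S" "g holomorphic_on S"
 shows "(fourier_on c d \<psi> g has_vector_derivative fourier_on c d \<psi> (\<lambda>z. \<i> * z * g z) \<eta>) (at \<eta>)"
proof -
 note cg = continuous_on_holomorphic_of_real[OF assms(4,3)]
 have "((\<lambda>\<eta>. integral (cbox c d) (\<lambda>x. of_real (\<psi> x) * g (of_real x) * cis (\<eta> * x))) has_vector_derivative
   integral (cbox c d) (\<lambda>x. of_real (\<psi> x) * (\<i> * of_real x * g (of_real x)) * cis (\<eta> * x))) (at \<eta> within UNIV)"
 proof (rule leibniz_rule_vector_derivative[where fx = "\<lambda>\<eta> x. of_real (\<psi> x) * (\<i> * of_real x * g (of_real x)) * cis (\<eta> * x)"])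
  fix \<eta> x :: real
  have "((\<lambda>z. exp (\<i> * (z * of_real x))) has_field_derivative (of_real x * \<i> * exp (\<i> * (of_real \<eta> * of_real x)))) (at (of_real \<eta>))"
   by (auto intro!: derivative_eq_intros)
  from has_vector_derivative_real_field[OF this] have "((\<lambda>\<eta>. cis (\<eta> * x)) has_vector_derivative (of_real x * \<i> * cis (\<eta> * x))) (at \<eta>)"
   by (simp add: cis_conv_exp)
  hence "((\<lambda>\<eta>. of_real (\<psi> x) * g (of_real x) * cis (\<eta> * x)) has_vector_derivative of_real (\<psi> x) * g (of_real x) * (of_real x * \<i> * cis (\<eta> * x))) (at \<eta>)"
   by (intro has_vector_derivative_mult_right)
  thus "((\<lambda>\<eta>. of_real (\<psi> x) * g (of_real x) * cis (\<eta> * x)) has_vector_derivative of_real (\<psi> x) * (\<i> * of_real x * g (of_real x)) * cis (\<eta> * x)) (at \<eta> within UNIV)"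
   by (simp add: mult_ac)
 next
  show "(\<lambda>x. of_real (\<psi> x) * g (of_real x) * cis (\<eta> * x)) integrable_on cbox c d" for \<eta>
   by (intro integrable_continuous continuous_intros Ck_imp_continuous[OF assms(1)]) (use cg in simp)
  have 1: "continuous_on (UNIV \<times> {c..d}) (\<lambda>(\<eta>::real, x). complex_of_real (\<psi> x))"
   unfolding case_prod_beta
   by (intro continuous_intros continuous_on_compose2[OF Ck_imp_continuous[OF assms(1), of UNIV]]) auto
  have 2: "continuous_on (UNIV \<times> {c..d}) (\<lambda>(\<eta>::real, x). g (of_real x))"
   unfolding case_prod_beta by (intro continuous_on_compose2[OF cg]) (auto intro!: continuous_intros)
  have 3: "continuous_on (UNIV \<times> {c..d}) (\<lambda>(\<eta>::real, x). of_real x :: complex)" "continuous_on (UNIV \<times> {c..d}) (\<lambda>(\<eta>::real, x). cis (\<eta> * x))"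
   unfolding case_prod_beta by (intro continuous_intros)+
  show "continuous_on (UNIV \<times> cbox c d) (\<lambda>(\<eta>, x). of_real (\<psi> x) * (\<i> * of_real x * g (of_real x)) * cis (\<eta> * x))"
   using continuous_on_mult[OF continuous_on_mult[OF 1 continuous_on_mult[OF continuous_on_mult[OF continuous_on_const[of _ \<i>] 3(1)] 2]] 3(2)]
   by (simp add: case_prod_beta)
 qed auto
 thus ?thesis unfolding fourier_on_def by (simp add: cbox_interval)
qed

section \<open>The Voronoi formula for smooth test functions\<close>

text \<open>The order 5 is dictated by \<open>hk''\<close>, which contains x powr (-\<nu> - 5):
  decay of order 5 of the cosine transform at u/x leaves x powr (-\<nu>) near 0, which is
  integrable. Positivity of \<open>c\<close> keeps the powers of t regular on the support.\<close>

locale test_function =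
 fixes \<psi> :: "real => real" and g :: "complex => complex" and c d :: real and S :: "complex set"
 assumes Ck: "Ck 5 \<psi>" and supp: "!!x. x \<notin> {c..d} ==> \<psi> x = 0" and c0: "0 < c" and cd: "c < d"
  and S: "open S" "of_real ` {c..d} \<subseteq> S" and hol: "g holomorphic_on S"
begin

definition F :: "real => complex" where "F t = of_real (\<psi> t) * g (of_real t)"

definition ft :: "nat => real => complex" where "ft k = fourier_on c d \<psi> (\<lambda>z. (\<i> * z) ^ k * g z)"

lemma hol_k: "(\<lambda>z. (\<i> * z) ^ k * g z) holomorphic_on S"
 by (intro holomorphic_intros hol)

lemma continuous_on_F: "continuous_on {c..d} F"
 unfolding F_def by (intro continuous_intros Ck_imp_continuous[OF Ck] continuous_on_holomorphic_of_real[OF hol S(2)])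

lemma ft_deriv: "(ft k has_vector_derivative ft (Suc k) \<eta>) (at \<eta>)"
proof -
 have "(\<lambda>z. \<i> * z * ((\<i> * z) ^ k * g z)) = (\<lambda>z. (\<i> * z) ^ Suc k * g z)" by (auto simp: fun_eq_iff)
 thus ?thesis using fourier_on_deriv[OF Ck S hol_k[of k], of \<eta>] unfolding ft_def by simp
qed

lemma ft_bound: obtains C where "!!\<eta>. norm (ft k \<eta>) \<le> C / (1 + \<bar>\<eta>\<bar>) ^ 5" "C \<ge> 0"
 by (rule fourier_on_decay[OF Ck supp S hol_k[of k] less_imp_le[OF cd]], assumption)
  (rule that, simp_all only: ft_def)

text \<open>The k-th derivative in \<xi> of the cosine transform of \<open>F\<close>. The sign
  (-1)^k arises because the cosine is the mean of two exponentials with opposite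
  frequencies.\<close>

definition cosint :: "nat => real => complex" where
 "cosint k \<xi> = of_real ((2 * pi) ^ k / 2) * (ft k (2 * pi * \<xi>) + (- 1) ^ k * ft k (- 2 * pi * \<xi>))"

lemma cosint_deriv: "(cosint k has_vector_derivative cosint (Suc k) \<xi>) (at \<xi>)"
proof -
 have 1: "((\<lambda>\<xi>. ft k (r * \<xi>)) has_vector_derivative r *\<^sub>R ft (Suc k) (r * \<xi>)) (at \<xi>)" for r
 proof -
  have "((\<lambda>\<xi>. r * \<xi>) has_vector_derivative r) (at \<xi>)" by (auto intro!: derivative_eq_intros)
  from vector_diff_chain_at[OF this ft_deriv[of k "r * \<xi>"]] show ?thesis by (simp add: o_def)
 qed
 have "(cosint k has_vector_derivative of_real ((2 * pi) ^ k / 2) * ((2 * pi) *\<^sub>R ft (Suc k) (2 * pi * \<xi>) + (- 1) ^ k * ((- 2 * pi) *\<^sub>R ft (Suc k) (- 2 * pi * \<xi>)))) (at \<xi>)"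
  unfolding cosint_def by (intro has_vector_derivative_mult_right has_vector_derivative_add 1)
 moreover have "of_real ((2 * pi) ^ k / 2) * ((2 * pi) *\<^sub>R ft (Suc k) (2 * pi * \<xi>) + (- 1) ^ k * ((- 2 * pi) *\<^sub>R ft (Suc k) (- 2 * pi * \<xi>))) = cosint (Suc k) \<xi>"
  unfolding cosint_def scaleR_conv_of_real by (simp add: algebra_simps)
 ultimately show ?thesis by simp
qed

lemma cosint_bound: obtains C where "!!\<xi>. norm (cosint k \<xi>) \<le> C / (1 + \<bar>\<xi>\<bar>) ^ 5" "C \<ge> 0"
proof -
 obtain C where C: "!!\<eta>. norm (ft k \<eta>) \<le> C / (1 + \<bar>\<eta>\<bar>) ^ 5" "C \<ge> 0" using ft_bound by blast
 have le: "norm (ft k (r * \<xi>)) \<le> C / (1 + \<bar>\<xi>\<bar>) ^ 5" if "\<bar>r\<bar> \<ge> 1" for r \<xi>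
 proof -
  have "\<bar>r * \<xi>\<bar> \<ge> \<bar>\<xi>\<bar>" using that mult_right_mono[of 1 "\<bar>r\<bar>" "\<bar>\<xi>\<bar>"] by (simp add: abs_mult)
  hence "(1 + \<bar>r * \<xi>\<bar>) ^ 5 \<ge> (1 + \<bar>\<xi>\<bar>) ^ 5" by (intro power_mono) auto
  moreover have "(1 + \<bar>\<xi>\<bar>) ^ 5 > 0" by (intro zero_less_power) auto
  ultimately have "C / (1 + \<bar>r * \<xi>\<bar>) ^ 5 \<le> C / (1 + \<bar>\<xi>\<bar>) ^ 5" using C(2) by (intro divide_left_mono mult_pos_pos) auto
  thus ?thesis using C(1)[of "r * \<xi>"] by linarith
 qed
 have pi1: "\<bar>2 * pi\<bar> \<ge> 1" "\<bar>- 2 * pi\<bar> \<ge> 1" using pi_gt3 by auto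
 show ?thesis
 proof (rule that[of "(2 * pi) ^ k * C"])
  fix \<xi>
  have "norm (cosint k \<xi>) \<le> (2 * pi) ^ k / 2 * (C / (1 + \<bar>\<xi>\<bar>) ^ 5 + C / (1 + \<bar>\<xi>\<bar>) ^ 5)"
   unfolding cosint_def norm_mult norm_of_real
   by (intro mult_mono order_trans[OF norm_triangle_ineq add_mono]) (use le[OF pi1(1)] le[OF pi1(2)] in \<open>auto simp: norm_mult norm_power\<close>)
  thus "norm (cosint k \<xi>) \<le> (2 * pi) ^ k * C / (1 + \<bar>\<xi>\<bar>) ^ 5" by (simp add: field_simps)
 qed (use C in auto)
qed

lemma cosint_0: "cosint 0 \<xi> = integral {c..d} (\<lambda>t. F t * of_real (cos (2 * pi * \<xi> * t)))"
proof -
 have i: "(\<lambda>t. F t * cis (r * t)) integrable_on {c..d}" for r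
  by (intro integrable_continuous_interval continuous_intros continuous_on_F)
 have ft0: "ft 0 r = integral {c..d} (\<lambda>t. F t * cis (r * t))" for r
  unfolding ft_def fourier_on_def F_def by simp
 have "cosint 0 \<xi> = 1/2 * (integral {c..d} (\<lambda>t. F t * cis (2 * pi * \<xi> * t)) + integral {c..d} (\<lambda>t. F t * cis (- 2 * pi * \<xi> * t)))"
  unfolding cosint_def ft0 by simp
 also have "\<dots> = integral {c..d} (\<lambda>t. 1/2 * (F t * cis (2 * pi * \<xi> * t) + F t * cis (- 2 * pi * \<xi> * t)))"
  by (rule integral_unique[symmetric], intro has_integral_mult_right has_integral_add integrable_integral i)
 also have "(\<lambda>t. 1/2 * (F t * cis (2 * pi * \<xi> * t) + F t * cis (- 2 * pi * \<xi> * t))) = (\<lambda>t. F t * of_real (cos (2 * pi * \<xi> * t)))"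
 proof
  fix t
  have "cis a + cis (- a) = 2 * of_real (cos a)" for a by (simp add: complex_eq_iff)
  from this[of "2 * pi * \<xi> * t"] show "1/2 * (F t * cis (2 * pi * \<xi> * t) + F t * cis (- 2 * pi * \<xi> * t)) = F t * of_real (cos (2 * pi * \<xi> * t))"
   by (simp add: distrib_left[symmetric])
 qed
 finally show ?thesis .
qed

text \<open>For u = a/p and x = m this is m powr (-\<nu>) times the a-th dual cosine integral in
  Poisson summation modulo p for b -> F(m b). As a function of x it is then itself subjected to
  Poisson summation, modulo q.\<close>

definition hk :: "complex => real => real => complex" where
 "hk \<nu> u x = of_real x powr (- \<nu> - 1) * cosint 0 (u / x)"
definition hk' :: "complex => real => real => complex" where
 "hk' \<nu> u x = (- \<nu> - 1) * (of_real x powr (- \<nu> - 2) * cosint 0 (u / x)) - of_real u * (of_real x powr (- \<nu> - 3) * cosint 1 (u / x))"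
definition hk'' :: "complex => real => real => complex" where
 "hk'' \<nu> u x = (- \<nu> - 1) * ((- \<nu> - 2) * (of_real x powr (- \<nu> - 3) * cosint 0 (u / x)) - of_real u * (of_real x powr (- \<nu> - 4) * cosint 1 (u / x)))
  - of_real u * ((- \<nu> - 3) * (of_real x powr (- \<nu> - 4) * cosint 1 (u / x)) - of_real u * (of_real x powr (- \<nu> - 5) * cosint 2 (u / x)))"

lemma hk_piece_deriv:
 assumes x: "x > 0"
 shows "((\<lambda>x. of_real x powr s * cosint k (u / x)) has_vector_derivative
  (s * (of_real x powr (s - 1) * cosint k (u / x)) - of_real u * (of_real x powr (s - 2) * cosint (Suc k) (u / x)))) (at x)"
proof -
 have "((\<lambda>x. u / x) has_vector_derivative (- u / x\<^sup>2)) (at x)"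
  unfolding has_real_derivative_iff_has_vector_derivative[symmetric]
  using x by (auto intro!: derivative_eq_intros simp: power2_eq_square)
 from vector_diff_chain_at[OF this cosint_deriv[of k "u / x"]]
 have 1: "((\<lambda>x. cosint k (u / x)) has_vector_derivative (- u / x\<^sup>2) *\<^sub>R cosint (Suc k) (u / x)) (at x)" by (simp add: o_def)
 have "((\<lambda>x. of_real x powr s * cosint k (u / x)) has_vector_derivative
  (of_real x powr s * ((- u / x\<^sup>2) *\<^sub>R cosint (Suc k) (u / x)) + s * of_real x powr (s - 1) * cosint k (u / x))) (at x)"
  by (intro has_vector_derivative_mult has_vector_derivative_powr_of_real 1 x)
 moreover have "complex_of_real x powr s = of_real x powr (s - 2) * of_real (x\<^sup>2)"
  using complex_powr_of_real_add_nat[OF x, of "s - 2" 2] by simp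
 ultimately show ?thesis using x by (simp add: scaleR_conv_of_real mult_ac)
qed

lemma hk_deriv: "x > 0 ==> (hk \<nu> u has_vector_derivative hk' \<nu> u x) (at x)"
proof -
 assume x: "x > 0"
 have e: "- \<nu> - 1 - 1 = - \<nu> - 2" "- \<nu> - 1 - 2 = - \<nu> - 3" by simp_all
 show ?thesis unfolding hk_def hk'_def using hk_piece_deriv[OF x, of "- \<nu> - 1" 0 u] by (simp add: e)
qed

lemma hk'_deriv: "x > 0 ==> (hk' \<nu> u has_vector_derivative hk'' \<nu> u x) (at x)"
proof -
 assume x: "x > 0"
 have e: "- \<nu> - 2 - 1 = - \<nu> - 3" "- \<nu> - 2 - 2 = - \<nu> - 4" "- \<nu> - 3 - 1 = - \<nu> - 4" "- \<nu> - 3 - 2 = - \<nu> - 5" "Suc 1 = 2" "Suc 0 = 1" by simp_all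
 show ?thesis unfolding hk'_def hk''_def
  using hk_piece_deriv[OF x, of "- \<nu> - 2" 0 u, unfolded e] hk_piece_deriv[OF x, of "- \<nu> - 3" 1 u, unfolded e]
  by (intro has_vector_derivative_diff has_vector_derivative_mult_right)
qed

lemma continuous_on_cosint: "continuous_on T (cosint k)"
 by (intro continuous_at_imp_continuous_on) (auto intro: has_vector_derivative_continuous cosint_deriv)

lemma continuous_on_hk: "continuous_on {0<..} (hk \<nu> u)" "continuous_on {0<..} (hk' \<nu> u)" "continuous_on {0<..} (hk'' \<nu> u)"
proof -
 have p: "continuous_on {0<..} (\<lambda>x. of_real x powr s * cosint k (u / x))" for s k
  by (intro continuous_intros continuous_on_compose2[OF continuous_on_cosint[of UNIV]]) (auto simp: complex_nonpos_Reals_iff)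
 show "continuous_on {0<..} (hk \<nu> u)" "continuous_on {0<..} (hk' \<nu> u)" "continuous_on {0<..} (hk'' \<nu> u)"
  unfolding hk_def hk'_def hk''_def by (intro p continuous_on_diff continuous_on_mult_left)+
qed

lemma hk_piece_bound:
 assumes u: "u > 0"
 obtains C where "C \<ge> 0" "!!x. x > 0 ==> norm (of_real x powr s * cosint k (u / x)) \<le> C * x powr Re s"
  "!!x. x > 0 ==> norm (of_real x powr s * cosint k (u / x)) \<le> C * x powr (Re s + 5)"
proof -
 obtain C where C: "!!\<xi>. norm (cosint k \<xi>) \<le> C / (1 + \<bar>\<xi>\<bar>) ^ 5" "C \<ge> 0" using cosint_bound by blast
 show ?thesis
 proof (rule that[of "max C (C / u ^ 5)"])
  show "max C (C / u ^ 5) \<ge> 0" using C by simp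
  fix x :: real assume x: "x > 0"
  have "(1 + \<bar>u / x\<bar>) ^ 5 \<ge> 1" by (rule one_le_power) simp
  hence "C / (1 + \<bar>u / x\<bar>) ^ 5 \<le> C / 1" using C(2) by (intro divide_left_mono) linarith+
  hence 1: "norm (cosint k (u / x)) \<le> max C (C / u ^ 5)" using C(1)[of "u / x"] by simp
  have "(1 + \<bar>u / x\<bar>) ^ 5 \<ge> (u / x) ^ 5" using u x by (intro power_mono) auto
  hence "C / (1 + \<bar>u / x\<bar>) ^ 5 \<le> C / (u / x) ^ 5" using C(2) u x by (intro divide_left_mono mult_pos_pos zero_less_power) (auto intro!: add_pos_pos)
  also have "\<dots> = C / u ^ 5 * x ^ 5" by (simp add: power_divide)
  also have "\<dots> \<le> max C (C / u ^ 5) * x ^ 5" using x by (intro mult_right_mono) auto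
  finally have 2: "norm (cosint k (u / x)) \<le> max C (C / u ^ 5) * x ^ 5" using C(1)[of "u / x"] by simp
  show "norm (of_real x powr s * cosint k (u / x)) \<le> max C (C / u ^ 5) * x powr Re s"
   unfolding norm_mult norm_powr_of_real[OF x] using mult_left_mono[OF 1, of "x powr Re s"] by (simp add: mult.commute)
  have "x powr (Re s + 5) = x powr Re s * x ^ 5" using x by (simp add: powr_add powr_numeral)
  thus "norm (of_real x powr s * cosint k (u / x)) \<le> max C (C / u ^ 5) * x powr (Re s + 5)"
   unfolding norm_mult norm_powr_of_real[OF x] using mult_left_mono[OF 2, of "x powr Re s"] by (simp add: mult_ac)
 qed
qed

text \<open>Near 0 the decay of order 5 of the transforms at u/x contributes x^5; near infinity the
  transforms are merely bounded and the explicit powers of x decide.\<close>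

lemma hk_bounds:
 assumes u: "u > 0" and r: "0 < Re \<nu>" "Re \<nu> < 1/2"
 obtains C where "C \<ge> 0"
  "!!x. 0 < x ==> x \<le> 1 ==> norm (hk \<nu> u x) \<le> C * x" "!!x. 0 < x ==> x \<le> 1 ==> norm (hk' \<nu> u x) \<le> C * x"
  "!!x. 0 < x ==> x \<le> 1 ==> norm (hk'' \<nu> u x) \<le> C * x powr (- Re \<nu>)"
  "!!x. x \<ge> 1 ==> norm (hk \<nu> u x) \<le> C * x powr (- Re \<nu> - 1)" "!!x. x \<ge> 1 ==> norm (hk' \<nu> u x) \<le> C * x powr (- Re \<nu> - 2)"
  "!!x. x \<ge> 1 ==> norm (hk'' \<nu> u x) \<le> C * x powr (- Re \<nu> - 3)"
proof -
 have ex: "\<exists>C\<ge>0. (\<forall>x>0. norm (of_real x powr (- \<nu> - of_nat j) * cosint k (u / x)) \<le> C * x powr (- Re \<nu> - real j)) \<and>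
  (\<forall>x>0. norm (of_real x powr (- \<nu> - of_nat j) * cosint k (u / x)) \<le> C * x powr (- Re \<nu> - real j + 5))" for j k
 proof (rule hk_piece_bound[OF u, of "- \<nu> - of_nat j" k])
  fix C assume "0 \<le> C" "!!x. 0 < x ==> norm (of_real x powr (- \<nu> - of_nat j) * cosint k (u / x)) \<le> C * x powr Re (- \<nu> - of_nat j)"
   "!!x. 0 < x ==> norm (of_real x powr (- \<nu> - of_nat j) * cosint k (u / x)) \<le> C * x powr (Re (- \<nu> - of_nat j) + 5)"
  moreover have "Re (- \<nu> - of_nat j) = - Re \<nu> - real j" "Re (- \<nu> - of_nat j) + 5 = - Re \<nu> - real j + 5" by simp_all
  ultimately show ?thesis by (intro exI[of _ C]) auto
 qed
 then obtain K where K0: "!!j k. K j k \<ge> 0"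
  and K1: "!!j k x. x > 0 ==> norm (of_real x powr (- \<nu> - of_nat j) * cosint k (u / x)) \<le> K j k * x powr (- Re \<nu> - real j)"
  and K2: "!!j k x. x > 0 ==> norm (of_real x powr (- \<nu> - of_nat j) * cosint k (u / x)) \<le> K j k * x powr (- Re \<nu> - real j + 5)" by metis
 have L: "norm (of_real x powr (- \<nu> - of_nat j) * cosint k (u / x)) \<le> K j k * x powr (- Re \<nu> - real i)" if "x \<ge> 1" "i \<le> j" for x i j k
  using that by (intro order_trans[OF K1] mult_left_mono powr_mono K0) auto
 have Sm: "norm (of_real x powr (- \<nu> - of_nat j) * cosint k (u / x)) \<le> K j k * x powr (- Re \<nu> - real i + 5)" if "0 < x" "x \<le> 1" "j \<le> i" for x i j k
  using that by (intro order_trans[OF K2] mult_left_mono powr_mono' K0) auto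
 define a where "a = norm (- \<nu> - 1)"
 define C1 where "C1 = a * K 2 0 + u * K 3 1"
 define C2 where "C2 = a * (norm (- \<nu> - 2) * K 3 0 + u * K 4 1) + u * (norm (- \<nu> - 3) * K 4 1 + u * K 5 2)"
 have a0: "a \<ge> 0" by (simp add: a_def)
 have n1: "norm (hk' \<nu> u x) \<le> C1 * w"
  if "!!j k. (j, k) \<in> {(2,0),(3,1)} ==> norm (of_real x powr (- \<nu> - of_nat j) * cosint k (u / x)) \<le> K j k * w" for x w
 proof -
  have "norm (hk' \<nu> u x) \<le> a * (K 2 0 * w) + u * (K 3 1 * w)"
   unfolding hk'_def
  proof (rule order_trans[OF norm_triangle_ineq4 add_mono])
   show "norm ((- \<nu> - 1) * (of_real x powr (- \<nu> - 2) * cosint 0 (u / x))) \<le> a * (K 2 0 * w)"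
    unfolding norm_mult[of "- \<nu> - 1"] a_def using that[of 2 0] by (intro mult_left_mono) auto
   show "norm (of_real u * (of_real x powr (- \<nu> - 3) * cosint 1 (u / x))) \<le> u * (K 3 1 * w)"
    unfolding norm_mult[of "of_real u"] using that[of 3 1] u by (simp add: mult_left_mono)
  qed
  thus ?thesis by (simp add: C1_def algebra_simps)
 qed
 have n2: "norm (hk'' \<nu> u x) \<le> C2 * w"
  if "!!j k. (j, k) \<in> {(3,0),(4,1),(5,2)} ==> norm (of_real x powr (- \<nu> - of_nat j) * cosint k (u / x)) \<le> K j k * w" for x w
 proof -
  let ?p = "\<lambda>j k. of_real x powr (- \<nu> - of_nat j) * cosint k (u / x)"
  have b: "norm (?p 3 0) \<le> K 3 0 * w" "norm (?p 4 1) \<le> K 4 1 * w" "norm (?p 5 2) \<le> K 5 2 * w" using that[of 3 0] that[of 4 1] that[of 5 2] by simp_all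
  have e: "hk'' \<nu> u x = (- \<nu> - 1) * ((- \<nu> - 2) * ?p 3 0 - of_real u * ?p 4 1) - of_real u * ((- \<nu> - 3) * ?p 4 1 - of_real u * ?p 5 2)"
   unfolding hk''_def by simp
  have i1: "norm ((- \<nu> - 2) * ?p 3 0 - of_real u * ?p 4 1) \<le> norm (- \<nu> - 2) * (K 3 0 * w) + u * (K 4 1 * w)"
   by (rule order_trans[OF norm_triangle_ineq4 add_mono])
    (use b u in \<open>auto simp: norm_mult[of "- \<nu> - 2"] norm_mult[of "of_real u"] intro!: mult_left_mono simp del: norm_mult\<close>)
  have i2: "norm ((- \<nu> - 3) * ?p 4 1 - of_real u * ?p 5 2) \<le> norm (- \<nu> - 3) * (K 4 1 * w) + u * (K 5 2 * w)"
   by (rule order_trans[OF norm_triangle_ineq4 add_mono])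
    (use b u in \<open>auto simp: norm_mult[of "- \<nu> - 3"] norm_mult[of "of_real u"] intro!: mult_left_mono simp del: norm_mult\<close>)
  have "norm (hk'' \<nu> u x) \<le> a * (norm (- \<nu> - 2) * (K 3 0 * w) + u * (K 4 1 * w)) + u * (norm (- \<nu> - 3) * (K 4 1 * w) + u * (K 5 2 * w))"
   unfolding e
  proof (rule order_trans[OF norm_triangle_ineq4 add_mono])
   show "norm ((- \<nu> - 1) * ((- \<nu> - 2) * ?p 3 0 - of_real u * ?p 4 1)) \<le> a * (norm (- \<nu> - 2) * (K 3 0 * w) + u * (K 4 1 * w))"
    unfolding norm_mult[of "- \<nu> - 1"] a_def by (intro mult_left_mono i1) auto
   show "norm (of_real u * ((- \<nu> - 3) * ?p 4 1 - of_real u * ?p 5 2)) \<le> u * (norm (- \<nu> - 3) * (K 4 1 * w) + u * (K 5 2 * w))"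
    unfolding norm_mult[of "of_real u"] norm_of_real abs_of_pos[OF u] using u by (intro mult_left_mono i2) auto
  qed
  thus ?thesis by (simp add: C2_def algebra_simps)
 qed
 define C where "C = max (K 1 0) (max C1 C2)"
 have C: "K 1 0 \<le> C" "C1 \<le> C" "C2 \<le> C" by (auto simp: C_def)
 have C0: "C \<ge> 0" using C(1) K0[of 1 0] by linarith
 show ?thesis
 proof (rule that[of C])
  fix x :: real assume x: "0 < x" "x \<le> 1"
  have w: "x powr (- Re \<nu> - real j + 5) \<le> x" if "j \<le> 3" for j
   using powr_mono'[of 1 "- Re \<nu> - real j + 5" x] x r that by simp
  have "norm (hk \<nu> u x) \<le> K 1 0 * x powr (- Re \<nu> - real 3 + 5)"
   unfolding hk_def using Sm[OF x, of 1 3 0] by simp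
  also have "\<dots> \<le> C * x" using w[of 3] C C0 K0 by (intro mult_mono) auto
  finally show "norm (hk \<nu> u x) \<le> C * x" .
  have "norm (hk' \<nu> u x) \<le> C1 * x powr (- Re \<nu> - real 3 + 5)"
   by (rule n1, rule Sm[OF x]) auto
  also have "\<dots> \<le> C * x" using w[of 3] C C0 by (intro mult_mono) auto
  finally show "norm (hk' \<nu> u x) \<le> C * x" .
  have "norm (hk'' \<nu> u x) \<le> C2 * x powr (- Re \<nu> - real 5 + 5)"
   by (rule n2, rule Sm[OF x]) auto
  also have "\<dots> \<le> C * x powr (- Re \<nu>)" using C by (simp add: mult_right_mono)
  finally show "norm (hk'' \<nu> u x) \<le> C * x powr (- Re \<nu>)" .
 next
  fix x :: real assume x: "1 \<le> x"
  have "norm (hk \<nu> u x) \<le> K 1 0 * x powr (- Re \<nu> - real 1)"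
   unfolding hk_def using L[OF x, of 1 1 0] by simp
  also have "\<dots> \<le> C * x powr (- Re \<nu> - 1)" using C by (simp add: mult_right_mono)
  finally show "norm (hk \<nu> u x) \<le> C * x powr (- Re \<nu> - 1)" .
  have "norm (hk' \<nu> u x) \<le> C1 * x powr (- Re \<nu> - real 2)"
   by (rule n1, rule L[OF x]) auto
  also have "\<dots> \<le> C * x powr (- Re \<nu> - 2)" using C by (simp add: mult_right_mono)
  finally show "norm (hk' \<nu> u x) \<le> C * x powr (- Re \<nu> - 2)" .
  have "norm (hk'' \<nu> u x) \<le> C2 * x powr (- Re \<nu> - real 3)"
   by (rule n2, rule L[OF x]) auto
  also have "\<dots> \<le> C * x powr (- Re \<nu> - 3)" using C by (simp add: mult_right_mono)
  finally show "norm (hk'' \<nu> u x) \<le> C * x powr (- Re \<nu> - 3)" .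
 qed (rule C0)
qed

end

section \<open>Character sums and Poisson summation for \<open>hk\<close> and
  \<open>F\<close>\<close>

text \<open>Sums over a full period vanish wherever they start, so a partial sum equals one with
  fewer than q terms.\<close>

lemma character_partial_sums_bounded:
 assumes chi: "dirichlet_character q chi" "\<not> principal_character q chi"
 shows "norm (\<Sum>i<m. chi (int (Suc i))) \<le> real q"
proof -
 have q: "q > 0" using chi by (simp add: dirichlet_character_def)
 have per: "chi (int (m + q)) = chi (int m)" for m using chi(1) by (simp add: dirichlet_character_def)
 define A where "A = (\<lambda>m. \<Sum>i<m. chi (int (Suc i)))"
 define T where "T = (\<lambda>m. \<Sum>i<q. chi (int (m + Suc i)))"
 have T0: "T 0 = 0"
 proof -
  have "T 0 = (\<Sum>h=1..q. chi (int h))"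
   unfolding T_def by (rule sum.reindex_bij_witness[of _ "\<lambda>h. h - 1" Suc]) auto
  also have "\<dots> = (\<Sum>h<q. chi (int h))" by (rule sum_atLeast1_eq_lessThan) (use per[of 0] in simp)
  finally show ?thesis using sum_nonprincipal_character[OF chi] by simp
 qed
 have TS: "T (Suc m) = T m" for m
 proof -
  have "T (Suc m) + chi (int (m + Suc 0)) = (\<Sum>i<Suc q. chi (int (m + Suc i)))"
   unfolding T_def by (subst sum.lessThan_Suc_shift) simp
  also have "\<dots> = T m + chi (int (m + Suc q))" by (simp add: T_def)
  also have "chi (int (m + Suc q)) = chi (int (m + Suc 0))" using per[of "m + Suc 0"] by (simp add: add_ac)
  finally show ?thesis by simp
 qed
 have Tm: "T m = 0" for m by (induction m) (use T0 TS in auto)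
 have Aper: "A (m + q) = A m" for m
 proof -
  have "A (m + q) = A m + T m" unfolding A_def T_def
   using sum.nat_group[of "\<lambda>i. chi (int (Suc i))"] by (induction q) (auto simp: add_ac)
  thus ?thesis using Tm by simp
 qed
 have Amul: "A (m + k * q) = A m" for m k
  by (induction k) (use Aper in \<open>auto simp: add_ac\<close>, metis Aper add.assoc add.commute)
 have "A m = A (m mod q + (m div q) * q)" by simp
 also have "\<dots> = A (m mod q)" by (rule Amul)
 finally have "norm (A m) = norm (A (m mod q))" by simp
 also have "\<dots> \<le> (\<Sum>i<m mod q. norm (chi (int (Suc i))))" unfolding A_def by (rule norm_sum)
 also have "\<dots> \<le> (\<Sum>i<m mod q. 1)" by (intro sum_mono dirichlet_character_norm_le[OF chi(1)])
 also have "\<dots> \<le> real q" using q by (simp add: less_imp_le)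
 finally show ?thesis by (simp add: A_def)
qed

text \<open>Summation by parts against the bounded partial sums of the character: only the last
  value and the total variation of w matter.\<close>

lemma character_sum_bounded_variation:
 fixes w :: "nat => complex"
 assumes chi: "dirichlet_character q chi" "\<not> principal_character q chi"
  and B: "norm (w N) \<le> B" "(\<Sum>m<N. norm (w (Suc m) - w m)) \<le> V"
 shows "norm (\<Sum>m<N. chi (int (Suc m)) * w m) \<le> real q * (B + V)"
proof -
 define A where "A = (\<lambda>m. \<Sum>i<m. chi (int (Suc i)))"
 have Ab: "norm (A m) \<le> real q" for m unfolding A_def by (rule character_partial_sums_bounded[OF chi])
 have "(\<Sum>m<N. chi (int (Suc m)) * w m) = A N * w N - (\<Sum>m<N. A (Suc m) * (w (Suc m) - w m))" for N
  by (induction N) (auto simp: A_def algebra_simps)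
 hence "norm (\<Sum>m<N. chi (int (Suc m)) * w m) \<le> norm (A N * w N) + norm (\<Sum>m<N. A (Suc m) * (w (Suc m) - w m))"
  by (metis norm_triangle_ineq4)
 also have "norm (A N * w N) \<le> real q * B" unfolding norm_mult using Ab B(1) by (intro mult_mono) auto
 also have "norm (\<Sum>m<N. A (Suc m) * (w (Suc m) - w m)) \<le> (\<Sum>m<N. norm (A (Suc m) * (w (Suc m) - w m)))" by (rule norm_sum)
 also have "\<dots> \<le> (\<Sum>m<N. real q * norm (w (Suc m) - w m))"
  unfolding norm_mult by (intro sum_mono mult_right_mono Ab) auto
 also have "\<dots> \<le> real q * V" unfolding sum_distrib_left[symmetric] using B(2) by (intro mult_left_mono) auto
 finally show ?thesis by (simp add: algebra_simps)
qed

context test_function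
begin

text \<open>At infinity x^2 \<open>hk''\<close> decays like x powr (- Re \<nu> - 1), which is
  integrable because Re \<nu> > 0. At 0, \<open>hk\<close> and \<open>hk'\<close> are O(x), which
  gives the vanishing boundary values.\<close>

lemma poisson_hk:
 assumes chi: "dirichlet_character q chi" "primitive_character q chi" "\<not> principal_character q chi" "even_character chi"
  and u: "u > 0" and r: "0 < Re \<nu>" "Re \<nu> < 1/2"
 shows "summable (\<lambda>m. chi (int (Suc m)) * hk \<nu> u (real (Suc m)))"
  and "(\<lambda>n. gauss_sum q chi * cnj (chi (int (Suc n))) * (LINT x:{0<..}|lborel. hk \<nu> u x * of_real (cos (2 * pi * real (Suc n) / real q * x))))
   sums (of_nat q / 2 * (\<Sum>m. chi (int (Suc m)) * hk \<nu> u (real (Suc m))))"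
  and "set_integrable lborel {0<..} (hk \<nu> u)"
proof -
 obtain C where C: "C \<ge> 0"
  "!!x. 0 < x ==> x \<le> 1 ==> norm (hk \<nu> u x) \<le> C * x" "!!x. 0 < x ==> x \<le> 1 ==> norm (hk' \<nu> u x) \<le> C * x"
  "!!x. 0 < x ==> x \<le> 1 ==> norm (hk'' \<nu> u x) \<le> C * x powr (- Re \<nu>)"
  "!!x. x \<ge> 1 ==> norm (hk \<nu> u x) \<le> C * x powr (- Re \<nu> - 1)" "!!x. x \<ge> 1 ==> norm (hk' \<nu> u x) \<le> C * x powr (- Re \<nu> - 2)"
  "!!x. x \<ge> 1 ==> norm (hk'' \<nu> u x) \<le> C * x powr (- Re \<nu> - 3)"
  by (rule hk_bounds[OF u r], rule that)
 have i0: "set_integrable lborel {0<..} (hk \<nu> u)"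
  by (rule set_integrable_Ioi_powr_bounds[where a = 1 and b = "- Re \<nu> - 1" and C = C]) (use C r continuous_on_hk in auto)
 thus "set_integrable lborel {0<..} (hk \<nu> u)" .
 have i2: "set_integrable lborel {0<..} (hk'' \<nu> u)"
  by (rule set_integrable_Ioi_powr_bounds[where a = "- Re \<nu>" and b = "- Re \<nu> - 3" and C = C]) (use C r continuous_on_hk in auto)
 have i3: "set_integrable lborel {0<..} (\<lambda>x. of_real (x\<^sup>2) * hk'' \<nu> u x)"
 proof (rule set_integrable_Ioi_powr_bounds[where a = "- Re \<nu>" and b = "- Re \<nu> - 1" and C = C])
  show "continuous_on {0<..} (\<lambda>x. of_real (x\<^sup>2) * hk'' \<nu> u x)" by (intro continuous_intros continuous_on_hk)
  fix x :: real
  { assume x: "0 < x" "x \<le> 1"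
   have "norm (of_real (x\<^sup>2) * hk'' \<nu> u x) = x\<^sup>2 * norm (hk'' \<nu> u x)" unfolding norm_mult norm_of_real by simp
   also have "\<dots> \<le> 1 * norm (hk'' \<nu> u x)" using x by (intro mult_right_mono power_le_one) auto
   finally show "norm (of_real (x\<^sup>2) * hk'' \<nu> u x) \<le> C * x powr (- Re \<nu>)" using C(4)[OF x] by linarith }
  { assume x: "1 \<le> x"
   have e: "x powr (- Re \<nu> - 1) = x\<^sup>2 * x powr (- Re \<nu> - 3)"
   proof -
    have "- Re \<nu> - 1 = 2 + (- Re \<nu> - 3)" by simp
    hence "x powr (- Re \<nu> - 1) = x powr 2 * x powr (- Re \<nu> - 3)" by (metis powr_add)
    thus ?thesis using x by (simp add: powr_numeral)
   qed
   have "norm (of_real (x\<^sup>2) * hk'' \<nu> u x) = x\<^sup>2 * norm (hk'' \<nu> u x)" unfolding norm_mult norm_of_real by simp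
   also have "\<dots> \<le> x\<^sup>2 * (C * x powr (- Re \<nu> - 3))" by (intro mult_left_mono C x) auto
   finally show "norm (of_real (x\<^sup>2) * hk'' \<nu> u x) \<le> C * x powr (- Re \<nu> - 1)" unfolding e by (simp add: mult_ac) }
 qed (use r in auto)
 have l0: "(f \<longlongrightarrow> 0) (at_right 0)" if "!!x. 0 < x ==> x \<le> 1 ==> norm (f x) \<le> C * x" for f :: "real => complex"
 proof (rule Lim_null_comparison)
  show "\<forall>\<^sub>F x in at_right 0. norm (f x) \<le> C * x"
   using that eventually_at_right_less[of 0] unfolding eventually_at_right_field by (intro exI[of _ 1]) auto
  have "((\<lambda>x. C * x) \<longlongrightarrow> C * 0) (at_right 0)" by (intro tendsto_intros)
  thus "((\<lambda>x. C * x) \<longlongrightarrow> 0) (at_right 0)" by simp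
 qed
 have pl: "((\<lambda>x. C * x powr (- Re \<nu> - 1)) \<longlongrightarrow> 0) at_top"
 proof -
  have "((\<lambda>x. x powr (- (Re \<nu> + 1))) \<longlongrightarrow> 0) at_top" using r by (intro tendsto_neg_powr filterlim_ident) auto
  from tendsto_mult_right_zero[OF this, of C] show ?thesis by simp
 qed
 have l1: "(f \<longlongrightarrow> 0) at_top" if "!!x. x \<ge> 1 ==> norm (f x) \<le> C * x powr (- Re \<nu> - 1)" for f :: "real => complex"
  by (rule Lim_null_comparison[OF _ pl]) (use that in \<open>auto simp: eventually_at_top_linorder\<close>)
 have x1: "norm (of_real x * hk' \<nu> u x) \<le> C * x powr (- Re \<nu> - 1)" if x: "x \<ge> 1" for x
 proof -
  have e: "x powr (- Re \<nu> - 1) = x * x powr (- Re \<nu> - 2)"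
  proof -
   have "- Re \<nu> - 1 = 1 + (- Re \<nu> - 2)" by simp
   hence "x powr (- Re \<nu> - 1) = x powr 1 * x powr (- Re \<nu> - 2)" by (metis powr_add)
   thus ?thesis using x by simp
  qed
  have "norm (of_real x * hk' \<nu> u x) \<le> x * (C * x powr (- Re \<nu> - 2))"
   unfolding norm_mult using x by (auto intro!: mult_left_mono C)
  thus ?thesis unfolding e by (simp add: mult_ac)
 qed
 note P = poisson_summation_character[OF chi hk_deriv hk'_deriv continuous_on_hk(3) i0 i2 i3 l0[OF C(2)] l0[OF C(3)] l1[OF C(5)] l1[OF x1]]
 show "summable (\<lambda>m. chi (int (Suc m)) * hk \<nu> u (real (Suc m)))" by (rule P(1))
 show "(\<lambda>n. gauss_sum q chi * cnj (chi (int (Suc n))) * (LINT x:{0<..}|lborel. hk \<nu> u x * of_real (cos (2 * pi * real (Suc n) / real q * x))))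
   sums (of_nat q / 2 * (\<Sum>m. chi (int (Suc m)) * hk \<nu> u (real (Suc m))))" by (rule P(2))
qed

text \<open>Inside [c, d] this is the product rule. Outside, \<open>h\<close> may be arbitrary, but
  the product is identically 0 in a neighbourhood.\<close>

lemma bump_product_deriv:
 assumes d: "!!x. (\<phi> has_real_derivative \<phi>' x) (at x)" and s: "!!x. x \<notin> {c..d} ==> \<phi> x = 0" and h: "h holomorphic_on S"
 shows "!!x. x \<notin> {c..d} ==> \<phi>' x = 0"
  and "((\<lambda>t. of_real (\<phi> t) * h (of_real t)) has_vector_derivative (of_real (\<phi>' t) * h (of_real t) + of_real (\<phi> t) * deriv h (of_real t))) (at t)"
proof -
 have op: "open (- {c..d})" by (simp add: open_Compl)
 show s': "\<phi>' x = 0" if "x \<notin> {c..d}" for x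
 proof -
  have "((\<lambda>x. 0) has_real_derivative 0) (at x)" by simp
  hence "(\<phi> has_real_derivative 0) (at x)"
   by (rule DERIV_cong_ev[THEN iffD1, rotated -1, OF _ refl _ refl])
    (use that s in \<open>auto intro!: eventually_mono[OF eventually_nhds_in_open[OF op, of x]]\<close>)
  thus ?thesis using d[of x] DERIV_unique by blast
 qed
 show "((\<lambda>t. of_real (\<phi> t) * h (of_real t)) has_vector_derivative (of_real (\<phi>' t) * h (of_real t) + of_real (\<phi> t) * deriv h (of_real t))) (at t)"
 proof (cases "t \<in> {c..d}")
  case True
  have "((\<lambda>x. complex_of_real (\<phi> x)) has_vector_derivative of_real (\<phi>' t)) (at t)"
   by (intro has_vector_derivative_of_real d)
  moreover have "((\<lambda>t. h (of_real t)) has_vector_derivative deriv h (of_real t)) (at t)"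
   by (rule has_vector_derivative_holomorphic_of_real[OF h S(1)]) (use S True in auto)
  ultimately have "((\<lambda>t. of_real (\<phi> t) * h (of_real t)) has_vector_derivative (of_real (\<phi> t) * deriv h (of_real t) + of_real (\<phi>' t) * h (of_real t))) (at t)"
   by (rule has_vector_derivative_mult)
  thus ?thesis by (simp add: add.commute)
 next
  case False
  have "((\<lambda>t. 0 :: complex) has_vector_derivative 0) (at t)" by simp
  hence "((\<lambda>t. of_real (\<phi> t) * h (of_real t)) has_vector_derivative 0) (at t)"
   by (rule has_vector_derivative_transform_within_open[OF _ op]) (use False s in auto)
  thus ?thesis using s[OF False] s'[OF False] by simp
 qed
qed

lemma F_smooth:
 obtains F1 F2 where "!!t. (F has_vector_derivative F1 t) (at t)" "!!t. (F1 has_vector_derivative F2 t) (at t)"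
  "continuous_on UNIV F2" "!!t. t \<notin> {c..d} ==> F1 t = 0" "!!t. t \<notin> {c..d} ==> F2 t = 0"
proof -
 have 5: "5 = Suc (Suc (Suc 2))" by simp
 from Ck[unfolded 5 Ck.simps(2)] obtain p1 p2 p3 where p: "!!x. (\<psi> has_real_derivative p1 x) (at x)" "!!x. (p1 has_real_derivative p2 x) (at x)" "!!x. (p2 has_real_derivative p3 x) (at x)"
  by blast
 have h1: "deriv g holomorphic_on S" by (rule holomorphic_deriv[OF hol S(1)])
 have h2: "deriv (deriv g) holomorphic_on S" by (rule holomorphic_deriv[OF h1 S(1)])
 have s1: "p1 x = 0" if "x \<notin> {c..d}" for x
  by (rule bump_product_deriv(1)[of \<psi> p1 g, OF p(1) _ hol that]) (rule supp)
 have s2: "p2 x = 0" if "x \<notin> {c..d}" for x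
  by (rule bump_product_deriv(1)[of p1 p2 g, OF p(2) _ hol that]) (rule s1)
 let ?f = "\<lambda>\<phi> h t. complex_of_real (\<phi> t) * h (complex_of_real t)"
 define F1 where "F1 = (\<lambda>t. ?f p1 g t + ?f \<psi> (deriv g) t)"
 define F2 where "F2 = (\<lambda>t. (?f p2 g t + ?f p1 (deriv g) t) + (?f p1 (deriv g) t + ?f \<psi> (deriv (deriv g)) t))"
 show ?thesis
 proof (rule that[of F1 F2])
  show "(F has_vector_derivative F1 t) (at t)" for t
   unfolding F_def F1_def by (rule bump_product_deriv(2)[OF p(1) supp hol])
  show "(F1 has_vector_derivative F2 t) (at t)" for t
   unfolding F1_def F2_def
   by (intro has_vector_derivative_add bump_product_deriv(2)[OF p(2) s1 hol] bump_product_deriv(2)[OF p(1) supp h1])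
  have ct: "continuous_on UNIV (?f \<phi> h)" if "!!x. (\<phi> has_real_derivative \<phi>' x) (at x)" "!!x. x \<notin> {c..d} ==> \<phi> x = 0" "h holomorphic_on S" for \<phi> \<phi>' h
   using bump_product_deriv(2)[OF that] by (intro continuous_at_imp_continuous_on) (auto intro: has_vector_derivative_continuous)
  show "continuous_on UNIV F2" unfolding F2_def
   by (intro continuous_on_add ct[OF p(3) s2 hol] ct[OF p(2) s1 h1] ct[OF p(1) supp h2])
  show "F1 t = 0" if "t \<notin> {c..d}" for t using s1[OF that] supp[OF that] by (simp add: F1_def)
  show "F2 t = 0" if "t \<notin> {c..d}" for t using s1[OF that] s2[OF that] supp[OF that] by (simp add: F2_def)
 qed
qed

lemma F_eq_0: "t \<notin> {c..d} ==> F t = 0" using supp by (simp add: F_def)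

lemma poisson_F:
 assumes chi: "dirichlet_character q chi" "primitive_character q chi" "\<not> principal_character q chi" "even_character chi"
  and D: "D > 0"
 shows "summable (\<lambda>m. chi (int (Suc m)) * F (D * real (Suc m)))"
  and "(\<lambda>n. gauss_sum q chi * cnj (chi (int (Suc n))) * (cosint 0 (real (Suc n) / real q / D) / of_real D))
   sums (of_nat q / 2 * (\<Sum>m. chi (int (Suc m)) * F (D * real (Suc m))))"
proof -
 obtain F1 F2 where FF: "!!t. (F has_vector_derivative F1 t) (at t)" "!!t. (F1 has_vector_derivative F2 t) (at t)"
  "continuous_on UNIV F2" "!!t. t \<notin> {c..d} ==> F1 t = 0" "!!t. t \<notin> {c..d} ==> F2 t = 0" using F_smooth by blast
 have contF: "continuous_on UNIV F" using FF(1) by (intro continuous_at_imp_continuous_on) (auto intro: has_vector_derivative_continuous)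
 define h where "h = (\<lambda>y. F (D * y))"
 define h1 where "h1 = (\<lambda>y. of_real D * F1 (D * y))"
 define h2 where "h2 = (\<lambda>y. of_real D * (of_real D * F2 (D * y)))"
 have ch: "((\<lambda>y. f (D * y)) has_vector_derivative of_real D * f' (D * y)) (at y)" if "!!t. (f has_vector_derivative f' t) (at t)" for f f' :: "real => complex" and y
 proof -
  have "((\<lambda>y. D * y) has_vector_derivative D) (at y)" by (auto intro!: derivative_eq_intros)
  from vector_diff_chain_at[OF this that[of "D * y"]] show ?thesis by (simp add: o_def scaleR_conv_of_real)
 qed
 have d1: "(h has_vector_derivative h1 y) (at y)" for y unfolding h_def h1_def by (rule ch[OF FF(1)])
 have d2: "(h1 has_vector_derivative h2 y) (at y)" for y unfolding h1_def h2_def by (intro has_vector_derivative_mult_right ch[OF FF(2)])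
 have "continuous_on UNIV (\<lambda>y. F2 (D * y))" by (rule continuous_on_compose2[OF FF(3)]) (auto intro!: continuous_intros)
 hence c2: "continuous_on UNIV h2" unfolding h2_def by (intro continuous_intros)
 have c0': "continuous_on UNIV h" unfolding h_def by (rule continuous_on_compose2[OF contF]) (auto intro!: continuous_intros)
 have out: "D * y \<notin> {c..d}" if "y \<notin> {c/D..d/D}" for y using that D by (auto simp: field_simps)
 have int: "set_integrable lborel {0<..} f" if "continuous_on UNIV f" "!!y. y \<notin> {c/D..d/D} ==> f y = 0" for f :: "real => complex"
 proof -
  have "set_integrable lborel {c/D..d/D} f"
   by (rule borel_integrable_atLeastAtMost'[OF continuous_on_subset[OF that(1)]]) auto
  moreover have "indicator {0<..} y *\<^sub>R f y = indicator {c/D..d/D} y *\<^sub>R f y" for y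
  proof (cases "y \<in> {c/D..d/D}")
   case True
   have "c / D > 0" using c0 D by simp
   thus ?thesis using True by (auto simp: indicator_def)
  qed (use that(2) in auto)
  ultimately show ?thesis unfolding set_integrable_def by (simp only:)
 qed
 have z: "\<forall>\<^sub>F y in at_right 0. y \<notin> {c/D..d/D}" "\<forall>\<^sub>F y in at_top. y \<notin> {c/D..d/D}"
 proof -
  have "c / D > 0" using c0 D by simp
  thus "\<forall>\<^sub>F y in at_right 0. y \<notin> {c/D..d/D}" unfolding eventually_at_right_field by (intro exI[of _ "c/D"]) auto
  show "\<forall>\<^sub>F y in at_top. y \<notin> {c/D..d/D}" using eventually_gt_at_top[of "d / D"] by eventually_elim auto
 qed
 have lim: "(f \<longlongrightarrow> 0) G" if "!!y. y \<notin> {c/D..d/D} ==> f y = 0" "\<forall>\<^sub>F y in G. y \<notin> {c/D..d/D}" for f :: "real => complex" and G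
  using that by (intro tendsto_eventually) (auto elim!: eventually_mono)
 have h0: "h y = 0" "h1 y = 0" "h2 y = 0" "of_real (y\<^sup>2) * h2 y = 0" "of_real y * h1 y = 0" if "y \<notin> {c/D..d/D}" for y
  using F_eq_0[OF out[OF that]] FF(4)[OF out[OF that]] FF(5)[OF out[OF that]] by (auto simp: h_def h1_def h2_def)
 have c3: "continuous_on UNIV (\<lambda>y. of_real (y\<^sup>2) * h2 y)" by (intro continuous_intros c2)
 have I0: "set_integrable lborel {0<..} h" by (rule int[OF c0']) (rule h0)
 have I2: "set_integrable lborel {0<..} h2" by (rule int[OF c2]) (rule h0)
 have I3: "set_integrable lborel {0<..} (\<lambda>y. of_real (y\<^sup>2) * h2 y)" by (rule int[OF c3]) (rule h0)
 have L0: "(h \<longlongrightarrow> 0) (at_right 0)" "(h1 \<longlongrightarrow> 0) (at_right 0)" by (rule lim[OF _ z(1)], rule h0, assumption)+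
 have L1: "(h \<longlongrightarrow> 0) at_top" "((\<lambda>y. of_real y * h1 y) \<longlongrightarrow> 0) at_top" by (rule lim[OF _ z(2)], rule h0, assumption)+
 note P = poisson_summation_character[OF chi d1 d2 continuous_on_subset[OF c2 subset_UNIV] I0 I2 I3 L0 L1]
 show "summable (\<lambda>m. chi (int (Suc m)) * F (D * real (Suc m)))" using P(1) unfolding h_def .
 have "(LINT x:{0<..}|lborel. h x * of_real (cos (2 * pi * real (Suc n) / real q * x))) = cosint 0 (real (Suc n) / real q / D) / of_real D" for n
 proof -
  define w where "w = 2 * pi * real (Suc n) / real q"
  have "(LINT x:{0<..}|lborel. h x * of_real (cos (w * x))) = (LINT x|lborel. indicator {0<..} x *\<^sub>R (F (D * x) * of_real (cos (w * x))))"
   by (simp add: set_lebesgue_integral_def h_def)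
  also have "\<dots> = \<bar>1 / D\<bar> *\<^sub>R (LINT x|lborel. indicator {0<..} (0 + 1 / D * x) *\<^sub>R (F (D * (0 + 1 / D * x)) * of_real (cos (w * (0 + 1 / D * x)))))"
   by (rule lborel_integral_real_affine) (use D in auto)
  also have "(\<lambda>x. indicator {0<..} (0 + 1 / D * x) *\<^sub>R (F (D * (0 + 1 / D * x)) * of_real (cos (w * (0 + 1 / D * x)))))
   = (\<lambda>x. indicator {c..d} x *\<^sub>R (F x * complex_of_real (cos (w / D * x))))"
  proof
   fix x
   show "indicator {0<..} (0 + 1 / D * x) *\<^sub>R (F (D * (0 + 1 / D * x)) * of_real (cos (w * (0 + 1 / D * x)))) = indicator {c..d} x *\<^sub>R (F x * complex_of_real (cos (w / D * x)))"
    using D c0 F_eq_0[of x] by (cases "x \<in> {c..d}") (auto simp: indicator_def)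
  qed
  also have "(LINT x|lborel. indicator {c..d} x *\<^sub>R (F x * complex_of_real (cos (w / D * x)))) = integral {c..d} (\<lambda>t. F t * of_real (cos (w / D * t)))"
  proof -
   have "set_integrable lborel {c..d} (\<lambda>t. F t * complex_of_real (cos (w / D * t)))"
    by (intro borel_integrable_atLeastAtMost' continuous_intros continuous_on_F)
   from set_borel_integral_eq_integral(2)[OF this] show ?thesis by (simp add: set_lebesgue_integral_def)
  qed
  also have "\<dots> = cosint 0 (real (Suc n) / real q / D)"
   unfolding cosint_0 w_def by (simp add: mult_ac del: of_nat_Suc)
  finally show ?thesis using D by (simp add: w_def scaleR_conv_of_real del: of_nat_Suc)
 qed
 thus "(\<lambda>n. gauss_sum q chi * cnj (chi (int (Suc n))) * (cosint 0 (real (Suc n) / real q / D) / of_real D))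
   sums (of_nat q / 2 * (\<Sum>m. chi (int (Suc m)) * F (D * real (Suc m))))"
  using P(2) unfolding h_def by (simp only:)
qed

end

section \<open>The integral of x powr (-\<nu> - 1) against two cosines\<close>

lemma hint_regularised:
 assumes x: "x > 0"
 shows "hint \<nu> (of_real \<delta> - \<i> * of_real a) (of_real \<delta> - \<i> * of_real b) x
  = of_real x powr (- \<nu> - 1) * of_real (exp (- \<delta> * x - \<delta> / x)) * (cis (a * x) * cis (b / x))"
proof -
 have e: "- (of_real \<delta> - \<i> * of_real a) * of_real x - (of_real \<delta> - \<i> * of_real b) / of_real x
  = of_real (- \<delta> * x - \<delta> / x) + (\<i> * of_real (a * x) + \<i> * of_real (b / x))"
  by (simp add: algebra_simps diff_divide_distrib)
 show ?thesis unfolding hint_def e exp_add cis_conv_exp by (simp only: exp_of_real mult.assoc)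
qed

text \<open>Mean over the four sign choices in cos(A x) cos(b/x) of the closed form of
  \<open>integral_hint\<close>. The formula keeps a meaning at \<delta> = 0, where the integral over
  x no longer converges absolutely.\<close>

definition kernel_limit :: "complex => real => real => real => complex" where
 "kernel_limit \<nu> A b \<delta> = (let \<Phi> = (\<lambda>a b. of_real pi / sin (of_real pi * \<nu>) * (b powr (- \<nu>) * bessel_series (- \<nu>) (a * b) - a powr \<nu> * bessel_series \<nu> (a * b))) in
  (\<Phi> (of_real \<delta> - \<i> * of_real A) (of_real \<delta> - \<i> * of_real b) + \<Phi> (of_real \<delta> - \<i> * of_real A) (of_real \<delta> - \<i> * of_real (- b))
   + \<Phi> (of_real \<delta> - \<i> * of_real (- A)) (of_real \<delta> - \<i> * of_real b) + \<Phi> (of_real \<delta> - \<i> * of_real (- A)) (of_real \<delta> - \<i> * of_real (- b))) / 4)"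

lemma kernel_limit_integral:
 assumes nu: "\<nu> \<notin> \<int>" and \<delta>: "\<delta> > 0"
 shows "(LINT x:{0<..}|lborel. of_real x powr (- \<nu> - 1) * of_real (exp (- \<delta> * x - \<delta> / x)) * of_real (cos (A * x)) * of_real (cos (b / x))) = kernel_limit \<nu> A b \<delta>"
proof -
 let ?h = "\<lambda>a b x. hint \<nu> (of_real \<delta> - \<i> * of_real a) (of_real \<delta> - \<i> * of_real b) x"
 have i: "set_integrable lborel {0<..} (?h a b)" for a b by (rule set_integrable_hint) (use \<delta> in auto)
 have eq: "of_real x powr (- \<nu> - 1) * of_real (exp (- \<delta> * x - \<delta> / x)) * of_real (cos (A * x)) * of_real (cos (b / x))
  = (?h A b x + ?h A (- b) x + ?h (- A) b x + ?h (- A) (- b) x) / 4" if "x \<in> {0<..}" for x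
 proof -
  have x: "x > 0" using that by simp
  have c: "of_real (cos a) = (cis a + cis (- a)) / 2" for a by (simp add: complex_eq_iff)
  have g: "p * e * ((a1 + a2) / 2) * ((b1 + b2) / 2) = (p * e * (a1 * b1) + p * e * (a1 * b2) + p * e * (a2 * b1) + p * e * (a2 * b2)) / 4" for p e a1 a2 b1 b2 :: complex
   by (simp add: field_simps)
  show ?thesis unfolding hint_regularised[OF x] c g by (simp only: mult_minus_left minus_divide_left)
 qed
 have v: "(LINT x:{0<..}|lborel. ?h a b x) = of_real pi / sin (of_real pi * \<nu>) * ((of_real \<delta> - \<i> * of_real b) powr (- \<nu>) * bessel_series (- \<nu>) ((of_real \<delta> - \<i> * of_real a) * (of_real \<delta> - \<i> * of_real b))
   - (of_real \<delta> - \<i> * of_real a) powr \<nu> * bessel_series \<nu> ((of_real \<delta> - \<i> * of_real a) * (of_real \<delta> - \<i> * of_real b)))" for a b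
  by (rule integral_hint) (use \<delta> nu in auto)
 have "(LINT x:{0<..}|lborel. of_real x powr (- \<nu> - 1) * of_real (exp (- \<delta> * x - \<delta> / x)) * of_real (cos (A * x)) * of_real (cos (b / x)))
  = (LINT x:{0<..}|lborel. (?h A b x + ?h A (- b) x + ?h (- A) b x + ?h (- A) (- b) x) / 4)"
  by (intro set_lebesgue_integral_cong) (use eq in auto)
 also have "\<dots> = ((LINT x:{0<..}|lborel. ?h A b x) + (LINT x:{0<..}|lborel. ?h A (- b) x) + (LINT x:{0<..}|lborel. ?h (- A) b x) + (LINT x:{0<..}|lborel. ?h (- A) (- b) x)) / 4"
  unfolding set_integral_divide_zero
  by (subst set_integral_add, intro set_integral_add i, rule i, subst set_integral_add, intro set_integral_add i, rule i, subst set_integral_add, rule i, rule i, rule refl)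
 also have "\<dots> = kernel_limit \<nu> A b \<delta>" unfolding v kernel_limit_def Let_def ..
 finally show ?thesis .
qed

text \<open>At \<delta> = 0 the product of the two parameters is -A b for equal signs and A b for
  opposite signs; this produces the J part and the I part. The principal powers contribute the
  phases exp(i pi \<nu>/2) and exp(-i pi \<nu>/2), whose sum 2 cos(pi \<nu>/2) cancels the cosine
  contained in sin(pi \<nu>).\<close>

lemma kernel_limit_0:
 assumes nu: "\<nu> \<notin> \<int>" and A: "A > 0" and b: "b > 0"
 shows "kernel_limit \<nu> A b 0 = of_real pi / 2 * (of_real (A / b) powr (\<nu> / 2) * vkernel \<nu> (2 * sqrt (A * b)))"
proof -
 let ?s = "sin (of_real pi * \<nu> / 2)" and ?c = "cos (of_real pi * \<nu> / 2)"
 note sc = sin_cos_half_nonzero[OF nu]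
 define P where "P = complex_of_real b powr (- \<nu>)"
 define Q where "Q = complex_of_real A powr \<nu>"
 define w where "w = complex_of_real (A * b)"
 define e where "e = exp (\<i> * of_real pi * \<nu> / 2)"
 define e' where "e' = exp (- (\<i> * of_real pi * \<nu> / 2))"
 have ee: "e + e' = 2 * ?c" unfolding e_def e'_def cos_exp_eq by (simp add: mult.assoc)
 have m: "(of_real 0 - \<i> * of_real y) powr z = of_real y powr z * exp (- (\<i> * of_real pi * z / 2))" if "y > 0" for y :: real and z
 proof -
  have e: "of_real 0 - \<i> * of_real y = of_real y * (- \<i>)" by simp
  have l: "Ln (of_real y * (- \<i>)) = Ln (of_real y) + Ln (- \<i>)" by (rule Ln_times_of_real[OF that]) simp
  show ?thesis unfolding e powr_def l using that by (simp add: Ln_minus_ii exp_add[symmetric] algebra_simps)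
 qed
 have p: "(of_real 0 - \<i> * of_real (- y)) powr z = of_real y powr z * exp (\<i> * of_real pi * z / 2)" if "y > 0" for y :: real and z
 proof -
  have e: "of_real 0 - \<i> * of_real (- y) = of_real y * \<i>" by simp
  have l: "Ln (of_real y * \<i>) = Ln (of_real y) + Ln \<i>" by (rule Ln_times_of_real[OF that]) simp
  show ?thesis unfolding e powr_def l using that by (simp add: Ln_ii exp_add[symmetric] algebra_simps)
 qed
 have pw: "(of_real 0 - \<i> * of_real b) powr (- \<nu>) = P * e" "(of_real 0 - \<i> * of_real (- b)) powr (- \<nu>) = P * e'"
  "(of_real 0 - \<i> * of_real A) powr \<nu> = Q * e'" "(of_real 0 - \<i> * of_real (- A)) powr \<nu> = Q * e"
  unfolding m[OF b] p[OF b] m[OF A] p[OF A] P_def Q_def e_def e'_def by simp_all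
 have pr: "(of_real 0 - \<i> * of_real A) * (of_real 0 - \<i> * of_real b) = - w" "(of_real 0 - \<i> * of_real A) * (of_real 0 - \<i> * of_real (- b)) = w"
  "(of_real 0 - \<i> * of_real (- A)) * (of_real 0 - \<i> * of_real b) = w" "(of_real 0 - \<i> * of_real (- A)) * (of_real 0 - \<i> * of_real (- b)) = - w"
  unfolding w_def by (simp_all add: complex_eq_iff)
 define T where "T = P * (bessel_series (- \<nu>) w + bessel_series (- \<nu>) (- w)) - Q * (bessel_series \<nu> w + bessel_series \<nu> (- w))"
 have g: "(k * (P' * f1 * x' - Q' * f2 * y') + k * (P' * f2 * x - Q' * f2 * y) + k * (P' * f1 * x - Q' * f1 * y) + k * (P' * f2 * x' - Q' * f1 * y')) / 4
  = k / 4 * ((f1 + f2) * (P' * (x + x') - Q' * (y + y')))" for k P' Q' f1 f2 x x' y y' :: complex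
  by (simp add: field_simps)
 have "kernel_limit \<nu> A b 0 = of_real pi / sin (of_real pi * \<nu>) / 4 * ((e + e') * T)"
  unfolding kernel_limit_def Let_def pw pr T_def g ..
 also have "\<dots> = of_real pi / (4 * ?s) * T" unfolding ee sc(1) using sc(2,3) by (simp add: divide_simps)
 finally have L: "kernel_limit \<nu> A b 0 = of_real pi / (4 * ?s) * T" .
 have half: "2 * sqrt (A * b) / 2 = sqrt (A * b)" by simp
 have sq: "(complex_of_real (sqrt (A * b)))\<^sup>2 = w" unfolding w_def using A b by (simp flip: of_real_power of_real_mult)
 have ab: "A * b > 0" using A b by simp
 have lnAb: "ln (A * b) = ln A + ln b" "ln (A / b) = ln A - ln b" using A b by (auto simp: ln_mult ln_div)
 have lns: "ln (sqrt (A * b)) = (ln A + ln b) / 2" using ab lnAb by (simp add: ln_sqrt)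
 have pp: "complex_of_real (A / b) powr (\<nu> / 2) * of_real (sqrt (A * b)) powr z = exp (\<nu> / 2 * of_real (ln A - ln b) + z * of_real ((ln A + ln b) / 2))" for z
  unfolding powr_def using A b ab by (simp add: Ln_of_real lns lnAb exp_add del: of_real_divide of_real_add of_real_diff)
 have r1: "complex_of_real (A / b) powr (\<nu> / 2) * of_real (sqrt (A * b)) powr (- \<nu>) = P"
 proof -
  have "\<nu> / 2 * of_real (ln A - ln b) + (- \<nu>) * of_real ((ln A + ln b) / 2) = - \<nu> * of_real (ln b)" by (simp add: field_simps)
  thus ?thesis unfolding pp P_def using b by (simp add: powr_def Ln_of_real)
 qed
 have r2: "complex_of_real (A / b) powr (\<nu> / 2) * of_real (sqrt (A * b)) powr \<nu> = Q"
 proof -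
  have "\<nu> / 2 * of_real (ln A - ln b) + \<nu> * of_real ((ln A + ln b) / 2) = \<nu> * of_real (ln A)" by (simp add: field_simps)
  thus ?thesis unfolding pp Q_def using A by (simp add: powr_def Ln_of_real)
 qed
 have g2: "R * (((S1 * x - S2 * y) + (S1 * x' - S2 * y')) / D) = ((R * S1) * (x + x') - (R * S2) * (y + y')) / D" for R S1 S2 x y x' y' D :: complex
  by (simp add: divide_inverse algebra_simps)
 have "complex_of_real (A / b) powr (\<nu> / 2) * vkernel \<nu> (2 * sqrt (A * b)) = T / (2 * ?s)"
  unfolding vkernel_eq[OF nu] besselI_eq besselJ_eq half sq g2 r1 r2 T_def ..
 thus ?thesis unfolding L by simp
qed

text \<open>The parameters have nonzero imaginary parts also at \<delta> = 0, so the principal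
  powers stay off their cut. Joint continuity on a compact set supplies the dominating constant for
  the limit \<delta> -> 0.\<close>

lemma continuous_on_kernel_limit:
 assumes A: "A > 0" and B: "B > 0" and c: "c > 0"
 shows "continuous_on ({0..1} \<times> {c..d}) (\<lambda>(\<delta>, t). kernel_limit \<nu> A (B * t) \<delta>)"
proof -
 let ?S = "{0..1::real} \<times> {c..d}"
 have gen: "continuous_on ?S (\<lambda>p. k * (b p powr (- \<nu>) * bessel_series (- \<nu>) (a p * b p) - a p powr \<nu> * bessel_series \<nu> (a p * b p)))"
  if ca: "continuous_on ?S a" and cb: "continuous_on ?S b" and na: "!!p. p \<in> ?S ==> Im (a p) \<noteq> 0" and nb: "!!p. p \<in> ?S ==> Im (b p) \<noteq> 0"
  for a b :: "real \<times> real => complex" and k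
 proof -
  have sub: "?S \<subseteq> {p. 0 \<le> Re (a p) \<or> Im (a p) \<noteq> 0}" "?S \<subseteq> {p. 0 \<le> Re (b p) \<or> Im (b p) \<noteq> 0}" using na nb by blast+
  have z: "a p = 0 ==> 0 < Re z" "b p = 0 ==> 0 < Re z" if "p \<in> ?S" for p z using na[OF that] nb[OF that] by auto
  have pa: "continuous_on ?S (\<lambda>p. a p powr \<nu>)" by (rule continuous_on_powr_complex[OF sub(1) z(1) ca continuous_on_const])
  have pb: "continuous_on ?S (\<lambda>p. b p powr (- \<nu>))" by (rule continuous_on_powr_complex[OF sub(2) z(2) cb continuous_on_const])
  show ?thesis by (intro continuous_on_mult continuous_on_diff continuous_on_const continuous_on_bessel_series ca cb pa pb)
 qed
 have ca: "continuous_on ?S (\<lambda>p. of_real (fst p) - \<i> * of_real y)" for y :: real by (intro continuous_intros)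
 have cb: "continuous_on ?S (\<lambda>p. of_real (fst p) - \<i> * of_real (B * snd p))" by (intro continuous_intros)
 have cb': "continuous_on ?S (\<lambda>p. of_real (fst p) - \<i> * of_real (- (B * snd p)))" by (intro continuous_intros)
 have nA: "Im (complex_of_real (fst p) - \<i> * of_real A) \<noteq> 0" "Im (complex_of_real (fst p) - \<i> * of_real (- A)) \<noteq> 0" for p
  using A by simp_all
 have nB: "Im (complex_of_real (fst p) - \<i> * of_real (B * snd p)) \<noteq> 0" "Im (complex_of_real (fst p) - \<i> * of_real (- (B * snd p))) \<noteq> 0"
  if "p \<in> ?S" for p using B c that by auto
 show ?thesis
  unfolding kernel_limit_def Let_def case_prod_beta
  by (intro continuous_on_divide continuous_on_add continuous_on_const gen[OF ca cb nA(1) nB(1)] gen[OF ca cb' nA(1) nB(2)] gen[OF ca cb nA(2) nB(1)] gen[OF ca cb' nA(2) nB(2)]) auto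
qed

context test_function
begin

text \<open>The damping makes x powr (-\<nu> - 1) absolutely integrable at both ends, which permits
  the exchange of the x-integral with the t-integral hidden in \<open>hk\<close>.\<close>

lemma regularised_fubini:
 assumes nu: "\<nu> \<notin> \<int>" and \<delta>: "\<delta> > 0"
 shows "(LINT x:{0<..}|lborel. hk \<nu> u x * of_real (cos (A * x)) * of_real (exp (- \<delta> * x - \<delta> / x)))
  = (LINT t:{c..d}|lborel. F t * kernel_limit \<nu> A (2 * pi * u * t) \<delta>)"
proof -
 define k where "k = (\<lambda>x t. complex_of_real x powr (- \<nu> - 1) * of_real (exp (- \<delta> * x - \<delta> / x)) * of_real (cos (A * x)) * of_real (cos (2 * pi * u * t / x)))"
 define G where "G = (\<lambda>t. indicator {c..d} t *\<^sub>R F t)"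
 have Gm [measurable]: "G \<in> borel_measurable borel"
  unfolding G_def by (rule borel_measurable_continuous_on_indicator[OF _ continuous_on_F]) auto
 have Gi: "integrable lborel G"
  using borel_integrable_atLeastAtMost'[OF continuous_on_F] unfolding G_def set_integrable_def .
 define f where "f = (\<lambda>(x, t). indicator {0<..} x *\<^sub>R (G t * k x t))"
 have fm: "f \<in> borel_measurable (lborel \<Otimes>\<^sub>M lborel)"
  unfolding f_def k_def by measurable
 define W where "W = (\<lambda>x. norm (hint \<nu> (of_real \<delta>) (of_real \<delta>) x))"
 have Wi: "set_integrable lborel {0<..} W" unfolding W_def by (intro set_integrable_norm set_integrable_hint) (use \<delta> in auto)
 have kW: "norm (k x t) \<le> W x" if "x > 0" for x t
 proof -
  have "norm (k x t) = x powr (- Re \<nu> - 1) * exp (- \<delta> * x - \<delta> / x) * \<bar>cos (A * x)\<bar> * \<bar>cos (2 * pi * u * t / x)\<bar>"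
   using that by (simp add: k_def norm_mult norm_powr_of_real)
  also have "\<dots> \<le> x powr (- Re \<nu> - 1) * exp (- \<delta> * x - \<delta> / x) * 1 * 1" by (intro mult_mono) auto
  finally show ?thesis using that by (simp add: W_def norm_hint)
 qed
 have fb: "norm (f (x, t)) \<le> (indicator {0<..} x *\<^sub>R W x) * norm (G t)" for x t
 proof (cases "x > 0")
  case True
  have "norm (f (x, t)) = norm (k x t) * norm (G t)" using True by (simp add: f_def norm_mult mult.commute)
  also have "\<dots> \<le> W x * norm (G t)" by (intro mult_right_mono kW True) auto
  finally show ?thesis using True by simp
 qed (auto simp: f_def)
 have fx: "integrable lborel (\<lambda>t. f (x, t))" for x
 proof (rule Bochner_Integration.integrable_bound)
  show "integrable lborel (\<lambda>t. (indicator {0<..} x *\<^sub>R W x) * norm (G t))" using Gi by auto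
  show "(\<lambda>t. f (x, t)) \<in> borel_measurable lborel" using fm by measurable
  show "AE t in lborel. norm (f (x, t)) \<le> norm ((indicator {0<..} x *\<^sub>R W x) * norm (G t))"
   using fb by (intro AE_I2 order_trans[OF fb]) auto
 qed
 have fi: "integrable (lborel \<Otimes>\<^sub>M lborel) f"
 proof (rule lborel_pair.Fubini_integrable[OF fm])
  show "AE x in lborel. integrable lborel (\<lambda>y. f (x, y))" using fx by auto
  show "integrable lborel (\<lambda>x. LINT y|lborel. norm (f (x, y)))"
  proof (rule Bochner_Integration.integrable_bound)
   show "integrable lborel (\<lambda>x. (indicator {0<..} x *\<^sub>R W x) * (LINT t|lborel. norm (G t)))"
    using Wi unfolding set_integrable_def by auto
   show "(\<lambda>x. LINT y|lborel. norm (f (x, y))) \<in> borel_measurable lborel" using fm by measurable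
   show "AE x in lborel. norm (LINT y|lborel. norm (f (x, y))) \<le> norm ((indicator {0<..} x *\<^sub>R W x) * (LINT t|lborel. norm (G t)))"
   proof (intro AE_I2)
    fix x
    have "(LINT y|lborel. norm (f (x, y))) \<le> (LINT y|lborel. (indicator {0<..} x *\<^sub>R W x) * norm (G y))"
     by (intro integral_mono) (use fx fb Gi in auto)
    also have "\<dots> = (indicator {0<..} x *\<^sub>R W x) * (LINT t|lborel. norm (G t))" by simp
    finally show "norm (LINT y|lborel. norm (f (x, y))) \<le> norm ((indicator {0<..} x *\<^sub>R W x) * (LINT t|lborel. norm (G t)))"
     by (simp add: Bochner_Integration.integral_nonneg)
   qed
  qed
 qed
 have "(LINT t|lborel. LINT x|lborel. f (x, t)) = (LINT x|lborel. LINT t|lborel. f (x, t))"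
  by (rule lborel_pair.Fubini_integral) (use fi in simp)
 moreover have "(LINT x|lborel. LINT t|lborel. f (x, t)) = (LINT x:{0<..}|lborel. hk \<nu> u x * of_real (cos (A * x)) * of_real (exp (- \<delta> * x - \<delta> / x)))"
  unfolding set_lebesgue_integral_def
 proof (rule Bochner_Integration.integral_cong[OF refl])
  fix x
  show "(LINT t|lborel. f (x, t)) = indicator {0<..} x *\<^sub>R (hk \<nu> u x * of_real (cos (A * x)) * of_real (exp (- \<delta> * x - \<delta> / x)))"
  proof (cases "x > 0")
   case True
   let ?p = "of_real x powr (- \<nu> - 1) * of_real (exp (- \<delta> * x - \<delta> / x)) * complex_of_real (cos (A * x))"
   have "(LINT t|lborel. f (x, t)) = (LINT t|lborel. ?p * (indicator {c..d} t *\<^sub>R (F t * of_real (cos (2 * pi * (u / x) * t)))))"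
    using True by (intro Bochner_Integration.integral_cong refl) (auto simp: f_def k_def G_def indicator_def)
   also have "\<dots> = ?p * (LINT t:{c..d}|lborel. F t * of_real (cos (2 * pi * (u / x) * t)))"
    unfolding set_lebesgue_integral_def by (rule integral_mult_right_zero)
   also have "(LINT t:{c..d}|lborel. F t * of_real (cos (2 * pi * (u / x) * t))) = cosint 0 (u / x)"
    unfolding cosint_0
    by (intro set_borel_integral_eq_integral borel_integrable_atLeastAtMost' continuous_intros continuous_on_F)
   finally show ?thesis using True by (simp add: hk_def mult_ac)
  qed (simp add: f_def)
 qed
 moreover have "(LINT t|lborel. LINT x|lborel. f (x, t)) = (LINT t:{c..d}|lborel. F t * kernel_limit \<nu> A (2 * pi * u * t) \<delta>)"
  unfolding set_lebesgue_integral_def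
 proof (rule Bochner_Integration.integral_cong[OF refl])
  fix t
  have "(LINT x|lborel. f (x, t)) = (LINT x|lborel. G t * (indicator {0<..} x *\<^sub>R k x t))"
   by (intro Bochner_Integration.integral_cong refl) (auto simp: f_def)
  also have "\<dots> = G t * (LINT x:{0<..}|lborel. k x t)" unfolding set_lebesgue_integral_def by (rule integral_mult_right_zero)
  also have "(LINT x:{0<..}|lborel. k x t) = kernel_limit \<nu> A (2 * pi * u * t) \<delta>"
   unfolding k_def by (rule kernel_limit_integral[OF nu \<delta>])
  finally show "(LINT x|lborel. f (x, t)) = indicator {c..d} t *\<^sub>R (F t * kernel_limit \<nu> A (2 * pi * u * t) \<delta>)" by (simp add: G_def)
 qed
 ultimately show ?thesis by simp
qed

text \<open>Both sides of \<open>regularised_fubini\<close> converge as \<delta> -> 0: the left by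
  domination through the integrable \<open>hk\<close>, the right by continuity of
  \<open>kernel_limit\<close>. The undamped x-integral is absolutely convergent only after the
  t-integration has been carried out, hence the detour.\<close>

theorem hk_cos_integral:
 assumes nu: "\<nu> \<notin> \<int>" and u: "u > 0" and A: "A > 0" and i: "set_integrable lborel {0<..} (hk \<nu> u)"
 shows "(LINT x:{0<..}|lborel. hk \<nu> u x * of_real (cos (A * x)))
  = of_real pi / 2 * integral {c..d} (\<lambda>t. F t * (of_real (A / (2 * pi * u * t)) powr (\<nu> / 2) * vkernel \<nu> (2 * sqrt (A * (2 * pi * u * t)))))"
proof -
 define \<delta> where "\<delta> = (\<lambda>n. 1 / real (Suc n))"
 have \<delta>: "\<delta> n > 0" "\<delta> n \<le> 1" for n by (auto simp: \<delta>_def)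
 have \<delta>lim: "\<delta> \<longlonglongrightarrow> 0" unfolding \<delta>_def using LIMSEQ_inverse_real_of_nat by (simp add: inverse_eq_divide)
 define B where "B = 2 * pi * u"
 have B: "B > 0" using u by (simp add: B_def)
 have bm: "(\<lambda>x. indicator {0<..} x *\<^sub>R hk \<nu> u x) \<in> borel_measurable lborel"
  using i unfolding set_integrable_def by (rule borel_measurable_integrable)
 have M1: "(\<lambda>n. LINT x:{0<..}|lborel. hk \<nu> u x * of_real (cos (A * x)) * of_real (exp (- \<delta> n * x - \<delta> n / x)))
  \<longlonglongrightarrow> (LINT x:{0<..}|lborel. hk \<nu> u x * of_real (cos (A * x)))"
 proof (rule set_integral_dominated_convergence[where w = "\<lambda>x. norm (hk \<nu> u x)"])
  show b: "norm (hk \<nu> u x * of_real (cos (A * x)) * of_real (exp (- \<delta> n * x - \<delta> n / x))) \<le> norm (hk \<nu> u x)" if "x \<in> {0<..}" for n x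
  proof -
   have "\<delta> n * x \<ge> 0" "\<delta> n / x \<ge> 0" using that \<delta>(1)[of n] by simp_all
   hence "- \<delta> n * x - \<delta> n / x \<le> 0" by simp
   hence "exp (- \<delta> n * x - \<delta> n / x) \<le> 1" by simp
   hence "norm (hk \<nu> u x) * \<bar>cos (A * x)\<bar> * exp (- \<delta> n * x - \<delta> n / x) \<le> norm (hk \<nu> u x) * 1 * 1"
    by (intro mult_mono) auto
   thus ?thesis by (simp add: norm_mult)
  qed
  have m: "(\<lambda>x. (indicator {0<..} x *\<^sub>R hk \<nu> u x) * complex_of_real (cos (A * x)) * complex_of_real (exp (- \<delta> n * x - \<delta> n / x))) \<in> borel_measurable lborel" for n
   using bm by measurable
  show "set_integrable lborel {0<..} (\<lambda>x. hk \<nu> u x * of_real (cos (A * x)) * of_real (exp (- \<delta> n * x - \<delta> n / x)))" for n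
  proof (rule set_integrable_bound[OF i])
   show "set_borel_measurable lborel {0<..} (\<lambda>x. hk \<nu> u x * of_real (cos (A * x)) * of_real (exp (- \<delta> n * x - \<delta> n / x)))"
    using m[of n] unfolding set_borel_measurable_def by (simp only: mult_scaleR_left)
   show "AE x in lborel. x \<in> {0<..} \<longrightarrow> norm (hk \<nu> u x * of_real (cos (A * x)) * of_real (exp (- \<delta> n * x - \<delta> n / x))) \<le> norm (hk \<nu> u x)"
    using b by (intro AE_I2) auto
  qed
  have "(\<lambda>x. (indicator {0<..} x *\<^sub>R hk \<nu> u x) * complex_of_real (cos (A * x))) \<in> borel_measurable lborel" using bm by measurable
  thus "set_borel_measurable lborel {0<..} (\<lambda>x. hk \<nu> u x * of_real (cos (A * x)))"
   unfolding set_borel_measurable_def by (simp only: mult_scaleR_left)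
  show "set_integrable lborel {0<..} (\<lambda>x. norm (hk \<nu> u x))" by (rule set_integrable_norm[OF i])
  show "(\<lambda>n. hk \<nu> u x * of_real (cos (A * x)) * of_real (exp (- \<delta> n * x - \<delta> n / x))) \<longlonglongrightarrow> hk \<nu> u x * of_real (cos (A * x))" if "x \<in> {0<..}" for x
  proof -
   have "(\<lambda>n. hk \<nu> u x * of_real (cos (A * x)) * of_real (exp (- \<delta> n * x - \<delta> n / x))) \<longlonglongrightarrow> hk \<nu> u x * of_real (cos (A * x)) * of_real (exp (- 0 * x - 0 / x))"
    by (intro tendsto_intros \<delta>lim) (use that in auto)
   thus ?thesis by simp
  qed
 qed
 let ?Z = "\<lambda>\<delta> t. kernel_limit \<nu> A (B * t) \<delta>"
 have cZ: "continuous_on ({0..1} \<times> {c..d}) (\<lambda>(\<delta>, t). ?Z \<delta> t)" by (rule continuous_on_kernel_limit[OF A B c0])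
 have cZt: "continuous_on {c..d} (?Z \<delta>)" if "\<delta> \<in> {0..1}" for \<delta>
 proof -
  have 1: "continuous_on {c..d} (\<lambda>t. (\<delta>, t))" by (intro continuous_intros)
  have 2: "(\<lambda>t. (\<delta>, t)) ` {c..d} \<subseteq> {0..1} \<times> {c..d}" using that by auto
  from continuous_on_compose2[OF cZ 1 2] show ?thesis by simp
 qed
 have "compact ({0..1::real} \<times> {c..d})" by (intro compact_Times) auto
 hence "bounded ((\<lambda>(\<delta>, t). ?Z \<delta> t) ` ({0..1} \<times> {c..d}))" by (intro compact_imp_bounded compact_continuous_image cZ)
 then obtain Bd where Bd: "!!\<delta> t. \<delta> \<in> {0..1} ==> t \<in> {c..d} ==> norm (?Z \<delta> t) \<le> Bd"
  unfolding bounded_iff by fastforce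
 have M2: "(\<lambda>n. LINT t:{c..d}|lborel. F t * ?Z (\<delta> n) t) \<longlonglongrightarrow> (LINT t:{c..d}|lborel. F t * ?Z 0 t)"
 proof (rule set_integral_dominated_convergence[where w = "\<lambda>t. norm (F t) * Bd"])
  show "set_integrable lborel {c..d} (\<lambda>t. F t * ?Z (\<delta> n) t)" for n
   by (intro borel_integrable_atLeastAtMost' continuous_on_mult continuous_on_F cZt) (use \<delta>[of n] in auto)
  have "set_integrable lborel {c..d} (\<lambda>t. F t * ?Z 0 t)"
   by (intro borel_integrable_atLeastAtMost' continuous_on_mult continuous_on_F cZt) auto
  thus "set_borel_measurable lborel {c..d} (\<lambda>t. F t * ?Z 0 t)"
   unfolding set_integrable_def set_borel_measurable_def by (rule borel_measurable_integrable)
  show "set_integrable lborel {c..d} (\<lambda>t. norm (F t) * Bd)"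
   by (intro borel_integrable_atLeastAtMost' continuous_intros continuous_on_F)
  show "norm (F t * ?Z (\<delta> n) t) \<le> norm (F t) * Bd" if "t \<in> {c..d}" for n t
   unfolding norm_mult using that \<delta>[of n] by (intro mult_left_mono Bd) auto
  show "(\<lambda>n. F t * ?Z (\<delta> n) t) \<longlonglongrightarrow> F t * ?Z 0 t" if "t \<in> {c..d}" for t
  proof (intro tendsto_mult tendsto_const)
   have "continuous_on {0..1} (\<lambda>\<delta>. ?Z \<delta> t)"
   proof -
    have 1: "continuous_on {0..1} (\<lambda>\<delta>::real. (\<delta>, t))" by (intro continuous_intros)
    have 2: "(\<lambda>\<delta>. (\<delta>, t)) ` {0..1} \<subseteq> {0..1} \<times> {c..d}" using that by auto
    from continuous_on_compose2[OF cZ 1 2] show ?thesis by simp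
   qed
   thus "(\<lambda>n. ?Z (\<delta> n) t) \<longlonglongrightarrow> ?Z 0 t"
    by (rule continuous_on_tendsto_compose[OF _ \<delta>lim]) (use \<delta> in \<open>auto simp: less_imp_le\<close>)
  qed
 qed
 have "(LINT x:{0<..}|lborel. hk \<nu> u x * of_real (cos (A * x))) = (LINT t:{c..d}|lborel. F t * ?Z 0 t)"
  using M1 M2 unfolding regularised_fubini[OF nu \<delta>(1)] B_def by (rule LIMSEQ_unique)
 also have "\<dots> = integral {c..d} (\<lambda>t. F t * ?Z 0 t)"
  by (intro set_borel_integral_eq_integral borel_integrable_atLeastAtMost' continuous_on_mult continuous_on_F cZt) auto
 also have "\<dots> = integral {c..d} (\<lambda>t. of_real pi / 2 * (F t * (of_real (A / (B * t)) powr (\<nu> / 2) * vkernel \<nu> (2 * sqrt (A * (B * t))))))"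
 proof (rule integral_cong)
  fix t assume "t \<in> {c..d}"
  hence "B * t > 0" using B c0 by simp
  from kernel_limit_0[OF nu A this] show "F t * ?Z 0 t = of_real pi / 2 * (F t * (of_real (A / (B * t)) powr (\<nu> / 2) * vkernel \<nu> (2 * sqrt (A * (B * t)))))"
   by (simp only: mult.left_commute)
 qed
 also have "\<dots> = of_real pi / 2 * integral {c..d} (\<lambda>t. F t * (of_real (A / (B * t)) powr (\<nu> / 2) * vkernel \<nu> (2 * sqrt (A * (B * t)))))"
  by (rule integral_mult_right)
 finally show ?thesis unfolding B_def .
qed

end

section \<open>Divisor sums and the smooth formula\<close>

text \<open>Pairs (a, b) of positive integers correspond to pairs (n, d) with d dividing n through n
  = a b and d = a. Every index is shifted by one because the series start at 0.\<close>

lemma sums_divisor_regroup: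
 fixes e :: "nat => nat => complex" and x y :: "nat => real"
 assumes e: "!!a b. norm (e (Suc a) (Suc b)) \<le> x a * y b" and x: "summable x" "!!k. x k \<ge> 0" and y: "summable y" "!!k. y k \<ge> 0"
 shows "(\<lambda>k. \<Sum>d | d dvd Suc k. e d (Suc k div d)) sums (\<Sum>a. \<Sum>b. e (Suc a) (Suc b))"
proof -
 let ?T = "\<Sum>a. \<Sum>b. e (Suc a) (Suc b)"
 have "((\<lambda>(a, b). e (Suc a) (Suc b)) has_sum ?T) UNIV"
  unfolding double_suminf_swap(7)[of "\<lambda>a b. e (Suc a) (Suc b)", OF e x y]
  by (rule has_sum_infsum, rule double_suminf_swap(1)[of "\<lambda>a b. e (Suc a) (Suc b)", OF e x y])
 also have "((\<lambda>(a, b). e (Suc a) (Suc b)) has_sum ?T) UNIV \<longleftrightarrow> ((\<lambda>(k, d). e d (Suc k div d)) has_sum ?T) (Sigma UNIV (\<lambda>k. {d. d dvd Suc k}))"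
 proof (rule has_sum_reindex_bij_witness[where i = "\<lambda>(k, d). (d - 1, Suc k div d - 1)" and j = "\<lambda>(a, b). (Suc a * Suc b - 1, Suc a)"], goal_cases)
  case (1 a) show ?case by (cases a) (simp del: mult_Suc mult_Suc_right)
 next
  case (2 a) show ?case by (cases a) (simp del: mult_Suc mult_Suc_right)
 next
  case (3 b)
  then obtain k d where b: "b = (k, d)" "d dvd Suc k" by (cases b) auto
  have d: "d > 0" "Suc k div d > 0" using b(2) by (auto intro: Nat.gr0I simp: dvd_imp_le div_greater_zero_iff)
  have "d * (Suc k div d) = Suc k" using b(2) by (rule dvd_mult_div_cancel)
  thus ?case using d by (simp add: b del: mult_Suc mult_Suc_right)
 next
  case (5 a) show ?case by (cases a) (simp del: mult_Suc mult_Suc_right)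
 qed auto
 finally have "((\<lambda>k. \<Sum>d | d dvd Suc k. e d (Suc k div d)) has_sum ?T) UNIV"
  by (rule has_sum_SigmaD) auto
 thus ?thesis by (rule has_sum_imp_sums)
qed

text \<open>A vanishing Gauss sum would make all its twists vanish, that is, the whole finite
  Fourier transform of \<open>chi\<close>. Inverting the transform at the residue 1 gives q chi(1) =
  q, a contradiction.\<close>

lemma gauss_sum_nonzero:
 assumes chi: "dirichlet_character q chi" "primitive_character q chi" "\<not> principal_character q chi"
 shows "gauss_sum q chi \<noteq> 0"
proof
 assume 0: "gauss_sum q chi = 0"
 have q: "q > 1" using nonprincipal_character_modulus[OF chi(1,3)] by simp
 define c where "c = exp (2 * of_real pi * \<i> / of_nat q)"
 have cn: "c ^ n = exp (2 * of_real pi * \<i> * of_nat n / of_nat q)" for n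
  unfolding c_def by (simp add: exp_of_nat_mult[symmetric] mult_ac)
 have c0: "c \<noteq> 0" unfolding c_def by simp
 have cq: "c ^ q = 1" unfolding cn using q by simp
 have gs: "(\<Sum>a<q. (c ^ h / c) ^ a) = (if h = 1 then of_nat q else 0)" if "h < q" for h
 proof (cases "h = 1")
  case False
  have "c ^ h \<noteq> c ^ 1" unfolding cn using that q False complex_root_unity_eq[of q h 1] by simp
  hence "c ^ h / c \<noteq> 1" using c0 by simp
  moreover have "(c ^ h / c) ^ q = 1" by (simp add: power_divide cq flip: power_mult) (simp add: power_mult mult.commute[of h] cq)
  ultimately show ?thesis using False by (simp add: geometric_sum)
 qed (use c0 in simp)
 have "(\<Sum>h<q. chi (int h) * exp (2 * of_real pi * \<i> * of_int (int a * int h) / of_nat q)) = 0" for a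
  unfolding gauss_sum_twist[OF chi(1,2)] 0 by simp
 hence "0 = (\<Sum>a<q. (1 / c) ^ a * (\<Sum>h<q. chi (int h) * exp (2 * of_real pi * \<i> * of_int (int a * int h) / of_nat q)))" by simp
 also have "\<dots> = (\<Sum>a<q. \<Sum>h<q. chi (int h) * (c ^ h / c) ^ a)"
 proof (intro sum.cong refl, unfold sum_distrib_left, intro sum.cong refl)
  fix a h
  have "exp (2 * of_real pi * \<i> * of_int (int a * int h) / of_nat q) = c ^ (h * a)" unfolding cn by (simp add: mult_ac)
  thus "(1 / c) ^ a * (chi (int h) * exp (2 * of_real pi * \<i> * of_int (int a * int h) / of_nat q)) = chi (int h) * (c ^ h / c) ^ a"
   by (simp add: power_divide power_mult)
 qed
 also have "\<dots> = (\<Sum>h<q. chi (int h) * (\<Sum>a<q. (c ^ h / c) ^ a))" by (subst sum.swap) (simp add: sum_distrib_left)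
 also have "\<dots> = (\<Sum>h<q. if h = 1 then of_nat q else 0)" by (intro sum.cong refl) (use gs dirichlet_character_1[OF chi(1)] in auto)
 also have "\<dots> = of_nat q" using q by simp
 finally show False using q by simp
qed

lemma sums_Suc_finite_support:
 fixes h :: "nat => complex"
 assumes J: "finite J" "0 \<notin> J" and h: "!!j. j \<ge> 1 ==> j \<notin> J ==> h j = 0"
 shows "(\<lambda>k. h (Suc k)) sums (\<Sum>j\<in>J. h j)"
proof -
 have "(\<lambda>k. h (Suc k)) sums (\<Sum>k\<in>(\<lambda>j. j - 1) ` J. h (Suc k))"
 proof (rule sums_finite)
  fix k assume k: "k \<notin> (\<lambda>j. j - 1) ` J"
  have "Suc k \<notin> J" using k image_eqI[of k "\<lambda>j. j - 1" "Suc k" J] by auto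
  thus "h (Suc k) = 0" by (intro h) auto
 qed (use J in auto)
 also have "(\<Sum>k\<in>(\<lambda>j. j - 1) ` J. h (Suc k)) = (\<Sum>j\<in>J. h (Suc (j - 1)))"
 proof (rule sum.reindex_cong[OF _ refl refl], rule inj_onI)
  fix a b assume "a \<in> J" "b \<in> J" "a - 1 = b - 1"
  moreover from this have "a \<noteq> 0" "b \<noteq> 0" using J(2) by metis+
  ultimately show "a = b" by arith
 qed
 also have "\<dots> = (\<Sum>j\<in>J. h j)"
 proof (intro sum.cong refl)
  fix j assume "j \<in> J"
  hence "j \<noteq> 0" using J(2) by metis
  thus "h (Suc (j - 1)) = h j" by simp
 qed
 finally show ?thesis .
qed

lemma of_real_divide_powr: "x > 0 ==> t > 0 ==> complex_of_real (x / t) powr z = of_real x powr z * of_real t powr (- z)"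
proof -
 assume "x > 0" "t > 0"
 hence "Ln (of_real (x / t)) = of_real (ln x - ln t)" "Ln (of_real x) = of_real (ln x)" "Ln (of_real t) = of_real (ln t)"
  by (simp_all only: Ln_of_real ln_div divide_pos_pos) simp
 thus ?thesis unfolding powr_def using \<open>x > 0\<close> \<open>t > 0\<close> by (simp add: right_diff_distrib exp_diff exp_minus divide_inverse)
qed

lemma of_real_mult_powr: "x > 0 ==> t > 0 ==> complex_of_real (x * t) powr z = of_real x powr z * of_real t powr z"
 by (simp add: powr_times_real)

lemma sigma_chi_Suc_mult:
 "sigma_chi z chi1 chi2 n * y = (\<Sum>d | d dvd n. of_nat d powr z * chi1 (int d) * chi2 (int (n div d)) * y)"
 by (simp add: sigma_chi_def sum_distrib_right)

context test_function
begin

definition vtransform :: "complex => real => nat => complex" where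
 "vtransform \<nu> k n = integral {c..d} (\<lambda>t. F t * (of_real t powr (- \<nu> / 2) * vkernel \<nu> (4 * pi * sqrt (real n * t / k))))"

text \<open>With A = 2 pi b/q and u = a/p the kernel sees a and b only through the product a b,
  apart from a power of b p/(a q). This is why the double series collapses to a divisor sum.\<close>

lemma hk_cos_integral_vtransform:
 assumes nu: "\<nu> \<notin> \<int>" and pos: "a > 0" "b > 0" "p > 0" "q > 0" and i: "set_integrable lborel {0<..} (hk \<nu> (real a / real p))"
 shows "(LINT x:{0<..}|lborel. hk \<nu> (real a / real p) x * of_real (cos (2 * pi * real b / real q * x)))
  = of_real pi / 2 * of_real (real b * real p / (real a * real q)) powr (\<nu> / 2) * vtransform \<nu> (real p * real q) (a * b)"
proof -
 let ?A = "2 * pi * real b / real q" and ?u = "real a / real p" and ?R = "real b * real p / (real a * real q)"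
 have A: "?A > 0" and u: "?u > 0" and R: "?R > 0" using pos by auto
 have "F t * (of_real (?A / (2 * pi * ?u * t)) powr (\<nu> / 2) * vkernel \<nu> (2 * sqrt (?A * (2 * pi * ?u * t))))
  = of_real ?R powr (\<nu> / 2) * (F t * (of_real t powr (- \<nu> / 2) * vkernel \<nu> (4 * pi * sqrt (real (a * b) * t / (real p * real q)))))" if t: "t \<in> {c..d}" for t
 proof -
  have t0: "t > 0" using t c0 by auto
  have e1: "?A / (2 * pi * ?u * t) = ?R / t" using pos t0 by (simp add: field_simps)
  have "?A * (2 * pi * ?u * t) = (2 * pi)\<^sup>2 * (real (a * b) * t / (real p * real q))"
   using pos by (simp add: field_simps power2_eq_square)
  hence e2: "2 * sqrt (?A * (2 * pi * ?u * t)) = 4 * pi * sqrt (real (a * b) * t / (real p * real q))"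
   by (simp only: real_sqrt_mult[of "(2 * pi)\<^sup>2"] real_sqrt_abs) simp
  have e3: "- \<nu> / 2 = - (\<nu> / 2)" by simp
  show ?thesis unfolding e1 e2 of_real_divide_powr[OF R t0] e3 by (simp only: mult_ac)
 qed
 hence "integral {c..d} (\<lambda>t. F t * (of_real (?A / (2 * pi * ?u * t)) powr (\<nu> / 2) * vkernel \<nu> (2 * sqrt (?A * (2 * pi * ?u * t)))))
  = of_real ?R powr (\<nu> / 2) * vtransform \<nu> (real p * real q) (a * b)"
  unfolding vtransform_def by (subst integral_mult_right[symmetric]) (intro Henstock_Kurzweil_Integration.integral_cong)
 thus ?thesis unfolding hk_cos_integral[OF nu u A i] by (simp only: mult_ac)
qed

text \<open>By homogeneity the summand with s = a + 1 is s powr (-\<nu> - 1) times a fixed function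
  sampled at (m + 1)/s. That function has bounded variation, so summation by parts bounds the
  character sum independently of s. Absolute values would only give s powr (- Re \<nu>), which is
  not summable over a.\<close>

lemma hk_character_sum_bound:
 assumes chi: "dirichlet_character q chi" "\<not> principal_character q chi"
  and p: "p > 0" and r: "0 < Re \<nu>" "Re \<nu> < 1/2"
 obtains B where "!!D a. norm (\<Sum>m<D. chi (int (Suc m)) * hk \<nu> (real (Suc a) / real p) (real (Suc m))) \<le> B * real (Suc a) powr (- Re \<nu> - 1)"
proof -
 have u: "1 / real p > 0" using p by simp
 let ?G = "hk \<nu> (1 / real p)" and ?G' = "hk' \<nu> (1 / real p)"
 obtain C where C: "C \<ge> 0"
  "!!x. 0 < x ==> x \<le> 1 ==> norm (?G x) \<le> C * x" "!!x. 0 < x ==> x \<le> 1 ==> norm (?G' x) \<le> C * x"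
  "!!x. 0 < x ==> x \<le> 1 ==> norm (hk'' \<nu> (1 / real p) x) \<le> C * x powr (- Re \<nu>)"
  "!!x. x \<ge> 1 ==> norm (?G x) \<le> C * x powr (- Re \<nu> - 1)" "!!x. x \<ge> 1 ==> norm (?G' x) \<le> C * x powr (- Re \<nu> - 2)"
  "!!x. x \<ge> 1 ==> norm (hk'' \<nu> (1 / real p) x) \<le> C * x powr (- Re \<nu> - 3)"
  by (rule hk_bounds[OF u r], rule that)
 have G: "norm (?G x) \<le> C" if x: "x > 0" for x
 proof (cases "x \<le> 1")
  case True thus ?thesis using C(2)[OF x True] mult_left_mono[OF True C(1)] by simp
 next
  case False
  hence "x powr (- Re \<nu> - 1) \<le> x powr 0" using r by (intro powr_mono) auto
  thus ?thesis using C(5)[of x] False mult_left_mono[OF _ C(1), of "x powr (- Re \<nu> - 1)" 1] by simp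
 qed
 have G': "norm (?G' x) \<le> 2 * C * inverse (1 + x\<^sup>2)" if x: "x > 0" for x
 proof (cases "x \<le> 1")
  case True
  have "norm (?G' x) \<le> C * 1" using C(3)[OF x True] mult_left_mono[OF True C(1)] by simp
  also have "\<dots> \<le> C * (2 * inverse (1 + x\<^sup>2))"
   using C(1) True x by (intro mult_left_mono) (auto simp: field_simps power_le_one add_pos_nonneg)
  finally show ?thesis by simp
 next
  case False
  have "x powr (- Re \<nu> - 2) \<le> x powr (- 2)" using r False by (intro powr_mono) auto
  also have "\<dots> = inverse (x\<^sup>2)" using x by (simp add: powr_minus powr_numeral)
  also have "\<dots> \<le> 2 * inverse (1 + x\<^sup>2)" using False by (simp add: field_simps add_pos_nonneg)
  finally have "C * x powr (- Re \<nu> - 2) \<le> C * (2 * inverse (1 + x\<^sup>2))" using C(1) by (rule mult_left_mono)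
  thus ?thesis using C(6)[of x] False by simp
 qed
 \<comment> \<open>2 C arctan is a primitive of the bound on \<open>hk'\<close>, so its increments
   dominate those of \<open>hk\<close> and telescope to at most 2 C pi.\<close>
 have dG: "norm (?G y - ?G x) \<le> 2 * C * arctan y - 2 * C * arctan x" if "0 < x" "x < y" for x y
 proof (rule differentiable_bound_general[where f' = ?G' and \<phi>' = "\<lambda>x. 2 * C * inverse (1 + x\<^sup>2)"])
  show "continuous_on {x..y} ?G" by (rule continuous_on_subset[OF continuous_on_hk(1)]) (use that in auto)
  show "continuous_on {x..y} (\<lambda>x. 2 * C * arctan x)" by (intro continuous_intros)
  fix z assume z: "x < z" "z < y"
  show "(?G has_vector_derivative ?G' z) (at z)" using z that by (intro hk_deriv) auto
  show "((\<lambda>x. 2 * C * arctan x) has_vector_derivative 2 * C * inverse (1 + z\<^sup>2)) (at z)"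
   unfolding has_real_derivative_iff_has_vector_derivative[symmetric] by (intro DERIV_cmult DERIV_arctan)
  show "norm (?G' z) \<le> 2 * C * inverse (1 + z\<^sup>2)" using z that by (intro G') auto
 qed (use that in auto)
 show ?thesis
 proof (rule that[of "real q * (C + 2 * C * pi)"])
  fix D a
  define s where "s = real (Suc a)"
  have s: "s > 0" by (simp add: s_def)
  define w where "w = (\<lambda>m. ?G (real (Suc m) / s))"
  have hw: "hk \<nu> (s / real p) (real (Suc m)) = of_real s powr (- \<nu> - 1) * w m" for m
  proof -
   have e: "complex_of_real (real (Suc m)) powr (- \<nu> - 1) = of_real s powr (- \<nu> - 1) * of_real (real (Suc m) / s) powr (- \<nu> - 1)"
    by (subst of_real_mult_powr[symmetric]) (use s in auto)
   show ?thesis unfolding w_def hk_def e using s by (simp add: mult_ac)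
  qed
  have "(\<Sum>m<D. norm (w (Suc m) - w m)) \<le> (\<Sum>m<D. 2 * C * arctan (real (Suc (Suc m)) / s) - 2 * C * arctan (real (Suc m) / s))"
   unfolding w_def by (intro sum_mono dG) (use s in \<open>auto simp: divide_strict_right_mono\<close>)
  also have "\<dots> = 2 * C * arctan (real (Suc D) / s) - 2 * C * arctan (1 / s)"
   using sum_lessThan_telescope[of "\<lambda>m. 2 * C * arctan (real (Suc m) / s)" D] by simp
  also have "\<dots> \<le> 2 * C * (pi / 2) - 2 * C * (- (pi / 2))"
   using C(1) arctan_bounded[of "real (Suc D) / s"] arctan_bounded[of "1 / s"] by (intro diff_mono mult_left_mono) auto
  finally have V: "(\<Sum>m<D. norm (w (Suc m) - w m)) \<le> 2 * C * pi" by simp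
  have "norm (w D) \<le> C" unfolding w_def by (rule G) (use s in auto)
  from character_sum_bounded_variation[OF chi this V]
  have "s powr (- Re \<nu> - 1) * norm (\<Sum>m<D. chi (int (Suc m)) * w m) \<le> s powr (- Re \<nu> - 1) * (real q * (C + 2 * C * pi))"
   by (intro mult_left_mono) auto
  moreover have "(\<Sum>m<D. chi (int (Suc m)) * hk \<nu> (s / real p) (real (Suc m))) = of_real s powr (- \<nu> - 1) * (\<Sum>m<D. chi (int (Suc m)) * w m)"
   unfolding hw sum_distrib_left by (simp only: mult_ac)
  ultimately have "norm (\<Sum>m<D. chi (int (Suc m)) * hk \<nu> (s / real p) (real (Suc m))) \<le> real q * (C + 2 * C * pi) * s powr (- Re \<nu> - 1)"
   using s by (simp add: norm_mult norm_powr_of_real mult_ac)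
  thus "norm (\<Sum>m<D. chi (int (Suc m)) * hk \<nu> (real (Suc a) / real p) (real (Suc m))) \<le> real q * (C + 2 * C * pi) * real (Suc a) powr (- Re \<nu> - 1)"
   unfolding s_def .
 qed
qed

text \<open>The double series over a and m is not estimated absolutely. The inner sum is truncated
  at D, each truncation is evaluated by Poisson summation for \<open>F\<close> term by term in m,
  and the bound uniform in D justifies D -> \<infinity> under the sum over a.\<close>

lemma hk_double_sum:
 assumes chi1: "dirichlet_character p chi1" "primitive_character p chi1" "\<not> principal_character p chi1" "even_character chi1"
  and chi2: "dirichlet_character q chi2" "primitive_character q chi2" "\<not> principal_character q chi2" "even_character chi2"
  and r: "0 < Re \<nu>" "Re \<nu> < 1/2"
  and J: "finite J" "0 \<notin> J" "!!j. j \<ge> 1 ==> j \<notin> J ==> F (real j) = 0"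
 shows "(\<Sum>a. gauss_sum p chi1 * cnj (chi1 (int (Suc a))) * (\<Sum>m. chi2 (int (Suc m)) * hk \<nu> (real (Suc a) / real p) (real (Suc m))))
  = of_nat p / 2 * (\<Sum>j\<in>J. sigma_chi (- \<nu>) chi2 chi1 j * F (real j))"
proof -
 have p: "p > 0" using chi1 by (simp add: dirichlet_character_def)
 let ?g = "\<lambda>a. gauss_sum p chi1 * cnj (chi1 (int (Suc a)))"
 let ?h = "\<lambda>a m. hk \<nu> (real (Suc a) / real p) (real (Suc m))"
 obtain B where B: "!!D a. norm (\<Sum>m<D. chi2 (int (Suc m)) * ?h a m) \<le> B * real (Suc a) powr (- Re \<nu> - 1)"
  using hk_character_sum_bound[OF chi2(1,3) p r] by blast
 have sm: "summable (\<lambda>k. norm (gauss_sum p chi1) * (B * real (Suc k) powr (- Re \<nu> - 1)))"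
  using r by (intro summable_mult summable_Suc_iff[THEN iffD2, of "\<lambda>k. real k powr (- Re \<nu> - 1)"]) (auto simp: summable_real_powr_iff)
 have bd: "norm (?g a * (\<Sum>m<D. chi2 (int (Suc m)) * ?h a m)) \<le> norm (gauss_sum p chi1) * (B * real (Suc a) powr (- Re \<nu> - 1))" for a D
 proof -
  have "norm (?g a) \<le> norm (gauss_sum p chi1) * 1" unfolding norm_mult complex_mod_cnj
   by (intro mult_left_mono dirichlet_character_norm_le[OF chi1(1)]) auto
  thus ?thesis unfolding norm_mult[of "?g a"] by (intro mult_mono B) auto
 qed
 have "(\<lambda>D. \<Sum>m<D. chi2 (int (Suc m)) * ?h a m) \<longlonglongrightarrow> (\<Sum>m. chi2 (int (Suc m)) * ?h a m)" for a
  by (rule summable_LIMSEQ, rule poisson_hk(1)[OF chi2 _ r]) (use p in auto)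
 hence lim: "(\<lambda>D. ?g a * (\<Sum>m<D. chi2 (int (Suc m)) * ?h a m)) \<longlonglongrightarrow> ?g a * (\<Sum>m. chi2 (int (Suc m)) * ?h a m)" for a
  by (intro tendsto_mult tendsto_const)
 have T: "(\<lambda>D. \<Sum>a. ?g a * (\<Sum>m<D. chi2 (int (Suc m)) * ?h a m)) \<longlonglongrightarrow> (\<Sum>a. ?g a * (\<Sum>m. chi2 (int (Suc m)) * ?h a m))"
  by (rule tannerys_theorem[where M = "\<lambda>k. norm (gauss_sum p chi1) * (B * real (Suc k) powr (- Re \<nu> - 1))" and F = sequentially, OF lim _ sm, THEN conjunct2, THEN conjunct2])
   (use bd in \<open>auto intro!: always_eventually\<close>)
 define E where "E = (\<lambda>d m. of_nat d powr (- \<nu>) * chi2 (int d) * chi1 (int m) * F (real (d * m)))"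
 obtain N where N: "d < real N" using reals_Archimedean2 by blast
 \<comment> \<open>The support of \<open>F\<close> ends below N, so only finitely many pairs
   contribute and the truncations are constant for D \<ge> N.\<close>
 have E0: "E (Suc a) (Suc b) = 0" if "a \<ge> N \<or> b \<ge> N" for a b
 proof -
  have "N \<le> Suc a * Suc b" using that by auto
  hence "F (real (Suc a * Suc b)) = 0" using N by (intro F_eq_0) (auto simp del: mult_Suc of_nat_mult)
  thus ?thesis by (simp add: E_def del: mult_Suc of_nat_mult)
 qed
 have Eb: "(\<Sum>b. E (Suc m) (Suc b)) = (\<Sum>b<N. E (Suc m) (Suc b))" for m
  by (rule suminf_finite) (use E0 in auto)
 have Ea: "(\<Sum>a. \<Sum>b. E (Suc a) (Suc b)) = (\<Sum>a<M. \<Sum>b. E (Suc a) (Suc b))" if "M \<ge> N" for M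
  by (rule suminf_finite) (use E0 that in \<open>auto simp: Eb\<close>)
 have inner: "(\<lambda>a. ?g a * (chi2 (int (Suc m)) * ?h a m)) sums (of_nat p / 2 * (\<Sum>b. E (Suc m) (Suc b)))" for m
 proof -
  have D: "real (Suc m) > 0" by simp
  let ?c = "of_nat (Suc m) powr (- \<nu>) * chi2 (int (Suc m))"
  have s: "(\<Sum>b. E (Suc m) (Suc b)) = ?c * (\<Sum>b. chi1 (int (Suc b)) * F (real (Suc m) * real (Suc b)))"
   using sums_mult[OF summable_sums[OF poisson_F(1)[OF chi1 D]], of ?c]
   unfolding E_def of_nat_mult by (simp only: mult.assoc sums_iff)
  have hh: "?h a m = of_nat (Suc m) powr (- \<nu>) * (cosint 0 (real (Suc a) / real p / real (Suc m)) / of_real (real (Suc m)))" for a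
   unfolding hk_def powr_diff by (simp del: of_nat_Suc add: of_real_of_nat_eq)
  show ?thesis using sums_mult[OF poisson_F(2)[OF chi1 D], of ?c] unfolding hh s by (simp add: mult_ac del: of_nat_Suc)
 qed
 have "(\<lambda>a. ?g a * (\<Sum>m<D. chi2 (int (Suc m)) * ?h a m)) sums (\<Sum>m<D. of_nat p / 2 * (\<Sum>b. E (Suc m) (Suc b)))" for D
  unfolding sum_distrib_left by (rule sums_sum[OF inner])
 hence "(\<Sum>a. ?g a * (\<Sum>m<D. chi2 (int (Suc m)) * ?h a m)) = of_nat p / 2 * (\<Sum>m<D. \<Sum>b. E (Suc m) (Suc b))" for D
  by (simp add: sums_iff sum_distrib_left)
 hence "\<forall>\<^sub>F D in sequentially. of_nat p / 2 * (\<Sum>a. \<Sum>b. E (Suc a) (Suc b)) = (\<Sum>a. ?g a * (\<Sum>m<D. chi2 (int (Suc m)) * ?h a m))"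
  unfolding eventually_sequentially by (intro exI[of _ N] allI impI) (simp only: Ea)
 hence "(\<lambda>D. \<Sum>a. ?g a * (\<Sum>m<D. chi2 (int (Suc m)) * ?h a m)) \<longlonglongrightarrow> of_nat p / 2 * (\<Sum>a. \<Sum>b. E (Suc a) (Suc b))"
  by (rule Lim_transform_eventually[OF tendsto_const])
 hence L: "(\<Sum>a. ?g a * (\<Sum>m. chi2 (int (Suc m)) * ?h a m)) = of_nat p / 2 * (\<Sum>a. \<Sum>b. E (Suc a) (Suc b))"
  by (rule LIMSEQ_unique[OF T])
 have "(\<lambda>k. \<Sum>d | d dvd Suc k. E d (Suc k div d)) sums (\<Sum>a. \<Sum>b. E (Suc a) (Suc b))"
 proof (rule sums_divisor_regroup[where x = "\<lambda>a. if a < N then \<Sum>b<N. norm (E (Suc a) (Suc b)) else 0" and y = "\<lambda>b. if b < N then 1 else 0"])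
  fix a b
  show "norm (E (Suc a) (Suc b)) \<le> (if a < N then \<Sum>b<N. norm (E (Suc a) (Suc b)) else 0) * (if b < N then 1 else 0)"
  proof (cases "a < N \<and> b < N")
   case True
   hence "norm (E (Suc a) (Suc b)) \<le> (\<Sum>b<N. norm (E (Suc a) (Suc b)))"
    by (intro member_le_sum[of b "{..<N}" "\<lambda>b. norm (E (Suc a) (Suc b))"]) auto
   thus ?thesis using True by simp
  next
   case False
   hence "E (Suc a) (Suc b) = 0" by (intro E0) auto
   thus ?thesis by (simp add: sum_nonneg)
  qed
 qed (auto intro!: summable_finite[of "{..<N}"] sum_nonneg)
 also have "(\<lambda>k. \<Sum>d | d dvd Suc k. E d (Suc k div d)) = (\<lambda>k. sigma_chi (- \<nu>) chi2 chi1 (Suc k) * F (real (Suc k)))"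
  unfolding sigma_chi_Suc_mult E_def by (intro ext sum.cong refl) (simp del: of_nat_Suc of_nat_mult)
 finally have "(\<Sum>a. \<Sum>b. E (Suc a) (Suc b)) = (\<Sum>j\<in>J. sigma_chi (- \<nu>) chi2 chi1 j * F (real j))"
  by (rule sums_unique2) (rule sums_Suc_finite_support[OF J(1,2), of "\<lambda>j. sigma_chi (- \<nu>) chi2 chi1 j * F (real j)"], simp add: J(3))
 thus ?thesis unfolding L by simp
qed

text \<open>The bound \<open>K\<close> makes the double series over a and b absolutely convergent.
  Summed over b first it is Poisson summation modulo q for \<open>hk\<close>, followed by
  \<open>hk_double_sum\<close>; summed along n = a b it is the series of transforms with divisor
  sums as coefficients.\<close>

lemma smooth_voronoi:
 assumes chi1: "dirichlet_character p chi1" "primitive_character p chi1" "\<not> principal_character p chi1" "even_character chi1"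
  and chi2: "dirichlet_character q chi2" "primitive_character q chi2" "\<not> principal_character q chi2" "even_character chi2"
  and r: "0 < Re \<nu>" "Re \<nu> < 1/2"
  and J: "finite J" "0 \<notin> J" "!!j. j \<ge> 1 ==> j \<notin> J ==> F (real j) = 0"
  and K: "!!n. n \<ge> 1 ==> norm (vtransform \<nu> (real p * real q) n) \<le> K * real n powr (- 5 / 4)"
 shows "(\<lambda>k. 2 * of_real pi * sigma_chi (- \<nu>) (\<lambda>a. cnj (chi1 a)) (\<lambda>a. cnj (chi2 a)) (Suc k) * of_nat (Suc k) powr (\<nu> / 2)
    * vtransform \<nu> (real p * real q) (Suc k))
  sums (of_nat p powr (1 - \<nu> / 2) * of_nat q powr (1 + \<nu> / 2) / (gauss_sum p chi1 * gauss_sum q chi2)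
    * (\<Sum>j\<in>J. sigma_chi (- \<nu>) chi2 chi1 j * F (real j)))"
proof -
 have nu: "\<nu> \<notin> \<int>"
 proof
  assume "\<nu> \<in> \<int>"
  then obtain k where "\<nu> = of_int k" by (elim Ints_cases)
  thus False using r by simp
 qed
 have p: "p > 0" and q: "q > 0" using chi1 chi2 by (auto simp: dirichlet_character_def)
 let ?t1 = "gauss_sum p chi1" and ?t2 = "gauss_sum q chi2" and ?V = "vtransform \<nu> (real p * real q)"
 have t0: "?t1 \<noteq> 0" "?t2 \<noteq> 0" by (rule gauss_sum_nonzero[OF chi1(1-3)], rule gauss_sum_nonzero[OF chi2(1-3)])
 define P where "P = complex_of_real (real p / real q) powr (\<nu> / 2)"
 have P0: "P \<noteq> 0" using p q by (simp add: P_def)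
 define W where "W = (\<lambda>a b. ?t1 * cnj (chi1 (int a)) * (?t2 * cnj (chi2 (int b)) * (of_real pi / 2 * of_real (real b * real p / (real a * real q)) powr (\<nu> / 2) * ?V (a * b))))"
 define H where "H = (\<lambda>a. \<Sum>m. chi2 (int (Suc m)) * hk \<nu> (real (Suc a) / real p) (real (Suc m)))"
 have K0: "K \<ge> 0" using K[of 1] norm_ge_zero[of "?V 1"] by (simp del: norm_ge_zero)
 \<comment> \<open>The exponent -5/4 of the assumed bound combines with (b/a) powr (Re \<nu>/2). The
   sum over b then has exponent -5/4 + Re \<nu>/2, which is below -1 exactly when Re \<nu> <
   1/2.\<close>
 define x where "x = (\<lambda>a. norm ?t1 * norm ?t2 * (pi / 2) * K * (real p / real q) powr (Re \<nu> / 2) * real (Suc a) powr (- 5 / 4 - Re \<nu> / 2))"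
 define y where "y = (\<lambda>b. real (Suc b) powr (- 5 / 4 + Re \<nu> / 2))"
 have xs: "summable x" unfolding x_def
  using r by (intro summable_mult summable_Suc_iff[THEN iffD2, of "\<lambda>k. real k powr (- 5 / 4 - Re \<nu> / 2)"]) (auto simp: summable_real_powr_iff)
 have ys: "summable y" unfolding y_def
  using r by (intro summable_Suc_iff[THEN iffD2, of "\<lambda>k. real k powr (- 5 / 4 + Re \<nu> / 2)"]) (auto simp: summable_real_powr_iff)
 have xy0: "x k \<ge> 0" "y k \<ge> 0" for k using K0 by (auto simp: x_def y_def)
 have Wb: "norm (W (Suc a) (Suc b)) \<le> x a * y b" for a b
 proof -
  let ?a = "real (Suc a)" and ?b = "real (Suc b)"
  have R: "?b * real p / (?a * real q) > 0" using p q by simp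
  have e: "(?b * real p / (?a * real q)) powr (Re \<nu> / 2) * real (Suc a * Suc b) powr (- 5 / 4)
    = (real p / real q) powr (Re \<nu> / 2) * ?a powr (- 5 / 4 - Re \<nu> / 2) * ?b powr (- 5 / 4 + Re \<nu> / 2)"
  proof -
   have "?b * real p / (?a * real q) = real p * ?b / (real q * ?a)" by (simp only: mult.commute)
   thus ?thesis unfolding of_nat_mult powr_diff powr_add using p q
    by (simp add: powr_mult powr_divide powr_diff del: of_nat_Suc)
  qed
  have "norm (W (Suc a) (Suc b)) = (norm ?t1 * norm (chi1 (int (Suc a)))) * ((norm ?t2 * norm (chi2 (int (Suc b)))) * (pi / 2 * (?b * real p / (?a * real q)) powr (Re \<nu> / 2) * norm (?V (Suc a * Suc b))))"
   unfolding W_def norm_mult norm_powr_of_real[OF R] by (simp add: norm_divide del: of_nat_Suc mult_Suc mult_Suc_right)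
  also have "\<dots> \<le> (norm ?t1 * 1) * ((norm ?t2 * 1) * (pi / 2 * (?b * real p / (?a * real q)) powr (Re \<nu> / 2) * (K * real (Suc a * Suc b) powr (- 5 / 4))))"
   by (intro mult_mono order.refl dirichlet_character_norm_le[OF chi1(1)] dirichlet_character_norm_le[OF chi2(1)] K mult_nonneg_nonneg) (use K0 in auto)
  also have "\<dots> = norm ?t1 * norm ?t2 * (pi / 2) * K * ((?b * real p / (?a * real q)) powr (Re \<nu> / 2) * real (Suc a * Suc b) powr (- 5 / 4))"
   by (simp only: mult_1_right mult_ac)
  also have "\<dots> = x a * y b" unfolding e x_def y_def by (simp only: mult_ac)
  finally show ?thesis .
 qed
 have inner: "(\<Sum>b. W (Suc a) (Suc b)) = of_nat q / 2 * (?t1 * cnj (chi1 (int (Suc a))) * H a)" for a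
 proof -
  have u: "real (Suc a) / real p > 0" using p by simp
  note ph = poisson_hk[OF chi2 u r]
  have eq: "W (Suc a) (Suc b) = ?t1 * cnj (chi1 (int (Suc a))) * (?t2 * cnj (chi2 (int (Suc b))) *
   (LINT x:{0<..}|lborel. hk \<nu> (real (Suc a) / real p) x * of_real (cos (2 * pi * real (Suc b) / real q * x))))" for b
   unfolding W_def by (subst hk_cos_integral_vtransform[OF nu _ _ p q ph(3)]) simp_all
  show ?thesis using sums_mult[OF ph(2), of "?t1 * cnj (chi1 (int (Suc a)))"] unfolding eq[symmetric] H_def
   by (simp only: sums_iff mult_ac)
 qed
 have "summable (\<lambda>a. \<Sum>b. W (Suc a) (Suc b))" by (rule double_suminf_swap(4)[OF Wb xs xy0(1) ys xy0(2)])
 hence sH: "summable (\<lambda>a. ?t1 * cnj (chi1 (int (Suc a))) * H a)" unfolding inner using q by (simp only: summable_cmult_iff) simp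
 have hd: "(\<Sum>a. ?t1 * cnj (chi1 (int (Suc a))) * H a) = of_nat p / 2 * (\<Sum>j\<in>J. sigma_chi (- \<nu>) chi2 chi1 j * F (real j))"
  unfolding H_def by (rule hk_double_sum[OF chi1 chi2 r J(1,2)]) (rule J(3))
 have tot: "(\<Sum>a. \<Sum>b. W (Suc a) (Suc b)) = of_nat q / 2 * (of_nat p / 2 * (\<Sum>j\<in>J. sigma_chi (- \<nu>) chi2 chi1 j * F (real j)))"
  unfolding inner suminf_mult[OF sH] hd ..
 have "(\<lambda>k. \<Sum>d | d dvd Suc k. W d (Suc k div d)) sums (\<Sum>a. \<Sum>b. W (Suc a) (Suc b))"
  by (rule sums_divisor_regroup[OF Wb xs xy0(1) ys xy0(2)])
 \<comment> \<open>The factor 4 undoes the halves in q/2 and p/2 and turns pi/2 into 2 pi.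
   \<open>P\<close> is the constant part (p/q) powr (\<nu>/2) of the power of b p/(a q); together
   with the Gauss sums it is divided out.\<close>
 hence S: "(\<lambda>k. 4 / (?t1 * ?t2 * P) * (\<Sum>d | d dvd Suc k. W d (Suc k div d))) sums
  (4 / (?t1 * ?t2 * P) * (of_nat q / 2 * (of_nat p / 2 * (\<Sum>j\<in>J. sigma_chi (- \<nu>) chi2 chi1 j * F (real j)))))" unfolding tot by (rule sums_mult)
 have pn: "of_nat n powr z = exp (z * of_real (ln (real n)))" if "n > 0" for n :: nat and z :: complex
  using that by (simp add: powr_def Ln_of_nat)
 have trm: "4 / (?t1 * ?t2 * P) * (\<Sum>d | d dvd n. W d (n div d)) = 2 * of_real pi * sigma_chi (- \<nu>) (\<lambda>a. cnj (chi1 a)) (\<lambda>a. cnj (chi2 a)) n * of_nat n powr (\<nu> / 2) * ?V n"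
  if n: "n > 0" for n
 proof -
  have "4 / (?t1 * ?t2 * P) * W d (n div d) = 2 * of_real pi * of_nat n powr (\<nu> / 2) * ?V n * (of_nat d powr (- \<nu>) * cnj (chi1 (int d)) * cnj (chi2 (int (n div d))))"
   if d: "d dvd n" for d
  proof -
   obtain e where e: "n = d * e" using d by (elim dvdE)
   have d0: "d > 0" "e > 0" using n e by auto
   have ne: "n div d = e" using e d0 by simp
   have R: "real e * real p / (real d * real q) = (real p / real q) * (real e / real d)" by (simp add: mult.commute)
   have "complex_of_real (real e / real d) powr (\<nu> / 2) = of_nat n powr (\<nu> / 2) * of_nat d powr (- \<nu>)"
   proof -
    have l: "ln (real e / real d) = ln (real n) - 2 * ln (real d)" using d0 unfolding e by (simp add: ln_div ln_mult)
    have "complex_of_real (real e / real d) powr (\<nu> / 2) = exp (\<nu> / 2 * of_real (ln (real n) - 2 * ln (real d)))"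
     unfolding l[symmetric] powr_def using d0 by (simp add: Ln_of_real del: of_real_divide)
    also have "\<dots> = exp (\<nu> / 2 * of_real (ln (real n)) + (- \<nu>) * of_real (ln (real d)))" by (simp add: algebra_simps)
    finally show ?thesis unfolding pn[OF n] pn[OF d0(1)] exp_add .
   qed
   hence RR: "complex_of_real (real e * real p / (real d * real q)) powr (\<nu> / 2) = P * (of_nat n powr (\<nu> / 2) * of_nat d powr (- \<nu>))"
    unfolding R P_def by (subst of_real_mult_powr) (use p q d0 in auto)
   have g: "4 / (a * b * c) * (a * x * (b * y * (w / 2 * (c * (u * v)) * z))) = 2 * w * u * z * (v * x * y)" if "a \<noteq> 0" "b \<noteq> 0" "c \<noteq> 0" for a b c w x y z u v :: complex
    using that by (simp add: field_simps)
   show ?thesis unfolding W_def ne RR e[symmetric] by (rule g[OF t0 P0])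
  qed
  hence "4 / (?t1 * ?t2 * P) * (\<Sum>d | d dvd n. W d (n div d)) = (\<Sum>d | d dvd n. 2 * of_real pi * of_nat n powr (\<nu> / 2) * ?V n * (of_nat d powr (- \<nu>) * cnj (chi1 (int d)) * cnj (chi2 (int (n div d)))))"
   unfolding sum_distrib_left by (intro sum.cong refl) auto
  thus ?thesis unfolding sigma_chi_def sum_distrib_left[symmetric] by (simp only: mult_ac)
 qed
 have pq: "of_nat p powr (1 - \<nu> / 2) * of_nat q powr (1 + \<nu> / 2) = of_nat p * of_nat q / P"
 proof -
  have P: "P = of_nat p powr (\<nu> / 2) / of_nat q powr (\<nu> / 2)"
   unfolding P_def of_real_divide_powr[OF of_nat_0_less_iff[THEN iffD2, OF p] of_nat_0_less_iff[THEN iffD2, OF q]]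
   by (simp only: powr_minus divide_inverse of_real_of_nat_eq)
  show ?thesis unfolding P powr_add powr_diff using p q by simp
 qed
 have rhs: "4 / (?t1 * ?t2 * P) * (of_nat q / 2 * (of_nat p / 2 * X)) = of_nat p powr (1 - \<nu> / 2) * of_nat q powr (1 + \<nu> / 2) / (?t1 * ?t2) * X" for X
 proof -
  have g: "4 / (a * b * c) * (y / 2 * (x / 2 * X)) = (x * y / c) / (a * b) * X" for a b c x y :: complex by (simp add: mult_ac)
  show ?thesis unfolding pq by (rule g)
 qed
 show ?thesis using S unfolding rhs trm[OF zero_less_Suc] .
qed

end

section \<open>Removing the smoothing\<close>

text \<open>Every divisor of p^k m has the form p^i e with i \<le> k and e dividing m.\<close>

lemma card_divisors_prime_power_mult:
 fixes p m :: nat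
 assumes p: "prime p" and m: "m > 0"
 shows "card {d. d dvd p ^ k * m} \<le> Suc k * card {d. d dvd m}"
proof -
 have "{d. d dvd p ^ k * m} \<subseteq> (\<lambda>(i, e). p ^ i * e) ` ({..k} \<times> {d. d dvd m})"
 proof
  fix d assume "d \<in> {d. d dvd p ^ k * m}"
  then obtain b c where d: "d = b * c" "b dvd p ^ k" "c dvd m" using division_decomp[of d "p ^ k" m] by auto
  then obtain i where "i \<le> k" "b = p ^ i" using divides_primepow_nat[OF p] by blast
  thus "d \<in> (\<lambda>(i, e). p ^ i * e) ` ({..k} \<times> {d. d dvd m})" using d by auto
 qed
 hence "card {d. d dvd p ^ k * m} \<le> card ((\<lambda>(i, e). p ^ i * e) ` ({..k} \<times> {d. d dvd m}))"
  using m by (intro card_mono) auto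
 also have "\<dots> \<le> card ({..k} \<times> {d. d dvd m})" using m by (intro card_image_le) auto
 finally show ?thesis by (simp add: card_cartesian_product)
qed

lemma Suc_le_two_power: "Suc k \<le> 2 ^ k"
 by (induction k) auto

text \<open>Strong induction strips one full prime power p^k at a time, at the cost of a factor k +
  1. For p \<ge> 2 powr (1/\<epsilon>) this is at most 2^k \<le> p powr (\<epsilon> k); each of the
  finitely many smaller primes costs one constant \<open>C\<close>.\<close>

lemma divisor_bound:
 assumes e: "\<epsilon> > 0"
 obtains C where "C \<ge> 0" "!!n. n > 0 ==> real (card {d::nat. d dvd n}) \<le> C * real n powr \<epsilon>"
proof -
 define P where "P = 2 powr (1 / \<epsilon>)"
 have "\<exists>C\<ge>1. \<forall>k. real (Suc k) \<le> C * 2 powr (\<epsilon> * real k)"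
 proof -
  have l: "\<epsilon> * ln 2 > 0" using e by simp
  \<comment> \<open>From exp y \<ge> 1 + y with y = \<epsilon> k ln 2: the maximum ensures both C
    \<ge> 1 and C \<epsilon> ln 2 \<ge> 1, hence C (1 + y) \<ge> 1 + k.\<close>
  define C where "C = max 1 (1 / (\<epsilon> * ln 2))"
  have "real (Suc k) \<le> C * 2 powr (\<epsilon> * real k)" for k
  proof -
   have C1: "C \<ge> 1" "C * (\<epsilon> * ln 2) \<ge> 1" using l e mult_right_mono[of "1 / (\<epsilon> * ln 2)" C "\<epsilon> * ln 2"] by (auto simp: C_def)
   have "C * (1 + \<epsilon> * real k * ln 2) \<le> C * exp (\<epsilon> * real k * ln 2)" using C1 exp_ge_add_one_self by (intro mult_left_mono) auto
   moreover have "real (Suc k) \<le> C * (1 + \<epsilon> * real k * ln 2)" using C1(1) mult_right_mono[OF C1(2), of "real k"] by (simp add: algebra_simps)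
   ultimately show ?thesis by (simp add: powr_def mult_ac)
  qed
  thus ?thesis by (intro exI[of _ C]) (auto simp: C_def)
 qed
 then obtain C where C: "C \<ge> 1" "!!k. real (Suc k) \<le> C * 2 powr (\<epsilon> * real k)" by blast
 define A where "A = {p. prime p \<and> real p < P}"
 have "{p. real p < P} \<subseteq> {..nat \<lceil>P\<rceil>}" by (auto simp: le_nat_iff) linarith
 hence finA: "finite A" unfolding A_def by (rule finite_subset[rotated, OF finite_subset]) auto
 have main: "real (card {d. d dvd n}) \<le> C ^ card (A \<inter> {p. p dvd n}) * real n powr \<epsilon>" if "n > 0" for n :: nat
  using that
 proof (induction n rule: less_induct)
  case (less n)
  show ?case
  proof (cases "n = 1")
   case True
   have "A \<inter> {p. p dvd n} = {}" using True by (auto simp: A_def)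
   thus ?thesis using True by (simp add: card_1_singleton_iff)
  next
   case False
   then obtain p where p: "prime p" "p dvd n" using prime_factor_nat by blast
   obtain m where m: "n = p ^ multiplicity p n * m" "\<not> p dvd m"
    using multiplicity_decompose'[of n p] less.prems p(1) by (metis not_prime_unit not_gr_zero)
   define k where "k = multiplicity p n"
   have n: "n = p ^ k * m" using m(1) by (simp add: k_def)
   have k: "k > 0" using p less.prems by (simp add: k_def prime_multiplicity_gt_zero_iff)
   have m0: "m > 0" using m(2) by (auto intro: Nat.gr0I)
   have pk: "p ^ k > 1" using p(1) k prime_gt_1_nat one_less_power by blast
   have mn: "m < n" unfolding n using pk m0 by simp
   have IH: "real (card {d. d dvd m}) \<le> C ^ card (A \<inter> {p. p dvd m}) * real m powr \<epsilon>" by (rule less.IH[OF mn m0])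
   have "real (card {d. d dvd n}) \<le> real (Suc k * card {d. d dvd m})"
    unfolding n by (intro of_nat_mono card_divisors_prime_power_mult p m0)
   also have "\<dots> \<le> real (Suc k) * (C ^ card (A \<inter> {p. p dvd m}) * real m powr \<epsilon>)"
    unfolding of_nat_mult by (intro mult_left_mono IH) auto
   finally have 1: "real (card {d. d dvd n}) \<le> real (Suc k) * (C ^ card (A \<inter> {p. p dvd m}) * real m powr \<epsilon>)" .
   have np: "real n powr \<epsilon> = real p powr (\<epsilon> * real k) * real m powr \<epsilon>"
    unfolding n using p(1) prime_gt_0_nat[OF p(1)] by (simp add: powr_mult powr_realpow[symmetric] powr_powr mult.commute)
   have sub: "A \<inter> {q. q dvd m} \<subseteq> A \<inter> {q. q dvd n}" unfolding n by auto
   show ?thesis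
   proof (cases "real p < P")
    case True
    have pA: "p \<in> A \<inter> {q. q dvd n}" "p \<notin> A \<inter> {q. q dvd m}" using True p m(2) by (auto simp: A_def)
    have "card (A \<inter> {q. q dvd m}) < card (A \<inter> {q. q dvd n})" by (intro psubset_card_mono) (use sub pA finA in auto)
    hence "C * C ^ card (A \<inter> {p. p dvd m}) \<le> C ^ card (A \<inter> {p. p dvd n})"
     unfolding power_Suc[symmetric] using C(1) by (intro power_increasing) auto
    moreover have "2 powr (\<epsilon> * real k) \<le> real p powr (\<epsilon> * real k)"
     using e prime_ge_2_nat[OF p(1)] by (intro powr_mono2) auto
    ultimately have "(C * C ^ card (A \<inter> {p. p dvd m})) * (2 powr (\<epsilon> * real k)) \<le> C ^ card (A \<inter> {p. p dvd n}) * real p powr (\<epsilon> * real k)"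
     using C(1) by (intro mult_mono) auto
    hence "(C * C ^ card (A \<inter> {p. p dvd m})) * (2 powr (\<epsilon> * real k)) * real m powr \<epsilon> \<le> C ^ card (A \<inter> {p. p dvd n}) * real p powr (\<epsilon> * real k) * real m powr \<epsilon>"
     by (intro mult_right_mono) auto
    moreover have "real (Suc k) * (C ^ card (A \<inter> {p. p dvd m}) * real m powr \<epsilon>) \<le> (C * 2 powr (\<epsilon> * real k)) * (C ^ card (A \<inter> {p. p dvd m}) * real m powr \<epsilon>)"
     using C by (intro mult_right_mono) auto
    ultimately show ?thesis using 1 unfolding np by (simp add: mult_ac)
   next
    case False
    have "2 powr 1 \<le> real p powr \<epsilon>"
    proof -
     have "P powr \<epsilon> \<le> real p powr \<epsilon>" using False e by (intro powr_mono2) (auto simp: P_def)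
     thus ?thesis using e by (simp add: P_def powr_powr)
    qed
    hence "2 ^ k \<le> (real p powr \<epsilon>) ^ k" by (intro power_mono) auto
    also have "\<dots> = real p powr (\<epsilon> * real k)" using prime_gt_0_nat[OF p(1)] by (simp add: powr_realpow[symmetric] powr_powr)
    finally have "real (Suc k) \<le> real p powr (\<epsilon> * real k)" using of_nat_mono[OF Suc_le_two_power[of k], where ?'a = real] by simp
    moreover have "C ^ card (A \<inter> {p. p dvd m}) \<le> C ^ card (A \<inter> {p. p dvd n})"
     using C(1) by (intro power_increasing card_mono sub) (use finA in auto)
    ultimately have "real (Suc k) * (C ^ card (A \<inter> {p. p dvd m}) * real m powr \<epsilon>) \<le> real p powr (\<epsilon> * real k) * (C ^ card (A \<inter> {p. p dvd n}) * real m powr \<epsilon>)"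
     using C(1) by (intro mult_mono mult_right_mono) auto
    thus ?thesis using 1 unfolding np by (simp add: mult_ac)
   qed
  qed
 qed
 show ?thesis
 proof (rule that[of "C ^ card A"])
  show "C ^ card A \<ge> 0" using C(1) by simp
  fix n :: nat assume n: "n > 0"
  have "C ^ card (A \<inter> {p. p dvd n}) \<le> C ^ card A" using C(1) by (intro power_increasing card_mono finA) auto
  thus "real (card {d. d dvd n}) \<le> C ^ card A * real n powr \<epsilon>"
   using main[OF n] mult_right_mono[of "C ^ card (A \<inter> {p. p dvd n})" "C ^ card A" "real n powr \<epsilon>"] by simp
 qed
qed

lemma norm_sigma_chi_le:
 assumes "dirichlet_character p chi1" "dirichlet_character q chi2" "Re \<nu> > 0" "n > 0"
 shows "norm (sigma_chi (- \<nu>) (\<lambda>a. cnj (chi1 a)) (\<lambda>a. cnj (chi2 a)) n) \<le> real (card {d. d dvd n})"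
proof -
 have "norm (of_nat d powr (- \<nu>) * cnj (chi1 (int d)) * cnj (chi2 (int (n div d)))) \<le> 1" if d: "d dvd n" for d
 proof -
  have d1: "real d \<ge> 1" using d assms(4) by (auto simp: Suc_le_eq intro!: Nat.gr0I)
  have "norm (complex_of_real (real d) powr (- \<nu>)) = real d powr (- Re \<nu>)" using d1 by (subst norm_powr_of_real) auto
  also have "\<dots> \<le> real d powr 0" using d1 assms(3) by (intro powr_mono) auto
  finally have "norm (of_nat d powr (- \<nu>)) \<le> 1" using d1 by simp
  hence "norm (of_nat d powr (- \<nu>)) * norm (chi1 (int d)) * norm (chi2 (int (n div d))) \<le> 1 * 1 * 1"
   by (intro mult_mono dirichlet_character_norm_le[OF assms(1)] dirichlet_character_norm_le[OF assms(2)]) auto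
  thus ?thesis by (simp add: norm_mult)
 qed
 hence "norm (sigma_chi (- \<nu>) (\<lambda>a. cnj (chi1 a)) (\<lambda>a. cnj (chi2 a)) n) \<le> (\<Sum>d | d dvd n. 1)"
  unfolding sigma_chi_def by (intro sum_norm_le) auto
 thus ?thesis by simp
qed

section \<open>Weights on the square-root scale and a Toeplitz argument\<close>

lemma sqrt_Suc_diff_ge: "sqrt (real (Suc n)) - sqrt (real n) \<ge> 1 / (2 * sqrt (real (Suc n)))"
proof -
 let ?a = "sqrt (real n)" and ?b = "sqrt (real (Suc n))"
 have b: "?b > 0" "?a \<le> ?b" "?a \<ge> 0" by auto
 have "(?b - ?a) * (?b + ?a) = 1" by (simp add: algebra_simps)
 moreover have "(?b - ?a) * (?b + ?a) \<le> (?b - ?a) * (2 * ?b)" using b by (intro mult_left_mono) auto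
 ultimately show ?thesis using b by (simp add: pos_divide_le_eq)
qed

text \<open>With y = b - s, one of the three powers of 1 + y pays for the density of square roots
  through b \<le> (1 + s) (1 + y). The other two, combined with b - a \<ge> 1/(2 b), are dominated
  by a telescoping difference of reciprocals.\<close>

lemma sqrt_weight_above:
 assumes "N \<le> n"
 shows "1 / (1 + \<bar>sqrt (real N) - sqrt (real (Suc n))\<bar>) ^ 3
  \<le> 2 * (1 + sqrt (real N)) / (1 + (sqrt (real n) - sqrt (real N))) - 2 * (1 + sqrt (real N)) / (1 + (sqrt (real (Suc n)) - sqrt (real N)))"
proof -
 define s a b where "s = sqrt (real N)" "a = sqrt (real n)" "b = sqrt (real (Suc n))"
 have o: "s \<ge> 0" "s \<le> a" "a \<le> b" "b > 0" using assms by (auto simp: s_a_b_def)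
 have ab: "b - a \<ge> 1 / (2 * b)" unfolding s_a_b_def by (rule sqrt_Suc_diff_ge)
 define y where "y = b - s"
 have y: "y \<ge> 0" "1 + y > 0" using o by (auto simp: y_def)
 have bsy: "b \<le> (1 + s) * (1 + y)" 
 proof -
  have "(1 + s) * (1 + y) = 1 + s + y + s * y" by (simp add: algebra_simps)
  moreover have "s * y \<ge> 0" using o y by simp
  ultimately show ?thesis by (simp add: y_def)
 qed
 have "1 / (1 + y) ^ 3 = ((1 + s) * (1 + y)) * (1 / ((1 + s) * (1 + y) * (1 + y) ^ 3))" using o y by simp
 also have "1 / ((1 + s) * (1 + y) * (1 + y) ^ 3) \<le> 1 / (b * (1 + y) ^ 3)"
  using bsy o y by (intro divide_left_mono mult_right_mono mult_pos_pos) auto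
 finally have "1 / (1 + y) ^ 3 \<le> ((1 + s) * (1 + y)) * (1 / (b * (1 + y) ^ 3))" using o y by (simp add: mult_left_mono)
 also have "\<dots> = 2 * (1 + s) * (1 / (2 * b)) / ((1 + y) * (1 + y))"
 proof -
  have g: "(S * Y) * (1 / (b * Y ^ 3)) = 2 * S * (1 / (2 * b)) / (Y * Y)" if "Y \<noteq> 0" for S Y using that by (simp add: field_simps power3_eq_cube)
  show ?thesis by (rule g) (use y in simp)
 qed
 also have "\<dots> \<le> 2 * (1 + s) * (b - a) / ((1 + (a - s)) * (1 + y))"
  using o y ab by (intro frac_le mult_left_mono mult_right_mono mult_pos_pos mult_nonneg_nonneg) (auto simp: y_def)
 also have "\<dots> = 2 * (1 + s) / (1 + (a - s)) - 2 * (1 + s) / (1 + y)"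
 proof -
  have "1 + (a - s) > 0" using o by simp
  thus ?thesis using y by (simp add: y_def divide_simps) (simp add: algebra_simps)
 qed
 finally show ?thesis using o by (simp add: y_def s_a_b_def)
qed

text \<open>Below the index N the density is bounded directly by b \<le> s, so two of the three
  powers already yield the telescoping difference.\<close>

lemma sqrt_weight_below:
 assumes "n < N"
 shows "1 / (1 + \<bar>sqrt (real N) - sqrt (real n)\<bar>) ^ 3
  \<le> 2 * (1 + sqrt (real N)) / (1 + (sqrt (real N) - sqrt (real (Suc n)))) - 2 * (1 + sqrt (real N)) / (1 + (sqrt (real N) - sqrt (real n)))"
proof -
 define s a b where "s = sqrt (real N)" "a = sqrt (real n)" "b = sqrt (real (Suc n))"
 have o: "a \<ge> 0" "b \<le> s" "a \<le> b" "b > 0" using assms by (auto simp: s_a_b_def)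
 have ab: "b - a \<ge> 1 / (2 * b)" unfolding s_a_b_def by (rule sqrt_Suc_diff_ge)
 define y where "y = s - a"
 have y: "y \<ge> 0" "1 + y \<ge> 1" using o by (auto simp: y_def)
 have "(1 + y) ^ 2 \<le> (1 + y) ^ 3" using y by (intro power_increasing) auto
 moreover have "(1 + y) ^ 2 > 0" using y by (intro zero_less_power) auto
 ultimately have "1 / (1 + y) ^ 3 \<le> 1 / (1 + y) ^ 2" using y by (intro divide_left_mono mult_pos_pos zero_less_power) auto
 also have "\<dots> \<le> (1 + s) / b * (1 / (1 + y) ^ 2)"
  using o mult_right_mono[of 1 "(1 + s) / b" "1 / (1 + y) ^ 2"] by (simp add: field_simps)
 also have "\<dots> = 2 * (1 + s) * (1 / (2 * b)) / ((1 + y) * (1 + y))"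
 proof -
  have "S / b * (1 / Y ^ 2) = 2 * S * (1 / (2 * b)) / (Y * Y)" for S Y :: real by (simp add: power2_eq_square)
  thus ?thesis .
 qed
 also have "\<dots> \<le> 2 * (1 + s) * (b - a) / ((1 + (s - b)) * (1 + y))"
  using o y ab by (intro frac_le mult_left_mono mult_right_mono mult_pos_pos mult_nonneg_nonneg) (auto simp: y_def)
 also have "\<dots> = 2 * (1 + s) / (1 + (s - b)) - 2 * (1 + s) / (1 + y)"
 proof -
  have "1 + (s - b) > 0" "1 + y > 0" using o y by auto
  thus ?thesis by (simp add: y_def divide_simps) (simp add: algebra_simps)
 qed
 finally show ?thesis using o by (simp add: y_def s_a_b_def)
qed

text \<open>Telescoping contributes 2 (1 + sqrt N) from each side of N, and the term at N is 1. The
  order of magnitude is the number of square roots within distance 1 of sqrt N.\<close>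

lemma sqrt_weight_sum_le:
 "(\<Sum>n<M. 1 / (1 + \<bar>sqrt (real N) - sqrt (real n)\<bar>) ^ 3) \<le> 5 * (1 + sqrt (real N))"
proof -
 let ?w = "\<lambda>n. 1 / (1 + \<bar>sqrt (real N) - sqrt (real n)\<bar>) ^ 3" and ?s = "sqrt (real N)"
 have split: "(\<Sum>n<N + m. h n) = (\<Sum>n<N. h n) + (\<Sum>n<m. h (N + n))" for m and h :: "nat => real"
  by (induction m) (simp_all add: add_ac)
 have "(\<Sum>n<N. ?w n) \<le> (\<Sum>n<N. 2 * (1 + ?s) / (1 + (?s - sqrt (real (Suc n)))) - 2 * (1 + ?s) / (1 + (?s - sqrt (real n))))"
  by (intro sum_mono sqrt_weight_below) auto
 also have "\<dots> = 2 * (1 + ?s) - 2 * (1 + ?s) / (1 + ?s)"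
  using sum_lessThan_telescope[of "\<lambda>n. 2 * (1 + ?s) / (1 + (?s - sqrt (real n)))" N] by simp
 also have "\<dots> \<le> 2 * (1 + ?s)" by simp
 finally have 1: "(\<Sum>n<N. ?w n) \<le> 2 * (1 + ?s)" .
 have 2: "(\<Sum>n<m. ?w (Suc (N + n))) \<le> 2 * (1 + ?s)" for m
 proof -
  let ?P = "\<lambda>n. 2 * (1 + ?s) / (1 + (sqrt (real (N + n)) - ?s))"
  have "(\<Sum>n<m. ?w (Suc (N + n))) \<le> (\<Sum>n<m. ?P n - ?P (Suc n))"
   by (intro sum_mono order.trans[OF sqrt_weight_above]) auto
  also have "\<dots> = ?P 0 - ?P m" by (rule sum_lessThan_telescope')
  also have "\<dots> \<le> ?P 0" by (simp add: divide_nonneg_nonneg)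
  finally show ?thesis by simp
 qed
 have "(\<Sum>n<M. ?w n) \<le> (\<Sum>n<N + Suc M. ?w n)" by (intro sum_mono2) auto
 also have "\<dots> = (\<Sum>n<N. ?w n) + (\<Sum>n<Suc M. ?w (N + n))" by (rule split)
 also have "(\<Sum>n<Suc M. ?w (N + n)) = ?w N + (\<Sum>n<M. ?w (Suc (N + n)))" by (subst sum.lessThan_Suc_shift) simp
 finally have "(\<Sum>n<M. ?w n) \<le> (\<Sum>n<N. ?w n) + (?w N + (\<Sum>n<M. ?w (Suc (N + n))))" .
 moreover have "?w N = 1" "?s \<ge> 0" by simp_all
 moreover have "A \<le> B + (w + D) ==> w = 1 ==> s \<ge> 0 ==> B \<le> 2 * (1 + s) ==> D \<le> 2 * (1 + s) ==> A \<le> 5 * (1 + s)" for A B w D s :: real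
  by simp
 ultimately show ?thesis using 1 2[of M] by blast
qed

text \<open>Finitely many columns tend to 0 one by one; beyond them x is small while the row sums
  are bounded. In the application the weights peak at k = N with height about 1 / sqrt N and thus
  have no summable majorant in k, so dominated convergence would not do.\<close>

lemma toeplitz_null:
 fixes w :: "nat => nat => real" and x :: "nat => real"
 assumes w: "!!N k. w N k \<ge> 0" "!!N M. (\<Sum>k<M. w N k) \<le> C" "!!k. (\<lambda>N. w N k) \<longlonglongrightarrow> 0"
  and x: "!!k. x k \<ge> 0" "x \<longlonglongrightarrow> 0"
 shows "!!N. summable (\<lambda>k. w N k * x k)" "(\<lambda>N. \<Sum>k. w N k * x k) \<longlonglongrightarrow> 0"
proof -
 have sw: "summable (w N)" for N by (rule summableI_nonneg_bounded[OF w(1,2)])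
 have C: "(\<Sum>k. w N k) \<le> C" for N by (rule suminf_le_const[OF sw w(2)])
 have C0: "C \<ge> 0" using w(2)[of 0 0] by simp
 have "Bseq x" using x(2) by (intro convergent_imp_Bseq convergentI)
 then obtain X where X': "!!k. norm (x k) \<le> X" unfolding Bseq_def by blast
 have X: "x k \<le> X" for k using X'[of k] x(1)[of k] by simp
 show s: "summable (\<lambda>k. w N k * x k)" for N
  by (rule summable_comparison_test'[OF summable_mult2[OF sw[of N], of X]]) (use w x X in \<open>auto simp: abs_mult intro!: mult_left_mono\<close>)
 show "(\<lambda>N. \<Sum>k. w N k * x k) \<longlonglongrightarrow> 0"
 proof (rule LIMSEQ_I)
  fix e :: real assume e: "e > 0"
  define \<eta> where "\<eta> = e / (2 * (C + 1))"
  have \<eta>: "\<eta> > 0" "\<eta> * C < e / 2" using e C0 by (auto simp: \<eta>_def field_simps)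
  obtain M where M: "!!k. k \<ge> M ==> x k < \<eta>" using LIMSEQ_D[OF x(2) \<eta>(1)] x(1) by auto
  have "(\<lambda>N. \<Sum>k<M. w N k * x k) \<longlonglongrightarrow> (\<Sum>k<M. 0 * x k)" by (intro tendsto_sum tendsto_mult w(3) tendsto_const)
  hence "(\<lambda>N. \<Sum>k<M. w N k * x k) \<longlonglongrightarrow> 0" by simp
  then obtain N0 where N0: "!!N. N \<ge> N0 ==> norm ((\<Sum>k<M. w N k * x k) - 0) < e / 2" 
   using LIMSEQ_D[of "\<lambda>N. \<Sum>k<M. w N k * x k" 0 "e / 2"] e half_gt_zero by blast
  show "\<exists>no. \<forall>n\<ge>no. norm ((\<Sum>k. w n k * x k) - 0) < e"
  proof (intro exI allI impI)
   fix N assume N: "N \<ge> N0"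
   have sM: "summable (\<lambda>k. w N (k + M))" using sw by (simp add: summable_iff_shift)
   have "(\<Sum>k. w N (k + M) * x (k + M)) \<le> (\<Sum>k. w N (k + M) * \<eta>)"
    by (intro suminf_le mult_left_mono summable_mult2 sM) (use M w s summable_iff_shift[of "\<lambda>k. w N k * x k" M] in \<open>auto intro: less_imp_le\<close>)
   also have "\<dots> = (\<Sum>k. w N (k + M)) * \<eta>" by (rule suminf_mult2[OF sM, symmetric])
   also have "(\<Sum>k. w N (k + M)) \<le> (\<Sum>k. w N k)" using suminf_split_initial_segment[OF sw, of N M] sum_nonneg[of "{..<M}" "w N"] w(1) by simp
   finally have "(\<Sum>k. w N (k + M) * x (k + M)) \<le> C * \<eta>" using C[of N] \<eta> by (meson mult_right_mono order_trans less_imp_le)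
   moreover have "(\<Sum>k. w N k * x k) = (\<Sum>k. w N (k + M) * x (k + M)) + (\<Sum>k<M. w N k * x k)" by (rule suminf_split_initial_segment[OF s])
   moreover have "(\<Sum>k. w N k * x k) \<ge> 0" by (intro suminf_nonneg s mult_nonneg_nonneg w x)
   ultimately show "norm ((\<Sum>k. w N k * x k) - 0) < e" using N0[OF N] \<eta>(2) by (simp add: mult.commute)
  qed
 qed
qed

section \<open>The truncated Fourier integral of an indicator function\<close>

lemma has_vector_derivative_cis:
 fixes w :: real
 assumes w: "w \<noteq> 0"
 shows "((\<lambda>x. cis (w * x) / (\<i> * of_real w)) has_vector_derivative cis (w * x)) (at x within T)"
proof -
 have "((\<lambda>z. exp (\<i> * of_real w * z) / (\<i> * of_real w)) has_field_derivative exp (\<i> * of_real w * of_real x)) (at (of_real x))"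
  using w by (auto intro!: derivative_eq_intros)
 from has_vector_derivative_real_field[OF this] show ?thesis by (simp add: cis_conv_exp mult_ac)
qed

lemma integral_cis:
 assumes "a \<le> b" "w \<noteq> 0"
 shows "integral {a..b} (\<lambda>x. cis (w * x)) = (cis (w * b) - cis (w * a)) / (\<i> * of_real w)"
proof -
 have "((\<lambda>x. cis (w * x)) has_integral (cis (w * b) / (\<i> * of_real w) - cis (w * a) / (\<i> * of_real w))) {a..b}"
  by (rule fundamental_theorem_of_calculus[OF assms(1)]) (rule has_vector_derivative_cis[OF assms(2)])
 thus ?thesis by (simp add: integral_unique diff_divide_distrib)
qed

lemma continuous_on_cis [continuous_intros]: "continuous_on A f ==> continuous_on A (\<lambda>x. cis (f x))"
 unfolding cis_conv_exp by (intro continuous_intros)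

text \<open>Fourier transform of the indicator function of [a, b]; written as an integral, it covers
  \<xi> = 0 without a separate case.\<close>

definition ehat :: "real => real => real => complex" where
 "ehat a b \<xi> = integral {a..b} (\<lambda>v. cis (- \<xi> * v))"

lemma norm_ehat_le:
 assumes "a \<le> b" shows "norm (ehat a b \<xi>) \<le> (2 + (b - a)) / (1 + \<bar>\<xi>\<bar>)"
proof -
 have 1: "norm (ehat a b \<xi>) \<le> 1 * (b - a)" unfolding ehat_def by (rule integral_bound[OF assms]) (auto intro!: continuous_intros)
 have 2: "norm (ehat a b \<xi>) * \<bar>\<xi>\<bar> \<le> 2"
 proof (cases "\<xi> = 0")
  case False
  have "norm (ehat a b \<xi>) = norm (cis (- \<xi> * b) - cis (- \<xi> * a)) / \<bar>\<xi>\<bar>"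
   unfolding ehat_def using integral_cis[OF assms, of "- \<xi>"] False by (simp add: norm_divide norm_mult)
  thus ?thesis using False norm_triangle_ineq4[of "cis (- \<xi> * b)" "cis (- \<xi> * a)"] by simp
 qed simp
 show ?thesis using 1 2 by (simp add: pos_le_divide_eq distrib_left)
qed

lemma continuous_on_ehat: "continuous_on T (ehat a b)"
proof -
 have "continuous_on UNIV (\<lambda>\<xi>. integral (cbox a b) (\<lambda>v. cis (- \<xi> * v)))"
  by (rule integral_continuous_on_param) (auto simp: case_prod_beta intro!: continuous_intros)
 thus ?thesis unfolding ehat_def by (auto intro: continuous_on_subset)
qed

text \<open>Defined for complex z: being entire, it fits into the holomorphic factor of
  \<open>fourier_on\<close> and of \<open>test_function\<close>.\<close>

definition trunc :: "real => real => real => complex => complex" where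
 "trunc a b L z = 1 / (2 * of_real pi) * integral {- L..L} (\<lambda>\<xi>. ehat a b \<xi> * exp (\<i> * of_real \<xi> * z))"

lemma holomorphic_trunc: "trunc a b L holomorphic_on UNIV"
proof -
 have "(\<lambda>z. integral (cbox (- L) L) (\<lambda>\<xi>. ehat a b \<xi> * exp (\<i> * of_real \<xi> * z))) holomorphic_on UNIV"
 proof (rule leibniz_rule_holomorphic[where fx = "\<lambda>z \<xi>. ehat a b \<xi> * (\<i> * of_real \<xi> * exp (\<i> * of_real \<xi> * z))"])
  show "((\<lambda>z. ehat a b \<xi> * exp (\<i> * of_real \<xi> * z)) has_field_derivative ehat a b \<xi> * (\<i> * of_real \<xi> * exp (\<i> * of_real \<xi> * z))) (at z within UNIV)" for z \<xi>
   by (auto intro!: derivative_eq_intros)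
  show "(\<lambda>\<xi>. ehat a b \<xi> * exp (\<i> * of_real \<xi> * z)) integrable_on cbox (- L) L" for z
   by (intro integrable_continuous continuous_intros continuous_on_ehat)
  show "continuous_on (UNIV \<times> cbox (- L) L) (\<lambda>(z, \<xi>). ehat a b \<xi> * (\<i> * of_real \<xi> * exp (\<i> * of_real \<xi> * z)))"
   unfolding case_prod_beta by (intro continuous_intros continuous_on_compose2[OF continuous_on_ehat[of UNIV]]) auto
 qed auto
 thus ?thesis unfolding trunc_def by (auto intro!: holomorphic_intros)
qed

lemma integral_cis_symmetric:
 assumes L: "L > 0"
 shows "integral {- L..L} (\<lambda>\<xi>. cis (\<xi> * w)) = of_real (2 * (L * sinc (L * w)))"
proof (cases "w = 0")
 case False
 have "integral {- L..L} (\<lambda>\<xi>. cis (\<xi> * w)) = (cis (w * L) - cis (w * - L)) / (\<i> * of_real w)"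
  using integral_cis[of "- L" L w] L False by (simp add: mult.commute)
 also have "cis (w * L) - cis (w * - L) = \<i> * of_real (2 * sin (L * w))" by (simp add: complex_eq_iff mult.commute)
 finally show ?thesis using False L by simp
qed (use L in \<open>simp add: scaleR_conv_of_real\<close>)

text \<open>Exchanging the integrals gives the Dirichlet kernel in u - v, whose primitive is the
  sine integral. Boundedness and limits of \<open>Si\<close> then provide a bound uniform in L and
  the pointwise limit.\<close>

lemma trunc_of_real:
 assumes L: "L > 0" and ab: "a \<le> b"
 shows "trunc a b L (of_real u) = of_real ((Si (L * (u - a)) - Si (L * (u - b))) / pi)"
proof -
 have "integral {- L..L} (\<lambda>\<xi>. ehat a b \<xi> * exp (\<i> * of_real \<xi> * of_real u)) = integral (cbox (- L) L) (\<lambda>\<xi>. integral (cbox a b) (\<lambda>v. cis (\<xi> * (u - v))))"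
 proof (unfold cbox_interval, intro Henstock_Kurzweil_Integration.integral_cong)
  fix \<xi>
  have "ehat a b \<xi> * exp (\<i> * of_real \<xi> * of_real u) = integral {a..b} (\<lambda>v. cis (- \<xi> * v) * cis (\<xi> * u))"
   unfolding ehat_def by (subst integral_mult_left[symmetric]) (auto simp: cis_conv_exp mult_ac intro!: integrable_continuous_interval continuous_intros)
  also have "\<dots> = integral {a..b} (\<lambda>v. cis (\<xi> * (u - v)))" by (simp add: cis_mult right_diff_distrib)
  finally show "ehat a b \<xi> * exp (\<i> * of_real \<xi> * of_real u) = integral {a..b} (\<lambda>v. cis (\<xi> * (u - v)))" .
 qed
 also have "\<dots> = integral (cbox a b) (\<lambda>v. integral (cbox (- L) L) (\<lambda>\<xi>. cis (\<xi> * (u - v))))"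
  by (rule integral_swap_continuous) (auto simp: case_prod_beta intro!: continuous_intros)
 also have "\<dots> = integral {a..b} (\<lambda>v. of_real (2 * (L * sinc (L * (u - v)))))"
  unfolding cbox_interval integral_cis_symmetric[OF L] ..
 also have "\<dots> = of_real (2 * (- Si (L * (u - b)))) - of_real (2 * (- Si (L * (u - a))))"
 proof (rule integral_unique, rule fundamental_theorem_of_calculus[OF ab])
  fix v
  have "((\<lambda>v. 2 * (- Si (L * (u - v)))) has_real_derivative 2 * (L * sinc (L * (u - v)))) (at v within {a..b})"
   by (rule derivative_eq_intros DERIV_chain2[OF DERIV_Si] refl)+ simp
  thus "((\<lambda>v. complex_of_real (2 * (- Si (L * (u - v))))) has_vector_derivative of_real (2 * (L * sinc (L * (u - v))))) (at v within {a..b})"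
   by (intro has_vector_derivative_of_real)
 qed
 finally show ?thesis unfolding trunc_def by (simp add: field_simps)
qed

lemma norm_trunc_bounded:
 assumes "a \<le> b"
 obtains B where "B \<ge> 0" "!!L u. L > 0 ==> norm (trunc a b L (of_real u)) \<le> B"
proof -
 obtain B where B: "!!T. \<bar>Si T\<bar> \<le> B" using bounded_Si by blast
 have B0: "B \<ge> 0" using B[of 0] by linarith
 show ?thesis
 proof (rule that[of "2 * B / pi"])
  fix L u :: real assume L: "L > 0"
  have "\<bar>Si (L * (u - a)) - Si (L * (u - b))\<bar> \<le> 2 * B" using B[of "L * (u - a)"] B[of "L * (u - b)"] by linarith
  thus "norm (trunc a b L (of_real u)) \<le> 2 * B / pi"
   unfolding trunc_of_real[OF L assms] norm_of_real abs_divide by (simp add: divide_right_mono)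
 qed (use B0 in simp)
qed

lemma tendsto_trunc:
 assumes ab: "a \<le> b"
 shows "((\<lambda>L. trunc a b L (of_real u)) \<longlongrightarrow> of_real ((sgn (u - a) - sgn (u - b)) / 2)) at_top"
proof -
 have p: "((\<lambda>L. Si (L * y)) \<longlongrightarrow> pi / 2) at_top" if "y > 0" for y
  by (rule filterlim_compose[OF Si_at_top]) (rule filterlim_at_top_mult_tendsto_pos[OF tendsto_const that filterlim_ident])
 have n: "((\<lambda>L. Si (L * y)) \<longlongrightarrow> - (pi / 2)) at_top" if y: "y < 0" for y
 proof (rule Lim_transform_eventually)
  show "((\<lambda>L. - Si (L * (- y))) \<longlongrightarrow> - (pi / 2)) at_top" by (intro tendsto_minus p) (use y in simp)
  show "\<forall>\<^sub>F L in at_top. - Si (L * - y) = Si (L * y)"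
   using eventually_ge_at_top[of 0]
  proof eventually_elim
   case (elim L)
   have "Si (- (L * - y)) = - Si (L * - y)" by (rule Si_neg) (use elim y in \<open>simp add: mult_nonneg_nonpos\<close>)
   thus ?case by simp
  qed
 qed
 have "Si 0 = 0" using Si_neg[of 0] by simp
 hence sg: "((\<lambda>L. Si (L * y)) \<longlongrightarrow> pi / 2 * sgn y) at_top" for y
  using p[of y] n[of y] by (cases y "0 :: real" rule: linorder_cases) auto
 have "((\<lambda>L. complex_of_real ((Si (L * (u - a)) - Si (L * (u - b))) / pi)) \<longlongrightarrow>
  of_real ((pi / 2 * sgn (u - a) - pi / 2 * sgn (u - b)) / pi)) at_top"
  by (intro tendsto_of_real tendsto_divide tendsto_diff tendsto_const sg) auto
 also have "(pi / 2 * sgn (u - a) - pi / 2 * sgn (u - b)) / pi = (sgn (u - a) - sgn (u - b)) / 2"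
  by (simp add: field_simps)
 finally show ?thesis
  by (rule Lim_transform_eventually) (use eventually_gt_at_top[of 0] in \<open>eventually_elim, use ab in \<open>auto simp: trunc_of_real\<close>\<close>)
qed

text \<open>Multiplication by the truncation becomes convolution with \<open>ehat\<close> restricted
  to [-L, L].\<close>

lemma fourier_on_trunc:
 assumes "continuous_on {c..d} \<psi>" "continuous_on {c..d} (\<lambda>x. G (complex_of_real x))"
 shows "fourier_on c d \<psi> (\<lambda>z. G z * trunc a b L z) \<eta>
  = 1 / (2 * of_real pi) * integral {- L..L} (\<lambda>\<xi>. ehat a b \<xi> * fourier_on c d \<psi> G (\<eta> + \<xi>))"
proof -
 let ?k = "\<lambda>x \<xi>. ehat a b \<xi> * (of_real (\<psi> x) * G (of_real x) * cis ((\<eta> + \<xi>) * x))"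
 have cx: "continuous_on {c..d} (\<lambda>x. of_real (\<psi> x) * G (of_real x) * cis ((\<eta> + \<xi>) * x))" for \<xi>
  by (intro continuous_intros assms)
 have "fourier_on c d \<psi> (\<lambda>z. G z * trunc a b L z) \<eta> = integral {c..d} (\<lambda>x. 1 / (2 * of_real pi) * integral {- L..L} (?k x))"
  unfolding fourier_on_def
 proof (intro Henstock_Kurzweil_Integration.integral_cong)
  fix x
  have e: "cis ((\<eta> + \<xi>) * x) = cis (\<eta> * x) * exp (\<i> * of_real \<xi> * of_real x)" for \<xi>
   by (simp add: cis_conv_exp exp_add[symmetric] algebra_simps)
  have "integral {- L..L} (?k x) = integral {- L..L} (\<lambda>\<xi>. (of_real (\<psi> x) * G (of_real x) * cis (\<eta> * x)) * (ehat a b \<xi> * exp (\<i> * of_real \<xi> * of_real x)))"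
   by (intro Henstock_Kurzweil_Integration.integral_cong) (unfold e, simp only: mult_ac)
  also have "\<dots> = (of_real (\<psi> x) * G (of_real x) * cis (\<eta> * x)) * integral {- L..L} (\<lambda>\<xi>. ehat a b \<xi> * exp (\<i> * of_real \<xi> * of_real x))"
   by (rule integral_mult_right)
  finally show "of_real (\<psi> x) * (G (of_real x) * trunc a b L (of_real x)) * cis (\<eta> * x) = 1 / (2 * of_real pi) * integral {- L..L} (?k x)"
   unfolding trunc_def by (simp only: mult_ac)
 qed
 also have "\<dots> = 1 / (2 * of_real pi) * integral (cbox c d) (\<lambda>x. integral (cbox (- L) L) (?k x))"
  unfolding cbox_interval by (rule integral_mult_right)
 also have "integral (cbox c d) (\<lambda>x. integral (cbox (- L) L) (?k x)) = integral (cbox (- L) L) (\<lambda>\<xi>. integral (cbox c d) (\<lambda>x. ?k x \<xi>))"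
 proof (rule integral_swap_continuous)
  show "continuous_on (cbox (c, - L) (d, L)) (\<lambda>(x, \<xi>). ?k x \<xi>)"
   unfolding case_prod_beta cbox_Pair_eq cbox_interval
   by (intro continuous_intros continuous_on_compose2[OF continuous_on_ehat[of UNIV]] continuous_on_compose2[OF assms(1)] continuous_on_compose2[OF assms(2)]) auto
 qed
 also have "\<dots> = integral {- L..L} (\<lambda>\<xi>. ehat a b \<xi> * fourier_on c d \<psi> G (\<eta> + \<xi>))"
  unfolding cbox_interval fourier_on_def integral_mult_right ..
 finally show ?thesis .
qed

lemma integral_inverse_power4_le:
 fixes k :: real
 shows "a \<le> b ==> b < k ==> (\<lambda>x. 1 / (k - x) ^ 4) integrable_on {a..b}"
  "a \<le> b ==> b < k ==> integral {a..b} (\<lambda>x. 1 / (k - x) ^ 4) \<le> 1 / (k - b) ^ 3"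
  "a \<le> b ==> - k < a ==> (\<lambda>x. 1 / (k + x) ^ 4) integrable_on {a..b}"
  "a \<le> b ==> - k < a ==> integral {a..b} (\<lambda>x. 1 / (k + x) ^ 4) \<le> 1 / (k + a) ^ 3"
proof -
 have main: "(\<lambda>x. 1 / (k - x) ^ 4) integrable_on {a..b} \<and> integral {a..b} (\<lambda>x. 1 / (k - x) ^ 4) \<le> 1 / (k - b) ^ 3" if "a \<le> b" "b < k" for a b :: real
 proof -
  have "((\<lambda>x. 1 / (k - x) ^ 4) has_integral (1 / (3 * (k - b) ^ 3) - 1 / (3 * (k - a) ^ 3))) {a..b}"
  proof (rule fundamental_theorem_of_calculus[OF that(1)])
   fix x assume "x \<in> {a..b}"
   hence x: "k - x > 0" using that by auto
   have "((\<lambda>x. 1 / (3 * (k - x) ^ 3)) has_real_derivative 1 / (k - x) ^ 4) (at x within {a..b})"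
   proof -
    have "((\<lambda>y. 1 / (3 * y ^ 3)) has_real_derivative - (1 / y ^ 4)) (at y)" if "y > 0" for y :: real
     using that by (auto intro!: derivative_eq_intros simp: field_simps eval_nat_numeral)
    moreover have "((\<lambda>x. k - x) has_real_derivative - 1) (at x within {a..b})" by (auto intro!: derivative_eq_intros)
    ultimately show ?thesis using x DERIV_chain2[of "\<lambda>y. 1 / (3 * y ^ 3)" "- (1 / (k - x) ^ 4)" "\<lambda>x. k - x" x "- 1"] by simp
   qed
   thus "((\<lambda>x. 1 / (3 * (k - x) ^ 3)) has_vector_derivative 1 / (k - x) ^ 4) (at x within {a..b})"
    by (simp add: has_real_derivative_iff_has_vector_derivative)
  qed
  moreover have "1 / (3 * (k - b) ^ 3) - 1 / (3 * (k - a) ^ 3) \<le> 1 / (k - b) ^ 3"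
  proof -
   have "1 / (3 * (k - a) ^ 3) \<ge> 0" "1 / (k - b) ^ 3 \<ge> 0" using that by auto
   moreover have "1 / (3 * (k - b) ^ 3) = (1 / (k - b) ^ 3) / 3" by simp
   ultimately show ?thesis by linarith
  qed
  ultimately show ?thesis by (auto simp: integral_unique has_integral_integrable)
 qed
 show "a \<le> b ==> b < k ==> (\<lambda>x. 1 / (k - x) ^ 4) integrable_on {a..b}"
  "a \<le> b ==> b < k ==> integral {a..b} (\<lambda>x. 1 / (k - x) ^ 4) \<le> 1 / (k - b) ^ 3" using main[of a b] by auto
 have e: "(\<lambda>x. 1 / (k + x) ^ 4) = (\<lambda>x. 1 / (k - (- x)) ^ 4)" by simp
 show "a \<le> b ==> - k < a ==> (\<lambda>x. 1 / (k + x) ^ 4) integrable_on {a..b}"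
  "a \<le> b ==> - k < a ==> integral {a..b} (\<lambda>x. 1 / (k + x) ^ 4) \<le> 1 / (k + a) ^ 3"
  unfolding e using main[of "- b" "- a"] Henstock_Kurzweil_Integration.integrable_reflect_real[where f = "\<lambda>x. 1 / (k - x) ^ 4" and a = "- b" and b = "- a"] Henstock_Kurzweil_Integration.integral_reflect_real[where f = "\<lambda>x. 1 / (k - x) ^ 4" and a = "- b" and b = "- a"]
  by auto
qed

text \<open>\<open>ehat\<close> decays only to first order, but \<Phi> concentrates the integral
  near \<xi> = -\<eta>. If that point is outside [-L, L], the integral over [-L, L] is small; if it
  is inside, what enlarging L adds is small.\<close>

lemma ehat_convolution_bounds:
 assumes ab: "a \<le> b" and \<Phi>: "continuous_on UNIV \<Phi>" "!!\<eta>. norm (\<Phi> \<eta>) \<le> C / (1 + \<bar>\<eta>\<bar>) ^ 5" and L: "0 \<le> L"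
 shows "L \<le> \<bar>\<eta>\<bar> ==> norm (integral {- L..L} (\<lambda>\<xi>. ehat a b \<xi> * \<Phi> (\<eta> + \<xi>))) \<le> 2 * ((2 + (b - a)) * C) / ((1 + L) * (1 + (\<bar>\<eta>\<bar> - L)) ^ 3)"
  and "\<bar>\<eta>\<bar> \<le> L ==> L \<le> L' ==> norm (integral {- L'..L'} (\<lambda>\<xi>. ehat a b \<xi> * \<Phi> (\<eta> + \<xi>)) - integral {- L..L} (\<lambda>\<xi>. ehat a b \<xi> * \<Phi> (\<eta> + \<xi>)))
    \<le> 2 * ((2 + (b - a)) * C) / ((1 + L) * (1 + (L - \<bar>\<eta>\<bar>)) ^ 3)"
proof -
 let ?h = "\<lambda>\<xi>. ehat a b \<xi> * \<Phi> (\<eta> + \<xi>)"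
 define E where "E = (2 + (b - a)) * C"
 have C0: "C \<ge> 0" using \<Phi>(2)[of 0] norm_ge_zero[of "\<Phi> 0"] by (simp del: norm_ge_zero)
 have E0: "E \<ge> 0" using C0 ab by (simp add: E_def)
 have hi: "?h integrable_on {x..y}" for x y
  by (intro integrable_continuous_interval continuous_intros continuous_on_ehat continuous_on_compose2[OF \<Phi>(1)]) auto
 \<comment> \<open>Of the five powers of Y one is joined with 1 + \<bar>\<xi>\<bar> to produce 1 +
   L; the remaining fourth power integrates to the cube in the result.\<close>
 have hb: "norm (?h \<xi>) \<le> E / (1 + L) * (1 / Y ^ 4)" if Y: "Y \<ge> 1" "Y \<le> 1 + \<bar>\<eta> + \<xi>\<bar>" "1 + L \<le> (1 + \<bar>\<xi>\<bar>) * Y" for \<xi> Y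
 proof -
  have "norm (\<Phi> (\<eta> + \<xi>)) \<le> C / Y ^ 5"
   by (rule order_trans[OF \<Phi>(2)]) (use Y C0 in \<open>intro divide_left_mono power_mono mult_pos_pos zero_less_power, auto\<close>)
  hence "norm (?h \<xi>) \<le> (2 + (b - a)) / (1 + \<bar>\<xi>\<bar>) * (C / Y ^ 5)"
   unfolding norm_mult using ab by (intro mult_mono norm_ehat_le) auto
  also have "\<dots> = E / (((1 + \<bar>\<xi>\<bar>) * Y) * Y ^ 4)" by (simp add: E_def eval_nat_numeral mult_ac)
  also have "\<dots> \<le> E / ((1 + L) * Y ^ 4)"
   using Y L E0 by (intro divide_left_mono mult_right_mono mult_pos_pos zero_less_power) auto
  finally show ?thesis by simp
 qed
 { assume l: "L \<le> \<bar>\<eta>\<bar>"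
  let ?g = "\<lambda>\<xi>. E / (1 + L) * (1 / ((1 + \<bar>\<eta>\<bar>) - \<xi>) ^ 4 + 1 / ((1 + \<bar>\<eta>\<bar>) + \<xi>) ^ 4)"
  have "norm (?h \<xi>) \<le> ?g \<xi>" if x: "\<xi> \<in> {- L..L}" for \<xi>
  proof -
   have xi: "\<bar>\<xi>\<bar> \<le> L" using x by auto
   have "norm (?h \<xi>) \<le> E / (1 + L) * (1 / (1 + (\<bar>\<eta>\<bar> - \<bar>\<xi>\<bar>)) ^ 4)"
   proof (rule hb)
    have "(1 + \<bar>\<xi>\<bar>) * (1 + (\<bar>\<eta>\<bar> - \<bar>\<xi>\<bar>)) = 1 + \<bar>\<eta>\<bar> + \<bar>\<xi>\<bar> * (\<bar>\<eta>\<bar> - \<bar>\<xi>\<bar>)" by (simp add: algebra_simps)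
    moreover have "\<bar>\<xi>\<bar> * (\<bar>\<eta>\<bar> - \<bar>\<xi>\<bar>) \<ge> 0" using xi l by simp
    ultimately show "1 + L \<le> (1 + \<bar>\<xi>\<bar>) * (1 + (\<bar>\<eta>\<bar> - \<bar>\<xi>\<bar>))" using l by linarith
   qed (use xi l in auto)
   also have "\<dots> \<le> ?g \<xi>"
   proof (intro mult_left_mono)
    have e: "1 + (\<bar>\<eta>\<bar> - \<bar>\<xi>\<bar>) = (if \<xi> \<ge> 0 then (1 + \<bar>\<eta>\<bar>) - \<xi> else (1 + \<bar>\<eta>\<bar>) + \<xi>)" by simp
    show "1 / (1 + (\<bar>\<eta>\<bar> - \<bar>\<xi>\<bar>)) ^ 4 \<le> 1 / ((1 + \<bar>\<eta>\<bar>) - \<xi>) ^ 4 + 1 / ((1 + \<bar>\<eta>\<bar>) + \<xi>) ^ 4" unfolding e by auto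
   qed (use E0 L in auto)
   finally show ?thesis .
  qed
  moreover have gi: "(\<lambda>\<xi>. 1 / ((1 + \<bar>\<eta>\<bar>) - \<xi>) ^ 4) integrable_on {- L..L}" "(\<lambda>\<xi>. 1 / ((1 + \<bar>\<eta>\<bar>) + \<xi>) ^ 4) integrable_on {- L..L}"
   using L l by (auto intro!: integral_inverse_power4_le(1,3))
  ultimately have "norm (integral {- L..L} ?h) \<le> integral {- L..L} ?g"
   by (intro integral_norm_bound_integral hi integrable_on_mult_right integrable_add)
  also have "\<dots> = E / (1 + L) * (integral {- L..L} (\<lambda>\<xi>. 1 / ((1 + \<bar>\<eta>\<bar>) - \<xi>) ^ 4) + integral {- L..L} (\<lambda>\<xi>. 1 / ((1 + \<bar>\<eta>\<bar>) + \<xi>) ^ 4))"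
   using gi by (simp only: integral_mult_right Henstock_Kurzweil_Integration.integral_add)
  also have "\<dots> \<le> E / (1 + L) * (1 / ((1 + \<bar>\<eta>\<bar>) - L) ^ 3 + 1 / ((1 + \<bar>\<eta>\<bar>) + (- L)) ^ 3)"
   using L l E0 by (intro mult_left_mono add_mono integral_inverse_power4_le(2,4)) auto
  also have "\<dots> = 2 * E / ((1 + L) * (1 + (\<bar>\<eta>\<bar> - L)) ^ 3)" by (simp add: add_diff_eq)
  finally show "norm (integral {- L..L} ?h) \<le> 2 * ((2 + (b - a)) * C) / ((1 + L) * (1 + (\<bar>\<eta>\<bar> - L)) ^ 3)" unfolding E_def . }
 { assume l: "\<bar>\<eta>\<bar> \<le> L" "L \<le> L'"
  have n1: "norm (integral {L..L'} ?h) \<le> E / (1 + L) * (1 / ((1 - \<bar>\<eta>\<bar>) + L) ^ 3)"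
  proof -
   have "norm (integral {L..L'} ?h) \<le> integral {L..L'} (\<lambda>\<xi>. E / (1 + L) * (1 / ((1 - \<bar>\<eta>\<bar>) + \<xi>) ^ 4))"
   proof (intro integral_norm_bound_integral hi integrable_on_mult_right integral_inverse_power4_le(3) hb)
    fix \<xi> assume x: "\<xi> \<in> {L..L'}"
    show "1 + L \<le> (1 + \<bar>\<xi>\<bar>) * (1 - \<bar>\<eta>\<bar> + \<xi>)" using mult_mono[of "1 + L" "1 + \<bar>\<xi>\<bar>" 1 "1 - \<bar>\<eta>\<bar> + \<xi>"] x l L by auto
   qed (use l in auto)
   also have "\<dots> \<le> E / (1 + L) * (1 / ((1 - \<bar>\<eta>\<bar>) + L) ^ 3)"
    unfolding integral_mult_right using E0 L l by (intro mult_left_mono integral_inverse_power4_le(4)) auto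
   finally show ?thesis .
  qed
  have n2: "norm (integral {- L'..- L} ?h) \<le> E / (1 + L) * (1 / ((1 - \<bar>\<eta>\<bar>) - (- L)) ^ 3)"
  proof -
   have "norm (integral {- L'..- L} ?h) \<le> integral {- L'..- L} (\<lambda>\<xi>. E / (1 + L) * (1 / ((1 - \<bar>\<eta>\<bar>) - \<xi>) ^ 4))"
   proof (intro integral_norm_bound_integral hi integrable_on_mult_right integral_inverse_power4_le(1) hb)
    fix \<xi> assume x: "\<xi> \<in> {- L'..- L}"
    show "1 + L \<le> (1 + \<bar>\<xi>\<bar>) * (1 - \<bar>\<eta>\<bar> - \<xi>)" using mult_mono[of "1 + L" "1 + \<bar>\<xi>\<bar>" 1 "1 - \<bar>\<eta>\<bar> - \<xi>"] x l L by auto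
   qed (use l in auto)
   also have "\<dots> \<le> E / (1 + L) * (1 / ((1 - \<bar>\<eta>\<bar>) - (- L)) ^ 3)"
    unfolding integral_mult_right using E0 L l by (intro mult_left_mono integral_inverse_power4_le(2)) auto
   finally show ?thesis .
  qed
  have "integral {- L'..L'} ?h = integral {- L'..- L} ?h + (integral {- L..L} ?h + integral {L..L'} ?h)"
   using Henstock_Kurzweil_Integration.integral_combine[of "- L'" "- L" L' ?h] Henstock_Kurzweil_Integration.integral_combine[of "- L" L L' ?h] hi l L by simp
  hence "norm (integral {- L'..L'} ?h - integral {- L..L} ?h) \<le> norm (integral {- L'..- L} ?h) + norm (integral {L..L'} ?h)"
   using norm_triangle_ineq[of "integral {- L'..- L} ?h" "integral {L..L'} ?h"] by (simp add: algebra_simps)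
  also have "\<dots> \<le> 2 * E / ((1 + L) * (1 + (L - \<bar>\<eta>\<bar>)) ^ 3)"
  proof -
   have e: "(1 - \<bar>\<eta>\<bar>) + L = 1 + (L - \<bar>\<eta>\<bar>)" "(1 - \<bar>\<eta>\<bar>) - (- L) = 1 + (L - \<bar>\<eta>\<bar>)" by simp_all
   have g: "2 * E / (x * y) = E / x * (1 / y) + E / x * (1 / y)" for x y by simp
   show ?thesis unfolding g by (intro add_mono n1[unfolded e] n2[unfolded e])
  qed
  finally show "norm (integral {- L'..L'} ?h - integral {- L..L} ?h) \<le> 2 * ((2 + (b - a)) * C) / ((1 + L) * (1 + (L - \<bar>\<eta>\<bar>)) ^ 3)" unfolding E_def . }
qed

section \<open>Truncated against sharp cutoff at one frequency\<close>

lemma continuous_on_vkernel: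
 assumes "\<nu> \<notin> \<int>"
 shows "continuous_on {0<..} (vkernel \<nu>)"
proof -
 have p: "continuous_on {0<..} (\<lambda>x. complex_of_real (x / 2) powr \<mu>)" for \<mu>
  by (intro continuous_intros) (auto simp: complex_nonpos_Reals_iff)
 have J: "continuous_on {0<..} (besselJ \<mu>)" "continuous_on {0<..} (besselI \<mu>)" for \<mu>
  unfolding besselJ_eq[abs_def] besselI_eq[abs_def] by (intro continuous_intros p; simp)+
 show ?thesis unfolding vkernel_eq[OF assms, abs_def] using sin_cos_half_nonzero(2)[OF assms]
  by (intro continuous_on_divide continuous_on_add continuous_on_diff continuous_on_const J) auto
qed

text \<open>The integration variable is u with t = u^2. The set \<open>S\<close> lives in the
  t-plane, whereas \<psi> and the interval ends live on the u-line, hence the square in the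
  assumption on \<open>S\<close>. The number \<open>l0\<close> bounds all frequencies from
  below.\<close>

locale cut_setup =
 fixes \<psi> :: "real => real" and f :: "complex => complex" and S :: "complex set" and c a b d :: real and \<nu> :: complex and l0 :: real
 assumes Ck: "Ck 5 \<psi>" and supp: "!!x. x \<notin> {c..d} ==> \<psi> x = 0" and one: "!!x. x \<in> {a..b} ==> \<psi> x = 1"
  and order: "0 < c" "c \<le> a" "a < b" "b \<le> d"
  and S: "open S" "!!u. u \<in> {c..d} ==> of_real (u\<^sup>2) \<in> S" and hol: "f holomorphic_on S"
  and nu: "\<nu> \<notin> \<int>" and l0: "l0 > 0"
begin

text \<open>Integrand of the theorem after t = u^2, with Jacobian 2 u and Bessel argument l
  u.\<close>

definition kern :: "real => real => complex" where
 "kern l u = of_real (2 * u) * (f (of_real (u\<^sup>2)) * (of_real (u\<^sup>2) powr (- \<nu> / 2) * vkernel \<nu> (l * u)))"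

definition Lam :: "real => (real => complex) => complex" where
 "Lam L k = integral {c..d} (\<lambda>u. (of_real (\<psi> u) * trunc a b L (of_real u)) * k u)"

definition Linf :: "(real => complex) => complex" where
 "Linf k = integral {a..b} (\<lambda>u. 1 * k u)"

definition T :: "complex set" where "T = {z. Re z > 0} \<inter> (\<lambda>z. z\<^sup>2) -` S"

text \<open>The amplitude that is left when sqrt(l u) is given to the kernel: sqrt l times
  \<open>kern l u\<close> is G0(u) times sqrt(l u) \<open>vkernel \<nu> (l * u)\<close>, as 2 u = 2
  sqrt u sqrt u. \<open>G1\<close> carries the extra 1/u of the second asymptotic term.\<close>

definition G0 :: "complex => complex" where "G0 z = 2 * csqrt z * (f (z\<^sup>2) * (z\<^sup>2) powr (- \<nu> / 2))"

definition G1 :: "complex => complex" where "G1 z = G0 z / z"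

lemma open_T: "open T"
proof -
 have "open ((\<lambda>z. z\<^sup>2) -` S)" by (rule open_vimage[OF S(1)]) (intro continuous_intros)
 thus ?thesis unfolding T_def by (intro open_Int open_halfspace_Re_gt)
qed

lemma T_sub: "of_real ` {c..d} \<subseteq> T"
 using S(2) order by (auto simp: T_def)

lemma sub: "{a..b} \<subseteq> {c..d}" using order by auto

lemma hol_G: "G0 holomorphic_on T" "G1 holomorphic_on T"
proof -
 have sq: "z\<^sup>2 \<notin> \<real>\<^sub>\<le>\<^sub>0" if "Re z > 0" for z :: complex
 proof
  assume "z\<^sup>2 \<in> \<real>\<^sub>\<le>\<^sub>0"
  hence "Im (z\<^sup>2) = 0" "Re (z\<^sup>2) \<le> 0" by (auto simp: complex_nonpos_Reals_iff)
  hence "Im z = 0" "(Re z)\<^sup>2 - (Im z)\<^sup>2 \<le> 0" using that by (auto simp: power2_eq_square)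
  thus False using that by simp
 qed
 have nz: "z \<notin> \<real>\<^sub>\<le>\<^sub>0" if "Re z > 0" for z using that by (auto simp: complex_nonpos_Reals_iff)
 have f2: "(\<lambda>z. f (z\<^sup>2)) holomorphic_on T"
  by (rule holomorphic_on_compose_gen[OF _ hol, unfolded o_def]) (auto intro!: holomorphic_intros simp: T_def)
 show g: "G0 holomorphic_on T" unfolding G0_def
  by (intro holomorphic_intros f2) (auto simp: T_def sq nz)
 show "G1 holomorphic_on T" unfolding G1_def
  by (intro holomorphic_intros g) (auto simp: T_def)
qed

lemma continuous_on_G: "G holomorphic_on T ==> continuous_on {c..d} (\<lambda>u. G (of_real u))"
 by (rule continuous_on_holomorphic_of_real[OF _ T_sub])

lemma continuous_on_kern:
 assumes l: "l > 0" shows "continuous_on {c..d} (kern l)"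
proof -
 have f: "continuous_on {c..d} (\<lambda>u. f (of_real (u\<^sup>2)))"
  by (rule continuous_on_compose2[OF holomorphic_on_imp_continuous_on[OF hol]]) (use S in \<open>auto intro!: continuous_intros\<close>)
 have v: "continuous_on {c..d} (\<lambda>u. vkernel \<nu> (l * u))"
 proof (rule continuous_on_compose2[OF continuous_on_vkernel[OF nu]])
  show "(\<lambda>u. l * u) ` {c..d} \<subseteq> {0<..}" by (rule image_subsetI) (use order l in auto)
 qed (intro continuous_intros)
 have p: "continuous_on {c..d} (\<lambda>u. complex_of_real (u\<^sup>2) powr (- \<nu> / 2))"
  by (intro continuous_intros) (use order in \<open>auto simp: complex_nonpos_Reals_iff\<close>)
 show ?thesis unfolding kern_def by (intro continuous_intros f v p)
qed

lemma continuous_on_trunc: "continuous_on X (\<lambda>u. trunc a b L (of_real u))"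
 by (rule continuous_on_compose2[OF holomorphic_on_imp_continuous_on[OF holomorphic_trunc]]) (auto intro!: continuous_intros)

lemma continuous_on_weight: "continuous_on X (\<lambda>u. complex_of_real (\<psi> u) * trunc a b L (of_real u))"
 by (intro continuous_intros continuous_on_trunc Ck_imp_continuous[OF Ck])

text \<open>Dominated convergence; the limit of the truncation differs from the indicator function
  only at a and b, where it is 1/2.\<close>

lemma Lam_tendsto:
 assumes k: "continuous_on {c..d} k" and L: "filterlim L at_top sequentially" "!!n. L n > 0"
 shows "(\<lambda>n. Lam (L n) k) \<longlonglongrightarrow> Linf k"
proof -
 let ?m = "\<lambda>u. complex_of_real ((sgn (u - a) - sgn (u - b)) / 2)"
 obtain B where B: "B \<ge> 0" "!!L u. L > 0 ==> norm (trunc a b L (of_real u)) \<le> B"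
  using norm_trunc_bounded[of a b] order by auto
 have psi: "continuous_on {c..d} \<psi>" by (rule Ck_imp_continuous[OF Ck])
 have "(\<lambda>n. integral {c..d} (\<lambda>u. (of_real (\<psi> u) * trunc a b (L n) (of_real u)) * k u)) \<longlonglongrightarrow> integral {c..d} (\<lambda>u. (of_real (\<psi> u) * ?m u) * k u)"
 proof (rule dominated_convergence(2))
  show "(\<lambda>u. of_real (\<psi> u) * trunc a b (L n) (of_real u) * k u) integrable_on {c..d}" for n
   by (intro integrable_continuous_interval continuous_intros continuous_on_weight k)
  show "(\<lambda>u. \<bar>\<psi> u\<bar> * B * norm (k u)) integrable_on {c..d}"
   by (intro integrable_continuous_interval continuous_intros psi k)
  show "norm (of_real (\<psi> u) * trunc a b (L n) (of_real u) * k u) \<le> \<bar>\<psi> u\<bar> * B * norm (k u)" for n u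
   unfolding norm_mult norm_of_real by (intro mult_right_mono mult_left_mono B L) auto
  show "(\<lambda>n. of_real (\<psi> u) * trunc a b (L n) (of_real u) * k u) \<longlonglongrightarrow> of_real (\<psi> u) * ?m u * k u" for u
   by (intro tendsto_mult tendsto_const filterlim_compose[OF tendsto_trunc L(1)]) (use order in auto)
 qed
 also have "integral {c..d} (\<lambda>u. (of_real (\<psi> u) * ?m u) * k u) = integral {c..d} (\<lambda>u. if u \<in> {a..b} then k u else 0)"
 proof (rule integral_spike[of "{a, b}"])
  fix u assume u: "u \<in> {c..d} - {a, b}"
  show "(if u \<in> {a..b} then k u else 0) = (of_real (\<psi> u) * ?m u) * k u"
  proof (cases "u \<in> {a..b}")
   case True
   hence "sgn (u - a) = 1" "sgn (u - b) = -1" using u by (auto simp: sgn_if)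
   thus ?thesis using True one by simp
  next
   case False
   hence "sgn (u - a) = sgn (u - b)" using u order by (auto simp: sgn_if)
   thus ?thesis using False by auto
  qed
 qed auto
 also have "\<dots> = integral {a..b} k" using sub by (simp only: integral_restrict_Int inf.absorb1)
 finally show ?thesis by (simp add: Lam_def Linf_def)
qed

text \<open>For \<bar>\<eta>\<bar> \<le> L the sharp integral is the limit of \<open>Lam\<close> at
  growing cut frequencies, so the difference is a tail of the convolution integral. For
  \<bar>\<eta>\<bar> > L the value \<open>Lam\<close> itself is a convolution over a range that
  misses the point of concentration.\<close>

lemma exponential_bounds:
 assumes G: "G holomorphic_on T"
 obtains C where "C \<ge> 0"
  "!!L \<eta>. L > 0 ==> norm ((if \<bar>\<eta>\<bar> \<le> L then Linf (\<lambda>u. G (of_real u) * cis (\<eta> * u)) else 0) - Lam L (\<lambda>u. G (of_real u) * cis (\<eta> * u)))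
   \<le> C / ((1 + L) * (1 + \<bar>L - \<bar>\<eta>\<bar>\<bar>) ^ 3)"
proof -
 let ?Phi = "fourier_on c d \<psi> G" and ?k = "\<lambda>\<eta> u. G (of_real u) * cis (\<eta> * u)"
 have cd: "c \<le> d" and ab: "a \<le> b" using order by auto
 obtain C where C: "!!\<eta>. norm (?Phi \<eta>) \<le> C / (1 + \<bar>\<eta>\<bar>) ^ 5" "C \<ge> 0"
  by (rule fourier_on_decay[OF Ck supp open_T T_sub G cd], assumption) (rule that)
 have cPhi: "continuous_on UNIV ?Phi"
  by (intro continuous_at_imp_continuous_on ballI has_vector_derivative_continuous[OF fourier_on_deriv[OF Ck open_T T_sub G]])
 have Lf: "Lam L (?k \<eta>) = 1 / (2 * of_real pi) * integral {- L..L} (\<lambda>\<xi>. ehat a b \<xi> * ?Phi (\<eta> + \<xi>))" for L \<eta>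
  unfolding fourier_on_trunc[OF Ck_imp_continuous[OF Ck] continuous_on_G[OF G], symmetric] unfolding Lam_def fourier_on_def
  by (simp only: mult_ac)
 let ?E = "2 * ((2 + (b - a)) * C)"
 have E0: "?E \<ge> 0" using C order by simp
 have pi1: "norm (1 / (2 * complex_of_real pi)) \<le> 1" using pi_gt3 by (simp add: norm_divide norm_mult)
 have sc: "norm (1 / (2 * of_real pi) * z) \<le> e" if "norm z \<le> e" for z :: complex and e
 proof -
  have "norm (1 / (2 * complex_of_real pi)) * norm z \<le> 1 * e" by (rule mult_mono[OF pi1 that]) auto
  thus ?thesis unfolding norm_mult by simp
 qed
 show ?thesis
 proof (rule that[OF E0])
  fix L \<eta> :: real assume L: "L > 0"
  show "norm ((if \<bar>\<eta>\<bar> \<le> L then Linf (?k \<eta>) else 0) - Lam L (?k \<eta>)) \<le> ?E / ((1 + L) * (1 + \<bar>L - \<bar>\<eta>\<bar>\<bar>) ^ 3)"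
  proof (cases "\<bar>\<eta>\<bar> \<le> L")
   case False
   have "norm (Lam L (?k \<eta>)) \<le> ?E / ((1 + L) * (1 + (\<bar>\<eta>\<bar> - L)) ^ 3)"
    unfolding Lf by (intro sc ehat_convolution_bounds(1)[OF ab cPhi C(1)]) (use False L in auto)
   moreover have "\<bar>L - \<bar>\<eta>\<bar>\<bar> = \<bar>\<eta>\<bar> - L" using False by simp
   ultimately show ?thesis using False by (simp only: if_False diff_0 norm_minus_cancel)
  next
   case True
   have "norm (Linf (?k \<eta>) - Lam L (?k \<eta>)) \<le> ?E / ((1 + L) * (1 + (L - \<bar>\<eta>\<bar>)) ^ 3)"
   proof (rule Lim_bounded)
    have "(\<lambda>n. Lam (L + real n) (?k \<eta>)) \<longlonglongrightarrow> Linf (?k \<eta>)"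
    proof (rule Lam_tendsto)
     show "continuous_on {c..d} (?k \<eta>)" by (intro continuous_intros continuous_on_G G)
     show "filterlim (\<lambda>n. L + real n) at_top sequentially"
      by (rule filterlim_tendsto_add_at_top[OF tendsto_const filterlim_real_sequentially])
    qed (use L in auto)
    thus "(\<lambda>n. norm (Lam (L + real n) (?k \<eta>) - Lam L (?k \<eta>))) \<longlonglongrightarrow> norm (Linf (?k \<eta>) - Lam L (?k \<eta>))"
     by (intro tendsto_norm tendsto_diff tendsto_const)
    show "\<forall>n\<ge>0. norm (Lam (L + real n) (?k \<eta>) - Lam L (?k \<eta>)) \<le> ?E / ((1 + L) * (1 + (L - \<bar>\<eta>\<bar>)) ^ 3)"
     unfolding Lf right_diff_distrib[symmetric]
     by (intro allI impI sc ehat_convolution_bounds(2)[OF ab cPhi C(1)]) (use True L in auto)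
   qed
   moreover have "\<bar>L - \<bar>\<eta>\<bar>\<bar> = L - \<bar>\<eta>\<bar>" using True by simp
   ultimately show ?thesis using True by (simp only: if_True)
  qed
 qed
qed

text \<open>The weight m and the interval are left general so that one statement serves both the
  truncated weight on [c, d] and the weight 1 on [a, b].\<close>

lemma linear_decomposition:
 fixes rho :: "real => complex"
 assumes xy: "{x..y} \<subseteq> {c..d}" and m: "continuous_on {x..y} m" and rho: "continuous_on {c..d} rho" and K: "continuous_on {c..d} K"
  and eq: "!!u. u \<in> {c..d} ==> s * K u = A * (G0 (of_real u) * cis (l * u)) + A' * (G0 (of_real u) * cis (- l * u))
    + B * (G1 (of_real u) * cis (l * u)) + B' * (G1 (of_real u) * cis (- l * u)) + rho u"
 shows "s * integral {x..y} (\<lambda>u. m u * K u) = A * integral {x..y} (\<lambda>u. m u * (G0 (of_real u) * cis (l * u))) + A' * integral {x..y} (\<lambda>u. m u * (G0 (of_real u) * cis (- l * u)))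
  + B * integral {x..y} (\<lambda>u. m u * (G1 (of_real u) * cis (l * u))) + B' * integral {x..y} (\<lambda>u. m u * (G1 (of_real u) * cis (- l * u))) + integral {x..y} (\<lambda>u. m u * rho u)"
proof -
 have i: "((\<lambda>u. m u * k u) has_integral integral {x..y} (\<lambda>u. m u * k u)) {x..y}" if "continuous_on {c..d} k" for k
  by (intro integrable_integral integrable_continuous_interval continuous_intros m continuous_on_subset[OF that xy])
 have g: "continuous_on {c..d} (\<lambda>u. G (of_real u) * cis (\<eta> * u))" if "G holomorphic_on T" for G \<eta>
  by (intro continuous_intros continuous_on_G that)
 have h1: "((\<lambda>u. A * (m u * (G0 (of_real u) * cis (l * u))) + A' * (m u * (G0 (of_real u) * cis (- l * u)))
  + B * (m u * (G1 (of_real u) * cis (l * u))) + B' * (m u * (G1 (of_real u) * cis (- l * u))) + m u * rho u) has_integral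
  (A * integral {x..y} (\<lambda>u. m u * (G0 (of_real u) * cis (l * u))) + A' * integral {x..y} (\<lambda>u. m u * (G0 (of_real u) * cis (- l * u)))
  + B * integral {x..y} (\<lambda>u. m u * (G1 (of_real u) * cis (l * u))) + B' * integral {x..y} (\<lambda>u. m u * (G1 (of_real u) * cis (- l * u))) + integral {x..y} (\<lambda>u. m u * rho u))) {x..y}"
  by (intro has_integral_add has_integral_mult_right i g hol_G rho)
 have h2: "((\<lambda>u. s * (m u * K u)) has_integral s * integral {x..y} (\<lambda>u. m u * K u)) {x..y}"
  by (intro has_integral_mult_right i K)
 have e: "s * (m u * K u) = A * (m u * (G0 (of_real u) * cis (l * u))) + A' * (m u * (G0 (of_real u) * cis (- l * u)))
  + B * (m u * (G1 (of_real u) * cis (l * u))) + B' * (m u * (G1 (of_real u) * cis (- l * u))) + m u * rho u" if "u \<in> {x..y}" for u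
 proof -
  have "s * (m u * K u) = m u * (s * K u)" by (simp only: mult_ac)
  also have "s * K u = A * (G0 (of_real u) * cis (l * u)) + A' * (G0 (of_real u) * cis (- l * u))
    + B * (G1 (of_real u) * cis (l * u)) + B' * (G1 (of_real u) * cis (- l * u)) + rho u" by (rule eq) (use that xy in auto)
  finally show ?thesis by (simp only: distrib_left mult_ac)
 qed
 show ?thesis by (rule has_integral_unique[OF has_integral_eq[OF e h2] h1])
qed

text \<open>The asymptotics of the kernel multiplied by the amplitude: four pure exponentials, and a
  remainder \<open>rho\<close> without structure that is controlled through its size O(l^-2)
  uniformly in u.\<close>

lemma kern_decomposition:
 obtains A A' B B' rho D where "D \<ge> 0" "!!l. l \<ge> l0 ==> continuous_on {c..d} (rho l)"
  "!!l u. l \<ge> l0 ==> u \<in> {c..d} ==> norm (rho l u) \<le> D / l\<^sup>2"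
  "!!l u. l \<ge> l0 ==> u \<in> {c..d} ==> of_real (sqrt l) * kern l u = A * (G0 (of_real u) * cis (l * u)) + A' * (G0 (of_real u) * cis (- l * u))
    + B / of_real l * (G1 (of_real u) * cis (l * u)) + B' / of_real l * (G1 (of_real u) * cis (- l * u)) + rho l u"
proof -
 have X0: "l0 * c > 0" using l0 order by simp
 obtain A B A' B' C where as: "!!X. X \<ge> l0 * c ==>
  norm (of_real (sqrt X) * vkernel \<nu> X - (cis X * (A + B / of_real X) + cis (- X) * (A' + B' / of_real X))) \<le> C / X\<^sup>2"
  by (rule vkernel_asymptotics[OF nu X0]) (rule that)
 have C0: "C \<ge> 0"
 proof -
  have "0 \<le> C / (l0 * c)\<^sup>2" using as[of "l0 * c"] norm_ge_zero order_trans by blast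
  thus ?thesis using l0 order by (auto simp: zero_le_divide_iff)
 qed
 have "compact ((\<lambda>u. G0 (of_real u)) ` {c..d})" by (intro compact_continuous_image continuous_on_G hol_G) auto
 then obtain M where M: "!!u. u \<in> {c..d} ==> norm (G0 (of_real u)) \<le> M" by (meson bounded_iff compact_imp_bounded imageI)
 have M0: "M \<ge> 0" by (rule order_trans[OF norm_ge_zero M[of c]]) (use order in auto)
 define P where "P = (\<lambda>l u. A * (G0 (of_real u) * cis (l * u)) + A' * (G0 (of_real u) * cis (- l * u))
    + B / of_real l * (G1 (of_real u) * cis (l * u)) + B' / of_real l * (G1 (of_real u) * cis (- l * u)))"
 define rho where "rho = (\<lambda>l u. of_real (sqrt l) * kern l u - P l u)"
 show ?thesis
 proof (rule that[of "M * C / c\<^sup>2" rho A A' B B'])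
  show "M * C / c\<^sup>2 \<ge> 0" using M0 C0 by simp
  show "continuous_on {c..d} (rho l)" if "l \<ge> l0" for l
   unfolding rho_def P_def using that l0 by (intro continuous_intros continuous_on_kern continuous_on_G hol_G) auto
  fix l u assume l: "l \<ge> l0" and u: "u \<in> {c..d}"
  show "of_real (sqrt l) * kern l u = A * (G0 (of_real u) * cis (l * u)) + A' * (G0 (of_real u) * cis (- l * u))
    + B / of_real l * (G1 (of_real u) * cis (l * u)) + B' / of_real l * (G1 (of_real u) * cis (- l * u)) + rho l u"
   unfolding rho_def P_def by simp
  have pos: "l > 0" "u > 0" using l l0 u order by auto
  let ?X = "l * u" and ?W = "f (of_real (u\<^sup>2)) * of_real (u\<^sup>2) powr (- \<nu> / 2)"
  have G0u: "G0 (of_real u) = 2 * of_real (sqrt u) * ?W" unfolding G0_def using pos by (simp add: csqrt_of_real_nonneg)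
  have "complex_of_real (sqrt l) * of_real (2 * u) = 2 * of_real (sqrt u) * of_real (sqrt ?X)"
  proof -
   have "sqrt l * (2 * u) = 2 * sqrt u * sqrt ?X" using pos by (simp add: real_sqrt_mult)
   thus ?thesis by (metis of_real_mult of_real_numeral)
  qed
  hence k: "of_real (sqrt l) * kern l u = G0 (of_real u) * (of_real (sqrt ?X) * vkernel \<nu> ?X)"
   unfolding kern_def G0u by (simp only: mult.assoc[symmetric]) (simp only: mult_ac)
  have P: "P l u = G0 (of_real u) * (cis ?X * (A + B / of_real ?X) + cis (- ?X) * (A' + B' / of_real ?X))"
  proof -
   have g: "A * (g * e) + A' * (g * e') + B / z * (g / w * e) + B' / z * (g / w * e') = g * (e * (A + B / (z * w)) + e' * (A' + B' / (z * w)))"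
    for g e e' z w :: complex by (simp add: algebra_simps)
   show ?thesis unfolding P_def G1_def of_real_mult minus_mult_left[symmetric] by (rule g)
  qed
  have "norm (rho l u) = norm (G0 (of_real u)) * norm (of_real (sqrt ?X) * vkernel \<nu> ?X - (cis ?X * (A + B / of_real ?X) + cis (- ?X) * (A' + B' / of_real ?X)))"
   unfolding rho_def k P right_diff_distrib[symmetric] norm_mult ..
  also have "\<dots> \<le> M * (C / ?X\<^sup>2)"
  proof -
   have X: "l0 * c \<le> l * u" using l u l0 order by (intro mult_mono) auto
   show ?thesis by (rule mult_mono[OF M[OF u] as[OF X] M0 norm_ge_zero])
  qed
  also have "\<dots> \<le> M * (C / (l * c)\<^sup>2)"
   using pos u order C0 M0 by (intro mult_left_mono divide_left_mono power_mono) auto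
  also have "\<dots> = M * C / c\<^sup>2 / l\<^sup>2" by (simp add: power_mult_distrib)
  finally show "norm (rho l u) \<le> M * C / c\<^sup>2 / l\<^sup>2" .
 qed
qed

text \<open>Both functionals are continuous for the supremum norm, with a constant independent of L
  because the truncations are uniformly bounded.\<close>

lemma functional_bound:
 obtains M where "M \<ge> 0" "!!L k e. L > 0 ==> continuous_on {c..d} k ==> \<forall>u\<in>{c..d}. norm (k u) \<le> e ==> norm (Lam L k) \<le> M * e"
  "!!k e. continuous_on {c..d} k ==> \<forall>u\<in>{c..d}. norm (k u) \<le> e ==> norm (Linf k) \<le> M * e"
proof -
 obtain B where B: "B \<ge> 0" "!!L u. L > 0 ==> norm (trunc a b L (of_real u)) \<le> B"
  using norm_trunc_bounded[of a b] order by auto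
 have "compact (\<psi> ` {c..d})" by (intro compact_continuous_image Ck_imp_continuous[OF Ck]) auto
 then obtain P where P: "!!u. u \<in> {c..d} ==> norm (\<psi> u) \<le> P" by (meson bounded_iff compact_imp_bounded imageI)
 have P0: "P \<ge> 0" by (rule order_trans[OF norm_ge_zero P[of c]]) (use order in auto)
 have M: "P * B * (d - c) \<ge> 0" using P0 B order by simp
 show ?thesis
 proof (rule that[of "P * B * (d - c) + (b - a)"])
  show "P * B * (d - c) + (b - a) \<ge> 0" using M order by simp
  fix k :: "real => complex" and e assume k: "continuous_on {c..d} k" and "\<forall>u\<in>{c..d}. norm (k u) \<le> e"
  hence ke: "norm (k u) \<le> e" if "u \<in> {c..d}" for u using that by blast
  have e: "e \<ge> 0" by (rule order_trans[OF norm_ge_zero ke[of c]]) (use order in auto)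
  show "norm (Lam L k) \<le> (P * B * (d - c) + (b - a)) * e" if L: "L > 0" for L
  proof -
   have "norm (Lam L k) \<le> (P * B * e) * (d - c)" unfolding Lam_def
   proof (rule integral_bound)
    show "continuous_on {c..d} (\<lambda>u. of_real (\<psi> u) * trunc a b L (of_real u) * k u)" by (intro continuous_on_mult[OF continuous_on_weight] k)
    show "norm (of_real (\<psi> u) * trunc a b L (of_real u) * k u) \<le> P * B * e" if "u \<in> {c..d}" for u
     unfolding norm_mult norm_of_real using P[OF that] P0 B(1) by (intro mult_mono ke B L that) auto
   qed (use order in auto)
   also have "\<dots> \<le> (P * B * (d - c) + (b - a)) * e" using mult_right_mono[of a b e] e order by (simp add: algebra_simps)
   finally show ?thesis .
  qed
  have "norm (Linf k) \<le> e * (b - a)" unfolding Linf_def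
   by (rule integral_bound) (use order k ke in \<open>auto intro: continuous_on_subset\<close>)
  also have "\<dots> \<le> (P * B * (d - c) + (b - a)) * e" using mult_left_mono[of "b - a" "P * B * (d - c) + (b - a)" e] M e by (simp add: mult.commute)
  finally show "norm (Linf k) \<le> (P * B * (d - c) + (b - a)) * e" .
 qed
qed

lemma inverse_sqrt_scale:
 fixes z :: complex
 assumes "l > 0" "norm (of_real (sqrt l) * z) \<le> e"
 shows "norm z \<le> l powr (- 1 / 2) * e"
proof -
 have "norm z = l powr (- 1 / 2) * norm (of_real (sqrt l) * z)"
  using assms(1) by (simp add: norm_mult powr_half_sqrt powr_minus)
 also have "\<dots> \<le> l powr (- 1 / 2) * e" by (intro mult_left_mono assms) auto
 finally show ?thesis .
qed

text \<open>For fixed L the truncated weight is as smooth as the cutoff, so the exponentials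
  contribute at most O(l^-2), like the remainder; sqrt l from the kernel makes it l powr (-5/2).
  Since l is a multiple of sqrt n, this is the rate n powr (-5/4) assumed in
  \<open>smooth_voronoi\<close>.\<close>

lemma Lam_kern_decay:
 assumes L: "L > 0"
 obtains K where "!!l. l \<ge> l0 ==> norm (Lam L (kern l)) \<le> K * l powr (- 5 / 2)"
proof -
 obtain A A' B B' rho D where D: "D \<ge> 0" and rc: "!!l. l \<ge> l0 ==> continuous_on {c..d} (rho l)"
  and rb: "!!l u. l \<ge> l0 ==> u \<in> {c..d} ==> norm (rho l u) \<le> D / l\<^sup>2"
  and dec: "!!l u. l \<ge> l0 ==> u \<in> {c..d} ==> of_real (sqrt l) * kern l u = A * (G0 (of_real u) * cis (l * u)) + A' * (G0 (of_real u) * cis (- l * u))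
    + B / of_real l * (G1 (of_real u) * cis (l * u)) + B' / of_real l * (G1 (of_real u) * cis (- l * u)) + rho l u"
  by (rule kern_decomposition) (rule that)
 obtain M where M: "M \<ge> 0" "!!L k e. L > 0 ==> continuous_on {c..d} k ==> \<forall>u\<in>{c..d}. norm (k u) \<le> e ==> norm (Lam L k) \<le> M * e"
  "!!k e. continuous_on {c..d} k ==> \<forall>u\<in>{c..d}. norm (k u) \<le> e ==> norm (Linf k) \<le> M * e"
  by (rule functional_bound) (rule that)
 have ex: "\<exists>C\<ge>0. \<forall>\<eta>. norm (Lam L (\<lambda>u. G (of_real u) * cis (\<eta> * u))) \<le> C / (1 + \<bar>\<eta>\<bar>) ^ 5" if G: "G holomorphic_on T" for G
 proof -
  have h: "(\<lambda>z. G z * trunc a b L z) holomorphic_on T" by (intro holomorphic_intros G holomorphic_on_subset[OF holomorphic_trunc]) auto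
  have e: "Lam L (\<lambda>u. G (of_real u) * cis (\<eta> * u)) = fourier_on c d \<psi> (\<lambda>z. G z * trunc a b L z) \<eta>" for \<eta>
   unfolding Lam_def fourier_on_def by (simp only: mult_ac)
  obtain C where "!!\<eta>. norm (fourier_on c d \<psi> (\<lambda>z. G z * trunc a b L z) \<eta>) \<le> C / (1 + \<bar>\<eta>\<bar>) ^ 5" "C \<ge> 0"
   by (rule fourier_on_decay[OF Ck supp open_T T_sub h], assumption) (use order in auto)
  thus ?thesis unfolding e by blast
 qed
 obtain C0 where C0: "C0 \<ge> 0" "!!\<eta>. norm (Lam L (\<lambda>u. G0 (of_real u) * cis (\<eta> * u))) \<le> C0 / (1 + \<bar>\<eta>\<bar>) ^ 5" using ex[OF hol_G(1)] by blast
 obtain C1 where C1: "C1 \<ge> 0" "!!\<eta>. norm (Lam L (\<lambda>u. G1 (of_real u) * cis (\<eta> * u))) \<le> C1 / (1 + \<bar>\<eta>\<bar>) ^ 5" using ex[OF hol_G(2)] by blast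
 let ?K = "norm A * C0 + norm A' * C0 + norm B / l0 * C1 + norm B' / l0 * C1 + M * D"
 show ?thesis
 proof (rule that[of ?K])
  fix l assume l: "l \<ge> l0"
  hence lp: "l > 0" using l0 by simp
  have sq: "Cc / (1 + \<bar>\<eta>\<bar>) ^ 5 \<le> Cc / l\<^sup>2" if "Cc \<ge> 0" "\<bar>\<eta>\<bar> = l" for Cc \<eta>
  proof -
   have "l\<^sup>2 \<le> (1 + l)\<^sup>2" using lp by (intro power_mono) auto
   also have "\<dots> \<le> (1 + l) ^ 5" using lp by (intro power_increasing) auto
   finally show ?thesis using that lp by (intro divide_left_mono mult_pos_pos zero_less_power) auto
  qed
  have b0: "norm (Lam L (\<lambda>u. G0 (of_real u) * cis (\<eta> * u))) \<le> C0 / l\<^sup>2" "norm (Lam L (\<lambda>u. G1 (of_real u) * cis (\<eta> * u))) \<le> C1 / l\<^sup>2" if "\<bar>\<eta>\<bar> = l" for \<eta>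
   using order_trans[OF C0(2) sq[OF C0(1) that]] order_trans[OF C1(2) sq[OF C1(1) that]] by auto
  have rb': "\<forall>u\<in>{c..d}. norm (rho l u) \<le> D / l\<^sup>2" using rb[OF l] by blast
  have bl: "norm (Bb / of_real l) \<le> norm Bb / l0" for Bb :: complex
   using l l0 lp by (simp add: norm_divide) (intro divide_left_mono mult_pos_pos; simp)
  have lin: "of_real (sqrt l) * Lam L (kern l) = A * Lam L (\<lambda>u. G0 (of_real u) * cis (l * u)) + A' * Lam L (\<lambda>u. G0 (of_real u) * cis (- l * u))
   + B / of_real l * Lam L (\<lambda>u. G1 (of_real u) * cis (l * u)) + B' / of_real l * Lam L (\<lambda>u. G1 (of_real u) * cis (- l * u)) + Lam L (rho l)"
   unfolding Lam_def by (rule linear_decomposition[OF order.refl continuous_on_weight rc[OF l] continuous_on_kern[OF lp] dec[OF l]])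
  have ml: "\<bar>- l\<bar> = l" "\<bar>l\<bar> = l" using lp by auto
  have "norm (of_real (sqrt l) * Lam L (kern l)) \<le> norm A * (C0 / l\<^sup>2) + norm A' * (C0 / l\<^sup>2) + norm B / l0 * (C1 / l\<^sup>2) + norm B' / l0 * (C1 / l\<^sup>2) + M * (D / l\<^sup>2)"
   unfolding lin
   by (intro norm_triangle_le add_mono M(2)[OF L rc[OF l] rb']; (unfold norm_mult; intro mult_mono b0 bl ml norm_ge_zero order.refl)?) (use l0 in auto)
  also have "\<dots> = ?K / l\<^sup>2" by (simp add: add_divide_distrib)
  finally have "norm (Lam L (kern l)) \<le> l powr (- 1 / 2) * (?K / l\<^sup>2)" by (rule inverse_sqrt_scale[OF lp])
  also have "l powr (- 1 / 2) * (?K / l\<^sup>2) = ?K * l powr (- 5 / 2)"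
  proof -
   have "l powr (- 5 / 2) = l powr (- 1 / 2 + - 2)" by simp
   also have "\<dots> = l powr (- 1 / 2) * l powr (- 2)" by (rule powr_add)
   also have "l powr (- 2) = inverse (l\<^sup>2)" using lp by (simp add: powr_minus powr_numeral)
   finally have e: "l powr (- 5 / 2) = l powr (- 1 / 2) * inverse (l\<^sup>2)" .
   have g: "x * (K / z) = K * (x * inverse z)" for x z K :: real by (simp add: divide_inverse)
   show ?thesis unfolding e by (rule g)
  qed
  finally show "norm (Lam L (kern l)) \<le> ?K * l powr (- 5 / 2)" .
 qed
qed

text \<open>The contribution of \<open>rho\<close> is kept as a norm because two facts about it are
  used later: it is O(l^-2), which is summable against the coefficients, and it tends to 0 for fixed
  l as L grows.\<close>

lemma cut_error:
 obtains C D rho where "C \<ge> 0" "D \<ge> 0" "!!l. l \<ge> l0 ==> continuous_on {c..d} (rho l)"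
  "!!l L. l \<ge> l0 ==> L > 0 ==> norm ((if l \<le> L then Linf (rho l) else 0) - Lam L (rho l)) \<le> D / l\<^sup>2"
  "!!l L. l \<ge> l0 ==> L > 0 ==> norm ((if l \<le> L then Linf (kern l) else 0) - Lam L (kern l))
   \<le> l powr (- 1 / 2) * (C / ((1 + L) * (1 + \<bar>L - l\<bar>) ^ 3) + norm ((if l \<le> L then Linf (rho l) else 0) - Lam L (rho l)))"
proof -
 obtain A A' B B' rho D where D: "D \<ge> 0" and rc: "!!l. l \<ge> l0 ==> continuous_on {c..d} (rho l)"
  and rb: "!!l u. l \<ge> l0 ==> u \<in> {c..d} ==> norm (rho l u) \<le> D / l\<^sup>2"
  and dec: "!!l u. l \<ge> l0 ==> u \<in> {c..d} ==> of_real (sqrt l) * kern l u = A * (G0 (of_real u) * cis (l * u)) + A' * (G0 (of_real u) * cis (- l * u))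
    + B / of_real l * (G1 (of_real u) * cis (l * u)) + B' / of_real l * (G1 (of_real u) * cis (- l * u)) + rho l u"
  by (rule kern_decomposition) (rule that)
 obtain M where M: "M \<ge> 0" "!!L k e. L > 0 ==> continuous_on {c..d} k ==> \<forall>u\<in>{c..d}. norm (k u) \<le> e ==> norm (Lam L k) \<le> M * e"
  "!!k e. continuous_on {c..d} k ==> \<forall>u\<in>{c..d}. norm (k u) \<le> e ==> norm (Linf k) \<le> M * e"
  by (rule functional_bound) (rule that)
 obtain C0 where C0: "C0 \<ge> 0" "!!L \<eta>. L > 0 ==> norm ((if \<bar>\<eta>\<bar> \<le> L then Linf (\<lambda>u. G0 (of_real u) * cis (\<eta> * u)) else 0) - Lam L (\<lambda>u. G0 (of_real u) * cis (\<eta> * u)))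
   \<le> C0 / ((1 + L) * (1 + \<bar>L - \<bar>\<eta>\<bar>\<bar>) ^ 3)" by (rule exponential_bounds[OF hol_G(1)]) (rule that)
 obtain C1 where C1: "C1 \<ge> 0" "!!L \<eta>. L > 0 ==> norm ((if \<bar>\<eta>\<bar> \<le> L then Linf (\<lambda>u. G1 (of_real u) * cis (\<eta> * u)) else 0) - Lam L (\<lambda>u. G1 (of_real u) * cis (\<eta> * u)))
   \<le> C1 / ((1 + L) * (1 + \<bar>L - \<bar>\<eta>\<bar>\<bar>) ^ 3)" by (rule exponential_bounds[OF hol_G(2)]) (rule that)
 let ?C = "norm A * C0 + norm A' * C0 + norm B / l0 * C1 + norm B' / l0 * C1"
 show ?thesis
 proof (rule that[of ?C "M * D + M * D" rho])
  show "?C \<ge> 0" using C0 C1 l0 by simp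
  show "M * D + M * D \<ge> 0" using M D by simp
  show "continuous_on {c..d} (rho l)" if "l \<ge> l0" for l by (rule rc[OF that])
  fix l L :: real assume l: "l \<ge> l0" and L: "L > 0"
  hence lp: "l > 0" using l0 by simp
  \<comment> \<open>Frequencies beyond the cut are compared with 0, which is what turns the sharp
    series into a partial sum.\<close>
  define dl where "dl = (\<lambda>k. (if l \<le> L then Linf k else 0) - Lam L k)"
  have rb': "\<forall>u\<in>{c..d}. norm (rho l u) \<le> D / l\<^sup>2" using rb[OF l] by blast
  have "norm (dl (rho l)) \<le> norm (if l \<le> L then Linf (rho l) else 0) + norm (Lam L (rho l))" unfolding dl_def by (rule norm_triangle_ineq4)
  also have "\<dots> \<le> M * (D / l\<^sup>2) + M * (D / l\<^sup>2)"
  proof (intro add_mono M(2)[OF L rc[OF l] rb'])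
   show "norm (if l \<le> L then Linf (rho l) else 0) \<le> M * (D / l\<^sup>2)"
    using M(3)[OF rc[OF l] rb'] M(1) D by auto
  qed
  finally show "norm ((if l \<le> L then Linf (rho l) else 0) - Lam L (rho l)) \<le> (M * D + M * D) / l\<^sup>2"
   by (simp add: dl_def add_divide_distrib)
  have lin1: "of_real (sqrt l) * Lam L (kern l) = A * Lam L (\<lambda>u. G0 (of_real u) * cis (l * u)) + A' * Lam L (\<lambda>u. G0 (of_real u) * cis (- l * u))
   + B / of_real l * Lam L (\<lambda>u. G1 (of_real u) * cis (l * u)) + B' / of_real l * Lam L (\<lambda>u. G1 (of_real u) * cis (- l * u)) + Lam L (rho l)"
   unfolding Lam_def by (rule linear_decomposition[OF order.refl continuous_on_weight rc[OF l] continuous_on_kern[OF lp] dec[OF l]])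
  have lin2: "of_real (sqrt l) * Linf (kern l) = A * Linf (\<lambda>u. G0 (of_real u) * cis (l * u)) + A' * Linf (\<lambda>u. G0 (of_real u) * cis (- l * u))
   + B / of_real l * Linf (\<lambda>u. G1 (of_real u) * cis (l * u)) + B' / of_real l * Linf (\<lambda>u. G1 (of_real u) * cis (- l * u)) + Linf (rho l)"
   unfolding Linf_def by (rule linear_decomposition[OF sub continuous_on_const rc[OF l] continuous_on_kern[OF lp] dec[OF l]])
  have lin: "of_real (sqrt l) * dl (kern l) = A * dl (\<lambda>u. G0 (of_real u) * cis (l * u)) + A' * dl (\<lambda>u. G0 (of_real u) * cis (- l * u))
   + B / of_real l * dl (\<lambda>u. G1 (of_real u) * cis (l * u)) + B' / of_real l * dl (\<lambda>u. G1 (of_real u) * cis (- l * u)) + dl (rho l)"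
  proof -
   have g: "A * (x1 - y1) + A' * (x2 - y2) + w * (x3 - y3) + w' * (x4 - y4) + (x5 - y5)
    = (A * x1 + A' * x2 + w * x3 + w' * x4 + x5) - (A * y1 + A' * y2 + w * y3 + w' * y4 + y5)" for x1 x2 x3 x4 x5 y1 y2 y3 y4 y5 w w' :: complex
    by (simp add: algebra_simps)
   show ?thesis unfolding dl_def g right_diff_distrib lin1 using lin2 by simp
  qed
  let ?e = "1 / ((1 + L) * (1 + \<bar>L - l\<bar>) ^ 3)"
  have b0: "norm (dl (\<lambda>u. G0 (of_real u) * cis (\<eta> * u))) \<le> C0 * ?e" "norm (dl (\<lambda>u. G1 (of_real u) * cis (\<eta> * u))) \<le> C1 * ?e" if "\<bar>\<eta>\<bar> = l" for \<eta>
   using C0(2)[OF L, of \<eta>] C1(2)[OF L, of \<eta>] unfolding that dl_def by auto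
  have bl: "norm (Bb / of_real l) \<le> norm Bb / l0" for Bb :: complex
   using l l0 lp by (simp add: norm_divide) (intro divide_left_mono mult_pos_pos; simp)
  have ml: "\<bar>- l\<bar> = l" "\<bar>l\<bar> = l" using lp by auto
  have "norm (of_real (sqrt l) * dl (kern l)) \<le> norm A * (C0 * ?e) + norm A' * (C0 * ?e) + norm B / l0 * (C1 * ?e) + norm B' / l0 * (C1 * ?e) + norm (dl (rho l))"
   unfolding lin
   by (intro norm_triangle_le add_mono order.refl[of "norm (dl (rho l))"]; (unfold norm_mult; intro mult_mono b0 bl ml norm_ge_zero order.refl)?) (use l0 in auto)
  also have "\<dots> = ?C / ((1 + L) * (1 + \<bar>L - l\<bar>) ^ 3) + norm (dl (rho l))" by (simp add: add_divide_distrib)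
  finally have "norm (dl (kern l)) \<le> l powr (- 1 / 2) * (?C / ((1 + L) * (1 + \<bar>L - l\<bar>) ^ 3) + norm (dl (rho l)))"
   by (rule inverse_sqrt_scale[OF lp])
  thus "norm ((if l \<le> L then Linf (kern l) else 0) - Lam L (kern l))
   \<le> l powr (- 1 / 2) * (?C / ((1 + L) * (1 + \<bar>L - l\<bar>) ^ 3) + norm ((if l \<le> L then Linf (rho l) else 0) - Lam L (rho l)))"
   unfolding dl_def .
 qed
qed

end

section \<open>Passage from truncated to sharp cutoffs in the series\<close>

text \<open>The N-th partial sum of the sharp series minus the N-th regularised series is split into
  two errors: the w-part, concentrated near k = N, is handled by the Toeplitz argument, and the
  y-part by domination through Y.\<close>

lemma sums_limit_of_truncations:
 fixes a Vi :: "nat => complex" and V :: "nat => nat => complex" and w y :: "nat => nat => real" and h Y :: "nat => real"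
 assumes S: "!!N. (\<lambda>k. a k * V N k) sums R N" and R: "R \<longlonglongrightarrow> R'"
  and bd: "!!N k. norm ((if k \<le> N then Vi k else 0) - V N k) \<le> h k * (C * w N k + y N k)"
  and h: "!!k. h k \<ge> 0" "(\<lambda>k. norm (a k) * h k) \<longlonglongrightarrow> 0" and C: "C \<ge> 0"
  and w: "!!N k. w N k \<ge> 0" "!!N M. (\<Sum>k<M. w N k) \<le> W" "!!k. (\<lambda>N. w N k) \<longlonglongrightarrow> 0"
  and y: "!!N k. y N k \<ge> 0" "!!N k. y N k \<le> Y k" "!!k. (\<lambda>N. y N k) \<longlonglongrightarrow> 0" "summable (\<lambda>k. norm (a k) * h k * Y k)"
 shows "(\<lambda>k. a k * Vi k) sums R'"
proof -
 define x where "x = (\<lambda>k. norm (a k) * h k * C)"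
 have x: "x k \<ge> 0" "x \<longlonglongrightarrow> 0" for k
  using h C tendsto_mult_left_zero[OF h(2), of C] by (auto simp: x_def)
 note T = toeplitz_null[of w W x, OF w x]
 define z where "z = (\<lambda>k N. norm (a k) * h k * y N k)"
 have zb: "norm (z k N) \<le> norm (a k) * h k * Y k" for k N
  using h(1)[of k] y(1)[of N k] y(2)[of N k] by (simp add: z_def abs_mult mult_left_mono)
 have zs: "summable (\<lambda>k. z k N)" for N by (rule summable_comparison_test'[OF y(4)]) (rule zb)
 have zl: "(\<lambda>N. z k N) \<longlonglongrightarrow> 0" for k
  unfolding z_def by (rule tendsto_mult_right_zero[OF y(3)])
 have "(\<lambda>N. suminf (\<lambda>k. z k N)) \<longlonglongrightarrow> suminf (\<lambda>k. 0 :: real)"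
  by (rule tannerys_theorem[where M = "\<lambda>k. norm (a k) * h k * Y k" and F = sequentially, OF zl _ y(4), THEN conjunct2, THEN conjunct2])
   (use zb in \<open>auto intro!: always_eventually\<close>)
 hence Z: "(\<lambda>N. \<Sum>k. z k N) \<longlonglongrightarrow> 0" by simp
 define E where "E = (\<lambda>N k. a k * ((if k \<le> N then Vi k else 0) - V N k))"
 have Eb: "norm (E N k) \<le> w N k * x k + z k N" for N k
 proof -
  have "norm (E N k) \<le> norm (a k) * (h k * (C * w N k + y N k))" unfolding E_def norm_mult by (intro mult_left_mono bd) auto
  thus ?thesis by (simp add: x_def z_def algebra_simps)
 qed
 have Es: "norm (\<Sum>k. E N k) \<le> (\<Sum>k. w N k * x k) + (\<Sum>k. z k N)" for N
 proof -
  have s: "summable (\<lambda>k. w N k * x k + z k N)" by (intro summable_add T(1) zs)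
  have "norm (\<Sum>k. E N k) \<le> (\<Sum>k. w N k * x k + z k N)" by (rule norm_suminf_le[OF Eb s])
  thus ?thesis using suminf_add[OF T(1)[of N] zs[of N]] by simp
 qed
 have "(\<lambda>N. (\<Sum>k. w N k * x k) + (\<Sum>k. z k N)) \<longlonglongrightarrow> 0 + 0" by (intro tendsto_add T(2) Z)
 hence TZ: "(\<lambda>N. (\<Sum>k. w N k * x k) + (\<Sum>k. z k N)) \<longlonglongrightarrow> 0" by (simp only: add_0)
 have E0: "(\<lambda>N. \<Sum>k. E N k) \<longlonglongrightarrow> 0"
  by (rule Lim_null_comparison[OF _ TZ], rule always_eventually, rule allI, rule Es)
 have "(\<Sum>k. E N k) = (\<Sum>k\<le>N. a k * Vi k) - R N" for N
 proof -
  have "(\<lambda>k. if k \<in> {..N} then a k * Vi k else 0) sums (\<Sum>k\<le>N. a k * Vi k)" by (rule sums_If_finite_set) auto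
  from sums_diff[OF this S[of N]] have "(\<lambda>k. (if k \<in> {..N} then a k * Vi k else 0) - a k * V N k) sums ((\<Sum>k\<le>N. a k * Vi k) - R N)" .
  moreover have "(\<lambda>k. (if k \<in> {..N} then a k * Vi k else 0) - a k * V N k) = E N" by (auto simp: E_def right_diff_distrib)
  ultimately show ?thesis by (simp add: sums_iff)
 qed
 hence "(\<lambda>N. (\<Sum>k\<le>N. a k * Vi k)) = (\<lambda>N. (\<Sum>k. E N k) + R N)" by (simp add: fun_eq_iff)
 moreover have "(\<lambda>N. (\<Sum>k. E N k) + R N) \<longlonglongrightarrow> 0 + R'" by (intro tendsto_add E0 R)
 ultimately show ?thesis unfolding sums_def_le by simp
qed

text \<open>Comparison with \<kappa> = 1 costs a factor min 1 \<kappa> for each of the four linear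
  factors. The growth 1 + sqrt(N + 1) of the sum of inverse cubes is cancelled by the factor 1/(1 +
  l N).\<close>

lemma scaled_sqrt_weights:
 fixes \<kappa> :: real
 assumes \<kappa>: "\<kappa> > 0"
 defines "l \<equiv> \<lambda>k. \<kappa> * sqrt (real (Suc k))"
 shows "(\<Sum>k<M. 1 / ((1 + l N) * (1 + \<bar>l N - l k\<bar>) ^ 3)) \<le> 5 / min 1 \<kappa> ^ 4"
  and "(\<lambda>N. 1 / ((1 + l N) * (1 + \<bar>l N - l k\<bar>) ^ 3)) \<longlonglongrightarrow> 0"
  and "filterlim l at_top sequentially"
proof -
 define m where "m = min 1 \<kappa>"
 have m: "m > 0" "m \<le> 1" "m \<le> \<kappa>" using \<kappa> by (auto simp: m_def)
 let ?s = "\<lambda>k. sqrt (real k)"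
 have ge: "1 + \<kappa> * t \<ge> m * (1 + t)" if "t \<ge> 0" for t using m mult_right_mono[OF m(3) that] by (simp add: distrib_left)
 have "1 / ((1 + l N) * (1 + \<bar>l N - l k\<bar>) ^ 3) \<le> 1 / m ^ 4 / (1 + ?s (Suc N)) * (1 / (1 + \<bar>?s (Suc N) - ?s (Suc k)\<bar>) ^ 3)" for k
 proof -
  have 1: "1 + l N \<ge> m * (1 + ?s (Suc N))" unfolding l_def by (rule ge) simp
  have "\<bar>l N - l k\<bar> = \<kappa> * \<bar>?s (Suc N) - ?s (Suc k)\<bar>" using \<kappa> by (simp add: l_def abs_mult flip: right_diff_distrib)
  hence 2: "1 + \<bar>l N - l k\<bar> \<ge> m * (1 + \<bar>?s (Suc N) - ?s (Suc k)\<bar>)" using ge by simp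
  have p: "1 + ?s (Suc N) > 0" "1 + \<bar>?s (Suc N) - ?s (Suc k)\<bar> > 0" using real_sqrt_ge_zero[of "real (Suc N)"] by linarith+
  have "1 / ((1 + l N) * (1 + \<bar>l N - l k\<bar>) ^ 3) \<le> 1 / ((m * (1 + ?s (Suc N))) * (m * (1 + \<bar>?s (Suc N) - ?s (Suc k)\<bar>)) ^ 3)"
   using 1 2 m p by (intro divide_left_mono mult_mono power_mono mult_pos_pos zero_less_power)
    (auto intro!: add_pos_nonneg mult_nonneg_nonneg simp: l_def \<kappa> less_imp_le)
  also have "\<dots> = 1 / m ^ 4 / (1 + ?s (Suc N)) * (1 / (1 + \<bar>?s (Suc N) - ?s (Suc k)\<bar>) ^ 3)"
  proof -
   have "1 / ((m * x) * (m * y) ^ 3) = 1 / m ^ 4 / x * (1 / y ^ 3)" for x y by (simp add: power_mult_distrib eval_nat_numeral mult_ac)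
   thus ?thesis .
  qed
  finally show ?thesis .
 qed
 hence "(\<Sum>k<M. 1 / ((1 + l N) * (1 + \<bar>l N - l k\<bar>) ^ 3)) \<le> (\<Sum>k<M. 1 / m ^ 4 / (1 + ?s (Suc N)) * (1 / (1 + \<bar>?s (Suc N) - ?s (Suc k)\<bar>) ^ 3))"
  by (intro sum_mono)
 also have "\<dots> = 1 / m ^ 4 / (1 + ?s (Suc N)) * (\<Sum>k<M. 1 / (1 + \<bar>?s (Suc N) - ?s (Suc k)\<bar>) ^ 3)" by (rule sum_distrib_left[symmetric])
 also have "\<dots> \<le> 1 / m ^ 4 / (1 + ?s (Suc N)) * (5 * (1 + ?s (Suc N)))"
 proof (rule mult_left_mono)
  \<comment> \<open>Adding the nonnegative term of index 0 turns the shifted sum into the one of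
    \<open>sqrt_weight_sum_le\<close>.\<close>
  have "(\<Sum>k<M. 1 / (1 + \<bar>?s (Suc N) - ?s (Suc k)\<bar>) ^ 3) \<le> (\<Sum>k<Suc M. 1 / (1 + \<bar>?s (Suc N) - ?s k\<bar>) ^ 3)"
   unfolding sum.lessThan_Suc_shift by simp
  also have "\<dots> \<le> 5 * (1 + ?s (Suc N))" by (rule sqrt_weight_sum_le)
  finally show "(\<Sum>k<M. 1 / (1 + \<bar>?s (Suc N) - ?s (Suc k)\<bar>) ^ 3) \<le> 5 * (1 + ?s (Suc N))" .
 qed (use m real_sqrt_ge_zero[of "real (Suc N)"] in auto)
 also have "\<dots> = 5 / m ^ 4"
 proof -
  have "1 + ?s (Suc N) \<noteq> 0" using real_sqrt_ge_zero[of "real (Suc N)"] by linarith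
  moreover have "1 / m ^ 4 / t * (5 * t) = 5 / m ^ 4" if "t \<noteq> 0" for t using that by simp
  ultimately show ?thesis by blast
 qed
 finally show "(\<Sum>k<M. 1 / ((1 + l N) * (1 + \<bar>l N - l k\<bar>) ^ 3)) \<le> 5 / min 1 \<kappa> ^ 4" unfolding m_def .
 have "filterlim (\<lambda>k. sqrt (real (Suc k))) at_top sequentially"
  by (rule filterlim_compose[OF sqrt_at_top filterlim_compose[OF filterlim_real_sequentially filterlim_Suc]])
 thus lt: "filterlim l at_top sequentially" unfolding l_def
  by (rule filterlim_tendsto_pos_mult_at_top[OF tendsto_const \<kappa>])
 have "filterlim (\<lambda>N. 1 + l N) at_top sequentially" by (rule filterlim_tendsto_add_at_top[OF tendsto_const lt])
 hence z: "(\<lambda>N. inverse (1 + l N)) \<longlonglongrightarrow> 0" by (rule tendsto_inverse_0_at_top)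
 show "(\<lambda>N. 1 / ((1 + l N) * (1 + \<bar>l N - l k\<bar>) ^ 3)) \<longlonglongrightarrow> 0"
 proof (rule Lim_null_comparison[OF always_eventually z], rule allI)
  fix N
  have l: "1 + l N > 0" using \<kappa> by (auto simp: l_def intro!: add_pos_nonneg)
  have 1: "(1 + \<bar>l N - l k\<bar>) ^ 3 \<ge> 1" by (rule one_le_power) simp
  have "1 / ((1 + l N) * (1 + \<bar>l N - l k\<bar>) ^ 3) \<le> 1 / ((1 + l N) * 1)"
   using l 1 by (intro divide_left_mono mult_left_mono mult_pos_pos) auto
  moreover have "1 / ((1 + l N) * (1 + \<bar>l N - l k\<bar>) ^ 3) \<ge> 0" using l 1 by simp
  ultimately show "norm (1 / ((1 + l N) * (1 + \<bar>l N - l k\<bar>) ^ 3)) \<le> inverse (1 + l N)" unfolding real_norm_def by (simp only: abs_of_nonneg) (simp add: inverse_eq_divide)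
 qed
qed

lemma integral_sqrt_substitution:
 fixes h :: "real => complex"
 assumes cd: "0 < c" "c \<le> d" and h: "continuous_on {c..d} h"
 shows "integral {c..d} h = integral {sqrt c..sqrt d} (\<lambda>u. of_real (2 * u) * h (u\<^sup>2))"
proof -
 have "((\<lambda>u. (2 * u) *\<^sub>R h (u\<^sup>2)) has_integral integral {(sqrt c)\<^sup>2..(sqrt d)\<^sup>2} h) {sqrt c..sqrt d}"
 proof (rule has_integral_substitution[OF _ _ _ h])
  show "(\<lambda>u. u\<^sup>2) ` {sqrt c..sqrt d} \<subseteq> {c..d}"
  proof (rule image_subsetI)
   fix u assume u: "u \<in> {sqrt c..sqrt d}"
   have "(sqrt c)\<^sup>2 \<le> u\<^sup>2" using u cd by (intro power_mono) auto
   moreover have "u\<^sup>2 \<le> (sqrt d)\<^sup>2" using u cd order_trans[of 0 "sqrt c" u] by (intro power_mono) auto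
   ultimately show "u\<^sup>2 \<in> {c..d}" using cd by simp
  qed
  show "((\<lambda>u. u\<^sup>2) has_real_derivative 2 * u) (at u within {sqrt c..sqrt d})" for u
   by (auto intro!: derivative_eq_intros)
 qed (use cd in auto)
 thus ?thesis using cd by (simp add: integral_unique scaleR_conv_of_real)
qed

text \<open>Since \<alpha> and \<beta> are not integers there is room on both sides before the next
  integer, so the smooth cutoff can be wider than [\<alpha>, \<beta>] without admitting new terms of
  the finite sum.\<close>

lemma cutoff_margin:
 assumes S: "open S" "closed_segment (complex_of_real \<alpha>) (complex_of_real \<beta>) \<subseteq> S" and ab: "0 < \<alpha>" "\<alpha> < \<beta>" "\<alpha> \<notin> \<int>" "\<beta> \<notin> \<int>"
 obtains \<delta> where "\<delta> > 0" "\<alpha> - \<delta> > 0" "complex_of_real ` {\<alpha> - \<delta>..\<beta> + \<delta>} \<subseteq> S"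
  "!!j::nat. real j \<in> {\<alpha> - \<delta>..\<beta> + \<delta>} ==> \<alpha> < real j \<and> real j < \<beta>"
proof -
 obtain e where e: "e > 0" "(\<Union>x\<in>closed_segment (complex_of_real \<alpha>) (of_real \<beta>). ball x e) \<subseteq> S"
  using compact_subset_open_imp_ball_epsilon_subset[OF compact_segment S] by blast
 have fr: "of_int \<lfloor>\<alpha>\<rfloor> < \<alpha>" "\<beta> < of_int \<lceil>\<beta>\<rceil>"
  using ab(3,4) of_int_floor_le[of \<alpha>] le_of_int_ceiling[of \<beta>] by (metis Ints_of_int order_le_less)+
 \<comment> \<open>Half of each of four distances: from \<alpha> to 0, the radius e of the balls
   around the segment inside \<open>S\<close>, from \<alpha> down to its floor and from \<beta> up
   to its ceiling.\<close>
 define \<delta> where "\<delta> = min (min (\<alpha> / 2) (e / 2)) (min ((\<alpha> - of_int \<lfloor>\<alpha>\<rfloor>) / 2) ((of_int \<lceil>\<beta>\<rceil> - \<beta>) / 2))"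
 have d: "\<delta> > 0" "\<delta> \<le> \<alpha> / 2" "\<delta> \<le> e / 2" "\<delta> \<le> (\<alpha> - of_int \<lfloor>\<alpha>\<rfloor>) / 2" "\<delta> \<le> (of_int \<lceil>\<beta>\<rceil> - \<beta>) / 2"
 proof -
  show "\<delta> > 0" using ab e fr by (auto simp: \<delta>_def)
  show "\<delta> \<le> \<alpha> / 2" "\<delta> \<le> e / 2" "\<delta> \<le> (\<alpha> - of_int \<lfloor>\<alpha>\<rfloor>) / 2" "\<delta> \<le> (of_int \<lceil>\<beta>\<rceil> - \<beta>) / 2"
   unfolding \<delta>_def by (rule min.coboundedI1[OF min.cobounded1] min.coboundedI1[OF min.cobounded2] min.coboundedI2[OF min.cobounded1] min.coboundedI2[OF min.cobounded2])+
 qed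
 show ?thesis
 proof (rule that[of \<delta>])
  show "\<delta> > 0" "\<alpha> - \<delta> > 0" using d ab by auto
  show "complex_of_real ` {\<alpha> - \<delta>..\<beta> + \<delta>} \<subseteq> S"
  proof (rule image_subsetI)
   fix t assume t: "t \<in> {\<alpha> - \<delta>..\<beta> + \<delta>}"
   define s where "s = max \<alpha> (min \<beta> t)"
   have s: "s \<in> {\<alpha>..\<beta>}" "\<bar>s - t\<bar> \<le> \<delta>" using t ab d by (auto simp: s_def)
   have "s \<in> closed_segment \<alpha> \<beta>" using s ab by (simp add: closed_segment_eq_real_ivl)
   hence "complex_of_real s \<in> closed_segment (of_real \<alpha>) (of_real \<beta>)" by (simp only: of_real_closed_segment)
   moreover have "complex_of_real t \<in> ball (of_real s) e" unfolding mem_ball using s d e by (simp add: dist_of_real dist_real_def)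
   ultimately show "complex_of_real t \<in> S" using e(2) by blast
  qed
  fix j :: nat assume j: "real j \<in> {\<alpha> - \<delta>..\<beta> + \<delta>}"
  have "\<alpha> < real j"
  proof (rule ccontr)
   assume "\<not> \<alpha> < real j"
   hence "int j \<le> \<lfloor>\<alpha>\<rfloor>" by (simp add: le_floor_iff)
   hence "real j \<le> of_int \<lfloor>\<alpha>\<rfloor>" using of_int_le_iff[of "int j" "\<lfloor>\<alpha>\<rfloor>", where ?'a = real] by simp
   thus False using j d fr by auto
  qed
  moreover have "real j < \<beta>"
  proof (rule ccontr)
   assume "\<not> real j < \<beta>"
   hence "\<lceil>\<beta>\<rceil> \<le> int j" by (simp add: ceiling_le_iff)
   hence "of_int \<lceil>\<beta>\<rceil> \<le> real j" using of_int_le_iff[of "\<lceil>\<beta>\<rceil>" "int j", where ?'a = real] by simp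
   thus False using j d fr by auto
  qed
  ultimately show "\<alpha> < real j \<and> real j < \<beta>" ..
 qed
qed



text \<open>For Re \<nu> > 0 the divisor sum is at most the number of divisors, hence smaller than
  any power of n, and n powr (\<nu>/2) stays strictly below n powr (1/4).\<close>

lemma voronoi_coefficient_bound:
 assumes "dirichlet_character p chi1" "dirichlet_character q chi2" and r: "0 < Re \<nu>" "Re \<nu> < 1/2"
 obtains C \<epsilon> where "C \<ge> 0" "\<epsilon> > 0"
  "!!n. n > 0 ==> norm (2 * of_real pi * sigma_chi (- \<nu>) (\<lambda>a. cnj (chi1 a)) (\<lambda>a. cnj (chi2 a)) n * of_nat n powr (\<nu> / 2)) \<le> C * real n powr (1 / 4 - \<epsilon>)"
proof -
 \<comment> \<open>Half of the gap between Re \<nu>/2 and 1/4: one half is spent on the divisor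
   bound, the other half remains as the saving in the exponent.\<close>
 define \<epsilon> where "\<epsilon> = (1 / 4 - Re \<nu> / 2) / 2"
 have e: "\<epsilon> > 0" using r by (simp add: \<epsilon>_def)
 obtain C where C: "C \<ge> 0" "!!n. n > 0 ==> real (card {d::nat. d dvd n}) \<le> C * real n powr \<epsilon>"
  using divisor_bound[OF e] by blast
 show ?thesis
 proof (rule that[of "2 * pi * C" \<epsilon>])
  fix n :: nat assume n: "n > 0"
  let ?s = "sigma_chi (- \<nu>) (\<lambda>a. cnj (chi1 a)) (\<lambda>a. cnj (chi2 a)) n"
  have "norm (of_nat n powr (\<nu> / 2)) = real n powr (Re \<nu> / 2)"
   using n norm_powr_of_real[of "real n" "\<nu> / 2"] by simp
  hence "norm (2 * of_real pi * ?s * of_nat n powr (\<nu> / 2)) = 2 * pi * norm ?s * real n powr (Re \<nu> / 2)"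
   by (simp add: norm_mult)
  also have "\<dots> \<le> 2 * pi * (C * real n powr \<epsilon>) * real n powr (Re \<nu> / 2)"
   using order_trans[OF norm_sigma_chi_le[OF assms(1,2) r(1) n] C(2)[OF n]] by (intro mult_right_mono mult_left_mono) auto
  also have "\<dots> = 2 * pi * C * real n powr (\<epsilon> + Re \<nu> / 2)" by (simp add: powr_add)
  also have "\<epsilon> + Re \<nu> / 2 = 1 / 4 - \<epsilon>" by (simp add: \<epsilon>_def field_simps)
  finally show "norm (2 * of_real pi * ?s * of_nat n powr (\<nu> / 2)) \<le> 2 * pi * C * real n powr (1 / 4 - \<epsilon>)" .
 qed (use C e in auto)
qed

lemma csqrt_of_real_square: "u \<ge> 0 ==> csqrt (of_real (u\<^sup>2)) = of_real u"
 by (simp add: csqrt_of_real_nonneg del: of_real_power)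

lemma continuous_on_voronoi_kernel:
 assumes nu: "\<nu> \<notin> \<int>" and c: "c > 0" and n: "n > 0" and k: "k > 0"
 shows "continuous_on {c..d} (\<lambda>t. of_real t powr (- \<nu> / 2) * vkernel \<nu> (4 * pi * sqrt (real n * t / k)))"
proof -
 have v: "continuous_on {c..d} (\<lambda>t. vkernel \<nu> (4 * pi * sqrt (real n * t / k)))"
 proof (rule continuous_on_compose2[OF continuous_on_vkernel[OF nu]])
  show "(\<lambda>t. 4 * pi * sqrt (real n * t / k)) ` {c..d} \<subseteq> {0<..}" by (rule image_subsetI) (use c n k in auto)
 qed (use k in \<open>auto intro!: continuous_intros\<close>)
 show ?thesis by (intro continuous_on_mult v continuous_intros) (use c in \<open>auto simp: complex_nonpos_Reals_iff\<close>)
qed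

text \<open>Analyticity inside a contour around [\<alpha>, \<beta>] is rendered as holomorphy on an
  open set containing the segment. Convergence is asserted for the series in its natural order, with
  n = k + 1, as only that order is controlled by cutting in frequency.\<close>

theorem theorem4p5:
  fixes \<alpha> \<beta> :: real and f :: "complex \<Rightarrow> complex" and p q :: nat
    and chi1 chi2 :: "int \<Rightarrow> complex" and \<nu> :: complex
  assumes "0 < \<alpha>" "\<alpha> < \<beta>" "\<alpha> \<notin> \<int>" "\<beta> \<notin> \<int>"
    and "\<exists>S. open S \<and> closed_segment (complex_of_real \<alpha>) (complex_of_real \<beta>) \<subseteq> S \<and> f holomorphic_on S"
    and "dirichlet_character p chi1" "primitive_character p chi1" "\<not> principal_character p chi1" "even_character chi1"
    and "dirichlet_character q chi2" "primitive_character q chi2" "\<not> principal_character q chi2" "even_character chi2"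
    and "0 < Re \<nu>" "Re \<nu> < 1/2"
  shows "(\<lambda>k. let n = Suc k in
            2 * of_real pi * sigma_chi (-\<nu>) (\<lambda>a. cnj (chi1 a)) (\<lambda>a. cnj (chi2 a)) n
            * of_nat n powr (\<nu> / 2)
            * integral {\<alpha>..\<beta>} (\<lambda>t. let X = 4 * pi * sqrt (real n * t / (real p * real q)) in
                f (of_real t) * of_real t powr (-\<nu> / 2)
                * ((2 / of_real pi * besselK \<nu> X - besselY \<nu> X) * cos (of_real pi * \<nu> / 2)
                   - besselJ \<nu> X * sin (of_real pi * \<nu> / 2))))
         sums
         (of_nat p powr (1 - \<nu> / 2) * of_nat q powr (1 + \<nu> / 2) / (gauss_sum p chi1 * gauss_sum q chi2)
          * (\<Sum>j \<in> {j::nat. \<alpha> < real j \<and> real j < \<beta>}. sigma_chi (-\<nu>) chi2 chi1 j * f (of_nat j)))"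
proof -
 note ab = assms(1-4) and chi1 = assms(6-9) and chi2 = assms(10-13) and r = assms(14,15)
 have p: "p > 0" and q: "q > 0" using chi1(1) chi2(1) by (auto simp: dirichlet_character_def)
 have nu: "\<nu> \<notin> \<int>"
 proof
  assume "\<nu> \<in> \<int>"
  then obtain k where "\<nu> = of_int k" by (elim Ints_cases)
  thus False using r by simp
 qed
 obtain S where S: "open S" "closed_segment (complex_of_real \<alpha>) (complex_of_real \<beta>) \<subseteq> S" "f holomorphic_on S" using assms(5) by blast
 obtain \<delta> where \<delta>: "\<delta> > 0" "\<alpha> - \<delta> > 0" "complex_of_real ` {\<alpha> - \<delta>..\<beta> + \<delta>} \<subseteq> S"
  and int: "!!j::nat. real j \<in> {\<alpha> - \<delta>..\<beta> + \<delta>} ==> \<alpha> < real j \<and> real j < \<beta>"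
  by (rule cutoff_margin[OF S(1,2) ab]) (rule that)
 define c d a b where cdab: "c = sqrt (\<alpha> - \<delta>)" "d = sqrt (\<beta> + \<delta>)" "a = sqrt \<alpha>" "b = sqrt \<beta>"
 have sq: "c\<^sup>2 = \<alpha> - \<delta>" "d\<^sup>2 = \<beta> + \<delta>" "a\<^sup>2 = \<alpha>" "b\<^sup>2 = \<beta>" using \<delta> ab by (auto simp: cdab)
 have ord: "0 < c" "c \<le> a" "a < b" "b \<le> d" using \<delta> ab by (auto simp: cdab)
 have between: "u\<^sup>2 \<in> {\<alpha> - \<delta>..\<beta> + \<delta>}" if "u \<in> {c..d}" for u
 proof -
  have "c\<^sup>2 \<le> u\<^sup>2" "u\<^sup>2 \<le> d\<^sup>2" using that ord by (auto intro!: power_mono)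
  thus ?thesis using sq by simp
 qed
 \<comment> \<open>The exponent 7 exceeds the order 5 of smoothness that both locales ask
   for.\<close>
 define \<psi> where "\<psi> = cutoff 7 \<alpha> \<beta> \<delta>"
 \<comment> \<open>The cutoff in u is \<psi>(u^2), but this is also nonzero on the mirror interval
   of negative u. The second factor is 1 on [c, d] and, with margin c/2, vanishes for all u \<le>
   0.\<close>
 define \<phi> where "\<phi> = (\<lambda>u. cutoff 7 \<alpha> \<beta> \<delta> (u * u) * cutoff 7 c d (c / 2) u)"
 have Ck\<psi>: "Ck 5 \<psi>" using Ck_cutoff[OF Ck_ident, of 5 7 \<alpha> \<beta> \<delta>] by (simp add: \<psi>_def)
 have Ck\<phi>: "Ck 5 \<phi>" unfolding \<phi>_def by (intro Ck_mult Ck_cutoff Ck_ident) auto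
 have \<psi>0: "\<psi> t = 0" if "t \<notin> {\<alpha> - \<delta>..\<beta> + \<delta>}" for t unfolding \<psi>_def by (rule cutoff_eq_0) (use that \<delta> in auto)
 have \<psi>1: "\<psi> t = 1" if "t \<in> {\<alpha>..\<beta>}" for t unfolding \<psi>_def by (rule cutoff_eq_1) (use that \<delta> in auto)
 have \<phi>\<psi>: "\<phi> u = \<psi> (u\<^sup>2)" if "u \<in> {c..d}" for u
 proof -
  have "cutoff 7 c d (c / 2) u = 1" by (rule cutoff_eq_1) (use that ord in auto)
  thus ?thesis by (simp add: \<phi>_def \<psi>_def power2_eq_square)
 qed
 have \<phi>0: "\<phi> u = 0" if u: "u \<notin> {c..d}" for u
 proof (cases "u > 0")
  case True
  have "u\<^sup>2 \<notin> {\<alpha> - \<delta>..\<beta> + \<delta>}"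
  proof
   assume h: "u\<^sup>2 \<in> {\<alpha> - \<delta>..\<beta> + \<delta>}"
   have "c \<le> u" by (rule power2_le_imp_le) (use h sq True in auto)
   moreover have "u \<le> d" by (rule power2_le_imp_le) (use h sq ord in auto)
   ultimately show False using u by auto
  qed
  thus ?thesis using \<psi>0[of "u\<^sup>2"] by (simp add: \<phi>_def \<psi>_def power2_eq_square)
 next
  case False
  have "cutoff 7 c d (c / 2) u = 0" by (rule cutoff_eq_0) (use False ord in auto)
  thus ?thesis by (simp add: \<phi>_def)
 qed
 have \<phi>1: "\<phi> u = 1" if u: "u \<in> {a..b}" for u
 proof -
  have "u\<^sup>2 \<in> {\<alpha>..\<beta>}" unfolding sq(3,4)[symmetric] using u ord by (auto intro!: power_mono)
  thus ?thesis using \<phi>\<psi>[of u] \<psi>1 u ord by auto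
 qed
 \<comment> \<open>With t = u^2 the Bessel argument 4 pi sqrt(n t/(p q)) is \<kappa> sqrt(n) u, so
   the frequency \<open>l k\<close> belongs to n = k + 1.\<close>
 define \<kappa> where "\<kappa> = 4 * pi / sqrt (real p * real q)"
 have \<kappa>: "\<kappa> > 0" using p q by (simp add: \<kappa>_def)
 define l where "l = (\<lambda>k. \<kappa> * sqrt (real (Suc k)))"
 have l\<kappa>: "l k \<ge> \<kappa>" for k using mult_left_mono[of 1 "sqrt (real (Suc k))" \<kappa>] \<kappa> by (simp add: l_def)
 have lpos: "l k > 0" for k using l\<kappa>[of k] \<kappa> by simp
 \<comment> \<open>Frequencies increase with the index, hence cutting at the frequency
   \<open>l N\<close> means cutting the series at the index N.\<close>
 have lmono: "l k \<le> l N \<longleftrightarrow> k \<le> N" for k N using \<kappa> by (simp add: l_def)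
 have weights: "(\<Sum>k<M. 1 / ((1 + l N) * (1 + \<bar>l N - l k\<bar>) ^ 3)) \<le> 5 / min 1 \<kappa> ^ 4"
  "(\<lambda>N. 1 / ((1 + l N) * (1 + \<bar>l N - l k\<bar>) ^ 3)) \<longlonglongrightarrow> 0" "filterlim l at_top sequentially" for M N k
  unfolding l_def by (rule scaled_sqrt_weights[OF \<kappa>])+
 have inS: "complex_of_real (u\<^sup>2) \<in> S" if "u \<in> {c..d}" for u
  using \<delta>(3) imageI[OF between[OF that], of complex_of_real] by (rule subsetD)
 interpret cut: cut_setup \<phi> f S c a b d \<nu> \<kappa>
  by (rule cut_setup.intro[OF Ck\<phi> _ _ ord S(1) _ S(3) nu \<kappa>]) (fact \<phi>0 \<phi>1 inS)+
 have arg: "4 * pi * sqrt (real (Suc k) * u\<^sup>2 / (real p * real q)) = l k * u" if "u \<ge> 0" for k u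
  using that by (simp add: l_def \<kappa>_def real_sqrt_mult real_sqrt_divide del: of_nat_Suc)
 \<comment> \<open>The truncation is a function of u, so in the variable t it is composed with the
   square root; this is holomorphic once \<open>S\<close> is intersected with the right
   half-plane.\<close>
 define g where "g = (\<lambda>L z. f z * trunc a b L (csqrt z))"
 have tf: "test_function \<psi> (g L) (\<alpha> - \<delta>) (\<beta> + \<delta>) (S \<inter> {z. Re z > 0})" for L
 proof
  show "open (S \<inter> {z. Re z > 0})" by (intro open_Int S open_halfspace_Re_gt)
  show "complex_of_real ` {\<alpha> - \<delta>..\<beta> + \<delta>} \<subseteq> S \<inter> {z. Re z > 0}" using \<delta> by auto
  have "(\<lambda>z. trunc a b L (csqrt z)) holomorphic_on S \<inter> {z. Re z > 0}"
   by (rule holomorphic_on_compose_gen[OF _ holomorphic_trunc, unfolded o_def])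
    (auto intro!: holomorphic_intros simp: complex_nonpos_Reals_iff)
  thus "g L holomorphic_on S \<inter> {z. Re z > 0}" unfolding g_def by (intro holomorphic_intros holomorphic_on_subset[OF S(3)]) auto
 qed (use Ck\<psi> \<psi>0 \<delta> ab in auto)
 let ?F = "\<lambda>L. test_function.F \<psi> (g L)" and ?V = "\<lambda>L. test_function.vtransform \<psi> (g L) (\<alpha> - \<delta>) (\<beta> + \<delta>) \<nu> (real p * real q)"
 have Fdef: "?F L t = of_real (\<psi> t) * g L (of_real t)" for L t by (rule test_function.F_def[OF tf])
 have V: "?V L (Suc k) = cut.Lam L (cut.kern (l k))" for L k
 proof -
  let ?K = "\<lambda>t. of_real t powr (- \<nu> / 2) * vkernel \<nu> (4 * pi * sqrt (real (Suc k) * t / (real p * real q)))"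
  have "continuous_on {\<alpha> - \<delta>..\<beta> + \<delta>} (\<lambda>t. ?F L t * ?K t)"
   by (intro continuous_on_mult test_function.continuous_on_F[OF tf] continuous_on_voronoi_kernel nu) (use \<delta> p q in auto)
  hence "?V L (Suc k) = integral {c..d} (\<lambda>u. of_real (2 * u) * (?F L (u\<^sup>2) * ?K (u\<^sup>2)))"
   unfolding test_function.vtransform_def[OF tf] cdab by (intro integral_sqrt_substitution) (use \<delta> ab in auto)
  also have "\<dots> = cut.Lam L (cut.kern (l k))" unfolding cut.Lam_def
  proof (intro Henstock_Kurzweil_Integration.integral_cong)
   fix u assume u: "u \<in> {c..d}"
   have u0: "u \<ge> 0" using u ord by auto
   show "of_real (2 * u) * (?F L (u\<^sup>2) * ?K (u\<^sup>2)) = of_real (\<phi> u) * trunc a b L (of_real u) * cut.kern (l k) u"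
    unfolding Fdef unfolding g_def cut.kern_def arg[OF u0] \<phi>\<psi>[OF u] csqrt_of_real_square[OF u0] by (simp only: mult_ac)
  qed
  finally show ?thesis .
 qed
 define Vi where "Vi = (\<lambda>k. integral {\<alpha>..\<beta>} (\<lambda>t. let X = 4 * pi * sqrt (real (Suc k) * t / (real p * real q)) in
        f (of_real t) * of_real t powr (-\<nu> / 2)
        * ((2 / of_real pi * besselK \<nu> X - besselY \<nu> X) * cos (of_real pi * \<nu> / 2)
         - besselJ \<nu> X * sin (of_real pi * \<nu> / 2))))"
 have Vi: "Vi k = cut.Linf (cut.kern (l k))" for k
 proof -
  let ?K = "\<lambda>t. of_real t powr (- \<nu> / 2) * vkernel \<nu> (4 * pi * sqrt (real (Suc k) * t / (real p * real q)))"
  have fc: "continuous_on {\<alpha>..\<beta>} (\<lambda>t. f (of_real t))"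
   by (rule continuous_on_holomorphic_of_real[OF S(3)]) (use \<delta> in force)
  have "continuous_on {\<alpha>..\<beta>} (\<lambda>t. f (of_real t) * ?K t)"
   by (intro continuous_on_mult fc continuous_on_voronoi_kernel nu) (use ab p q in auto)
  moreover have "Vi k = integral {\<alpha>..\<beta>} (\<lambda>t. f (of_real t) * ?K t)"
   unfolding Vi_def Let_def vkernel_def[symmetric] by (simp only: mult.assoc)
  ultimately have "Vi k = integral {a..b} (\<lambda>u. of_real (2 * u) * (f (of_real (u\<^sup>2)) * ?K (u\<^sup>2)))"
   unfolding cdab using ab by (simp only: integral_sqrt_substitution less_imp_le)
  also have "\<dots> = cut.Linf (cut.kern (l k))" unfolding cut.Linf_def
  proof (intro Henstock_Kurzweil_Integration.integral_cong)
   fix u assume u: "u \<in> {a..b}"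
   have u0: "u \<ge> 0" using u ord by auto
   show "of_real (2 * u) * (f (of_real (u\<^sup>2)) * ?K (u\<^sup>2)) = 1 * cut.kern (l k) u"
    unfolding cut.kern_def arg[OF u0] by simp
  qed
  finally show ?thesis .
 qed
 define J where "J = {j::nat. \<alpha> < real j \<and> real j < \<beta>}"
 have "J \<subseteq> {..nat \<lceil>\<beta>\<rceil>}" unfolding J_def by (auto simp: le_nat_iff) linarith
 hence finJ: "finite J" by (rule finite_subset) auto
 have J0: "0 \<notin> J" using ab by (simp add: J_def)
 define A where "A = (\<lambda>k. 2 * of_real pi * sigma_chi (- \<nu>) (\<lambda>a. cnj (chi1 a)) (\<lambda>a. cnj (chi2 a)) (Suc k) * of_nat (Suc k) powr (\<nu> / 2))"
 define Q where "Q = of_nat p powr (1 - \<nu> / 2) * of_nat q powr (1 + \<nu> / 2) / (gauss_sum p chi1 * gauss_sum q chi2)"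
 \<comment> \<open>The decay constant \<open>K\<close> depends on L; this is harmless because the
   smooth formula is applied for one L at a time.\<close>
 have sv: "(\<lambda>k. A k * cut.Lam L (cut.kern (l k))) sums (Q * (\<Sum>j\<in>J. sigma_chi (- \<nu>) chi2 chi1 j * ?F L (real j)))" if L: "L > 0" for L
 proof -
  obtain K where K: "!!x. x \<ge> \<kappa> ==> norm (cut.Lam L (cut.kern x)) \<le> K * x powr (- 5 / 2)"
   by (rule cut.Lam_kern_decay[OF L]) (rule that)
  have Vb: "norm (?V L n) \<le> K * \<kappa> powr (- 5 / 2) * real n powr (- 5 / 4)" if n: "n \<ge> 1" for n
  proof -
   obtain k where k: "n = Suc k" using n by (cases n) auto
   have "sqrt (real n) powr (- 5 / 2) = real n powr (- 5 / 4)" using n by (simp add: powr_half_sqrt[symmetric] powr_powr)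
   hence "l k powr (- 5 / 2) = \<kappa> powr (- 5 / 2) * real n powr (- 5 / 4)" unfolding l_def k[symmetric] using \<kappa> by (simp add: powr_mult)
   thus ?thesis using K[OF l\<kappa>[of k]] unfolding k V by simp
  qed
  have F0: "?F L (real j) = 0" if "j \<ge> 1" "j \<notin> J" for j
  proof -
   have "real j \<notin> {\<alpha> - \<delta>..\<beta> + \<delta>}" using int[of j] that by (auto simp: J_def)
   thus ?thesis unfolding Fdef using \<psi>0 by simp
  qed
  show ?thesis
   using test_function.smooth_voronoi[OF tf chi1 chi2 r finJ J0 F0 Vb] unfolding A_def Q_def V by simp
 qed
 \<comment> \<open>Only finitely many j occur, each with sqrt j strictly between a and b, where the
   truncation tends to 1 and the cutoff equals 1.\<close>
 have R: "(\<lambda>N. Q * (\<Sum>j\<in>J. sigma_chi (- \<nu>) chi2 chi1 j * ?F (l N) (real j))) \<longlonglongrightarrow> Q * (\<Sum>j\<in>J. sigma_chi (- \<nu>) chi2 chi1 j * f (of_nat j))"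
 proof (intro tendsto_mult tendsto_const tendsto_sum)
  fix j assume "j \<in> J"
  hence j: "\<alpha> < real j" "real j < \<beta>" by (auto simp: J_def)
  have u: "a < sqrt (real j)" "sqrt (real j) < b" using j by (auto simp: cdab)
  have "((\<lambda>N. trunc a b (l N) (of_real (sqrt (real j)))) \<longlonglongrightarrow> of_real ((sgn (sqrt (real j) - a) - sgn (sqrt (real j) - b)) / 2))"
   by (rule filterlim_compose[OF tendsto_trunc weights(3)]) (use ord in simp)
  hence "(\<lambda>N. of_real (\<psi> (real j)) * (f (of_real (real j)) * trunc a b (l N) (csqrt (of_real (real j))))) \<longlonglongrightarrow> of_real 1 * (f (of_real (real j)) * 1)"
   using u j \<psi>1[of "real j"] by (intro tendsto_mult tendsto_const) (auto simp: csqrt_of_real_nonneg)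
  thus "(\<lambda>N. ?F (l N) (real j)) \<longlonglongrightarrow> f (of_nat j)" unfolding Fdef unfolding g_def by simp
 qed
 obtain C D rho where C: "C \<ge> 0" and D: "D \<ge> 0" and rc: "!!x. x \<ge> \<kappa> ==> continuous_on {c..d} (rho x)"
  and rb: "!!x L. x \<ge> \<kappa> ==> L > 0 ==> norm ((if x \<le> L then cut.Linf (rho x) else 0) - cut.Lam L (rho x)) \<le> D / x\<^sup>2"
  and err: "!!x L. x \<ge> \<kappa> ==> L > 0 ==> norm ((if x \<le> L then cut.Linf (cut.kern x) else 0) - cut.Lam L (cut.kern x))
   \<le> x powr (- 1 / 2) * (C / ((1 + L) * (1 + \<bar>L - x\<bar>) ^ 3) + norm ((if x \<le> L then cut.Linf (rho x) else 0) - cut.Lam L (rho x)))"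
  by (rule cut.cut_error) (rule that)
 obtain Ca \<epsilon> where Ca: "Ca \<ge> 0" and \<epsilon>: "\<epsilon> > 0"
  and "!!n. n > 0 ==> norm (2 * of_real pi * sigma_chi (- \<nu>) (\<lambda>a. cnj (chi1 a)) (\<lambda>a. cnj (chi2 a)) n * of_nat n powr (\<nu> / 2)) \<le> Ca * real n powr (1 / 4 - \<epsilon>)"
  by (rule voronoi_coefficient_bound[OF chi1(1) chi2(1) r]) (rule that)
 hence Ab: "norm (A k) \<le> Ca * real (Suc k) powr (1 / 4 - \<epsilon>)" for k unfolding A_def by blast
 have lp: "l k powr (- 1 / 2) = \<kappa> powr (- 1 / 2) * real (Suc k) powr (- 1 / 4)" for k
 proof -
  have "sqrt (real (Suc k)) powr (- 1 / 2) = real (Suc k) powr (- 1 / 4)" by (simp add: powr_half_sqrt[symmetric] powr_powr del: of_nat_Suc)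
  thus ?thesis unfolding l_def using \<kappa> by (simp add: powr_mult del: of_nat_Suc)
 qed
 \<comment> \<open>The place where Re \<nu> < 1/2 decides: a coefficient of size n powr (1/4 -
   \<epsilon>) meets the factor n powr (-1/4) from the kernel, so the product tends to 0.\<close>
 have Al: "norm (A k) * l k powr (- 1 / 2) \<le> Ca * \<kappa> powr (- 1 / 2) * real (Suc k) powr (- \<epsilon>)" for k
 proof -
  have "norm (A k) * l k powr (- 1 / 2) \<le> (Ca * real (Suc k) powr (1 / 4 - \<epsilon>)) * (\<kappa> powr (- 1 / 2) * real (Suc k) powr (- 1 / 4))"
   unfolding lp by (intro mult_right_mono Ab) auto
  also have "\<dots> = Ca * \<kappa> powr (- 1 / 2) * (real (Suc k) powr (1 / 4 - \<epsilon>) * real (Suc k) powr (- 1 / 4))" by (simp only: mult_ac)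
  also have "real (Suc k) powr (1 / 4 - \<epsilon>) * real (Suc k) powr (- 1 / 4) = real (Suc k) powr (- \<epsilon>)" by (simp flip: powr_add del: of_nat_Suc)
  finally show ?thesis .
 qed
 have pe: "(\<lambda>k. real (Suc k) powr (- \<epsilon>)) \<longlonglongrightarrow> 0"
  by (rule tendsto_neg_powr[OF _ filterlim_compose[OF filterlim_real_sequentially filterlim_Suc]]) (use \<epsilon> in simp)
 have "(\<lambda>k. A k * Vi k) sums (Q * (\<Sum>j\<in>J. sigma_chi (- \<nu>) chi2 chi1 j * f (of_nat j)))"
 \<comment> \<open>The regularised series of index N uses the cut frequency \<open>l N\<close>. The
   exponential parts give the weights w, and the asymptotic remainders \<open>rho\<close> give the
   part y with majorant D/(l k)^2.\<close>
 proof (rule sums_limit_of_truncations[where V = "\<lambda>N k. cut.Lam (l N) (cut.kern (l k))" and h = "\<lambda>k. l k powr (- 1 / 2)" and C = C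
    and w = "\<lambda>N k. 1 / ((1 + l N) * (1 + \<bar>l N - l k\<bar>) ^ 3)" and W = "5 / min 1 \<kappa> ^ 4"
    and y = "\<lambda>N k. norm ((if l k \<le> l N then cut.Linf (rho (l k)) else 0) - cut.Lam (l N) (rho (l k)))" and Y = "\<lambda>k. D / (l k)\<^sup>2", OF sv[OF lpos] R])
  show "norm ((if k \<le> N then Vi k else 0) - cut.Lam (l N) (cut.kern (l k))) \<le> l k powr (- 1 / 2) * (C * (1 / ((1 + l N) * (1 + \<bar>l N - l k\<bar>) ^ 3))
    + norm ((if l k \<le> l N then cut.Linf (rho (l k)) else 0) - cut.Lam (l N) (rho (l k))))" for N k
   using err[OF l\<kappa>[of k] lpos[of N]] unfolding Vi lmono by simp
  show "(\<lambda>k. norm (A k) * l k powr (- 1 / 2)) \<longlonglongrightarrow> 0"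
   by (rule Lim_null_comparison[OF always_eventually tendsto_mult_right_zero[OF pe, of "Ca * \<kappa> powr (- 1 / 2)"]]) (use Al in simp)
  show "1 / ((1 + l N) * (1 + \<bar>l N - l k\<bar>) ^ 3) \<ge> 0" for N k using lpos[of N] by simp
  show "(\<Sum>k<M. 1 / ((1 + l N) * (1 + \<bar>l N - l k\<bar>) ^ 3)) \<le> 5 / min 1 \<kappa> ^ 4" for N M by (rule weights(1))
  show "(\<lambda>N. 1 / ((1 + l N) * (1 + \<bar>l N - l k\<bar>) ^ 3)) \<longlonglongrightarrow> 0" for k by (rule weights(2))
  show "norm ((if l k \<le> l N then cut.Linf (rho (l k)) else 0) - cut.Lam (l N) (rho (l k))) \<le> D / (l k)\<^sup>2" for N k by (rule rb[OF l\<kappa> lpos])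
  show "(\<lambda>N. norm ((if l k \<le> l N then cut.Linf (rho (l k)) else 0) - cut.Lam (l N) (rho (l k)))) \<longlonglongrightarrow> 0" for k
  proof (rule Lim_transform_eventually)
   have "(\<lambda>N. cut.Lam (l N) (rho (l k))) \<longlonglongrightarrow> cut.Linf (rho (l k))" by (rule cut.Lam_tendsto[OF rc[OF l\<kappa>] weights(3) lpos])
   hence "(\<lambda>N. norm (cut.Linf (rho (l k)) - cut.Lam (l N) (rho (l k)))) \<longlonglongrightarrow> norm (cut.Linf (rho (l k)) - cut.Linf (rho (l k)))"
    by (intro tendsto_norm tendsto_diff tendsto_const)
   thus "(\<lambda>N. norm (cut.Linf (rho (l k)) - cut.Lam (l N) (rho (l k)))) \<longlonglongrightarrow> 0" by simp
   show "\<forall>\<^sub>F N in sequentially. norm (cut.Linf (rho (l k)) - cut.Lam (l N) (rho (l k))) = norm ((if l k \<le> l N then cut.Linf (rho (l k)) else 0) - cut.Lam (l N) (rho (l k)))"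
    using eventually_ge_at_top[of k] by eventually_elim (simp add: lmono)
  qed
  show "summable (\<lambda>k. norm (A k) * l k powr (- 1 / 2) * (D / (l k)\<^sup>2))"
  proof (rule summable_comparison_test')
   show "summable (\<lambda>k. Ca * \<kappa> powr (- 1 / 2) * (D / \<kappa>\<^sup>2) * real (Suc k) powr (- \<epsilon> - 1))"
    using \<epsilon> by (intro summable_mult summable_Suc_iff[THEN iffD2, of "\<lambda>k. real k powr (- \<epsilon> - 1)"]) (auto simp: summable_real_powr_iff)
   fix k
   have "(l k)\<^sup>2 = \<kappa>\<^sup>2 * real (Suc k)" by (simp add: l_def power_mult_distrib)
   hence e: "D / (l k)\<^sup>2 = D / \<kappa>\<^sup>2 * real (Suc k) powr (- 1)" by (simp add: powr_minus divide_inverse del: of_nat_Suc)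
   have "norm (A k) * l k powr (- 1 / 2) * (D / (l k)\<^sup>2) \<le> Ca * \<kappa> powr (- 1 / 2) * real (Suc k) powr (- \<epsilon>) * (D / (l k)\<^sup>2)"
    using D by (intro mult_right_mono Al) auto
   also have "\<dots> = Ca * \<kappa> powr (- 1 / 2) * (D / \<kappa>\<^sup>2) * (real (Suc k) powr (- \<epsilon>) * real (Suc k) powr (- 1))" unfolding e by (simp only: mult_ac)
   also have "real (Suc k) powr (- \<epsilon>) * real (Suc k) powr (- 1) = real (Suc k) powr (- \<epsilon> - 1)" by (simp only: powr_add[symmetric] diff_conv_add_uminus)
   finally show "norm (norm (A k) * l k powr (- 1 / 2) * (D / (l k)\<^sup>2)) \<le> Ca * \<kappa> powr (- 1 / 2) * (D / \<kappa>\<^sup>2) * real (Suc k) powr (- \<epsilon> - 1)"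
    using D by simp
  qed
 qed (use C in auto)
 thus ?thesis unfolding A_def Vi_def Q_def J_def Let_def .
qed

end
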